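(* Let $n \geq 1$ be an integer, let $R$ be a commutative ring and let $A$ be an Azumaya algebra over $R$ of constant rank $n^2$. Then $A$ satisfies all the $\mathbb{Z}$-identities of the ring $M_n(\mathbb{Z})$, and no nonzero homomorphic image of the ring $A$ satisfies all the $\mathbb{Z}$-identities of the ring $M_{n-1}(\mathbb{Z})$.
   Context: Rings are associative with unit. $M_n(\mathbb{Z})$ is the ring of $n \times n$ matrices over $\mathbb{Z}$ (for $n-1=0$, $M_0(\mathbb{Z})$ is the zero ring). A $\mathbb{Z}$-identity of a ring $B$ is a noncommutative polynomial $f(x_1,\dots,x_m)$ with coefficients in $\mathbb{Z}$ (an element of a free associative ring $\mathbb{Z}\langle x_1,\dots,x_m\rangle$) such that $f(b_1,\dots,b_m) = 0$ for all $b_1,\dots,b_m \in B$; a ring $C$ satisfies the $\mathbb{Z}$-identity $f$ if $f(c_1,\dots,c_m)=0$ for all $c_1,\dots,c_m\in C$. A homomorphic image of $A$ is a quotient ring of $A$ by a two-sided ideal. An Azumaya algebra over a commutative ring $R$ is an $R$-algebra $A$ (not necessarily commutative) which is a finitely generated faithful $R$-module such that for each maximal ideal $\mathfrak{m}$ of $R$ the quotient $A/\mathfrak{m}A$ is a central simple $R/\mathfrak{m}$-algebra. It is a standard fact that for each prime $\mathfrak{p}$ of $R$, $A \otimes_R R_{\mathfrak{p}}$ is a free $R_{\mathfrak{p}}$-module of finite rank $r_{\mathfrak{p}}(A)$. $A$ has constant rank $r$ if $r_{\mathfrak{p}}(A) = r$ for every $\mathfrak{p} \in \mathrm{Spec}(R)$.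 *)

theory Defs
  imports
    "HOL-Algebra.Algebra"
    "HOL-Library.Poly_Mapping"
    "Jordan_Normal_Form.Matrix"
    "Jordan_Normal_Form.Missing_VectorSpace"
begin

hide_const (open) Multiset.mult Wellorder_Constructions.zero

section \<open>Noncommutative polynomials and identities\<close>

text \<open>The free monoid on letters \<open>x\<^sub>1, x\<^sub>2, \<dots>\<close>, written additively so that \<open>word \<Rightarrow>\<^sub>0 int\<close>, with the
  convolution product of \<open>HOL-Library.Poly_Mapping\<close>, is the free associative ring on these
  letters (its \<open>ring_1\<close> instance comes from the library).\<close>

datatype word = Word (letters: "nat list")

instantiation word :: monoid_add
begin

definition zero_word :: word where "0 = Word []"

definition plus_word :: "word \<Rightarrow> word \<Rightarrow> word" where "v + w = Word (letters v @ letters w)"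

instance
  by standard (simp_all add: zero_word_def plus_word_def)

end

type_synonym ncpoly = "word \<Rightarrow>\<^sub>0 int"

text \<open>The subring \<open>\<int>\<langle>x\<^sub>1, \<dots>, x\<^sub>m\<rangle>\<close>.\<close>

definition free_assoc_ring :: "nat \<Rightarrow> ncpoly set" where
  "free_assoc_ring m = {f. \<forall>w \<in> Poly_Mapping.keys f. set (letters w) \<subseteq> {1..m}}"

definition word_eval :: "('b, 'c) ring_scheme \<Rightarrow> (nat \<Rightarrow> 'b) \<Rightarrow> word \<Rightarrow> 'b" where
  "word_eval B b w = foldr (\<lambda>i y. b i \<otimes>\<^bsub>B\<^esub> y) (letters w) \<one>\<^bsub>B\<^esub>"

definition ncpoly_eval :: "('b, 'c) ring_scheme \<Rightarrow> (nat \<Rightarrow> 'b) \<Rightarrow> ncpoly \<Rightarrow> 'b" where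
  "ncpoly_eval B b f =
     (\<Oplus>\<^bsub>B\<^esub> w \<in> Poly_Mapping.keys f. [Poly_Mapping.lookup f w] \<cdot>\<^bsub>B\<^esub> word_eval B b w)"

definition satisfies_identity :: "('b, 'c) ring_scheme \<Rightarrow> nat \<Rightarrow> ncpoly \<Rightarrow> bool" where
  "satisfies_identity B m f \<longleftrightarrow> (\<forall>b \<in> {1..m} \<rightarrow> carrier B. ncpoly_eval B b f = \<zero>\<^bsub>B\<^esub>)"

definition Z_identity :: "('b, 'c) ring_scheme \<Rightarrow> nat \<Rightarrow> ncpoly \<Rightarrow> bool" where
  "Z_identity B m f \<longleftrightarrow> f \<in> free_assoc_ring m \<and> satisfies_identity B m f"

definition satisfies_all_Z_identities_of ::
    "('c, 'd) ring_scheme \<Rightarrow> ('b, 'e) ring_scheme \<Rightarrow> bool" where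
  "satisfies_all_Z_identities_of C B \<longleftrightarrow> (\<forall>m f. Z_identity B m f \<longrightarrow> satisfies_identity C m f)"

text \<open>For \<open>n = 0\<close> there is exactly one \<open>0 \<times> 0\<close> matrix, so this is the zero ring.\<close>

abbreviation int_matrix_ring :: "nat \<Rightarrow> int mat ring" where
  "int_matrix_ring n \<equiv> ring_mat TYPE(int) n ()"

section \<open>Modules and associative algebras\<close>

definition finitely_generated :: "('r, 'p) ring_scheme \<Rightarrow> ('r, 'a, 'q) module_scheme \<Rightarrow> bool" where
  "finitely_generated R M \<longleftrightarrow>
     (\<exists>B. finite B \<and> B \<subseteq> carrier M \<and> module.span R M B = carrier M)"

definition faithful_module :: "('r, 'p) ring_scheme \<Rightarrow> ('r, 'a, 'q) module_scheme \<Rightarrow> bool" where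
  "faithful_module R M \<longleftrightarrow>
     (\<forall>r \<in> carrier R. (\<forall>x \<in> carrier M. r \<odot>\<^bsub>M\<^esub> x = \<zero>\<^bsub>M\<^esub>) \<longrightarrow> r = \<zero>\<^bsub>R\<^esub>)"

definition free_of_rank ::
    "('r, 'p) ring_scheme \<Rightarrow> ('r, 'a, 'q) module_scheme \<Rightarrow> nat \<Rightarrow> bool" where
  "free_of_rank R M r \<longleftrightarrow>
     (\<exists>B. finite B \<and> card B = r \<and> B \<subseteq> carrier M \<and>
          \<not> module.lin_dep R M B \<and> module.span R M B = carrier M)"

text \<open>The locale \<open>algebra\<close> of HOL-Algebra requires the algebra to be commutative.\<close>

locale assoc_algebra = Module.module R A + A?: ring A for R (structure) and A (structure) +
  assumes smult_mult_left:
      "\<lbrakk>r \<in> carrier R; x \<in> carrier A; y \<in> carrier A\<rbrakk> \<Longrightarrow>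
       (r \<odot>\<^bsub>A\<^esub> x) \<otimes>\<^bsub>A\<^esub> y = r \<odot>\<^bsub>A\<^esub> (x \<otimes>\<^bsub>A\<^esub> y)"
    and smult_mult_right:
      "\<lbrakk>r \<in> carrier R; x \<in> carrier A; y \<in> carrier A\<rbrakk> \<Longrightarrow>
       x \<otimes>\<^bsub>A\<^esub> (r \<odot>\<^bsub>A\<^esub> y) = r \<odot>\<^bsub>A\<^esub> (x \<otimes>\<^bsub>A\<^esub> y)"

text \<open>For an ideal \<open>I\<close> of the base ring, \<open>I A\<close> is the additive subgroup of \<open>A\<close> generated by the
  products \<open>r \<odot> x\<close>, and \<open>A / I A\<close> is an algebra over \<open>R / I\<close>.\<close>

definition ideal_smult :: "'r set \<Rightarrow> ('r, 'a, 'q) module_scheme \<Rightarrow> 'a set" where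
  "ideal_smult I A = generate (add_monoid A) {r \<odot>\<^bsub>A\<^esub> x | r x. r \<in> I \<and> x \<in> carrier A}"

definition quotient_algebra ::
    "('r, 'a, 'q) module_scheme \<Rightarrow> 'r set \<Rightarrow> ('r set, 'a set) module" where
  "quotient_algebra A I =
     (let J = ideal_smult I A; Q = A Quot J in
      \<lparr>carrier = carrier Q, mult = mult Q, one = one Q, zero = zero Q, add = add Q,
       smult = (\<lambda>C D. \<Union>r \<in> C. \<Union>x \<in> D. J +>\<^bsub>A\<^esub> (r \<odot>\<^bsub>A\<^esub> x))\<rparr>)"

definition nonzero_ring :: "('a, 'p) ring_scheme \<Rightarrow> bool" where
  "nonzero_ring A \<longleftrightarrow> carrier A \<noteq> {\<zero>\<^bsub>A\<^esub>}"

definition ring_center :: "('a, 'p) ring_scheme \<Rightarrow> 'a set" where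
  "ring_center A = {z \<in> carrier A. \<forall>x \<in> carrier A. z \<otimes>\<^bsub>A\<^esub> x = x \<otimes>\<^bsub>A\<^esub> z}"

definition simple_ring :: "('a, 'p) ring_scheme \<Rightarrow> bool" where
  "simple_ring A \<longleftrightarrow>
     ring A \<and> nonzero_ring A \<and> (\<forall>I. ideal I A \<longrightarrow> I = {\<zero>\<^bsub>A\<^esub>} \<or> I = carrier A)"

definition central_simple_algebra ::
    "('k, 'p) ring_scheme \<Rightarrow> ('k, 'a, 'q) module_scheme \<Rightarrow> bool" where
  "central_simple_algebra K A \<longleftrightarrow>
     field K \<and> assoc_algebra K A \<and> finitely_generated K A \<and> simple_ring A \<and>
     ring_center A = (\<lambda>k. k \<odot>\<^bsub>A\<^esub> \<one>\<^bsub>A\<^esub>) ` carrier K"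

locale azumaya_algebra = assoc_algebra +
  assumes finitely_generated: "finitely_generated R A"
    and faithful: "faithful_module R A"
    and residually_central_simple:
      "maximalideal M R \<Longrightarrow> central_simple_algebra (R Quot M) (quotient_algebra A M)"

section \<open>Localization, base change and rank\<close>

definition fraction_rel :: "('r, 'p) ring_scheme \<Rightarrow> 'r set \<Rightarrow> (('r \<times> 'r) \<times> ('r \<times> 'r)) set" where
  "fraction_rel R S =
     {((a, s), (b, t)). a \<in> carrier R \<and> s \<in> S \<and> b \<in> carrier R \<and> t \<in> S \<and>
        (\<exists>u \<in> S. u \<otimes>\<^bsub>R\<^esub> (a \<otimes>\<^bsub>R\<^esub> t \<ominus>\<^bsub>R\<^esub> b \<otimes>\<^bsub>R\<^esub> s) = \<zero>\<^bsub>R\<^esub>)}"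

definition fraction :: "('r, 'p) ring_scheme \<Rightarrow> 'r set \<Rightarrow> 'r \<Rightarrow> 'r \<Rightarrow> ('r \<times> 'r) set" where
  "fraction R S a s = fraction_rel R S `` {(a, s)}"

definition localization :: "('r, 'p) ring_scheme \<Rightarrow> 'r set \<Rightarrow> ('r \<times> 'r) set ring" where
  "localization R S =
     \<lparr>carrier = (carrier R \<times> S) // fraction_rel R S,
      mult = (\<lambda>C D. \<Union>(a, s) \<in> C. \<Union>(b, t) \<in> D. fraction R S (a \<otimes>\<^bsub>R\<^esub> b) (s \<otimes>\<^bsub>R\<^esub> t)),
      one = fraction R S \<one>\<^bsub>R\<^esub> \<one>\<^bsub>R\<^esub>,
      zero = fraction R S \<zero>\<^bsub>R\<^esub> \<one>\<^bsub>R\<^esub>,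
      add = (\<lambda>C D. \<Union>(a, s) \<in> C. \<Union>(b, t) \<in> D.
               fraction R S (a \<otimes>\<^bsub>R\<^esub> t \<oplus>\<^bsub>R\<^esub> b \<otimes>\<^bsub>R\<^esub> s) (s \<otimes>\<^bsub>R\<^esub> t))\<rparr>"

definition restrict_scalars :: "('r \<Rightarrow> 't) \<Rightarrow> ('t, 'p) ring_scheme \<Rightarrow> ('r, 't) module" where
  "restrict_scalars \<phi> T =
     \<lparr>carrier = carrier T, mult = mult T, one = one T, zero = zero T, add = add T,
      smult = (\<lambda>r x. \<phi> r \<otimes>\<^bsub>T\<^esub> x)\<rparr>"

definition tensor_relations ::
    "('r, 'p) ring_scheme \<Rightarrow> ('r, 'a, 'q) module_scheme \<Rightarrow> ('r, 'b, 's) module_scheme \<Rightarrow>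
     ('a \<times> 'b \<Rightarrow>\<^sub>0 int) set" where
  "tensor_relations R M N =
     {frag_of (x \<oplus>\<^bsub>M\<^esub> x', y) - frag_of (x, y) - frag_of (x', y) | x x' y.
        x \<in> carrier M \<and> x' \<in> carrier M \<and> y \<in> carrier N} \<union>
     {frag_of (x, y \<oplus>\<^bsub>N\<^esub> y') - frag_of (x, y) - frag_of (x, y') | x y y'.
        x \<in> carrier M \<and> y \<in> carrier N \<and> y' \<in> carrier N} \<union>
     {frag_of (r \<odot>\<^bsub>M\<^esub> x, y) - frag_of (x, r \<odot>\<^bsub>N\<^esub> y) | r x y.
        r \<in> carrier R \<and> x \<in> carrier M \<and> y \<in> carrier N}"

definition tensor_kernel ::
    "('r, 'p) ring_scheme \<Rightarrow> ('r, 'a, 'q) module_scheme \<Rightarrow> ('r, 'b, 's) module_scheme \<Rightarrow>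
     ('a \<times> 'b \<Rightarrow>\<^sub>0 int) set" where
  "tensor_kernel R M N =
     generate (free_Abelian_group (carrier M \<times> carrier N)) (tensor_relations R M N)"

definition tensor_product ::
    "('r, 'p) ring_scheme \<Rightarrow> ('r, 'a, 'q) module_scheme \<Rightarrow> ('r, 'b, 's) module_scheme \<Rightarrow>
     ('a \<times> 'b \<Rightarrow>\<^sub>0 int) set monoid" where
  "tensor_product R M N =
     free_Abelian_group (carrier M \<times> carrier N) Mod tensor_kernel R M N"

text \<open>The \<open>T\<close>-module \<open>M \<otimes>\<^sub>R T\<close> for a ring homomorphism \<open>\<phi> : R \<rightarrow> T\<close>; scalars act by
  \<open>t (x \<otimes> y) = x \<otimes> t y\<close>. Only the module structure matters here, so the ring operations that the
  record type \<open>module\<close> also contains are left unspecified.\<close>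

definition base_change ::
    "('r, 'p) ring_scheme \<Rightarrow> ('r, 'a, 'q) module_scheme \<Rightarrow> ('r \<Rightarrow> 't) \<Rightarrow> ('t, 's) ring_scheme \<Rightarrow>
     ('t, ('a \<times> 't \<Rightarrow>\<^sub>0 int) set) module" where
  "base_change R M \<phi> T =
     (let N = restrict_scalars \<phi> T; F = free_Abelian_group (carrier M \<times> carrier N);
          K = tensor_kernel R M N; G = tensor_product R M N in
      \<lparr>carrier = carrier G, mult = undefined, one = undefined,
       zero = \<one>\<^bsub>G\<^esub>, add = mult G,
       smult = (\<lambda>t C. \<Union>c \<in> C.
         K #>\<^bsub>F\<^esub> frag_extend (\<lambda>(x, y). frag_of (x, t \<otimes>\<^bsub>T\<^esub> y)) c)\<rparr>)"

text \<open>\<open>A \<otimes>\<^sub>R R\<^sub>p\<close> as a module over the local ring \<open>R\<^sub>p\<close>.\<close>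

abbreviation local_ring_at :: "('r, 'p) ring_scheme \<Rightarrow> 'r set \<Rightarrow> ('r \<times> 'r) set ring" where
  "local_ring_at R P \<equiv> localization R (carrier R - P)"

definition local_module_at ::
    "('r, 'p) ring_scheme \<Rightarrow> ('r, 'a, 'q) module_scheme \<Rightarrow> 'r set \<Rightarrow>
     (('r \<times> 'r) set, ('a \<times> ('r \<times> 'r) set \<Rightarrow>\<^sub>0 int) set) module" where
  "local_module_at R A P =
     base_change R A (\<lambda>r. fraction R (carrier R - P) r \<one>\<^bsub>R\<^esub>) (local_ring_at R P)"

text \<open>The local rank is uniquely determined, since \<open>R\<^sub>p\<close> is a nonzero commutative ring; so
  \<open>r\<^sub>p(A) = r\<close> means that \<open>A \<otimes>\<^sub>R R\<^sub>p\<close> is free with a basis of \<open>r\<close> elements.\<close>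

definition constant_rank ::
    "('r, 'p) ring_scheme \<Rightarrow> ('r, 'a, 'q) module_scheme \<Rightarrow> nat \<Rightarrow> bool" where
  "constant_rank R A r \<longleftrightarrow>
     (\<forall>P. primeideal P R \<longrightarrow> free_of_rank (local_ring_at R P) (local_module_at R A P) r)"

end

theory Submission
  imports Defs "HOL-Computational_Algebra.Polynomial"
begin

text \<open>Both halves are local at a maximal ideal \<open>M\<close> of \<open>R\<close>. Put \<open>Q = A / M A\<close>, a simple ring with centre
  \<open>R / M\<close>; a basis of the localization of \<open>A\<close> at \<open>M\<close> reduces to a basis of \<open>Q\<close> over its centre.

  Let \<open>f\<close> be an identity of the integer \<open>n \<times> n\<close> matrices. The annihilator in \<open>R\<close> of a value of \<open>f\<close> on
  \<open>A\<close> is an ideal, so it suffices to find an element of it outside \<open>M\<close>. Let \<open>e\<close> be a primitive idempotent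
  of \<open>Q\<close> and \<open>K\<close> a maximal commutative subset of the division ring \<open>e Q e\<close>. By density the operators
  \<open>w \<mapsto> \<Sum> a w k\<close> with \<open>a \<in> Q\<close>, \<open>k \<in> K\<close> induce all \<open>K\<close>-linear maps of \<open>Q e\<close>, and counting dimensions over \<open>K\<close>
  gives \<open>dim (Q e) \<le> n\<close>. The field \<open>K\<close> need not lift to an extension of \<open>R\<close>, but it is a quotient of the
  group algebra of its multiplicative group \<open>G\<close>. So \<open>Q\<close> and \<open>K\<close> are replaced by the group algebra \<open>B\<close> of \<open>G\<close> over
  \<open>A\<close> and by its central subring \<open>PB\<close> of elements with scalar coefficients: modulo the kernel of
  \<open>PB \<rightarrow> K\<close>, the ring \<open>B\<close> is a full matrix ring over \<open>K\<close>. Nakayama's lemma lifts this to an action of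
  \<open>B\<close>, up to a central factor that is \<open>1\<close> modulo that kernel, by matrices over a commutative ring; the
  polynomial \<open>f\<close> vanishes on these.

  By Nakayama's lemma again, a proper ideal of \<open>A\<close> lies in \<open>M A\<close> for some \<open>M\<close>. It remains to find an identity
  of the integer matrices of size \<open>n - 1\<close> that is not an identity of \<open>Q\<close>. Any \<open>n\<^sup>2\<close> such matrices are linearly
  dependent, and the polynomial \<open>eliminant\<close>, which eliminates one of \<open>n\<^sup>2\<close> elements after the other, vanishes
  on dependent elements. On a basis of \<open>Q\<close> it has a nonzero value, since by density the coordinate
  functions of \<open>Q\<close> have the form \<open>z \<mapsto> \<Sum> u z v\<close>.\<close>

section \<open>Evaluation of noncommutative polynomials\<close>

text \<open>An identity of integer matrices holds for generic matrices, hence over every commutative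
  ring. So generation is enough: if left multiplications by \<open>B\<close> carry a row of at most
  n elements into its right span over a commutative subring, then f of the acting matrices is zero
  and f(b) kills the row. The row lifts one column of matrix units. Over scalars alone it spans a
  single column; a power of the lifted Jordan block, multiplied on the right, brings any basis
  vector to the one that the column sees, and so yields all matrix units.

  The group algebra is free over \<open>A\<close> on the group elements. Hence an annihilator of
  f(b) in \<open>PB\<close> gives annihilators in \<open>R\<close>, its coefficients, and they
  cannot all vanish in the residue field if the annihilator maps to 1 in \<open>K\<close>. Elements
  congruent to 1 are not inverted: a central factor is carried along, each letter of f consumes one
  copy of it, and this forces a homogenised evaluation.

  \<open>eliminant\<close> plays the part of the Capelli polynomial; a recursion in place of the
  alternating sum turns both of its properties into inductions over a list.\<close>

definition pm_eval :: "('b, 'c) ring_scheme \<Rightarrow> ('k \<Rightarrow> 'b) \<Rightarrow> ('k \<Rightarrow>\<^sub>0 int) \<Rightarrow> 'b" where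
  "pm_eval B \<phi> f = (\<Oplus>\<^bsub>B\<^esub> w \<in> Poly_Mapping.keys f. [Poly_Mapping.lookup f w] \<cdot>\<^bsub>B\<^esub> \<phi> w)"

lemma ncpoly_eval_eq_pm_eval: "ncpoly_eval B b = pm_eval B (word_eval B b)"
  by (simp add: fun_eq_iff ncpoly_eval_def pm_eval_def)

lemma single_add_induct [case_names zero add]:
  assumes "P 0" "\<And>f k v. P f \<Longrightarrow> P (f + Poly_Mapping.single k v)"
  shows "P (f :: 'k \<Rightarrow>\<^sub>0 'v::comm_monoid_add)"
proof (induct f rule: update_induct)
  case (update f a b)
  have "Poly_Mapping.update a b f = f + Poly_Mapping.single a b"
    using update(1)
    by (intro poly_mapping_eqI) (auto simp: lookup_add lookup_update lookup_single when_def in_keys_iff)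
  then show ?case using assms(2) update by simp
qed (rule assms(1))

context ring
begin

lemma pm_eval_closed [simp]:
  assumes "\<And>k. \<phi> k \<in> carrier R" shows "pm_eval R \<phi> f \<in> carrier R"
  unfolding pm_eval_def using assms by (intro finsum_closed) auto

lemma add_pow_int_0: "[(0::int)] \<cdot>\<^bsub>R\<^esub> x = \<zero>"
  by (simp add: add_pow_def)

lemma pm_eval_superset:
  assumes "\<And>k. \<phi> k \<in> carrier R" "finite S" "Poly_Mapping.keys f \<subseteq> S"
  shows "pm_eval R \<phi> f = (\<Oplus> w \<in> S. [Poly_Mapping.lookup f w] \<cdot>\<^bsub>R\<^esub> \<phi> w)"
  unfolding pm_eval_def using assms
  by (intro add.finprod_mono_neutral_cong_left) (auto simp: in_keys_iff add_pow_int_0)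

lemma pm_eval_0 [simp]: "pm_eval R \<phi> 0 = \<zero>"
  by (simp add: pm_eval_def)

lemma pm_eval_single:
  assumes "\<And>k. \<phi> k \<in> carrier R"
  shows "pm_eval R \<phi> (Poly_Mapping.single k c) = [c] \<cdot>\<^bsub>R\<^esub> \<phi> k"
  using assms pm_eval_superset[of \<phi> "{k}" "Poly_Mapping.single k c"] by simp

lemma pm_eval_add:
  assumes "\<And>k. \<phi> k \<in> carrier R"
  shows "pm_eval R \<phi> (f + g) = pm_eval R \<phi> f \<oplus> pm_eval R \<phi> g"
proof -
  let ?S = "Poly_Mapping.keys f \<union> Poly_Mapping.keys g"
  have "pm_eval R \<phi> (f + g) = (\<Oplus> w \<in> ?S. [Poly_Mapping.lookup (f + g) w] \<cdot>\<^bsub>R\<^esub> \<phi> w)"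
    using keys_add[of f g] by (intro pm_eval_superset assms) auto
  also have "\<dots> = (\<Oplus> w \<in> ?S. [Poly_Mapping.lookup f w] \<cdot>\<^bsub>R\<^esub> \<phi> w \<oplus> [Poly_Mapping.lookup g w] \<cdot>\<^bsub>R\<^esub> \<phi> w)"
    using assms by (intro finsum_cong') (auto simp: lookup_add add.int_pow_mult)
  also have "\<dots> = pm_eval R \<phi> f \<oplus> pm_eval R \<phi> g"
    using assms by (simp add: finsum_addf Pi_def pm_eval_superset[of \<phi> ?S])
  finally show ?thesis .
qed

lemma pm_eval_sum:
  assumes "\<And>k. \<phi> k \<in> carrier R" "finite I"
  shows "pm_eval R \<phi> (\<Sum>i\<in>I. f i) = (\<Oplus>i\<in>I. pm_eval R \<phi> (f i))"
  using assms(2) by induct (auto simp: pm_eval_add assms(1))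

lemma pm_eval_uminus:
  assumes "\<And>k. \<phi> k \<in> carrier R"
  shows "pm_eval R \<phi> (- f) = \<ominus> pm_eval R \<phi> f"
proof -
  have "pm_eval R \<phi> (- f) \<oplus> pm_eval R \<phi> f = \<zero>"
    using assms pm_eval_add[of \<phi> "- f" f] by simp
  then show ?thesis using assms by (simp add: minus_equality)
qed

lemma pm_eval_diff:
  assumes "\<And>k. \<phi> k \<in> carrier R"
  shows "pm_eval R \<phi> (f - g) = pm_eval R \<phi> f \<ominus> pm_eval R \<phi> g"
  using assms pm_eval_add[of \<phi> f "- g"] by (simp add: pm_eval_uminus a_minus_def)

text \<open>Two maps are used because a homogenised evaluation is not multiplicative: splitting off
  one variable lowers the degree bound, so \<open>\<phi>\<close> carries the bound before this and
  \<open>\<psi>\<close> the bound after it.\<close>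

lemma pm_eval_single_mult:
  assumes cl: "\<And>k. \<phi> k \<in> carrier R" "\<And>k. \<psi> k \<in> carrier R" "x \<in> carrier R"
    and hom: "\<And>j. \<phi> (k + j) = x \<otimes> \<psi> j"
  shows "pm_eval R \<phi> (Poly_Mapping.single k c * f) = ([c] \<cdot>\<^bsub>R\<^esub> x) \<otimes> pm_eval R \<psi> f"
proof (induct f rule: single_add_induct)
  case (add f j d)
  have "[(c * d)] \<cdot>\<^bsub>R\<^esub> (x \<otimes> \<psi> j) = ([c] \<cdot>\<^bsub>R\<^esub> x) \<otimes> ([d] \<cdot>\<^bsub>R\<^esub> \<psi> j)"
    using cl by (simp add: add_pow_ldistr_int add_pow_rdistr_int add.int_pow_pow mult.commute)
  then show ?case
    using cl add by (simp add: distrib_left pm_eval_add mult_single pm_eval_single hom r_distr)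
qed (use cl in auto)

lemma pm_eval_mult:
  assumes cl: "\<And>k. \<phi> k \<in> carrier R" and hom: "\<And>j k. \<phi> (k + j) = \<phi> k \<otimes> \<phi> j"
  shows "pm_eval R \<phi> (f * g) = pm_eval R \<phi> f \<otimes> pm_eval R \<phi> g"
proof (induct f rule: single_add_induct)
  case (add f k c)
  then show ?case
    using cl by (simp add: distrib_right pm_eval_add pm_eval_single_mult[where \<psi>=\<phi> and x="\<phi> k"] hom
        l_distr pm_eval_single)
qed (use cl in auto)

lemma word_eval_closed [simp]:
  assumes "\<And>k. b k \<in> carrier R" shows "word_eval R b w \<in> carrier R"
proof -
  have "foldr (\<lambda>i y. b i \<otimes> y) xs \<one> \<in> carrier R" for xs
    using assms by (induct xs) auto
  then show ?thesis unfolding word_eval_def .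
qed

lemma word_eval_add:
  assumes "\<And>k. b k \<in> carrier R"
  shows "word_eval R b (v + w) = word_eval R b v \<otimes> word_eval R b w"
proof -
  have c: "foldr (\<lambda>i y. b i \<otimes> y) xs \<one> \<in> carrier R" for xs
    using assms by (induct xs) auto
  have "foldr (\<lambda>i y. b i \<otimes> y) (xs @ ys) \<one>
      = foldr (\<lambda>i y. b i \<otimes> y) xs \<one> \<otimes> foldr (\<lambda>i y. b i \<otimes> y) ys \<one>" for xs ys
    using assms c by (induct xs) (auto simp: m_assoc)
  then show ?thesis by (simp add: word_eval_def plus_word_def)
qed

lemma word_eval_0 [simp]: "word_eval R b 0 = \<one>"
  by (simp add: word_eval_def zero_word_def)

end

definition ncvar :: "nat \<Rightarrow> ncpoly" where "ncvar i = Poly_Mapping.single (Word [i]) 1"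

lemma (in ring) ncpoly_eval_ncvar:
  assumes "\<And>k. b k \<in> carrier R" shows "ncpoly_eval R b (ncvar i) = b i"
  using assms unfolding ncpoly_eval_eq_pm_eval ncvar_def
  by (subst pm_eval_single) (simp, simp add: word_eval_def add.int_pow_1)

lemma (in ring) ncpoly_eval_mult:
  assumes "\<And>k. b k \<in> carrier R"
  shows "ncpoly_eval R b (f * g) = ncpoly_eval R b f \<otimes> ncpoly_eval R b g"
  unfolding ncpoly_eval_eq_pm_eval using assms by (intro pm_eval_mult) (auto simp: word_eval_add)

lemma (in ring) ncpoly_eval_closed:
  assumes "\<And>k. b k \<in> carrier R" shows "ncpoly_eval R b f \<in> carrier R"
  unfolding ncpoly_eval_eq_pm_eval using assms by simp

lemma word_eval_cong:
  assumes "\<And>i. i \<in> set (letters w) \<Longrightarrow> b i = b' i"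
  shows "word_eval B b w = word_eval B b' w"
proof -
  have "(\<And>i. i \<in> set xs \<Longrightarrow> b i = b' i) \<Longrightarrow>
      foldr (\<lambda>i y. b i \<otimes>\<^bsub>B\<^esub> y) xs \<one>\<^bsub>B\<^esub> = foldr (\<lambda>i y. b' i \<otimes>\<^bsub>B\<^esub> y) xs \<one>\<^bsub>B\<^esub>" for xs
    by (induct xs) auto
  with assms show ?thesis by (simp add: word_eval_def)
qed

text \<open>The letters of f lie in 1..m, so values elsewhere can be set to zero. Later arguments
  can then assume that every letter has a value in the ring.\<close>

lemma (in ring) satisfies_identity_iff_total:
  assumes "f \<in> free_assoc_ring m"
  shows "satisfies_identity R m f \<longleftrightarrow> (\<forall>b. (\<forall>i. b i \<in> carrier R) \<longrightarrow> ncpoly_eval R b f = \<zero>)"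
proof
  assume "satisfies_identity R m f"
  then show "\<forall>b. (\<forall>i. b i \<in> carrier R) \<longrightarrow> ncpoly_eval R b f = \<zero>"
    by (simp add: satisfies_identity_def Pi_def)
next
  assume *: "\<forall>b. (\<forall>i. b i \<in> carrier R) \<longrightarrow> ncpoly_eval R b f = \<zero>"
  show "satisfies_identity R m f"
    unfolding satisfies_identity_def
  proof
    fix b :: "nat \<Rightarrow> 'a" assume b: "b \<in> {1..m} \<rightarrow> carrier R"
    define b' where "b' i = (if i \<in> {1..m} then b i else \<zero>)" for i
    have b': "b' i \<in> carrier R" for i using b by (auto simp: b'_def)
    have w: "word_eval R b w = word_eval R b' w" if "w \<in> Poly_Mapping.keys f" for w
      using assms that by (intro word_eval_cong) (fastforce simp: free_assoc_ring_def b'_def)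
    have "ncpoly_eval R b f = ncpoly_eval R b' f"
      unfolding ncpoly_eval_def using b' w by (intro finsum_cong') auto
    then show "ncpoly_eval R b f = \<zero>" using * b' by simp
  qed
qed

text \<open>A polynomial involves finitely many letters, so some m bounds them. The letter 0 is
  excluded because the variables of \<open>free_assoc_ring\<close> start at 1.\<close>

lemma ex_free_assoc_ring:
  assumes "\<And>w. w \<in> Poly_Mapping.keys f \<Longrightarrow> 0 \<notin> set (letters w)"
  shows "\<exists>m. f \<in> free_assoc_ring m"
proof -
  have "finite (\<Union>w\<in>Poly_Mapping.keys f. set (letters w))" by auto
  then obtain m where "\<forall>i \<in> (\<Union>w\<in>Poly_Mapping.keys f. set (letters w)). i \<le> m"
    using finite_nat_set_iff_bounded_le by blast
  with assms have "f \<in> free_assoc_ring m"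
    unfolding free_assoc_ring_def by (auto simp: Suc_le_eq intro!: gr0I)
  then show ?thesis ..
qed

section \<open>Identities of integer matrices\<close>

text \<open>A nonzero polynomial has finitely many roots, and there are infinitely many integers.
  \<open>K\<close> is the set of exponents that occur.\<close>

lemma vandermonde_zero:
  fixes h :: "nat \<Rightarrow> int"
  assumes "finite K" "\<And>t :: int. (\<Sum>k\<in>K. h k * t ^ k) = 0" "k \<in> K"
  shows "h k = 0"
proof -
  define p where "p = (\<Sum>k\<in>K. Polynomial.monom (h k) k)"
  have "poly p t = 0" for t
    using assms(2)[of t] by (simp add: p_def poly_sum poly_monom)
  then have "p = 0" using poly_all_0_iff_0 by blast
  moreover have "Polynomial.coeff p k = h k"
    using assms by (simp add: p_def coeff_sum)
  ultimately show ?thesis by simp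
qed

text \<open>Induction on the number of monomials. Two distinct monomials differ in the exponent of
  some variable x; by the one-variable case the part with the exponent of m at x vanishes on its
  own, and it has fewer monomials.\<close>

lemma multiset_polynomial_zero:
  fixes c :: "'v multiset \<Rightarrow> int"
  assumes "finite S" "\<And>g :: 'v \<Rightarrow> int. (\<Sum>m\<in>S. c m * (\<Prod>x\<in>#m. g x)) = 0" "m \<in> S"
  shows "c m = 0"
  using assms
proof (induct "card S" arbitrary: S m rule: less_induct)
  case less
  show ?case
  proof (cases "S = {m}")
    case True
    then show ?thesis using less.prems(2)[of "\<lambda>_. 1"] by simp
  next
    case False
    then obtain m' where "m' \<in> S" "m' \<noteq> m" using less.prems(3) by auto
    then obtain x where x: "count m' x \<noteq> count m x" by (meson multiset_eqI)
    define S' where "S' = {u \<in> S. count u x = count m x}"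
    have S': "S' \<subset> S" "finite S'" "m \<in> S'"
      using \<open>m' \<in> S\<close> x less.prems by (auto simp: S'_def)
    have split: "(\<Prod>y\<in>#u. g y) = g x ^ count u x * (\<Prod>y\<in>#filter_mset (\<lambda>y. y \<noteq> x) u. g y)"
      for u and g :: "'v \<Rightarrow> int"
      by (induct u) (auto simp: algebra_simps)
    have "(\<Sum>u\<in>S'. c u * (\<Prod>y\<in>#filter_mset (\<lambda>y. y \<noteq> x) u. g y)) = 0" for g :: "'v \<Rightarrow> int"
    \<comment> \<open>All values except the one at x are frozen. The sum becomes a polynomial in t
      whose coefficient at each exponent collects the monomials with that exponent of x.\<close>
    proof (rule vandermonde_zero[where k = "count m x" and K = "(\<lambda>u. count u x) ` S"
          and h = "\<lambda>k. \<Sum>u\<in>{u\<in>S. count u x = k}. c u * (\<Prod>y\<in>#filter_mset (\<lambda>y. y \<noteq> x) u. g y)",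
          folded S'_def])
      fix t :: int
      define g' where "g' = g(x := t)"
      have g': "(\<Prod>y\<in>#filter_mset (\<lambda>y. y \<noteq> x) u. g y) = (\<Prod>y\<in>#filter_mset (\<lambda>y. y \<noteq> x) u. g' y)"
        for u
        by (rule arg_cong[of _ _ prod_mset], rule image_mset_cong) (auto simp: g'_def)
      have e: "0 = (\<Sum>u\<in>S. c u * (\<Prod>y\<in>#filter_mset (\<lambda>y. y \<noteq> x) u. g' y) * t ^ count u x)"
      proof -
        have "(\<Prod>y\<in>#u. g' y) = (\<Prod>y\<in>#filter_mset (\<lambda>y. y \<noteq> x) u. g' y) * t ^ count u x" for u
          using split[of g' u] by (simp add: g'_def)
        then have "(\<Sum>u\<in>S. c u * (\<Prod>y\<in>#u. g' y)) =
            (\<Sum>u\<in>S. c u * (\<Prod>y\<in>#filter_mset (\<lambda>y. y \<noteq> x) u. g' y) * t ^ count u x)"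
          by (intro sum.cong refl) (metis mult.assoc)
        then show ?thesis using less.prems(2)[of g'] by metis
      qed
      note e also have "(\<Sum>u\<in>S. c u * (\<Prod>y\<in>#filter_mset (\<lambda>y. y \<noteq> x) u. g' y) * t ^ count u x) = (\<Sum>k\<in>(\<lambda>u. count u x) ` S. \<Sum>u\<in>{u\<in>S. count u x = k}.
          c u * (\<Prod>y\<in>#filter_mset (\<lambda>y. y \<noteq> x) u. g' y) * t ^ count u x)"
        using less.prems(1) by (rule sum.image_gen)
      also have "\<dots> = (\<Sum>k\<in>(\<lambda>u. count u x) ` S. (\<Sum>u\<in>{u\<in>S. count u x = k}.
          c u * (\<Prod>y\<in>#filter_mset (\<lambda>y. y \<noteq> x) u. g y)) * t ^ k)"
        by (simp add: g' sum_distrib_right)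
      finally show "(\<Sum>k\<in>(\<lambda>u. count u x) ` S. (\<Sum>u\<in>{u\<in>S. count u x = k}.
          c u * (\<Prod>y\<in>#filter_mset (\<lambda>y. y \<noteq> x) u. g y)) * t ^ k) = 0" ..
    qed (use less.prems in auto)
    then have "(\<Sum>u\<in>S'. c u * (\<Prod>y\<in>#u. g y)) = 0" for g :: "'v \<Rightarrow> int"
    proof -
      have "(\<Sum>u\<in>S'. c u * (\<Prod>y\<in>#u. g y)) = g x ^ count m x *
          (\<Sum>u\<in>S'. c u * (\<Prod>y\<in>#filter_mset (\<lambda>y. y \<noteq> x) u. g y))"
        unfolding sum_distrib_left
        by (intro sum.cong refl, subst split[of g]) (simp add: S'_def)
      with \<open>\<And>g. (\<Sum>u\<in>S'. c u * (\<Prod>y\<in>#filter_mset (\<lambda>y. y \<noteq> x) u. g y)) = 0\<close> show ?thesis by simp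
    qed
    then show ?thesis
      using less.hyps[of S' m] S' less.prems(1) by (simp add: psubset_card_mono)
  qed
qed

text \<open>Multisets of variables are commutative monomials, added as exponents; with the
  convolution product this type is the polynomial ring over the integers in the entries of the
  generic matrices.\<close>

type_synonym generic_poly = "(nat \<times> nat \<times> nat) multiset \<Rightarrow>\<^sub>0 int"

text \<open>Entry \<open>(l, i)\<close> of a word in generic \<open>n \<times> n\<close> matrices; the variable \<open>(k, l, j)\<close> is the
  \<open>(l, j)\<close> entry of the \<open>k\<close>-th matrix.\<close>

primrec generic_entry :: "nat \<Rightarrow> nat list \<Rightarrow> nat \<Rightarrow> nat \<Rightarrow> generic_poly" where
  "generic_entry n [] l i = (if l = i then 1 else 0)"
| "generic_entry n (k # w) l i =
     (\<Sum>j<n. Poly_Mapping.single {#(k, l, j)#} 1 * generic_entry n w j i)"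

definition generic_value :: "nat \<Rightarrow> ncpoly \<Rightarrow> nat \<Rightarrow> nat \<Rightarrow> generic_poly" where
  "generic_value n f l i =
     (\<Sum>w\<in>Poly_Mapping.keys f. of_int (Poly_Mapping.lookup f w) * generic_entry n (letters w) l i)"

lemma int_ring_pow: "[(k::int)] \<cdot>\<^bsub>\<Z>\<^esub> x = k * x"
proof (induct k rule: int_induct[where k = 0])
  case base
  then show ?case by (simp add: add_pow_def)
next
  case (step1 i)
  have "[(i + 1)] \<cdot>\<^bsub>\<Z>\<^esub> x = [i] \<cdot>\<^bsub>\<Z>\<^esub> x + [(1::int)] \<cdot>\<^bsub>\<Z>\<^esub> x"
    using int.add.int_pow_mult[of x i 1] by simp
  also have "[(1::int)] \<cdot>\<^bsub>\<Z>\<^esub> x = x" using int.add.int_pow_1[of x] by simp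
  finally show ?case using step1 by (simp add: distrib_right)
next
  case (step2 i)
  have "[(i - 1 + 1)] \<cdot>\<^bsub>\<Z>\<^esub> x = [(i - 1)] \<cdot>\<^bsub>\<Z>\<^esub> x + [(1::int)] \<cdot>\<^bsub>\<Z>\<^esub> x"
    using int.add.int_pow_mult[of x "i - 1" 1] by simp
  moreover have "[(1::int)] \<cdot>\<^bsub>\<Z>\<^esub> x = x" using int.add.int_pow_1[of x] by simp
  ultimately show ?case using step2 by (simp add: left_diff_distrib)
qed

text \<open>A value of \<open>pm_eval\<close> is an integer combination, and additive maps preserve
  these. The map h is later a matrix entry, a right multiplication or a ring homomorphism.\<close>

lemma additive_map_pm_eval:
  assumes R: "ring R" and S: "ring S" and h: "h \<in> carrier R \<rightarrow> carrier S"
    and add: "\<And>x y. x \<in> carrier R \<Longrightarrow> y \<in> carrier R \<Longrightarrow> h (x \<oplus>\<^bsub>R\<^esub> y) = h x \<oplus>\<^bsub>S\<^esub> h y"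
    and \<phi>: "\<And>k. \<phi> k \<in> carrier R"
  shows "h (pm_eval R \<phi> f) = pm_eval S (\<lambda>k. h (\<phi> k)) f"
proof -
  interpret R: ring R by fact
  interpret S: ring S by fact
  interpret H: group_hom "add_monoid R" "add_monoid S" h
    using h add by unfold_locales (auto simp: hom_def)
  have \<phi>': "h (\<phi> k) \<in> carrier S" for k using h \<phi> by auto
  have pow: "h ([(c::int)] \<cdot>\<^bsub>R\<^esub> x) = [c] \<cdot>\<^bsub>S\<^esub> h x" if "x \<in> carrier R" for c x
    using H.hom_int_pow[of x c] that by (simp add: add_pow_def)
  show ?thesis
  proof (induct f rule: single_add_induct)
    case zero
    then show ?case using H.hom_one by simp
  next
    case (add f k v)
    then show ?case
      using \<phi> \<phi>' assms(4) by (simp add: R.pm_eval_add S.pm_eval_add R.pm_eval_single S.pm_eval_single pow)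
  qed
qed

lemma (in abelian_monoid) finsum_swap:
  assumes "finite I" "finite J" "\<And>i j. i \<in> I \<Longrightarrow> j \<in> J \<Longrightarrow> f i j \<in> carrier G"
  shows "(\<Oplus>i\<in>I. \<Oplus>j\<in>J. f i j) = (\<Oplus>j\<in>J. \<Oplus>i\<in>I. f i j)"
  using assms(1,3)
proof (induct I)
  case empty
  then show ?case using assms(2) by (simp add: finsum_zero)
next
  case (insert a I)
  have "(\<Oplus>i\<in>insert a I. \<Oplus>j\<in>J. f i j) = (\<Oplus>j\<in>J. f a j) \<oplus> (\<Oplus>j\<in>J. \<Oplus>i\<in>I. f i j)"
    using insert by (subst finsum_insert) (auto intro!: finsum_closed)
  also have "\<dots> = (\<Oplus>j\<in>J. f a j \<oplus> (\<Oplus>i\<in>I. f i j))"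
    using insert by (subst finsum_addf) (auto intro!: finsum_closed)
  also have "\<dots> = (\<Oplus>j\<in>J. \<Oplus>i\<in>insert a I. f i j)"
    using insert by (intro finsum_cong' refl) (auto intro!: finsum_closed finsum_insert[symmetric])
  finally show ?case .
qed

lemma ring_int_matrix: "ring (int_matrix_ring n)"
  by (rule ring_mat)

section \<open>Generic matrices and their integer specialisations\<close>

definition generic_point :: "(nat \<times> nat \<times> nat \<Rightarrow> int) \<Rightarrow> (nat \<times> nat \<times> nat) multiset \<Rightarrow> int" where
  "generic_point g \<mu> = (\<Prod>x\<in>#\<mu>. g x)"

lemma pm_eval_int_mult:
  "pm_eval \<Z> (generic_point g) (p * q) = pm_eval \<Z> (generic_point g) p * pm_eval \<Z> (generic_point g) q"
proof -
  show ?thesis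
    using ring.pm_eval_mult[OF int.ring_axioms, of "generic_point g" p q, simplified] by (simp add: generic_point_def)
qed

lemma pm_eval_int_sum:
  assumes "finite I"
  shows "pm_eval \<Z> \<phi> (\<Sum>i\<in>I. f i) = (\<Sum>i\<in>I. pm_eval \<Z> \<phi> (f i))"
proof -
  show ?thesis using ring.pm_eval_sum[OF int.ring_axioms, of \<phi> I f] assms by (simp add: int_finsum_eq)
qed

lemma pm_eval_int_eq: "pm_eval \<Z> \<phi> f = (\<Sum>w\<in>Poly_Mapping.keys f. Poly_Mapping.lookup f w * \<phi> w)"
  by (simp add: pm_eval_def int_ring_pow int_finsum_eq)

lemma pm_eval_int_of_int: "pm_eval \<Z> (generic_point g) (of_int c) = c"
proof -
  have "of_int c = (Poly_Mapping.single 0 c :: generic_poly)"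
    by (rule poly_mapping_eqI) (simp add: lookup_of_int lookup_single)
  then show ?thesis
    using ring.pm_eval_single[OF int.ring_axioms, of "generic_point g" 0 c] by (simp add: int_ring_pow generic_point_def)
qed

lemma word_eval_int_matrix:
  assumes "\<And>k. Y k = mat n n (\<lambda>(l, j). g (k, l, j))" "l < n" "i < n"
  shows "word_eval (int_matrix_ring n) Y w $$ (l, i) =
    pm_eval \<Z> (generic_point g) (generic_entry n (letters w) l i)"
proof -
  interpret M: ring "int_matrix_ring n" by (rule ring_int_matrix)
  have c: "foldr (\<lambda>i y. Y i \<otimes>\<^bsub>int_matrix_ring n\<^esub> y) xs \<one>\<^bsub>int_matrix_ring n\<^esub> \<in> carrier_mat n n" for xs
    by (induct xs) (auto simp: ring_mat_simps assms(1))
  have "l < n \<Longrightarrow> foldr (\<lambda>i y. Y i \<otimes>\<^bsub>int_matrix_ring n\<^esub> y) xs \<one>\<^bsub>int_matrix_ring n\<^esub> $$ (l, i) =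
      pm_eval \<Z> (generic_point g) (generic_entry n xs l i)" for xs
  proof (induct xs arbitrary: l)
    case Nil
    then show ?case
      using assms(3) pm_eval_int_of_int[of g 1] by (simp add: ring_mat_simps)
  next
    case (Cons k xs)
    let ?W = "foldr (\<lambda>i y. Y i \<otimes>\<^bsub>int_matrix_ring n\<^esub> y) xs \<one>\<^bsub>int_matrix_ring n\<^esub>"
    have W: "?W \<in> carrier_mat n n" by (rule c)
    have "(Y k * ?W) $$ (l, i) = (\<Sum>j<n. g (k, l, j) * ?W $$ (j, i))"
      using Cons.prems assms(3) W
      by (simp add: assms(1) scalar_prod_def lessThan_atLeast0)
    also have "\<dots> = (\<Sum>j<n. g (k, l, j) * pm_eval \<Z> (generic_point g) (generic_entry n xs j i))"
      using Cons.hyps by (intro sum.cong refl) auto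
    also have "\<dots> = pm_eval \<Z> (generic_point g) (generic_entry n (k # xs) l i)"
      using ring.pm_eval_single[OF int.ring_axioms, of "generic_point g" _ 1]
      by (simp add: pm_eval_int_sum pm_eval_int_mult int_ring_pow generic_point_def)
    finally show ?case by (simp add: ring_mat_simps)
  qed
  with assms(2) show ?thesis by (simp add: word_eval_def)
qed

text \<open>Every integer specialisation of this polynomial is an entry of f at integer matrices,
  hence zero, and an integer polynomial that vanishes at all integer points is zero. The identity
  thereby becomes formal, and commuting elements of any ring may be substituted.\<close>

lemma generic_value_eq_0:
  assumes "Z_identity (int_matrix_ring n) m f" "l < n" "i < n"
  shows "generic_value n f l i = 0"
proof -
  interpret M: ring "int_matrix_ring n" by (rule ring_int_matrix)
  have van: "pm_eval \<Z> (generic_point g) (generic_value n f l i) = 0" for g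
  proof -
    define Y where "Y k = mat n n (\<lambda>(l, j). g (k, l, j))" for k :: nat
    have Y: "Y k \<in> carrier (int_matrix_ring n)" for k
      by (simp add: Y_def ring_mat_simps)
    have "ncpoly_eval (int_matrix_ring n) Y f = \<zero>\<^bsub>int_matrix_ring n\<^esub>"
      using assms(1) Y M.satisfies_identity_iff_total[of f m] by (auto simp: Z_identity_def)
    then have "0 = (ncpoly_eval (int_matrix_ring n) Y f) $$ (l, i)"
      using assms(2,3) by (simp add: ring_mat_simps)
    also have "\<dots> = pm_eval \<Z> (\<lambda>w. word_eval (int_matrix_ring n) Y w $$ (l, i)) f"
      unfolding ncpoly_eval_eq_pm_eval
      using assms(2,3) Y
      by (intro additive_map_pm_eval[where h = "\<lambda>M. M $$ (l, i)"] ring_int_matrix int.ring_axioms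
          M.word_eval_closed)
        (auto simp: ring_mat_simps)
    also have "\<dots> = (\<Sum>w\<in>Poly_Mapping.keys f. Poly_Mapping.lookup f w *
        pm_eval \<Z> (generic_point g) (generic_entry n (letters w) l i))"
      using assms(2,3) by (simp add: pm_eval_int_eq[of _ f] word_eval_int_matrix[OF Y_def])
    also have "\<dots> = pm_eval \<Z> (generic_point g) (generic_value n f l i)"
      by (simp add: generic_value_def pm_eval_int_sum pm_eval_int_mult pm_eval_int_of_int)
    finally show ?thesis ..
  qed
  have "Poly_Mapping.lookup (generic_value n f l i) \<mu> = 0"
    if "\<mu> \<in> Poly_Mapping.keys (generic_value n f l i)" for \<mu>
  proof (rule multiset_polynomial_zero[OF _ _ that])
    fix g
    show "(\<Sum>m\<in>Poly_Mapping.keys (generic_value n f l i).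
        Poly_Mapping.lookup (generic_value n f l i) m * (\<Prod>x\<in>#m. g x)) = 0"
      using van[of g] by (simp add: pm_eval_int_eq generic_point_def)
  qed simp
  then have "Poly_Mapping.keys (generic_value n f l i) = {}"
    by (meson all_not_in_conv in_keys_iff)
  then show ?thesis by simp
qed

text \<open>\<open>\<Phi>\<close> is the evaluation of commutative monomials at Y. The ring is not
  commutative and only the elements \<open>Y x\<close> commute with each other, so the product is
  taken along a chosen ordering of the multiset and shown not to depend on it.\<close>

lemma (in ring) ex_multiset_product:
  assumes Y: "\<And>x. Y x \<in> carrier R" and comm: "\<And>x y. Y x \<otimes> Y y = Y y \<otimes> Y x"
  shows "\<exists>\<Phi>. \<Phi> {#} = \<one> \<and> (\<forall>x \<mu>. \<Phi> (add_mset x \<mu>) = Y x \<otimes> \<Phi> \<mu>) \<and> (\<forall>\<mu>. \<Phi> \<mu> \<in> carrier R)"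
proof -
  define p where "p xs = foldr (\<lambda>x y. Y x \<otimes> y) xs \<one>" for xs
  have c: "p xs \<in> carrier R" for xs
    by (induct xs) (auto simp: p_def Y)
  have move: "p (xs @ x # ys) = Y x \<otimes> p (xs @ ys)" for xs x ys
  proof (induct xs)
    case (Cons a xs)
    have "p (a # xs @ x # ys) = Y a \<otimes> (Y x \<otimes> p (xs @ ys))"
      using Cons by (simp add: p_def)
    also have "\<dots> = Y x \<otimes> (Y a \<otimes> p (xs @ ys))"
      using Y c comm[of a x] by (metis m_assoc)
    finally show ?case by (simp add: p_def)
  qed (simp add: p_def)
  have perm: "mset xs = mset ys \<Longrightarrow> p xs = p ys" for xs ys
  proof (induct xs arbitrary: ys)
    case (Cons a xs)
    then obtain ys1 ys2 where ys: "ys = ys1 @ a # ys2"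
      by (metis list.set_intros(1) mset_eq_setD split_list)
    with Cons.prems have "mset xs = mset (ys1 @ ys2)" by simp
    then have "p xs = p (ys1 @ ys2)" by (rule Cons.hyps)
    then show ?case unfolding ys move by (simp add: p_def)
  qed (simp add: p_def)
  define \<Phi> where "\<Phi> \<mu> = p (SOME xs. mset xs = \<mu>)" for \<mu>
  have \<Phi>: "\<Phi> (mset xs) = p xs" for xs
    unfolding \<Phi>_def by (rule perm) (metis (mono_tags) someI)
  have "\<Phi> {#} = \<one>" using \<Phi>[of "[]"] by (simp add: p_def)
  moreover have "\<Phi> (add_mset x \<mu>) = Y x \<otimes> \<Phi> \<mu>" for x \<mu>
  proof -
    obtain xs where "\<mu> = mset xs" by (metis ex_mset)
    then show ?thesis using \<Phi>[of xs] \<Phi>[of "x # xs"] by (simp add: p_def)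
  qed
  moreover have "\<Phi> \<mu> \<in> carrier R" for \<mu> by (simp add: \<Phi>_def c)
  ultimately show ?thesis by blast
qed

text \<open>Each letter of the word uses up one factor \<open>\<delta>\<close> to become a matrix,
  and the remaining factors are left over. The weight \<open>\<delta> [^] (D - size \<mu>)\<close>
  records this for each monomial, so that words of different lengths can later be added with the
  same exponent D.\<close>

lemma (in ring) word_action:
  assumes b: "\<And>k. b k \<in> carrier R" and v: "\<And>i. v i \<in> carrier R" and Y: "\<And>x. Y x \<in> carrier R"
    and \<Phi>: "\<Phi> {#} = \<one>" "\<And>x \<mu>. \<Phi> (add_mset x \<mu>) = Y x \<otimes> \<Phi> \<mu>" "\<And>\<mu>. \<Phi> \<mu> \<in> carrier R"
    and \<delta>: "\<delta> \<in> carrier R" "\<And>y. y \<in> carrier R \<Longrightarrow> \<delta> \<otimes> y = y \<otimes> \<delta>"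
    and act: "\<And>k i. i < n \<Longrightarrow> b k \<otimes> v i \<otimes> \<delta> = (\<Oplus>l\<in>{..<n}. v l \<otimes> Y (k, l, i))"
    and "length w \<le> D" "i < n"
  shows "word_eval R b (Word w) \<otimes> v i \<otimes> \<delta> [^] D =
    (\<Oplus>l\<in>{..<n}. v l \<otimes> pm_eval R (\<lambda>\<mu>. \<Phi> \<mu> \<otimes> \<delta> [^] (D - size \<mu>)) (generic_entry n w l i))"
  using assms(10)
proof (induct w arbitrary: D)
  case Nil
  have 1: "pm_eval R (\<lambda>\<mu>. \<Phi> \<mu> \<otimes> \<delta> [^] (D - size \<mu>)) 1 = \<delta> [^] D"
    using \<Phi> \<delta> by (simp add: pm_eval_single add.int_pow_1 flip: single_one)
  have "(\<Oplus>l\<in>{..<n}. v l \<otimes> pm_eval R (\<lambda>\<mu>. \<Phi> \<mu> \<otimes> \<delta> [^] (D - size \<mu>)) (generic_entry n [] l i))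
      = (\<Oplus>l\<in>{..<n}. if i = l then v l \<otimes> \<delta> [^] D else \<zero>)"
    using v \<Phi> \<delta> by (intro finsum_cong' refl) (auto simp: 1)
  also have "\<dots> = v i \<otimes> \<delta> [^] D"
    using assms(11) v \<delta> by (intro add.finprod_singleton) auto
  finally show ?case using v by (simp add: word_eval_def)
next
  case (Cons k w)
  \<comment> \<open>The bound on the length leaves at least one factor \<open>\<delta>\<close> for
    the letter k.\<close>
  then obtain D' where D: "D = Suc D'" by (cases D) auto
  define \<theta> where "\<theta> D = pm_eval R (\<lambda>\<mu>. \<Phi> \<mu> \<otimes> \<delta> [^] (D - size \<mu>))" for D
  have c\<theta>: "\<theta> D p \<in> carrier R" for D p
    unfolding \<theta>_def using \<Phi> \<delta> by simp
  have step: "\<theta> (Suc D') (Poly_Mapping.single {#x#} 1 * p) = Y x \<otimes> \<theta> D' p" for x p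
    unfolding \<theta>_def using \<Phi> \<delta> Y
    by (subst pm_eval_single_mult[where x = "Y x" and \<psi> = "\<lambda>\<mu>. \<Phi> \<mu> \<otimes> \<delta> [^] (D' - size \<mu>)"])
      (auto simp: m_assoc add.int_pow_1)
  have W: "word_eval R b (Word w) \<in> carrier R" using b by simp
  have IH: "word_eval R b (Word w) \<otimes> v i \<otimes> \<delta> [^] D' =
      (\<Oplus>j\<in>{..<n}. v j \<otimes> \<theta> D' (generic_entry n w j i))"
    using Cons D by (simp add: \<theta>_def)
  have "word_eval R b (Word (k # w)) \<otimes> v i \<otimes> \<delta> [^] D =
      b k \<otimes> (word_eval R b (Word w) \<otimes> v i \<otimes> \<delta> [^] D') \<otimes> \<delta>"
    using b v \<delta> W by (simp add: word_eval_def D m_assoc)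
  also have "\<dots> = (\<Oplus>j\<in>{..<n}. (b k \<otimes> v j \<otimes> \<delta>) \<otimes> \<theta> D' (generic_entry n w j i))"
    unfolding IH using b v \<delta> c\<theta>
    by (simp add: finsum_ldistr finsum_rdistr Pi_def m_assoc)
  also have "\<dots> = (\<Oplus>j\<in>{..<n}. \<Oplus>l\<in>{..<n}. v l \<otimes> Y (k, l, j) \<otimes> \<theta> D' (generic_entry n w j i))"
    using v Y c\<theta> by (intro finsum_cong' refl) (auto simp: act finsum_ldistr Pi_def intro!: finsum_closed)
  also have "\<dots> = (\<Oplus>l\<in>{..<n}. \<Oplus>j\<in>{..<n}. v l \<otimes> Y (k, l, j) \<otimes> \<theta> D' (generic_entry n w j i))"
    using v Y c\<theta> by (intro finsum_swap) auto
  also have "\<dots> = (\<Oplus>l\<in>{..<n}. v l \<otimes> \<theta> D (generic_entry n (k # w) l i))"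
  proof (intro finsum_cong' refl)
    fix l assume "l \<in> {..<n}"
    have "\<theta> D (generic_entry n (k # w) l i) = (\<Oplus>j\<in>{..<n}. Y (k, l, j) \<otimes> \<theta> D' (generic_entry n w j i))"
      unfolding generic_entry.simps
      using \<Phi> \<delta> step unfolding \<theta>_def D by (subst pm_eval_sum) auto
    then show "(\<Oplus>j\<in>{..<n}. v l \<otimes> Y (k, l, j) \<otimes> \<theta> D' (generic_entry n w j i)) =
        v l \<otimes> \<theta> D (generic_entry n (k # w) l i)"
      using v Y c\<theta> by (simp add: finsum_rdistr Pi_def m_assoc)
  qed (use v c\<theta> in auto)
  finally show ?case by (simp add: \<theta>_def)
qed

text \<open>If every \<open>b k\<close> acts on the row \<open>v\<close> through a matrix over a commutative ring, up to the central
  factor \<open>\<delta>\<close>, then so does \<open>f(b)\<close>, through \<open>f\<close> of these matrices homogenised by \<open>\<delta>\<close>.\<close>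

lemma (in ring) identity_annihilates_row:
  assumes f: "Z_identity (int_matrix_ring n) m f"
    and b: "\<And>k. b k \<in> carrier R" and v: "\<And>i. v i \<in> carrier R" and Y: "\<And>x. Y x \<in> carrier R"
    and comm: "\<And>x y. Y x \<otimes> Y y = Y y \<otimes> Y x"
    and \<delta>: "\<delta> \<in> carrier R" "\<And>y. y \<in> carrier R \<Longrightarrow> \<delta> \<otimes> y = y \<otimes> \<delta>"
    and act: "\<And>k i. i < n \<Longrightarrow> b k \<otimes> v i \<otimes> \<delta> = (\<Oplus>l\<in>{..<n}. v l \<otimes> Y (k, l, i))"
  shows "\<exists>D::nat. \<forall>i<n. ncpoly_eval R b f \<otimes> v i \<otimes> \<delta> [^] D = \<zero>"
proof -
  from ex_multiset_product[of Y, OF Y comm] obtain \<Phi> where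
    \<Phi>: "\<Phi> {#} = \<one>" "\<And>x \<mu>. \<Phi> (add_mset x \<mu>) = Y x \<otimes> \<Phi> \<mu>" "\<And>\<mu>. \<Phi> \<mu> \<in> carrier R" by blast
  \<comment> \<open>D bounds the degree of f: it is the number of factors \<open>\<delta>\<close>
    that suffices for all words of f at once.\<close>
  have "finite ((\<lambda>w. length (letters w)) ` Poly_Mapping.keys f)" by simp
  then obtain D where "\<forall>d \<in> (\<lambda>w. length (letters w)) ` Poly_Mapping.keys f. d \<le> D"
    using finite_nat_set_iff_bounded_le by blast
  then have D: "length (letters w) \<le> D" if "w \<in> Poly_Mapping.keys f" for w using that by auto
  define \<theta> where "\<theta> = pm_eval R (\<lambda>\<mu>. \<Phi> \<mu> \<otimes> \<delta> [^] (D - size \<mu>))"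
  have c: "\<Phi> \<mu> \<otimes> \<delta> [^] (D - size \<mu>) \<in> carrier R" for \<mu> using \<Phi> \<delta> by simp
  have c\<theta>: "\<theta> p \<in> carrier R" for p unfolding \<theta>_def using c by simp
  have "ncpoly_eval R b f \<otimes> v i \<otimes> \<delta> [^] D = \<zero>" if i: "i < n" for i
  proof -
    have W: "word_eval R b w \<in> carrier R" for w using b by simp
    have of_int_mult: "\<theta> (of_int z * p) = [z] \<cdot>\<^bsub>R\<^esub> \<theta> p" for z p
    proof -
      have "\<theta> (Poly_Mapping.single 0 z * p) = ([z] \<cdot>\<^bsub>R\<^esub> \<one>) \<otimes> \<theta> p"
        unfolding \<theta>_def using c by (intro pm_eval_single_mult) auto
      then show ?thesis
        using c\<theta> add_pow_ldistr_int[of \<one> "\<theta> p" z] by (simp flip: single_of_int)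
    qed
    have "ncpoly_eval R b f \<otimes> v i \<otimes> \<delta> [^] D =
        pm_eval R (\<lambda>w. word_eval R b w \<otimes> v i \<otimes> \<delta> [^] D) f"
      unfolding ncpoly_eval_eq_pm_eval using v \<delta> W
      by (intro additive_map_pm_eval[where h = "\<lambda>y. y \<otimes> v i \<otimes> \<delta> [^] D"] ring_axioms)
        (auto simp: l_distr)
    also have "\<dots> = (\<Oplus>w\<in>Poly_Mapping.keys f. [Poly_Mapping.lookup f w] \<cdot>\<^bsub>R\<^esub>
        (\<Oplus>l\<in>{..<n}. v l \<otimes> \<theta> (generic_entry n (letters w) l i)))"
      unfolding pm_eval_def
    proof (intro finsum_cong' refl)
      fix w assume "w \<in> Poly_Mapping.keys f"
      from word_action[OF b v Y \<Phi> \<delta> act D[OF this] i]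
      show "[Poly_Mapping.lookup f w] \<cdot>\<^bsub>R\<^esub> (word_eval R b w \<otimes> v i \<otimes> \<delta> [^] D) =
        [Poly_Mapping.lookup f w] \<cdot>\<^bsub>R\<^esub> (\<Oplus>l\<in>{..<n}. v l \<otimes> \<theta> (generic_entry n (letters w) l i))"
        by (simp add: \<theta>_def)
    qed (use v c\<theta> in \<open>auto intro!: finsum_closed\<close>)
    also have "\<dots> = (\<Oplus>w\<in>Poly_Mapping.keys f. \<Oplus>l\<in>{..<n}.
        v l \<otimes> \<theta> (of_int (Poly_Mapping.lookup f w) * generic_entry n (letters w) l i))"
    proof (intro finsum_cong' refl)
      fix w
      define z where "z = Poly_Mapping.lookup f w"
      have hom: "[z] \<cdot>\<^bsub>R\<^esub> (\<Oplus>l\<in>A. y l) = (\<Oplus>l\<in>A. [z] \<cdot>\<^bsub>R\<^esub> y l)"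
        if "finite A" "\<And>l. y l \<in> carrier R" for A and y :: "nat \<Rightarrow> 'a"
        using that(1) by induct (auto simp: that add.int_pow_distrib)
      show "[Poly_Mapping.lookup f w] \<cdot>\<^bsub>R\<^esub> (\<Oplus>l\<in>{..<n}. v l \<otimes> \<theta> (generic_entry n (letters w) l i)) =
        (\<Oplus>l\<in>{..<n}. v l \<otimes> \<theta> (of_int (Poly_Mapping.lookup f w) * generic_entry n (letters w) l i))"
        unfolding z_def[symmetric]
        using v c\<theta> by (simp add: hom of_int_mult add_pow_rdistr_int)
    qed (use v c\<theta> in \<open>auto intro!: finsum_closed\<close>)
    also have "\<dots> = (\<Oplus>l\<in>{..<n}. \<Oplus>w\<in>Poly_Mapping.keys f.
        v l \<otimes> \<theta> (of_int (Poly_Mapping.lookup f w) * generic_entry n (letters w) l i))"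
      using v c\<theta> by (intro finsum_swap) auto
    also have "\<dots> = (\<Oplus>l\<in>{..<n}. v l \<otimes> \<theta> (generic_value n f l i))"
    proof (intro finsum_cong' refl)
      fix l
      have "\<theta> (generic_value n f l i) = (\<Oplus>w\<in>Poly_Mapping.keys f.
          \<theta> (of_int (Poly_Mapping.lookup f w) * generic_entry n (letters w) l i))"
        unfolding \<theta>_def generic_value_def using c by (intro pm_eval_sum) auto
      then show "(\<Oplus>w\<in>Poly_Mapping.keys f.
          v l \<otimes> \<theta> (of_int (Poly_Mapping.lookup f w) * generic_entry n (letters w) l i)) =
          v l \<otimes> \<theta> (generic_value n f l i)"
        using v c\<theta> by (simp add: finsum_rdistr Pi_def)
    qed (use v c\<theta> in auto)
    also have "\<dots> = \<zero>"
      using generic_value_eq_0[OF f _ i] v by (intro add.finprod_one_eqI) (simp add: \<theta>_def)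
    finally show ?thesis .
  qed
  then show ?thesis by blast
qed

section \<open>Linear algebra over a domain\<close>

lemma (in ring) finsum_uminus:
  assumes "finite A" "f \<in> A \<rightarrow> carrier R" shows "(\<Oplus>i\<in>A. \<ominus> f i) = \<ominus> (\<Oplus>i\<in>A. f i)"
proof -
  have "(\<Oplus>i\<in>A. \<ominus> f i) = (\<Oplus>i\<in>A. \<ominus> \<one> \<otimes> f i)"
    using assms by (intro finsum_cong') (auto simp: l_minus Pi_iff)
  also have "\<dots> = \<ominus> \<one> \<otimes> (\<Oplus>i\<in>A. f i)"
    using assms by (simp add: finsum_rdistr)
  finally show ?thesis using assms by (simp add: l_minus)
qed

text \<open>Elimination without division, by induction on the equations. \<open>K\<close> is a bare
  subset because it is later a centre, the integers, or a field inside a corner ring whose unit e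
  differs from the unit of the ring in general; u only supplies a nonzero element.\<close>

lemma (in ring) homogeneous_system:
  assumes K: "K \<subseteq> carrier R" "u \<in> K" "u \<noteq> \<zero>" "\<zero> \<in> K" "\<And>x y. x \<in> K \<Longrightarrow> y \<in> K \<Longrightarrow> x \<oplus> y \<in> K"
      "\<And>x. x \<in> K \<Longrightarrow> \<ominus> x \<in> K" "\<And>x y. x \<in> K \<Longrightarrow> y \<in> K \<Longrightarrow> x \<otimes> y \<in> K"
      "\<And>x y. x \<in> K \<Longrightarrow> y \<in> K \<Longrightarrow> x \<otimes> y = y \<otimes> x"
      "\<And>x y. x \<in> K \<Longrightarrow> y \<in> K \<Longrightarrow> x \<otimes> y = \<zero> \<Longrightarrow> x = \<zero> \<or> y = \<zero>"
    and "finite I" "finite J" "card I < card J" "\<And>i j. a i j \<in> K"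
  shows "\<exists>c. (\<forall>j. c j \<in> K) \<and> (\<exists>j\<in>J. c j \<noteq> \<zero>) \<and> (\<forall>i\<in>I. (\<Oplus>j\<in>J. a i j \<otimes> c j) = \<zero>)"
  using assms(10-13)
proof (induct I arbitrary: J a rule: finite_induct)
  case empty
  then have "J \<noteq> {}" by auto
  then show ?case using K(2,3) by (intro exI[of _ "\<lambda>_. u"]) auto
next
  case (insert i0 I)
  have KR: "x \<in> carrier R" if "x \<in> K" for x using that K(1) by auto
  show ?case
  proof (cases "\<forall>j\<in>J. a i0 j = \<zero>")
    case True
    have "card I < card J" using insert by simp
    with insert.hyps(3)[of J a] insert.prems obtain c where
      c: "\<And>j. c j \<in> K" "\<exists>j\<in>J. c j \<noteq> \<zero>" "\<forall>i\<in>I. (\<Oplus>j\<in>J. a i j \<otimes> c j) = \<zero>" by auto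
    moreover have "(\<Oplus>j\<in>J. a i0 j \<otimes> c j) = \<zero>"
      using True KR[OF c(1)] by (intro add.finprod_one_eqI) auto
    ultimately show ?thesis by (intro exI[of _ c]) auto
  next
    case False
    then obtain p where p: "p \<in> J" "a i0 p \<noteq> \<zero>" by auto
    define J' where "J' = J - {p}"
    have J': "finite J'" "card I < card J'" "p \<notin> J'" "J = insert p J'"
      using insert p by (auto simp: J'_def)
    \<comment> \<open>Cross-multiplication with the pivot \<open>a i0 p\<close> eliminates the
      unknown p from the other equations and stays inside \<open>K\<close>.\<close>
    define a' where "a' i j = a i0 p \<otimes> a i j \<ominus> a i0 j \<otimes> a i p" for i j
    have aK: "a i j \<in> K" for i j using insert.prems(3) by simp
    have a'K: "a' i j \<in> K" for i j unfolding a'_def a_minus_def by (intro K aK)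
    from insert.hyps(3)[of J' a', OF J'(1,2) a'K] obtain c where
      cK: "\<And>j. c j \<in> K" and c: "\<exists>j\<in>J'. c j \<noteq> \<zero>" "\<forall>i\<in>I. (\<Oplus>j\<in>J'. a' i j \<otimes> c j) = \<zero>" by auto
    note a = KR[OF aK] and a' = KR[OF a'K] and cR = KR[OF cK]
    \<comment> \<open>Back substitution: the other unknowns are scaled by the pivot, so that the
      pivot equation can be solved for p without dividing. The solution stays nonzero because
      \<open>K\<close> has no zero divisors.\<close>
    define d where "d j = (if j = p then \<ominus> (\<Oplus>j\<in>J'. a i0 j \<otimes> c j) else a i0 p \<otimes> c j)" for j
    have sumK: "(\<Oplus>j\<in>A. a i0 j \<otimes> c j) \<in> K" for A
      using K(4,5,7) aK cK KR by (induct A rule: infinite_finite_induct) (auto simp: Pi_def)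
    have dK: "d j \<in> K" for j unfolding d_def by (auto intro!: K sumK aK cK)
    note d = KR[OF dK]
    have "(\<Oplus>j\<in>J. a i j \<otimes> d j) = (\<Oplus>j\<in>J'. a' i j \<otimes> c j)" for i
    proof -
      have "(\<Oplus>j\<in>J. a i j \<otimes> d j) = a i p \<otimes> d p \<oplus> (\<Oplus>j\<in>J'. a i j \<otimes> d j)"
        using J' a d by simp
      also have "a i p \<otimes> d p = (\<Oplus>j\<in>J'. \<ominus> (a i p \<otimes> (a i0 j \<otimes> c j)))"
        using J' a cR by (simp add: d_def finsum_rdistr Pi_def r_minus finsum_uminus)
      also have "(\<Oplus>j\<in>J'. a i j \<otimes> d j) = (\<Oplus>j\<in>J'. a i j \<otimes> (a i0 p \<otimes> c j))"
        using J' a cR by (intro finsum_cong') (auto simp: d_def)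
      also have "(\<Oplus>j\<in>J'. \<ominus> (a i p \<otimes> (a i0 j \<otimes> c j))) \<oplus> \<dots>
          = (\<Oplus>j\<in>J'. \<ominus> (a i p \<otimes> (a i0 j \<otimes> c j)) \<oplus> a i j \<otimes> (a i0 p \<otimes> c j))"
        using a cR by (simp add: finsum_addf Pi_def)
      also have "\<dots> = (\<Oplus>j\<in>J'. a' i j \<otimes> c j)"
      proof (intro finsum_cong' refl)
        fix j
        have "a i0 p \<otimes> a i j = a i j \<otimes> a i0 p" "a i0 j \<otimes> a i p = a i p \<otimes> a i0 j"
          using K(8) aK by auto
        then show "\<ominus> (a i p \<otimes> (a i0 j \<otimes> c j)) \<oplus> a i j \<otimes> (a i0 p \<otimes> c j) = a' i j \<otimes> c j"
          using a cR by (simp add: a'_def a_minus_def l_distr l_minus m_assoc a_comm)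
      qed (use a' cR in auto)
      finally show ?thesis .
    qed
    moreover have "(\<Oplus>j\<in>J'. a' i0 j \<otimes> c j) = \<zero>"
    proof (intro add.finprod_one_eqI)
      fix j
      have "a' i0 j = \<zero>"
        using K(8)[OF aK[of i0 j] aK[of i0 p]] a by (simp add: a'_def)
      then show "a' i0 j \<otimes> c j = \<zero>" using cR by simp
    qed
    moreover from c(1) obtain j where "j \<in> J'" "c j \<noteq> \<zero>" by auto
    then have "\<exists>j\<in>J. d j \<noteq> \<zero>"
      using p(2) K(9)[OF aK[of i0 p] cK[of j]] J' by (intro bexI[of _ j]) (auto simp: d_def)
    ultimately show ?thesis using c(2) dK by (intro exI[of _ d]) auto
  qed
qed

section \<open>Density\<close>

text \<open>The action of the tensor \<Sigma> a \<otimes> b on w by multiplication from both sides,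
  given by a list of its terms.\<close>

definition bimul :: "('a, 'm) ring_scheme \<Rightarrow> ('a \<times> 'a) list \<Rightarrow> 'a \<Rightarrow> 'a" where
  "bimul R us w = foldr (\<lambda>(a, b) s. a \<otimes>\<^bsub>R\<^esub> w \<otimes>\<^bsub>R\<^esub> b \<oplus>\<^bsub>R\<^esub> s) us \<zero>\<^bsub>R\<^esub>"

text \<open>Operators in the algebra generated by left multiplications by R and right
  multiplications by Z. Two cases matter: Z the whole ring, where invariant subgroups are two-sided
  ideals, and Z the field \<open>K\<close>.\<close>

definition biop :: "('a, 'm) ring_scheme \<Rightarrow> 'a set \<Rightarrow> ('a \<Rightarrow> 'a) \<Rightarrow> bool" where
  "biop R Z T \<longleftrightarrow> (\<exists>us. set us \<subseteq> carrier R \<times> Z \<and> (\<forall>w\<in>carrier R. T w = bimul R us w))"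

context ring
begin

lemma bimul_simps [simp]:
  "bimul R [] w = \<zero>" "bimul R ((a, b) # us) w = a \<otimes> w \<otimes> b \<oplus> bimul R us w"
  by (simp_all add: bimul_def)

lemma bimul_closed [simp]:
  assumes "set us \<subseteq> carrier R \<times> carrier R" "w \<in> carrier R" shows "bimul R us w \<in> carrier R"
  using assms by (induct us) auto

lemma bimul_append:
  assumes "set us \<subseteq> carrier R \<times> carrier R" "set vs \<subseteq> carrier R \<times> carrier R" "w \<in> carrier R"
  shows "bimul R (us @ vs) w = bimul R us w \<oplus> bimul R vs w"
  using assms by (induct us) (auto simp: a_assoc)

lemma biop_cong: "(\<And>w. w \<in> carrier R \<Longrightarrow> T w = T' w) \<Longrightarrow> biop R Z T' \<Longrightarrow> biop R Z T"
  by (auto simp: biop_def)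

lemma biop_closed:
  assumes "biop R Z T" "Z \<subseteq> carrier R" "w \<in> carrier R" shows "T w \<in> carrier R"
proof -
  from assms obtain us where us: "set us \<subseteq> carrier R \<times> Z" "T w = bimul R us w" by (auto simp: biop_def)
  moreover have "set us \<subseteq> carrier R \<times> carrier R" using us(1) assms(2) by auto
  ultimately show ?thesis using assms(3) by simp
qed

lemma biop_single: "a \<in> carrier R \<Longrightarrow> b \<in> Z \<Longrightarrow> Z \<subseteq> carrier R \<Longrightarrow> biop R Z (\<lambda>w. a \<otimes> w \<otimes> b)"
  unfolding biop_def by (intro exI[of _ "[(a, b)]"]) auto

lemma biop_zero: "biop R Z (\<lambda>w. \<zero>)"
  unfolding biop_def by (intro exI[of _ "[]"]) auto

lemma biop_add:
  assumes "biop R Z T" "biop R Z T'" "Z \<subseteq> carrier R" shows "biop R Z (\<lambda>w. T w \<oplus> T' w)"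
proof -
  from assms obtain us vs where
    us: "set us \<subseteq> carrier R \<times> Z" "\<forall>w\<in>carrier R. T w = bimul R us w" and
    vs: "set vs \<subseteq> carrier R \<times> Z" "\<forall>w\<in>carrier R. T' w = bimul R vs w" by (auto simp: biop_def)
  then have "set us \<subseteq> carrier R \<times> carrier R" "set vs \<subseteq> carrier R \<times> carrier R" using assms(3) by auto
  with us vs show ?thesis
    unfolding biop_def by (intro exI[of _ "us @ vs"]) (simp add: bimul_append)
qed

lemma biop_finsum:
  assumes "finite I" "\<And>i. i \<in> I \<Longrightarrow> biop R Z (T i)" "Z \<subseteq> carrier R"
  shows "biop R Z (\<lambda>w. \<Oplus>i\<in>I. T i w)"
  using assms(1,2)
proof (induct I)
  case (insert a I)
  have "biop R Z (\<lambda>w. T a w \<oplus> (\<Oplus>i\<in>I. T i w))"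
    using insert assms(3) by (intro biop_add) auto
  then show ?case
  proof (rule biop_cong[rotated])
    fix w assume w: "w \<in> carrier R"
    have "T i w \<in> carrier R" if "i \<in> insert a I" for i
      using biop_closed[OF insert.prems(1)[OF that] assms(3) w] .
    then show "(\<Oplus>i\<in>insert a I. T i w) = T a w \<oplus> (\<Oplus>i\<in>I. T i w)"
      using insert.hyps by (intro finsum_insert) auto
  qed
qed (simp add: biop_zero)

lemma biop_bimul_comp:
  assumes "biop R Z T" "Z \<subseteq> carrier R" "a \<in> carrier R" "b \<in> carrier R" "\<And>z. z \<in> Z \<Longrightarrow> z \<otimes> b \<in> Z"
  shows "biop R Z (\<lambda>w. a \<otimes> T w \<otimes> b)"
proof -
  from assms obtain us where
    us: "set us \<subseteq> carrier R \<times> Z" "\<forall>w\<in>carrier R. T w = bimul R us w" by (auto simp: biop_def)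
  have "set us \<subseteq> carrier R \<times> Z \<Longrightarrow> biop R Z (\<lambda>w. a \<otimes> bimul R us w \<otimes> b)" for us
  proof (induct us)
    case Nil
    then show ?case using assms(3,4) by (simp add: biop_zero)
  next
    case (Cons u us)
    obtain c d where u: "u = (c, d)" by (cases u)
    have cd: "c \<in> carrier R" "d \<in> Z" "d \<in> carrier R" and us: "set us \<subseteq> carrier R \<times> carrier R"
      using Cons.prems assms(2) u by auto
    have "biop R Z (\<lambda>w. (a \<otimes> c) \<otimes> w \<otimes> (d \<otimes> b) \<oplus> a \<otimes> bimul R us w \<otimes> b)"
      using Cons assms cd by (intro biop_add biop_single) auto
    then show ?case
      by (rule biop_cong[rotated]) (use assms cd us in \<open>simp add: u r_distr l_distr m_assoc\<close>)
  qed
  from biop_cong[OF _ this[OF us(1)]] us(2) show ?thesis by simp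
qed

lemma biop_comp:
  assumes "biop R Z T" "biop R Z T'" "Z \<subseteq> carrier R" "\<And>z z'. z \<in> Z \<Longrightarrow> z' \<in> Z \<Longrightarrow> z \<otimes> z' \<in> Z"
  shows "biop R Z (\<lambda>w. T (T' w))"
proof -
  from assms obtain us where
    us: "set us \<subseteq> carrier R \<times> Z" "\<forall>w\<in>carrier R. T w = bimul R us w" by (auto simp: biop_def)
  have *: "set us \<subseteq> carrier R \<times> Z \<Longrightarrow> biop R Z (\<lambda>w. bimul R us (T' w))" for us
  proof (induct us)
    case (Cons u us)
    obtain c d where u: "u = (c, d)" by (cases u)
    have "biop R Z (\<lambda>w. c \<otimes> T' w \<otimes> d \<oplus> bimul R us (T' w))"
      using Cons assms u by (intro biop_add biop_bimul_comp) auto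
    then show ?case by (simp add: u)
  qed (simp add: biop_zero)
  have "T (T' w) = bimul R us (T' w)" if "w \<in> carrier R" for w
    using us(2) biop_closed[OF assms(2,3) that] by simp
  from biop_cong[OF this *[OF us(1)]] show ?thesis .
qed

text \<open>Right multiplication by an element that commutes with Z commutes with every left
  multiplication and with right multiplications by Z.\<close>

lemma biop_linear:
  assumes "biop R Z T" "Z \<subseteq> carrier R" "finite I" "\<And>i. i \<in> I \<Longrightarrow> x i \<in> carrier R"
    "\<And>i. i \<in> I \<Longrightarrow> c i \<in> carrier R" "\<And>i z. i \<in> I \<Longrightarrow> z \<in> Z \<Longrightarrow> c i \<otimes> z = z \<otimes> c i"
  shows "T (\<Oplus>i\<in>I. x i \<otimes> c i) = (\<Oplus>i\<in>I. T (x i) \<otimes> c i)"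
proof -
  from assms obtain us where
    us: "set us \<subseteq> carrier R \<times> Z" "\<forall>w\<in>carrier R. T w = bimul R us w" by (auto simp: biop_def)
  have add: "set us \<subseteq> carrier R \<times> Z \<Longrightarrow> w \<in> carrier R \<Longrightarrow> w' \<in> carrier R \<Longrightarrow>
     bimul R us (w \<oplus> w') = bimul R us w \<oplus> bimul R us w'" for us w w'
  proof (induct us)
    case (Cons u us)
    obtain a b where u: "u = (a, b)" by (cases u)
    have *: "a \<in> carrier R" "b \<in> carrier R" "set us \<subseteq> carrier R \<times> carrier R"
      using Cons.prems assms(2) u by auto
    then show ?case using Cons by (simp add: u l_distr r_distr a_ac)
  qed simp
  have mul: "set us \<subseteq> carrier R \<times> Z \<Longrightarrow> i \<in> I \<Longrightarrow> bimul R us (x i \<otimes> c i) = bimul R us (x i) \<otimes> c i" for us i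
  proof (induct us)
    case (Cons u us)
    obtain a b where u: "u = (a, b)" by (cases u)
    have *: "a \<in> carrier R" "b \<in> carrier R" "b \<in> Z" "set us \<subseteq> carrier R \<times> carrier R" "x i \<in> carrier R" "c i \<in> carrier R"
      using Cons.prems assms u by auto
    then have "a \<otimes> (x i \<otimes> c i) \<otimes> b = a \<otimes> x i \<otimes> b \<otimes> c i"
      using assms(6)[of i b] Cons.prems by (simp add: m_assoc)
    then show ?case using Cons * by (simp add: u l_distr)
  qed (use assms in auto)
  have T0: "T \<zero> = \<zero>"
  proof -
    have "set us \<subseteq> carrier R \<times> Z \<Longrightarrow> bimul R us \<zero> = \<zero>" for us
    proof (induct us)
      case (Cons u us)
      then show ?case using assms(2) by (cases u) auto
    qed simp
    then show ?thesis using us by simp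
  qed
  have Tc: "T w \<in> carrier R" if "w \<in> carrier R" for w using biop_closed[OF assms(1,2) that] .
  have "J \<subseteq> I \<Longrightarrow> T (\<Oplus>i\<in>J. x i \<otimes> c i) = (\<Oplus>i\<in>J. T (x i) \<otimes> c i)" for J
  proof (induct J rule: infinite_finite_induct)
    case (infinite J)
    then show ?case using assms(3) finite_subset by auto
  next
    case empty
    then show ?case by (simp add: T0)
  next
    case (insert j J)
    have cl: "x i \<otimes> c i \<in> carrier R" "x i \<in> carrier R" "c i \<in> carrier R" if "i \<in> insert j J" for i
      using that insert.prems assms(4,5) by auto
    have "T (\<Oplus>i\<in>insert j J. x i \<otimes> c i) = T (x j \<otimes> c j \<oplus> (\<Oplus>i\<in>J. x i \<otimes> c i))"
      using insert cl by (subst finsum_insert) auto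
    also have "\<dots> = T (x j \<otimes> c j) \<oplus> T (\<Oplus>i\<in>J. x i \<otimes> c i)"
      using cl us add[OF us(1)] by (simp add: finsum_closed Pi_def)
    also have "T (x j \<otimes> c j) = T (x j) \<otimes> c j"
      using cl us mul[OF us(1), of j] insert.prems by simp
    finally show ?case
      using insert cl Tc by (simp add: Pi_def)
  qed
  then show ?thesis by blast
qed

text \<open>Jacobson's density theorem for the module R e under these operators: \<open>irr\<close>
  says that it is irreducible, and C is its ring of endomorphisms, the centraliser of Z in e R e. By
  induction the other vectors have dual operators; unless some operator kills them and not
  \<open>x j\<close>, they express \<open>x j\<close> with coefficients in C, against independence.
  It is used with e = 1 for the multiplication algebra of a simple ring and with a primitive e and Z
  = K.\<close>

lemma density:
  assumes e: "e \<in> carrier R" "e \<otimes> e = e" "e \<noteq> \<zero>"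
    and Z: "Z \<subseteq> carrier R" "e \<in> Z" "\<And>z z'. z \<in> Z \<Longrightarrow> z' \<in> Z \<Longrightarrow> z \<otimes> z' \<in> Z"
      "\<And>z. z \<in> Z \<Longrightarrow> e \<otimes> z = z" "\<And>z. z \<in> Z \<Longrightarrow> z \<otimes> e = z"
    and irr: "\<And>w. \<lbrakk>w \<in> carrier R; w \<otimes> e = w; w \<noteq> \<zero>\<rbrakk> \<Longrightarrow> \<exists>T. biop R Z T \<and> T w = e"
    and C: "C = {c \<in> carrier R. e \<otimes> c = c \<and> c \<otimes> e = c \<and> (\<forall>z\<in>Z. c \<otimes> z = z \<otimes> c)}"
    and "finite I" "\<And>i. i \<in> I \<Longrightarrow> x i \<in> carrier R \<and> x i \<otimes> e = x i"
    and "\<And>c i. \<lbrakk>\<And>i. c i \<in> C; (\<Oplus>i\<in>I. x i \<otimes> c i) = \<zero>; i \<in> I\<rbrakk> \<Longrightarrow> c i = \<zero>"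
    and "j \<in> I"
  shows "\<exists>T. biop R Z T \<and> T (x j) = e \<and> (\<forall>i\<in>I - {j}. T (x i) = \<zero>)"
  using assms(11-14)
proof (induct I arbitrary: j rule: finite_psubset_induct)
  case (psubset I)
  note x = psubset.prems(1) and indep = psubset.prems(2) and j = psubset.prems(3)
  define I' where "I' = I - {j}"
  have I': "finite I'" "I' \<subset> I" "I = insert j I'" "j \<notin> I'"
    using psubset.hyps(1) j by (auto simp: I'_def)
  have C0: "\<zero> \<in> C" using e Z(1) C by (auto dest: subsetD)
  have eC: "e \<in> C" using e Z C by auto
  have CR: "c \<in> carrier R" if "c \<in> C" for c using that C by auto
  have "\<exists>T. biop R Z T \<and> T (x i) = e \<and> (\<forall>k\<in>I' - {i}. T (x k) = \<zero>)" if "i \<in> I'" for i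
  proof (rule psubset.hyps(2)[OF I'(2) _ _ that])
    show "x i \<in> carrier R \<and> x i \<otimes> e = x i" if "i \<in> I'" for i using that x I' by auto
  next
    fix c i assume c: "\<And>i. c i \<in> C" "(\<Oplus>i\<in>I'. x i \<otimes> c i) = \<zero>" "i \<in> I'"
    define c' where "c' i = (if i = j then \<zero> else c i)" for i
    have "(\<Oplus>i\<in>I. x i \<otimes> c' i) = x j \<otimes> c' j \<oplus> (\<Oplus>i\<in>I'. x i \<otimes> c' i)"
      unfolding I'(3) using I' x c CR C0 by (intro finsum_insert) (auto simp: c'_def)
    also have "(\<Oplus>i\<in>I'. x i \<otimes> c' i) = (\<Oplus>i\<in>I'. x i \<otimes> c i)"
      using I' x c CR by (intro finsum_cong') (auto simp: c'_def)
    finally have "(\<Oplus>i\<in>I. x i \<otimes> c' i) = \<zero>" using c x[OF j] by (simp add: c'_def)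
    then have "c' i = \<zero>" using indep[of c' i] c C0 I' by (auto simp: c'_def)
    then show "c i = \<zero>" using c I' by (auto simp: c'_def split: if_splits)
  qed
  then obtain t where t: "\<And>i. i \<in> I' \<Longrightarrow> biop R Z (t i)" "\<And>i. i \<in> I' \<Longrightarrow> t i (x i) = e"
      "\<And>i k. i \<in> I' \<Longrightarrow> k \<in> I' \<Longrightarrow> k \<noteq> i \<Longrightarrow> t i (x k) = \<zero>"
    by (metis DiffI singletonD)
  have Te: "T w \<otimes> e = T w" if "biop R Z T" "w \<in> carrier R" for T w
  proof -
    from that obtain us where
      us: "set us \<subseteq> carrier R \<times> Z" "T w = bimul R us w" by (auto simp: biop_def)
    have "set us \<subseteq> carrier R \<times> Z \<Longrightarrow> bimul R us w \<otimes> e = bimul R us w" for us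
    proof (induct us)
      case (Cons u us)
      obtain a b where u: "u = (a, b)" by (cases u)
      have *: "a \<in> carrier R" "b \<in> carrier R" "b \<in> Z" "set us \<subseteq> carrier R \<times> carrier R"
        using Cons.prems Z(1) u by auto
      then show ?case using Cons that(2) e Z(5)[of b] by (simp add: u l_distr m_assoc)
    qed (use e in simp)
    then show ?thesis using us by simp
  qed
  have xc: "x i \<in> carrier R" "x i \<otimes> e = x i" if "i \<in> I" for i using x that by auto
  show ?case
  proof (cases "\<exists>T. biop R Z T \<and> (\<forall>i\<in>I'. T (x i) = \<zero>) \<and> T (x j) \<noteq> \<zero>")
    case True
    then obtain T where T: "biop R Z T" "\<forall>i\<in>I'. T (x i) = \<zero>" "T (x j) \<noteq> \<zero>" by blast
    with irr[of "T (x j)"] Te[OF T(1)] xc j obtain S where S: "biop R Z S" "S (T (x j)) = e"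
      using biop_closed[OF T(1) Z(1)] by blast
    have "S \<zero> = \<zero>" using biop_linear[OF S(1) Z(1), of "{}"] by simp
    then show ?thesis
      using T S biop_comp[OF S(1) T(1) Z(1,3)] by (intro exI[of _ "\<lambda>w. S (T w)"]) (auto simp: I'_def)
  next
    case False
    \<comment> \<open>If \<open>x j\<close> were a combination of the other vectors, applying the
      dual operator \<open>t i\<close> would give this coefficient.\<close>
    define z where "z i = e \<otimes> t i (x j)" for i
    have zc: "z i \<in> carrier R" "e \<otimes> z i = z i" "z i \<otimes> e = z i" if "i \<in> I'" for i
    proof -
      have "t i (x j) \<in> carrier R" "t i (x j) \<otimes> e = t i (x j)"
        using that Te[OF t(1), of i "x j"] biop_closed[OF t(1) Z(1), of i "x j"] xc[OF j] by auto
      then show "z i \<in> carrier R" "e \<otimes> z i = z i" "z i \<otimes> e = z i"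
        using e by (simp_all add: z_def m_assoc) (simp flip: m_assoc)
    qed
    have main: "T (x j) = (\<Oplus>i\<in>I'. T (x i) \<otimes> z i)" if T: "biop R Z T" for T
    proof -
      have Tc: "T w \<in> carrier R" if "w \<in> carrier R" for w using biop_closed[OF T Z(1) that] .
      have tc: "t i w \<in> carrier R" if "i \<in> I'" "w \<in> carrier R" for i w
        using biop_closed[OF t(1)[OF that(1)] Z(1) that(2)] .
      have xI: "x i \<in> carrier R" if "i \<in> I'" for i using xc that I' by auto
      \<comment> \<open>Correcting T by the dual operators produces an operator that kills all
        vectors of \<open>I'\<close>; by the case assumption it kills \<open>x j\<close>
        too.\<close>
      define S where "S w = T w \<oplus> (\<Oplus>i\<in>I'. (\<ominus> T (x i)) \<otimes> t i w \<otimes> e)" for w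
      have S: "biop R Z S"
        unfolding S_def using t Tc xI Z e I'
        by (intro biop_add T biop_finsum biop_bimul_comp) auto
      have te: "t i (x k) \<otimes> e = (if i = k then e else \<zero>)" if "i \<in> I'" "k \<in> I'" for i k
        using t that e by auto
      have "S (x k) = \<zero>" if k: "k \<in> I'" for k
      proof -
        have "(\<Oplus>i\<in>I'. (\<ominus> T (x i)) \<otimes> t i (x k) \<otimes> e) = (\<Oplus>i\<in>I'. if k = i then \<ominus> T (x i) else \<zero>)"
        proof (intro finsum_cong' refl)
          fix i assume i: "i \<in> I'"
          have "T (x i) \<otimes> e = T (x i)" using Te[OF T] xI i by simp
          then show "(\<ominus> T (x i)) \<otimes> t i (x k) \<otimes> e = (if k = i then \<ominus> T (x i) else \<zero>)"
            using te[OF i k] i k Tc xI tc e by (auto simp: m_assoc l_minus)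
        qed (use Tc xI in auto)
        also have "\<dots> = \<ominus> T (x k)"
          using k I' Tc xI by (intro add.finprod_singleton) auto
        finally show ?thesis using Tc xI k by (simp add: S_def r_neg)
      qed
      then have "S (x j) = \<zero>" using False S by blast
      moreover have "(\<Oplus>i\<in>I'. (\<ominus> T (x i)) \<otimes> t i (x j) \<otimes> e) = \<ominus> (\<Oplus>i\<in>I'. T (x i) \<otimes> z i)"
      proof -
        have "(\<Oplus>i\<in>I'. (\<ominus> T (x i)) \<otimes> t i (x j) \<otimes> e) = (\<Oplus>i\<in>I'. \<ominus> \<one> \<otimes> (T (x i) \<otimes> z i))"
        proof (intro finsum_cong' refl)
          fix i assume i: "i \<in> I'"
          have "T (x i) \<otimes> z i = T (x i) \<otimes> t i (x j)"
            using Te[OF T xI[OF i]] Tc[OF xI[OF i]] e tc[OF i] xc[OF j] by (simp add: z_def flip: m_assoc)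
          moreover have "t i (x j) \<otimes> e = t i (x j)" using Te[OF t(1)[OF i]] xc[OF j] by simp
          ultimately show "(\<ominus> T (x i)) \<otimes> t i (x j) \<otimes> e = \<ominus> \<one> \<otimes> (T (x i) \<otimes> z i)"
            using Tc xI i tc[OF i] xc[OF j] e by (simp add: m_assoc l_minus)
        qed (use Tc xI zc in auto)
        also have "\<dots> = \<ominus> \<one> \<otimes> (\<Oplus>i\<in>I'. T (x i) \<otimes> z i)"
          using I' Tc xI zc by (intro finsum_rdistr[symmetric]) auto
        also have "\<dots> = \<ominus> (\<Oplus>i\<in>I'. T (x i) \<otimes> z i)"
          using Tc xI zc by (simp add: l_minus Pi_def)
        finally show ?thesis .
      qed
      ultimately have "T (x j) \<oplus> \<ominus> (\<Oplus>i\<in>I'. T (x i) \<otimes> z i) = \<zero>" by (simp add: S_def)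
      moreover have "(\<Oplus>i\<in>I'. T (x i) \<otimes> z i) \<in> carrier R" "T (x j) \<in> carrier R"
        using Tc xI zc xc[OF j] by auto
      ultimately show ?thesis by (simp flip: a_minus_def)
    qed
    have zC: "z i \<in> C" if i: "i \<in> I'" for i
    proof -
      have "z i \<otimes> y = y \<otimes> z i" if y: "y \<in> Z" for y
      proof -
        have yR: "y \<in> carrier R" using y Z(1) by auto
        \<comment> \<open>Expanding this operator at \<open>x j\<close> by \<open>main\<close> gives
          z i * y on one side and y * z i on the other, so the coefficients centralise Z.\<close>
        have "biop R Z (\<lambda>w. e \<otimes> t i w \<otimes> y)"
          using t i Z y yR e by (intro biop_bimul_comp) auto
        from main[OF this] have "z i \<otimes> y = (\<Oplus>k\<in>I'. e \<otimes> t i (x k) \<otimes> y \<otimes> z k)"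
          by (simp add: z_def)
        also have "\<dots> = (\<Oplus>k\<in>I'. if i = k then y \<otimes> z k else \<zero>)"
          using t i e yR zc Z(4)[OF y] by (intro finsum_cong' refl) (auto simp: m_assoc[symmetric])
        also have "\<dots> = y \<otimes> z i"
          using i I' zc yR by (intro add.finprod_singleton) auto
        finally show ?thesis .
      qed
      then show ?thesis using zc[OF i] C by auto
    qed
    \<comment> \<open>Right multiplication by e is the identity on R e, and it is an admissible
      operator because e lies in Z.\<close>
    have "biop R Z (\<lambda>w. \<one> \<otimes> w \<otimes> e)" using Z by (intro biop_single) auto
    from main[OF this] have xj: "x j = (\<Oplus>i\<in>I'. x i \<otimes> z i)"
    proof -
      assume "\<one> \<otimes> x j \<otimes> e = (\<Oplus>i\<in>I'. \<one> \<otimes> x i \<otimes> e \<otimes> z i)"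
      also have "\<dots> = (\<Oplus>i\<in>I'. x i \<otimes> z i)"
        using xc zc I' by (intro finsum_cong') auto
      finally show ?thesis using xc[OF j] by simp
    qed
    \<comment> \<open>The expansion of \<open>x j\<close> read as a relation: its coefficient at j
      is the negative of e, which is nonzero.\<close>
    define c where "c i = (if i = j then \<ominus> e else if i \<in> I' then z i else \<zero>)" for i
    have meC: "\<ominus> e \<in> C" using e Z C by (auto simp: l_minus r_minus dest: subsetD)
    have cC: "c i \<in> C" for i using zC C0 meC by (auto simp: c_def)
    have "(\<Oplus>i\<in>I. x i \<otimes> c i) = x j \<otimes> c j \<oplus> (\<Oplus>i\<in>I'. x i \<otimes> c i)"
      unfolding I'(3) using I' xc cC CR by (intro finsum_insert) auto
    also have "(\<Oplus>i\<in>I'. x i \<otimes> c i) = (\<Oplus>i\<in>I'. x i \<otimes> z i)"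
      using I' xc zc by (intro finsum_cong') (auto simp: c_def)
    also have "x j \<otimes> c j = \<ominus> x j" using xc[OF j] e by (simp add: c_def r_minus)
    finally have "(\<Oplus>i\<in>I. x i \<otimes> c i) = \<zero>" using xj xc[OF j] by (simp add: l_neg)
    then have "c j = \<zero>" using indep[of c j] cC j by auto
    then show ?thesis using e by (simp add: c_def)
  qed
qed

end

section \<open>Nakayama's lemma\<close>

text \<open>The sum N + q g(0) + ... + q g(s - 1), built so that the last generator can be split
  off.\<close>

primrec (in ring) comb :: "'a set \<Rightarrow> 'a set \<Rightarrow> (nat \<Rightarrow> 'a) \<Rightarrow> nat \<Rightarrow> 'a set" where
  "comb N q g 0 = N"
| "comb N q g (Suc s) = {x \<oplus> c \<otimes> g s | x c. x \<in> comb N q g s \<and> c \<in> q}"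

text \<open>The ideal q of P need not lie in a radical, so generation by N is reached only after
  multiplication by some \<open>\<delta>\<close> congruent to 1 modulo q. The generators are removed
  one at a time in place of a determinant; allowing a factor \<open>\<delta>\<close> already in the
  hypothesis lets the induction continue.\<close>

lemma (in ring) nakayama:
  assumes P: "P \<subseteq> carrier R" "\<one> \<in> P" "\<And>x y. x \<in> P \<Longrightarrow> y \<in> P \<Longrightarrow> x \<oplus> y \<in> P"
      "\<And>x y. x \<in> P \<Longrightarrow> y \<in> P \<Longrightarrow> x \<otimes> y \<in> P" "\<And>x y. x \<in> P \<Longrightarrow> y \<in> carrier R \<Longrightarrow> x \<otimes> y = y \<otimes> x"
    and q: "q \<subseteq> P" "\<And>x y. x \<in> q \<Longrightarrow> y \<in> q \<Longrightarrow> x \<oplus> y \<in> q" "\<And>x y. x \<in> P \<Longrightarrow> y \<in> q \<Longrightarrow> x \<otimes> y \<in> q"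
      "\<And>x. x \<in> q \<Longrightarrow> \<ominus> x \<in> q" "\<zero> \<in> q"
    and N: "N \<subseteq> carrier R" "\<And>x y. x \<in> N \<Longrightarrow> y \<in> N \<Longrightarrow> x \<oplus> y \<in> N" "\<And>x y. x \<in> P \<Longrightarrow> y \<in> N \<Longrightarrow> x \<otimes> y \<in> N"
    and g: "\<And>i. g i \<in> carrier R"
    and gen: "\<And>i. i < s \<Longrightarrow> \<exists>\<delta>\<in>P. \<delta> \<ominus> \<one> \<in> q \<and> \<delta> \<otimes> g i \<in> comb N q g s"
  shows "\<exists>\<delta>\<in>P. \<delta> \<ominus> \<one> \<in> q \<and> (\<forall>i<s. \<delta> \<otimes> g i \<in> N)"
proof -
  define U where "U = {\<delta> \<in> P. \<delta> \<ominus> \<one> \<in> q}"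
  have PR: "x \<in> carrier R" if "x \<in> P" for x using that P(1) by auto
  have qR: "x \<in> carrier R" "x \<in> P" if "x \<in> q" for x using that q(1) PR by auto
  have U_mult: "x \<otimes> y \<in> U" if "x \<in> U" "y \<in> U" for x y
  proof -
    have "x \<in> carrier R" "y \<in> carrier R" using that PR by (auto simp: U_def)
    then have "x \<otimes> y \<ominus> \<one> = x \<otimes> (y \<ominus> \<one>) \<oplus> (x \<ominus> \<one>)"
      by (simp add: a_minus_def r_distr r_minus a_assoc r_neg1)
    then show ?thesis using that P(4) q(2,3) by (auto simp: U_def)
  qed
  have U_diff: "x \<ominus> c \<in> U" if "x \<in> U" "c \<in> q" for x c
  proof -
    have xc: "x \<in> carrier R" "c \<in> carrier R" using that PR qR by (auto simp: U_def)
    then have "x \<ominus> c \<ominus> \<one> = (x \<ominus> \<one>) \<oplus> \<ominus> c" by (simp add: a_minus_def a_ac)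
    moreover have "x \<ominus> c \<in> P" using that q(1,4) P(3) by (auto simp: U_def a_minus_def)
    ultimately show ?thesis using that q(2,4) by (auto simp: U_def)
  qed
  have comb_R: "comb N q g s \<subseteq> carrier R" for s
    by (induct s) (use N(1) qR g in auto)
  have comb_add: "x \<in> comb N q g s \<Longrightarrow> y \<in> comb N q g s \<Longrightarrow> x \<oplus> y \<in> comb N q g s" for x y s
  proof (induct s arbitrary: x y)
    case (Suc s)
    then obtain x' c y' d where *: "x = x' \<oplus> c \<otimes> g s" "x' \<in> comb N q g s" "c \<in> q"
      "y = y' \<oplus> d \<otimes> g s" "y' \<in> comb N q g s" "d \<in> q" by auto
    then have "x' \<in> carrier R" "c \<in> carrier R" "y' \<in> carrier R" "d \<in> carrier R"
      using comb_R qR by (auto dest: subsetD)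
    then have "x \<oplus> y = (x' \<oplus> y') \<oplus> (c \<oplus> d) \<otimes> g s" using * g by (simp add: l_distr a_ac)
    with Suc.hyps[of x' y'] * q(2) show ?case by auto
  qed (use N in auto)
  have comb_mult: "p \<in> P \<Longrightarrow> x \<in> comb N q g s \<Longrightarrow> p \<otimes> x \<in> comb N q g s" for p x s
  proof (induct s arbitrary: x)
    case (Suc s)
    then obtain x' c where *: "x = x' \<oplus> c \<otimes> g s" "x' \<in> comb N q g s" "c \<in> q" by auto
    then have "x' \<in> carrier R" "c \<in> carrier R" using comb_R qR by (auto dest: subsetD)
    then have "p \<otimes> x = p \<otimes> x' \<oplus> (p \<otimes> c) \<otimes> g s" using * g Suc.prems(1) PR by (simp add: r_distr m_assoc)
    moreover have "p \<otimes> x' \<in> comb N q g s" "p \<otimes> c \<in> q" using Suc * q(3) by auto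
    ultimately show ?case by auto
  qed (use N in auto)
  have "\<forall>i<s. \<exists>\<delta>\<in>U. \<delta> \<otimes> g i \<in> comb N q g s \<Longrightarrow> \<exists>\<delta>\<in>U. \<forall>i<s. \<delta> \<otimes> g i \<in> N" for s
  proof (induct s)
    case 0
    have "\<one> \<in> U" using P(2) q(5) by (simp add: U_def a_minus_def r_neg)
    then show ?case by auto
  next
    case (Suc s)
    obtain \<delta> x c where \<delta>: "\<delta> \<in> U" "\<delta> \<otimes> g s = x \<oplus> c \<otimes> g s" "x \<in> comb N q g s" "c \<in> q"
      using Suc.prems by auto
    \<comment> \<open>Moving the term c g(s) to the left removes g(s) from its own expansion, and
      the new factor is still 1 modulo q.\<close>
    define \<epsilon> where "\<epsilon> = \<delta> \<ominus> c"
    have \<epsilon>U: "\<epsilon> \<in> U" using U_diff \<delta> by (simp add: \<epsilon>_def)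
    have R: "\<delta> \<in> carrier R" "c \<in> carrier R" "x \<in> carrier R" "\<epsilon> \<in> carrier R"
      using \<delta> \<epsilon>U PR qR comb_R by (auto simp: U_def dest: subsetD)
    have "\<epsilon> \<otimes> g s = \<delta> \<otimes> g s \<oplus> \<ominus> (c \<otimes> g s)" using R g by (simp add: \<epsilon>_def a_minus_def l_distr l_minus)
    also have "\<dots> = x" using R g unfolding \<delta>(2) by (simp add: a_assoc r_neg)
    finally have \<epsilon>g: "\<epsilon> \<otimes> g s \<in> comb N q g s" using \<delta> by simp
    have "\<exists>\<delta>\<in>U. \<delta> \<otimes> g i \<in> comb N q g s" if i: "i < s" for i
    proof -
      obtain \<alpha> y d where \<alpha>: "\<alpha> \<in> U" "\<alpha> \<otimes> g i = y \<oplus> d \<otimes> g s" "y \<in> comb N q g s" "d \<in> q"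
        using Suc.prems i by (auto simp: less_Suc_eq)
      have R': "\<alpha> \<in> carrier R" "y \<in> carrier R" "d \<in> carrier R"
        using \<alpha> PR qR comb_R by (auto simp: U_def dest: subsetD)
      \<comment> \<open>After multiplication by \<open>\<epsilon>\<close>, the remaining occurrence
        of g(s) can be replaced by its expansion in the earlier generators.\<close>
      have "(\<epsilon> \<otimes> \<alpha>) \<otimes> g i = \<epsilon> \<otimes> y \<oplus> d \<otimes> (\<epsilon> \<otimes> g s)"
      proof -
        have "\<epsilon> \<otimes> d = d \<otimes> \<epsilon>" using P(5)[of \<epsilon> d] \<epsilon>U R' by (simp add: U_def)
        then show ?thesis using R R' g \<alpha>(2) by (simp add: m_assoc r_distr) (simp flip: m_assoc)
      qed
      then show ?thesis
        using U_mult[OF \<epsilon>U \<alpha>(1)] comb_add comb_mult \<alpha> \<epsilon>U \<epsilon>g qR by (intro bexI[of _ "\<epsilon> \<otimes> \<alpha>"]) (auto simp: U_def)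
    qed
    with Suc.hyps obtain \<beta> where \<beta>: "\<beta> \<in> U" "\<forall>i<s. \<beta> \<otimes> g i \<in> N" by auto
    have comb_N: "\<beta> \<otimes> y \<in> N" if "y \<in> comb N q g t" "t \<le> s" for y t
      using that
    proof (induct t arbitrary: y)
      case 0
      then show ?case using \<beta> N by (auto simp: U_def)
    next
      case (Suc t)
      then obtain y' d where *: "y = y' \<oplus> d \<otimes> g t" "y' \<in> comb N q g t" "d \<in> q" by auto
      have R': "\<beta> \<in> carrier R" "y' \<in> carrier R" "d \<in> carrier R"
        using \<beta> * PR qR comb_R[of t] by (auto simp: U_def)
      have "\<beta> \<otimes> d = d \<otimes> \<beta>" using P(5)[of \<beta> d] \<beta> R' by (simp add: U_def)
      then have "\<beta> \<otimes> y = \<beta> \<otimes> y' \<oplus> d \<otimes> (\<beta> \<otimes> g t)"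
        using R' g * by (simp add: r_distr) (simp flip: m_assoc)
      then show ?case using Suc * \<beta> N(2,3) qR by auto
    qed
    have "(\<beta> \<otimes> \<epsilon>) \<otimes> g i \<in> N" if "i < Suc s" for i
    proof (cases "i = s")
      case True
      then show ?thesis using comb_N[OF \<epsilon>g] \<beta> R g PR by (simp add: m_assoc U_def)
    next
      case False
      have "\<beta> \<otimes> \<epsilon> = \<epsilon> \<otimes> \<beta>" using P(5)[of \<beta> \<epsilon>] \<beta> R by (simp add: U_def)
      then have "(\<beta> \<otimes> \<epsilon>) \<otimes> g i = \<epsilon> \<otimes> (\<beta> \<otimes> g i)" using R g \<beta> PR by (simp add: m_assoc U_def)
      then show ?thesis using False that \<beta> N(3) \<epsilon>U by (auto simp: U_def)
    qed
    then show ?case using U_mult[OF \<beta>(1) \<epsilon>U] by auto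
  qed
  from this[of s] gen show ?thesis by (auto simp: U_def)
qed

section \<open>Simple rings of finite rank over their centre\<close>

text \<open>A central simple algebra of dimension N with its own centre as the field of scalars. The
  basis and the coefficients are total functions on the natural numbers of which the first N values
  count.\<close>

locale simple_ring_of_rank = ring R for R (structure) +
  fixes N :: nat and \<epsilon> :: "nat \<Rightarrow> 'a"
  assumes one_not_zero: "\<one> \<noteq> \<zero>"
    and simple: "\<And>I. ideal I R \<Longrightarrow> I = {\<zero>} \<or> I = carrier R"
    and \<epsilon>_closed: "\<And>p. \<epsilon> p \<in> carrier R"
    and \<epsilon>_span: "\<And>w. w \<in> carrier R \<Longrightarrow>
      \<exists>c. (\<forall>p. c p \<in> ring_center R) \<and> w = (\<Oplus>p\<in>{..<N}. c p \<otimes> \<epsilon> p)"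
    and \<epsilon>_indep: "\<And>c p. \<lbrakk>\<And>p. c p \<in> ring_center R; (\<Oplus>p\<in>{..<N}. c p \<otimes> \<epsilon> p) = \<zero>; p < N\<rbrakk> \<Longrightarrow> c p = \<zero>"

section \<open>The centre and the two-sided multiplications of a ring\<close>

context ring
begin

lemma center_closed:
  "ring_center R \<subseteq> carrier R" "\<zero> \<in> ring_center R" "\<one> \<in> ring_center R"
  "x \<in> ring_center R \<Longrightarrow> y \<in> ring_center R \<Longrightarrow> x \<oplus> y \<in> ring_center R"
  "x \<in> ring_center R \<Longrightarrow> y \<in> ring_center R \<Longrightarrow> x \<otimes> y \<in> ring_center R"
  "x \<in> ring_center R \<Longrightarrow> \<ominus> x \<in> ring_center R"
proof -
  show "x \<otimes> y \<in> ring_center R" if "x \<in> ring_center R" "y \<in> ring_center R"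
  proof -
    have "x \<otimes> y \<otimes> z = z \<otimes> (x \<otimes> y)" if "z \<in> carrier R" for z
    proof -
      have R: "x \<in> carrier R" "y \<in> carrier R" "x \<otimes> z = z \<otimes> x" "y \<otimes> z = z \<otimes> y"
        using \<open>x \<in> ring_center R\<close> \<open>y \<in> ring_center R\<close> that by (auto simp: ring_center_def)
      then have "x \<otimes> y \<otimes> z = x \<otimes> (z \<otimes> y)" using m_assoc[of x y z] that by simp
      also have "\<dots> = x \<otimes> z \<otimes> y" using m_assoc[of x z y] R that by simp
      also have "\<dots> = z \<otimes> (x \<otimes> y)" using m_assoc[of z x y] R that by simp
      finally show ?thesis .
    qed
    moreover have "x \<otimes> y \<in> carrier R" using that unfolding ring_center_def by blast
    ultimately show ?thesis unfolding ring_center_def by blast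
  qed
qed (auto simp: ring_center_def l_distr r_distr l_minus r_minus)

lemma center_comm: "x \<in> ring_center R \<Longrightarrow> y \<in> carrier R \<Longrightarrow> x \<otimes> y = y \<otimes> x"
  by (simp add: ring_center_def)

lemma biop_mult:
  assumes T: "biop R (carrier R) T" and a: "a \<in> carrier R" "b \<in> carrier R"
  shows "biop R (carrier R) (\<lambda>w. a \<otimes> T w \<otimes> b)"
  using assms by (intro biop_bimul_comp) auto

text \<open>This set is the two-sided ideal R a R. Simplicity thus says that the two-sided
  multiplications reach 1 from every nonzero element, which is the irreducibility that
  \<open>density\<close> asks for.\<close>

lemma ideal_biops:
  assumes a: "a \<in> carrier R"
  shows "ideal {T a | T. biop R (carrier R) T} R" (is "ideal ?I R")
proof -
  have I: "T a \<in> ?I" if "biop R (carrier R) T" for T using that by auto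
  have J: "\<exists>T. x = T a \<and> T a \<in> carrier R \<and> biop R (carrier R) T" if "x \<in> ?I" for x
    using that biop_closed[OF _ _ a] by auto
  show ?thesis
  proof (rule idealI)
    show "subgroup ?I (add_monoid R)"
    proof
      show "?I \<subseteq> carrier (add_monoid R)" using a by (auto intro: biop_closed)
      show "x \<otimes>\<^bsub>add_monoid R\<^esub> y \<in> ?I" if xy: "x \<in> ?I" "y \<in> ?I" for x y
      proof -
        from J[OF xy(1)] obtain T where T: "x = T a" "biop R (carrier R) T" by blast
        from J[OF xy(2)] obtain T' where T': "y = T' a" "biop R (carrier R) T'" by blast
        show ?thesis using I[OF biop_add[OF T(2) T'(2)]] T T' by simp
      qed
      show "\<one>\<^bsub>add_monoid R\<^esub> \<in> ?I" using I[OF biop_zero] by simp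
      show "inv\<^bsub>add_monoid R\<^esub> x \<in> ?I" if x: "x \<in> ?I" for x
      proof -
        from J[OF x] obtain T where T: "x = T a" "T a \<in> carrier R" "biop R (carrier R) T" by blast
        from I[OF biop_mult[OF T(3) _ one_closed, of "\<ominus> \<one>"]] have "\<ominus> x \<in> ?I"
          using T by (simp add: l_minus)
        then show ?thesis by (simp add: a_inv_def)
      qed
    qed
  next
    fix x y assume x: "x \<in> ?I" and y: "y \<in> carrier R"
    from J[OF x] obtain T where T: "x = T a" "T a \<in> carrier R" "biop R (carrier R) T" by blast
    show "y \<otimes> x \<in> ?I" using I[OF biop_mult[OF T(3) y one_closed]] T y by simp
    show "x \<otimes> y \<in> ?I" using I[OF biop_mult[OF T(3) one_closed y]] T y by simp
  qed (rule ring_axioms)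
qed

end

context simple_ring_of_rank
begin

lemma biop_one:
  assumes a: "a \<in> carrier R" "a \<noteq> \<zero>"
  shows "\<exists>T. biop R (carrier R) T \<and> T a = \<one>"
proof -
  have "biop R (carrier R) (\<lambda>w. \<one> \<otimes> w \<otimes> \<one>)" by (rule biop_single) auto
  then have "a \<in> {T a | T. biop R (carrier R) T}" using a by (auto intro!: exI[of _ "\<lambda>w. \<one> \<otimes> w \<otimes> \<one>"])
  with simple[OF ideal_biops[OF a(1)]] a have "{T a | T. biop R (carrier R) T} = carrier R" by auto
  then have "\<one> \<in> {T a | T. biop R (carrier R) T}" by simp
  then show ?thesis by auto
qed

text \<open>In an expression of 1 as a sum of terms a z b, the central z can be pulled out to the
  right. A left inverse of a central element is again central.\<close>

lemma center_inverse:
  assumes z: "z \<in> ring_center R" "z \<noteq> \<zero>"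
  shows "\<exists>y\<in>ring_center R. y \<otimes> z = \<one>"
proof -
  have zR: "z \<in> carrier R" using z center_closed by auto
  from biop_one[OF zR z(2)] obtain T where T: "biop R (carrier R) T" "T z = \<one>" by auto
  then obtain us where us: "set us \<subseteq> carrier R \<times> carrier R" "bimul R us z = \<one>"
    using zR by (auto simp: biop_def)
  have "set us \<subseteq> carrier R \<times> carrier R \<Longrightarrow> \<exists>y\<in>carrier R. bimul R us z = y \<otimes> z" for us
  proof (induct us)
    case Nil
    then show ?case using zR by (intro bexI[of _ \<zero>]) auto
  next
    case (Cons u us)
    obtain a b where u: "u = (a, b)" by (cases u)
    from Cons obtain y where y: "y \<in> carrier R" "bimul R us z = y \<otimes> z" by auto
    have ab: "a \<in> carrier R" "b \<in> carrier R" using Cons.prems u by auto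
    have "a \<otimes> z \<otimes> b = a \<otimes> b \<otimes> z" using ab z zR by (simp add: m_assoc center_comm)
    then have "bimul R (u # us) z = (a \<otimes> b \<oplus> y) \<otimes> z" using ab y zR by (simp add: u l_distr)
    then show ?case using ab y by blast
  qed
  with us obtain y where y: "y \<in> carrier R" "y \<otimes> z = \<one>" by metis
  have "y \<otimes> x = x \<otimes> y" if x: "x \<in> carrier R" for x
  proof -
    have "y \<otimes> x = y \<otimes> x \<otimes> (y \<otimes> z)" using x y by simp
    also have "\<dots> = y \<otimes> (z \<otimes> x) \<otimes> y"
      using x y zR center_comm[OF z(1), of "x \<otimes> y"] center_comm[OF z(1), of y] by (simp add: m_assoc)
    also have "\<dots> = x \<otimes> y" using x y zR by (simp flip: m_assoc)
    finally show ?thesis .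
  qed
  then have "y \<in> ring_center R" using y by (simp add: ring_center_def)
  with y show ?thesis by auto
qed

lemma center_integral:
  assumes "x \<in> ring_center R" "y \<in> carrier R" "x \<otimes> y = \<zero>" shows "x = \<zero> \<or> y = \<zero>"
proof (cases "x = \<zero>")
  case False
  then obtain z where z: "z \<in> ring_center R" "z \<otimes> x = \<one>" using center_inverse assms by auto
  have "x \<in> carrier R" "z \<in> carrier R" using assms z center_closed by auto
  then have "z \<otimes> (x \<otimes> y) = y" using z(2) assms(2) m_assoc[of z x y] by simp
  then show ?thesis using assms(3) \<open>z \<in> carrier R\<close> by simp
qed simp

definition c_indep :: "nat \<Rightarrow> (nat \<Rightarrow> 'a) \<Rightarrow> bool" where
  "c_indep k x \<longleftrightarrow> (\<forall>c. (\<forall>i. c i \<in> ring_center R) \<longrightarrow> (\<Oplus>i\<in>{..<k}. c i \<otimes> x i) = \<zero> \<longrightarrow> (\<forall>i<k. c i = \<zero>))"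

text \<open>The coordinates of the vectors with respect to the basis form a system of N equations
  over the centre, a commutative domain; with more than N unknowns it has a nonzero
  solution.\<close>

lemma c_indep_le:
  assumes "c_indep k x" "\<And>i. x i \<in> carrier R"
  shows "k \<le> N"
proof (rule ccontr)
  assume "\<not> k \<le> N"
  have CR: "c \<in> carrier R" if "c \<in> ring_center R" for c using that center_closed by auto
  have "\<forall>i. \<exists>a. (\<forall>p. a p \<in> ring_center R) \<and> x i = (\<Oplus>p\<in>{..<N}. a p \<otimes> \<epsilon> p)"
    using \<epsilon>_span assms(2) by blast
  then obtain a where a: "\<And>i p. a i p \<in> ring_center R" "\<And>i. x i = (\<Oplus>p\<in>{..<N}. a i p \<otimes> \<epsilon> p)" by metis
  have "\<exists>c. (\<forall>j. c j \<in> ring_center R) \<and> (\<exists>j\<in>{..<k}. c j \<noteq> \<zero>) \<and>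
      (\<forall>p\<in>{..<N}. (\<Oplus>j\<in>{..<k}. a j p \<otimes> c j) = \<zero>)"
    using one_not_zero \<open>\<not> k \<le> N\<close> a(1) center_closed center_integral
    by (intro homogeneous_system[where u = \<one>]) (auto intro: center_comm dest: center_integral subsetD)
  then obtain c where c: "\<And>j. c j \<in> ring_center R" "\<exists>j<k. c j \<noteq> \<zero>"
     "\<And>p. p < N \<Longrightarrow> (\<Oplus>j\<in>{..<k}. a j p \<otimes> c j) = \<zero>" by auto
  have "(\<Oplus>i\<in>{..<k}. c i \<otimes> x i) = (\<Oplus>i\<in>{..<k}. \<Oplus>p\<in>{..<N}. (a i p \<otimes> c i) \<otimes> \<epsilon> p)"
  proof (intro finsum_cong' refl)
    fix i
    have "c i \<otimes> x i = (\<Oplus>p\<in>{..<N}. c i \<otimes> (a i p \<otimes> \<epsilon> p))"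
      unfolding a(2) using CR[OF a(1)] CR[OF c(1)] \<epsilon>_closed by (intro finsum_rdistr) auto
    also have "\<dots> = (\<Oplus>p\<in>{..<N}. (a i p \<otimes> c i) \<otimes> \<epsilon> p)"
      using CR[OF a(1)] CR[OF c(1)] \<epsilon>_closed
      by (intro finsum_cong' refl) (auto simp: center_comm[OF c(1)] simp flip: m_assoc)
    finally show "c i \<otimes> x i = (\<Oplus>p\<in>{..<N}. (a i p \<otimes> c i) \<otimes> \<epsilon> p)" .
  qed (use CR[OF a(1)] CR[OF c(1)] \<epsilon>_closed in \<open>auto intro!: finsum_closed\<close>)
  also have "\<dots> = (\<Oplus>p\<in>{..<N}. \<Oplus>i\<in>{..<k}. (a i p \<otimes> c i) \<otimes> \<epsilon> p)"
    using CR[OF a(1)] CR[OF c(1)] \<epsilon>_closed by (intro finsum_swap) auto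
  also have "\<dots> = \<zero>"
  proof (rule add.finprod_one_eqI)
    fix p assume p: "p \<in> {..<N}"
    have "(\<Oplus>i\<in>{..<k}. (a i p \<otimes> c i) \<otimes> \<epsilon> p) = (\<Oplus>i\<in>{..<k}. a i p \<otimes> c i) \<otimes> \<epsilon> p"
      using CR[OF a(1)] CR[OF c(1)] \<epsilon>_closed by (intro finsum_ldistr[symmetric]) auto
    then show "(\<Oplus>i\<in>{..<k}. (a i p \<otimes> c i) \<otimes> \<epsilon> p) = \<zero>" using c(3)[of p] p \<epsilon>_closed by simp
  qed
  finally show False using assms(1) c by (auto simp: c_indep_def)
qed

section \<open>Minimal left ideals and primitive idempotents\<close>

definition left_ideal :: "'a set \<Rightarrow> bool" where
  "left_ideal L \<longleftrightarrow> L \<subseteq> carrier R \<and> \<zero> \<in> L \<and> (\<forall>x\<in>L. \<forall>y\<in>L. x \<oplus> y \<in> L) \<and> (\<forall>x\<in>carrier R. \<forall>y\<in>L. x \<otimes> y \<in> L)"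

lemma left_ideal_principal:
  assumes "left_ideal L" "x \<in> carrier R"
  shows "left_ideal {y \<otimes> x | y. y \<in> L}"
  unfolding left_ideal_def
proof (intro conjI ballI)
  have L: "y \<in> carrier R" if "y \<in> L" for y using that assms(1) by (auto simp: left_ideal_def)
  show "{y \<otimes> x | y. y \<in> L} \<subseteq> carrier R" using L assms by auto
  show "\<zero> \<in> {y \<otimes> x | y. y \<in> L}"
    using assms by (auto simp: left_ideal_def intro!: exI[of _ \<zero>])
  show "u \<oplus> v \<in> {y \<otimes> x | y. y \<in> L}" if uv: "u \<in> {y \<otimes> x | y. y \<in> L}" "v \<in> {y \<otimes> x | y. y \<in> L}" for u v
  proof -
    from uv obtain y z where yz: "u = y \<otimes> x" "v = z \<otimes> x" "y \<in> L" "z \<in> L" by auto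
    then have "u \<oplus> v = (y \<oplus> z) \<otimes> x" "y \<oplus> z \<in> L" using L assms by (auto simp: l_distr left_ideal_def)
    then show ?thesis by auto
  qed
  show "a \<otimes> u \<in> {y \<otimes> x | y. y \<in> L}" if "a \<in> carrier R" "u \<in> {y \<otimes> x | y. y \<in> L}" for a u
  proof -
    from that obtain y where y: "u = y \<otimes> x" "y \<in> L" by auto
    then have "a \<otimes> u = (a \<otimes> y) \<otimes> x" "a \<otimes> y \<in> L"
      using that(1) assms L[OF y(2)] by (auto simp: left_ideal_def m_assoc)
    then show ?thesis by auto
  qed
qed

text \<open>\<open>d L\<close> is the dimension of L over the centre. A nonzero left ideal of least
  dimension is minimal, because an independent family in a properly smaller ideal can be enlarged by
  an element outside that ideal.\<close>

lemma ex_minimal_left_ideal: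
  "\<exists>L. left_ideal L \<and> L \<noteq> {\<zero>} \<and> (\<forall>L'. left_ideal L' \<longrightarrow> L' \<noteq> {\<zero>} \<longrightarrow> L' \<subseteq> L \<longrightarrow> L' = L)"
proof -
  have CR: "c \<in> carrier R" if "c \<in> ring_center R" for c using that center_closed by auto
  define A where "A L = {k. \<exists>x. (\<forall>i. x i \<in> L) \<and> c_indep k x}" for L
  have A_bound: "A L \<subseteq> {..N}" if "left_ideal L" for L
    using that by (auto simp: A_def left_ideal_def intro!: c_indep_le)
  have A0: "0 \<in> A L" if "left_ideal L" for L
    using that by (auto simp: A_def c_indep_def left_ideal_def)
  define d where "d L = Max (A L)" for L
  have dA: "d L \<in> A L" if "left_ideal L" for L
    unfolding d_def using A_bound[OF that] A0[OF that] by (intro Max_in) (auto intro: finite_subset)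
  have "left_ideal (carrier R)" by (auto simp: left_ideal_def)
  moreover have "carrier R \<noteq> {\<zero>}" using one_not_zero one_closed by auto
  ultimately obtain L where L: "left_ideal L" "L \<noteq> {\<zero>}"
      "\<And>L'. left_ideal L' \<Longrightarrow> L' \<noteq> {\<zero>} \<Longrightarrow> d L \<le> d L'"
    using ex_has_least_nat[of "\<lambda>L. left_ideal L \<and> L \<noteq> {\<zero>}" "carrier R" d] by blast
  have "L' = L" if L': "left_ideal L'" "L' \<noteq> {\<zero>}" "L' \<subseteq> L" for L'
  proof (rule ccontr)
    assume "L' \<noteq> L"
    then obtain y where y: "y \<in> L" "y \<notin> L'" using L'(3) by auto
    have yR: "y \<in> carrier R" using y L(1) by (auto simp: left_ideal_def)
    from dA[OF L'(1)] obtain x where x: "\<And>i. x i \<in> L'" "c_indep (d L') x" by (auto simp: A_def)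
    have xR: "x i \<in> carrier R" for i using x(1) L'(1) by (auto simp: left_ideal_def)
    define k where "k = d L'"
    define x' where "x' i = (if i = k then y else x i)" for i
    have x'R: "x' i \<in> carrier R" for i using xR yR by (simp add: x'_def)
    have "c_indep (Suc k) x'"
      unfolding c_indep_def
    proof (intro allI impI)
      fix c i assume c: "\<forall>i. c i \<in> ring_center R" "(\<Oplus>i\<in>{..<Suc k}. c i \<otimes> x' i) = \<zero>" and i: "i < Suc k"
      have cR: "c i \<in> carrier R" for i using c(1) CR by simp
      have sum: "(\<Oplus>i\<in>{..<Suc k}. c i \<otimes> x' i) = c k \<otimes> y \<oplus> (\<Oplus>i\<in>{..<k}. c i \<otimes> x i)"
      proof -
        have "(\<Oplus>i\<in>{..<Suc k}. c i \<otimes> x' i) = c k \<otimes> x' k \<oplus> (\<Oplus>i\<in>{..<k}. c i \<otimes> x' i)"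
          unfolding lessThan_Suc using cR x'R by (intro finsum_insert) auto
        also have "(\<Oplus>i\<in>{..<k}. c i \<otimes> x' i) = (\<Oplus>i\<in>{..<k}. c i \<otimes> x i)"
          using cR xR by (intro finsum_cong' refl) (auto simp: x'_def)
        finally show ?thesis by (simp add: x'_def)
      qed
      have SL: "(\<Oplus>i\<in>{..<m}. c i \<otimes> x i) \<in> L'" for m
        using cR xR x(1) L'(1) by (induct m) (auto simp: lessThan_Suc left_ideal_def Pi_def)
      have "c k = \<zero>"
      proof (rule ccontr)
        assume "c k \<noteq> \<zero>"
        then obtain b where b: "b \<in> ring_center R" "b \<otimes> c k = \<one>" using center_inverse c(1) by blast
        have bR: "b \<in> carrier R" using b CR by simp
        have "c k \<otimes> y = \<ominus> (\<Oplus>i\<in>{..<k}. c i \<otimes> x i)"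
          using c(2) sum cR yR xR by (intro minus_equality[symmetric]) auto
        also have "\<dots> = \<ominus> \<one> \<otimes> (\<Oplus>i\<in>{..<k}. c i \<otimes> x i)"
          using cR xR by (simp add: l_minus)
        finally have "c k \<otimes> y \<in> L'" using SL[of k] L'(1) by (simp add: left_ideal_def)
        then have "b \<otimes> (c k \<otimes> y) \<in> L'" using bR L'(1) by (simp add: left_ideal_def)
        moreover have "b \<otimes> (c k \<otimes> y) = y" using b bR cR yR by (simp flip: m_assoc)
        ultimately show False using y by simp
      qed
      moreover from this have "(\<Oplus>i\<in>{..<k}. c i \<otimes> x i) = \<zero>"
        using c(2) sum cR yR xR by simp
      then have "\<forall>i<k. c i = \<zero>" using x(2) c(1) by (auto simp: c_indep_def k_def)
      ultimately show "c i = \<zero>" using i by (auto simp: less_Suc_eq)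
    qed
    then have "Suc k \<in> A L"
      unfolding A_def using subsetD[OF L'(3) x(1)] y(1) by (auto intro!: exI[of _ x'] simp: x'_def)
    then have "Suc k \<le> d L"
      unfolding d_def using A_bound[OF L(1)] by (intro Max_ge) (auto intro: finite_subset)
    then show False using L(3)[OF L'(1,2)] by (simp add: k_def)
  qed
  then show ?thesis using L by blast
qed

text \<open>Brauer's lemma. The square of a minimal left ideal L is nonzero, so L = L x for some x
  in L, and an element e of L that fixes x is an idempotent. Every nonzero w in R e generates L by
  minimality, hence reaches e.\<close>

lemma ex_primitive_idempotent:
  "\<exists>e\<in>carrier R. e \<otimes> e = e \<and> e \<noteq> \<zero> \<and>
    (\<forall>w\<in>carrier R. w \<otimes> e = w \<longrightarrow> w \<noteq> \<zero> \<longrightarrow> (\<exists>a\<in>carrier R. a \<otimes> w = e))"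
proof -
  from ex_minimal_left_ideal obtain L where L: "left_ideal L" "L \<noteq> {\<zero>}"
    and min: "\<And>L'. left_ideal L' \<Longrightarrow> L' \<noteq> {\<zero>} \<Longrightarrow> L' \<subseteq> L \<Longrightarrow> L' = L" by metis
  have LR: "x \<in> carrier R" if "x \<in> L" for x using that L(1) by (auto simp: left_ideal_def)
  have Lm: "a \<otimes> x \<in> L" if "a \<in> carrier R" "x \<in> L" for a x using that L(1) by (auto simp: left_ideal_def)
  have L0: "\<zero> \<in> L" using L(1) by (auto simp: left_ideal_def)
  have "\<exists>x\<in>L. \<exists>y\<in>L. y \<otimes> x \<noteq> \<zero>"
  proof (rule ccontr)
    assume "\<not> (\<exists>x\<in>L. \<exists>y\<in>L. y \<otimes> x \<noteq> \<zero>)"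
    then have LL: "y \<otimes> x = \<zero>" if "x \<in> L" "y \<in> L" for x y using that by blast
    obtain a where a: "a \<in> L" "a \<noteq> \<zero>" using L L0 by auto
    \<comment> \<open>If L had square zero, a would annihilate R a R from the left, and R a R
      contains 1.\<close>
    from biop_one[OF LR[OF a(1)] a(2)] obtain us where
      us: "set us \<subseteq> carrier R \<times> carrier R" "bimul R us a = \<one>"
      using LR[OF a(1)] unfolding biop_def by metis
    have "set us \<subseteq> carrier R \<times> carrier R \<Longrightarrow> a \<otimes> bimul R us a = \<zero>" for us
    proof (induct us)
      case (Cons u us)
      obtain b c where u: "u = (b, c)" by (cases u)
      have bc: "b \<in> carrier R" "c \<in> carrier R" "set us \<subseteq> carrier R \<times> carrier R"
        using Cons.prems u by auto
      have "a \<otimes> (b \<otimes> a \<otimes> c) = (a \<otimes> (b \<otimes> a)) \<otimes> c" using bc LR[OF a(1)] by (simp add: m_assoc)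
      also have "a \<otimes> (b \<otimes> a) = \<zero>" using LL[OF Lm[OF bc(1) a(1)] a(1)] .
      finally show ?case using Cons bc LR[OF a(1)] by (simp add: u r_distr)
    qed (use LR[OF a(1)] in simp)
    from this[OF us(1)] us(2) a LR[OF a(1)] show False by simp
  qed
  then obtain x y where xy: "x \<in> L" "y \<in> L" "y \<otimes> x \<noteq> \<zero>" by blast
  have xR: "x \<in> carrier R" using LR xy by auto
  have "{y \<otimes> x | y. y \<in> L} = L"
    using xy xR by (intro min left_ideal_principal L(1)) (auto intro: Lm LR)
  then obtain e where e: "e \<in> L" "e \<otimes> x = x" using xy(1) by force
  have eR: "e \<in> carrier R" using e LR by auto
  \<comment> \<open>The left annihilator of x inside L is a left ideal different from L, hence zero;
    it contains e e - e since e fixes x.\<close>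
  define L0 where "L0 = {y \<in> L. y \<otimes> x = \<zero>}"
  have "left_ideal L0"
    using L(1) xR LR unfolding left_ideal_def L0_def by (auto simp: l_distr m_assoc)
  moreover have "L0 \<noteq> L" using xy by (auto simp: L0_def)
  ultimately have L0': "L0 = {\<zero>}" using min[of L0] by (auto simp: L0_def)
  have "e \<otimes> e \<ominus> e \<in> L0"
  proof -
    have "e \<otimes> e \<ominus> e = (e \<ominus> \<one>) \<otimes> e" using eR by (simp add: a_minus_def l_distr l_minus)
    then have "e \<otimes> e \<ominus> e \<in> L" using Lm[of "e \<ominus> \<one>" e] e eR by simp
    moreover have "(e \<otimes> e \<ominus> e) \<otimes> x = \<zero>"
      using eR xR e by (simp add: a_minus_def l_distr l_minus m_assoc r_neg)
    ultimately show ?thesis by (simp add: L0_def)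
  qed
  then have ee: "e \<otimes> e = e" using L0' eR by auto
  have e0: "e \<noteq> \<zero>" using e xR xy LR by auto
  have "\<exists>a\<in>carrier R. a \<otimes> w = e" if w: "w \<in> carrier R" "w \<otimes> e = w" "w \<noteq> \<zero>" for w
  proof -
    have "left_ideal {y \<otimes> w | y. y \<in> carrier R}"
      using w by (intro left_ideal_principal) (auto simp: left_ideal_def)
    moreover have "{y \<otimes> w | y. y \<in> carrier R} \<subseteq> L"
    proof -
      have "w \<in> L" using Lm[OF w(1) e(1)] w by simp
      then show ?thesis using Lm by auto
    qed
    moreover have "\<one> \<otimes> w \<in> {y \<otimes> w | y. y \<in> carrier R}" by blast
    then have "{y \<otimes> w | y. y \<in> carrier R} \<noteq> {\<zero>}" using w by auto
    ultimately have "{y \<otimes> w | y. y \<in> carrier R} = L" by (intro min)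
    then show ?thesis using e by auto
  qed
  then show ?thesis using eR ee e0 by blast
qed

end

text \<open>\<open>density\<close> with e = 1 and all right multiplications allowed; the
  endomorphisms are then multiplications by central elements, over which the basis is
  independent.\<close>

lemma (in simple_ring_of_rank) dual_bimul:
  assumes "j < N"
  shows "\<exists>us. set us \<subseteq> carrier R \<times> carrier R \<and> (\<forall>i<N. bimul R us (\<epsilon> i) = (if i = j then \<one> else \<zero>))"
proof -
  have "\<exists>T. biop R (carrier R) T \<and> T (\<epsilon> j) = \<one> \<and> (\<forall>i\<in>{..<N} - {j}. T (\<epsilon> i) = \<zero>)"
  proof (rule density[where e = \<one> and C = "ring_center R"])
    show "\<exists>T. biop R (carrier R) T \<and> T w = \<one>" if "w \<in> carrier R" "w \<noteq> \<zero>" for w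
      using biop_one that by blast
    show "ring_center R = {c \<in> carrier R. \<one> \<otimes> c = c \<and> c \<otimes> \<one> = c \<and> (\<forall>z\<in>carrier R. c \<otimes> z = z \<otimes> c)}"
      by (auto simp: ring_center_def)
    show "c i = \<zero>" if c: "\<And>i. c i \<in> ring_center R" "(\<Oplus>i\<in>{..<N}. \<epsilon> i \<otimes> c i) = \<zero>" "i \<in> {..<N}" for c i
    proof -
      have "(\<Oplus>i\<in>{..<N}. \<epsilon> i \<otimes> c i) = (\<Oplus>i\<in>{..<N}. c i \<otimes> \<epsilon> i)"
        using center_comm[OF c(1) \<epsilon>_closed] subsetD[OF center_closed(1) c(1)] \<epsilon>_closed
        by (intro finsum_cong' refl) (auto simp: Pi_def)
      then have "(\<Oplus>i\<in>{..<N}. c i \<otimes> \<epsilon> i) = \<zero>" using c(2) by (rule trans[OF sym])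
      then show ?thesis using \<epsilon>_indep[of c i] c(1,3) by simp
    qed
  qed (use one_not_zero \<epsilon>_closed assms in auto)
  then show ?thesis using \<epsilon>_closed by (fastforce simp: biop_def)
qed

locale split_simple_ring = simple_ring_of_rank +
  fixes e :: 'a and K :: "'a set"
  assumes e: "e \<in> carrier R" "e \<otimes> e = e" "e \<noteq> \<zero>"
    and e_min: "\<And>w. \<lbrakk>w \<in> carrier R; w \<otimes> e = w; w \<noteq> \<zero>\<rbrakk> \<Longrightarrow> \<exists>a\<in>carrier R. a \<otimes> w = e"
    and K_eq: "K = {d \<in> carrier R. e \<otimes> d = d \<and> d \<otimes> e = d \<and> (\<forall>z\<in>K. d \<otimes> z = z \<otimes> d)}"

text \<open>\<open>K\<close> is a maximal commutative subset of the division ring \<open>e R e\<close>, hence its own centraliser there.\<close>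

lemma (in simple_ring_of_rank) ex_split: "\<exists>e K. split_simple_ring R N \<epsilon> e K"
proof -
  from ex_primitive_idempotent obtain e where e: "e \<in> carrier R" "e \<otimes> e = e" "e \<noteq> \<zero>"
    and min: "\<And>w. \<lbrakk>w \<in> carrier R; w \<otimes> e = w; w \<noteq> \<zero>\<rbrakk> \<Longrightarrow> \<exists>a\<in>carrier R. a \<otimes> w = e" by blast
  define D where "D = {d \<in> carrier R. e \<otimes> d = d \<and> d \<otimes> e = d}"
  define A where "A = {S. S \<subseteq> D \<and> (\<forall>x\<in>S. \<forall>y\<in>S. x \<otimes> y = y \<otimes> x)}"
  have "\<exists>M\<in>A. \<forall>U\<in>A. M \<subseteq> U \<longrightarrow> U = M"
  proof (rule subset_Zorn)
    fix C assume C: "subset.chain A C"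
    have "\<Union>C \<in> A"
      unfolding A_def
    proof (intro CollectI conjI ballI)
      show "\<Union>C \<subseteq> D" using C by (auto simp: subset.chain_def A_def)
      fix x y assume "x \<in> \<Union>C" "y \<in> \<Union>C"
      then obtain U V where XY: "x \<in> U" "U \<in> C" "y \<in> V" "V \<in> C" by auto
      then have "U \<subseteq> V \<or> V \<subseteq> U" using C by (auto simp: subset.chain_def)
      moreover have "U \<in> A" "V \<in> A" using XY C by (auto simp: subset.chain_def)
      ultimately show "x \<otimes> y = y \<otimes> x" using XY by (auto simp: A_def)
    qed
    then show "\<exists>H\<in>A. \<forall>U\<in>C. U \<subseteq> H" by (intro bexI[of _ "\<Union>C"]) auto
  qed
  then obtain K where K: "K \<in> A" "\<And>U. U \<in> A \<Longrightarrow> K \<subseteq> U \<Longrightarrow> U = K" by blast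
  have "K = {d \<in> carrier R. e \<otimes> d = d \<and> d \<otimes> e = d \<and> (\<forall>z\<in>K. d \<otimes> z = z \<otimes> d)}" (is "K = ?C")
  proof
    show "K \<subseteq> ?C" using K(1) by (auto simp: A_def D_def)
    show "?C \<subseteq> K"
    proof
      fix d assume d: "d \<in> ?C"
      have "insert d K \<in> A" using K(1) d by (auto simp: A_def D_def)
      then show "d \<in> K" using K(2)[of "insert d K"] by auto
    qed
  qed
  then have "split_simple_ring R N \<epsilon> e K"
    using e min by unfold_locales auto
  then show ?thesis by blast
qed

section \<open>The field \<open>K\<close> and the right \<open>K\<close>-space
  \<open>W\<close>\<close>

context split_simple_ring
begin

lemma K_memI: "d \<in> carrier R \<Longrightarrow> e \<otimes> d = d \<Longrightarrow> d \<otimes> e = d \<Longrightarrow> (\<And>z. z \<in> K \<Longrightarrow> d \<otimes> z = z \<otimes> d) \<Longrightarrow> d \<in> K"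
  by (subst K_eq) auto

lemma K_memD:
  assumes "d \<in> K"
  shows "d \<in> carrier R" "e \<otimes> d = d" "d \<otimes> e = d" "\<And>z. z \<in> K \<Longrightarrow> d \<otimes> z = z \<otimes> d"
  using assms by (subst (asm) K_eq; blast)+

lemma K_subset: "K \<subseteq> carrier R" using K_memD(1) by auto

lemma K_e: "e \<in> K" using e by (intro K_memI) (auto simp: K_memD)

lemma K_zero: "\<zero> \<in> K" using e by (intro K_memI) (auto simp: K_memD)

lemma K_add: "x \<in> K \<Longrightarrow> y \<in> K \<Longrightarrow> x \<oplus> y \<in> K"
  using e by (intro K_memI) (auto simp: K_memD l_distr r_distr)

lemma K_uminus: "x \<in> K \<Longrightarrow> \<ominus> x \<in> K"
  using e by (intro K_memI) (auto simp: K_memD l_minus r_minus)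

lemma K_mult:
  assumes x: "x \<in> K" and y: "y \<in> K" shows "x \<otimes> y \<in> K"
proof (rule K_memI)
  note X = K_memD[OF x] and Y = K_memD[OF y]
  show "x \<otimes> y \<in> carrier R" "x \<otimes> y \<otimes> e = x \<otimes> y" using X Y e by (auto simp: m_assoc)
  show "e \<otimes> (x \<otimes> y) = x \<otimes> y" using X Y e by (simp flip: m_assoc)
  fix z assume z: "z \<in> K"
  have "x \<otimes> y \<otimes> z = x \<otimes> z \<otimes> y" using X Y(1) Y(4)[OF z] K_memD(1)[OF z] by (simp add: m_assoc)
  also have "\<dots> = z \<otimes> x \<otimes> y" using X(4)[OF z] by simp
  finally show "x \<otimes> y \<otimes> z = z \<otimes> (x \<otimes> y)" using X Y K_memD(1)[OF z] by (simp add: m_assoc)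
qed

lemma K_finsum: "(\<And>i. i \<in> A \<Longrightarrow> f i \<in> K) \<Longrightarrow> (\<Oplus>i\<in>A. f i) \<in> K"
  by (induct A rule: infinite_finite_induct) (auto simp: K_zero K_add K_memD(1) Pi_def)

text \<open>The product c e of a central element c with e commutes with all of e R e, so it lies in
  \<open>K\<close>; the centre acts on \<open>K\<close> through it.\<close>

lemma K_center:
  assumes c: "c \<in> ring_center R" and z: "z \<in> K" shows "c \<otimes> z \<in> K"
proof -
  have "c \<otimes> e \<in> K"
  proof (rule K_memI)
    have cR: "c \<in> carrier R" using c center_closed by auto
    show "c \<otimes> e \<in> carrier R" "c \<otimes> e \<otimes> e = c \<otimes> e" using cR e by (auto simp: m_assoc)
    show "e \<otimes> (c \<otimes> e) = c \<otimes> e" using cR e center_comm[OF c e(1)] by (simp flip: m_assoc)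
    fix z assume z: "z \<in> K"
    note Z = K_memD[OF z]
    have "c \<otimes> e \<otimes> z = z \<otimes> c" using cR e Z center_comm[OF c Z(1)] by (simp add: m_assoc)
    also have "\<dots> = z \<otimes> (c \<otimes> e)"
      using cR e Z center_comm[OF c e(1)] by (simp flip: m_assoc)
    finally show "c \<otimes> e \<otimes> z = z \<otimes> (c \<otimes> e)" .
  qed
  from K_mult[OF this z] show ?thesis
    using c center_closed e K_memD[OF z] by (auto simp: m_assoc dest: subsetD)
qed

text \<open>Cutting down the a with a d = e to e a e keeps the equation. This makes e R e a division
  ring.\<close>

lemma corner_left_inverse:
  assumes d: "d \<in> carrier R" "e \<otimes> d = d" "d \<otimes> e = d" "d \<noteq> \<zero>"
  shows "\<exists>a\<in>carrier R. e \<otimes> a = a \<and> a \<otimes> e = a \<and> a \<otimes> d = e \<and> a \<noteq> \<zero>"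
proof -
  from e_min[of d] d obtain a where a: "a \<in> carrier R" "a \<otimes> d = e" by auto
  define b where "b = e \<otimes> a \<otimes> e"
  have bR: "b \<in> carrier R" using a e by (simp add: b_def)
  have "b \<otimes> d = e" using a d e by (simp add: b_def m_assoc)
  moreover have "b \<otimes> e = b" using a e by (simp add: b_def m_assoc)
  moreover have "e \<otimes> b = b" using a e by (simp add: b_def flip: m_assoc)
  moreover have "b \<noteq> \<zero>" using \<open>b \<otimes> d = e\<close> e d by auto
  ultimately show ?thesis using bR by blast
qed

lemma K_inverse:
  assumes k: "k \<in> K" "k \<noteq> \<zero>"
  shows "\<exists>k'\<in>K. k \<otimes> k' = e"
proof -
  note kD = K_memD[OF k(1)]
  from corner_left_inverse[OF kD(1-3) k(2)] obtain d where
    d: "d \<in> carrier R" "e \<otimes> d = d" "d \<otimes> e = d" "d \<otimes> k = e" "d \<noteq> \<zero>" by blast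
  from corner_left_inverse[OF d(1-3,5)] obtain d' where
    d': "d' \<in> carrier R" "e \<otimes> d' = d'" "d' \<otimes> e = d'" "d' \<otimes> d = e" by blast
  \<comment> \<open>The left inverse d has itself a left inverse, which must be k; so d is a
    two-sided inverse.\<close>
  have "k = d'" using m_assoc[of d' d k] d d' kD(1-3) by simp
  then have kd: "k \<otimes> d = e" using d' by simp
  have "d \<in> K"
  proof (rule K_memI[OF d(1-3)])
    fix z assume z: "z \<in> K"
    note Z = K_memD[OF z]
    have "d \<otimes> z = d \<otimes> z \<otimes> (k \<otimes> d)" using kd d e(1) Z(1-3) by (simp add: m_assoc)
    also have "\<dots> = d \<otimes> (z \<otimes> k) \<otimes> d" using d Z(1) kD(1) by (simp add: m_assoc)
    also have "\<dots> = d \<otimes> k \<otimes> z \<otimes> d" using m_assoc[of d k z] d(1) Z(1) kD(1) Z(4)[OF k(1)] by simp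
    also have "\<dots> = z \<otimes> d" using d Z(1-3) by simp
    finally show "d \<otimes> z = z \<otimes> d" .
  qed
  with kd show ?thesis by blast
qed

lemma K_integral:
  assumes x: "x \<in> K" and y: "y \<in> carrier R" "e \<otimes> y = y" and xy: "x \<otimes> y = \<zero>" shows "x = \<zero> \<or> y = \<zero>"
proof (cases "x = \<zero>")
  case False
  then obtain z where z: "z \<in> K" "x \<otimes> z = e" using K_inverse x by auto
  have "y = z \<otimes> x \<otimes> y" using z K_memD(4)[OF x z(1)] y by simp
  also have "\<dots> = z \<otimes> (x \<otimes> y)" using x y z K_memD(1) by (simp add: m_assoc)
  finally show ?thesis using xy K_memD(1)[OF z(1)] by simp
qed simp

definition W :: "'a set" where "W = {w \<in> carrier R. w \<otimes> e = w}"

lemma W_closed: "w \<in> W \<Longrightarrow> w \<in> carrier R" "w \<in> W \<Longrightarrow> a \<in> carrier R \<Longrightarrow> a \<otimes> w \<in> W"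
    "w \<in> W \<Longrightarrow> w' \<in> W \<Longrightarrow> w \<oplus> w' \<in> W" "w \<in> carrier R \<Longrightarrow> z \<in> K \<Longrightarrow> w \<otimes> z \<in> W" "\<zero> \<in> W" "e \<in> W"
    "w \<in> W \<Longrightarrow> w \<otimes> e = w"
  using e by (auto simp: W_def m_assoc l_distr K_memD)

lemma W_finsum: "(\<And>i. i \<in> A \<Longrightarrow> f i \<in> W) \<Longrightarrow> (\<Oplus>i\<in>A. f i) \<in> W"
  by (induct A rule: infinite_finite_induct) (auto simp: W_closed Pi_def)

definition k_indep :: "nat \<Rightarrow> (nat \<Rightarrow> 'a) \<Rightarrow> bool" where
  "k_indep l w \<longleftrightarrow> (\<forall>c. (\<forall>i. c i \<in> K) \<longrightarrow> (\<Oplus>i\<in>{..<l}. w i \<otimes> c i) = \<zero> \<longrightarrow> (\<forall>i<l. c i = \<zero>))"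

text \<open>\<open>density\<close> with Z = K: the endomorphism ring is the centraliser of
  \<open>K\<close> in e R e, that is \<open>K\<close> itself, so the operators realise any values
  prescribed on independent vectors of W.\<close>

lemma interpolation:
  assumes w: "\<And>i. w i \<in> W" and indep: "k_indep l w" and y: "\<And>i. y i \<in> W"
  shows "\<exists>T. biop R K T \<and> (\<forall>j<l. T (w j) = y j)"
proof -
  have "\<exists>T. biop R K T \<and> T (w j) = e \<and> (\<forall>i\<in>{..<l} - {j}. T (w i) = \<zero>)" if j: "j < l" for j
  proof (rule density[where e = e and C = K])
    show "\<exists>T. biop R K T \<and> T w = e" if ww: "w \<in> carrier R" "w \<otimes> e = w" "w \<noteq> \<zero>" for w
    proof -
      from e_min[OF ww] obtain a where a: "a \<in> carrier R" "a \<otimes> w = e" by auto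
      then show ?thesis using e K_e K_subset
        by (intro exI[of _ "\<lambda>w. a \<otimes> w \<otimes> e"] conjI biop_single) auto
    qed
    show "c i = \<zero>" if "\<And>i. c i \<in> K" "(\<Oplus>i\<in>{..<l}. w i \<otimes> c i) = \<zero>" "i \<in> {..<l}" for c i
      using indep that by (auto simp: k_indep_def)
  qed (use e K_e K_subset K_mult K_memD w W_closed j K_eq in auto)
  then obtain t where t: "\<And>j. j < l \<Longrightarrow> biop R K (t j)" "\<And>j. j < l \<Longrightarrow> t j (w j) = e"
      "\<And>j i. j < l \<Longrightarrow> i < l \<Longrightarrow> i \<noteq> j \<Longrightarrow> t j (w i) = \<zero>"
    by (metis DiffI lessThan_iff singletonD)
  have yR: "y i \<in> carrier R" "y i \<otimes> e = y i" for i using y W_closed by auto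
  define T where "T u = (\<Oplus>j\<in>{..<l}. y j \<otimes> t j u \<otimes> e)" for u
  have "biop R K T" unfolding T_def
    using t(1) yR K_subset e K_mult K_e by (intro biop_finsum biop_bimul_comp) auto
  moreover have "T (w i) = y i" if i: "i < l" for i
  proof -
    have "T (w i) = (\<Oplus>j\<in>{..<l}. if i = j then y j else \<zero>)"
      unfolding T_def using t i yR e by (intro finsum_cong' refl) (auto simp: m_assoc)
    also have "\<dots> = y i" using i yR by (intro add.finprod_singleton) auto
    finally show ?thesis .
  qed
  ultimately show ?thesis by blast
qed

text \<open>Each left factor is a combination of the basis over the centre, and the central
  coefficients can be moved into the right factor. The operators therefore form a
  \<open>K\<close>-space spanned by N elements, which is the upper bound in the dimension
  count.\<close>

lemma biop_coordinates:
  assumes "biop R K T"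
  shows "\<exists>\<kappa>. (\<forall>p. \<kappa> p \<in> K) \<and> (\<forall>u\<in>carrier R. T u = (\<Oplus>p\<in>{..<N}. \<epsilon> p \<otimes> u \<otimes> \<kappa> p))"
proof -
  have CR: "c \<in> carrier R" if "c \<in> ring_center R" for c using that center_closed by auto
  have "set us \<subseteq> carrier R \<times> K \<Longrightarrow>
    \<exists>\<kappa>. (\<forall>p. \<kappa> p \<in> K) \<and> (\<forall>u\<in>carrier R. bimul R us u = (\<Oplus>p\<in>{..<N}. \<epsilon> p \<otimes> u \<otimes> \<kappa> p))" for us
  proof (induct us)
    case Nil
    show ?case
      using \<epsilon>_closed by (intro exI[of _ "\<lambda>_. \<zero>"]) (auto simp: K_zero)
  next
    case (Cons v us)
    obtain a b where v: "v = (a, b)" by (cases v)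
    then have ab: "a \<in> carrier R" "b \<in> K" "b \<in> carrier R" using Cons.prems K_subset by auto
    from Cons obtain \<kappa> where \<kappa>: "\<And>p. \<kappa> p \<in> K" "\<And>u. u \<in> carrier R \<Longrightarrow> bimul R us u = (\<Oplus>p\<in>{..<N}. \<epsilon> p \<otimes> u \<otimes> \<kappa> p)"
      by auto
    from \<epsilon>_span[OF ab(1)] obtain c where c: "\<And>p. c p \<in> ring_center R" "a = (\<Oplus>p\<in>{..<N}. c p \<otimes> \<epsilon> p)" by auto
    note cR = CR[OF c(1)] and \<kappa>R = K_memD(1)[OF \<kappa>(1)]
    have "bimul R (v # us) u = (\<Oplus>p\<in>{..<N}. \<epsilon> p \<otimes> u \<otimes> (c p \<otimes> b \<oplus> \<kappa> p))" if u: "u \<in> carrier R" for u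
    proof -
      have "a \<otimes> u \<otimes> b = (\<Oplus>p\<in>{..<N}. c p \<otimes> \<epsilon> p \<otimes> u \<otimes> b)"
        unfolding c(2) using cR \<epsilon>_closed u ab by (simp add: finsum_ldistr Pi_def)
      also have "\<dots> = (\<Oplus>p\<in>{..<N}. \<epsilon> p \<otimes> u \<otimes> (c p \<otimes> b))"
      proof (intro finsum_cong' refl)
        fix p
        have "c p \<otimes> \<epsilon> p \<otimes> u \<otimes> b = c p \<otimes> (\<epsilon> p \<otimes> u) \<otimes> b"
          using cR \<epsilon>_closed u ab by (simp add: m_assoc)
        also have "\<dots> = \<epsilon> p \<otimes> u \<otimes> (c p \<otimes> b)"
          using cR \<epsilon>_closed u ab center_comm[OF c(1), of "\<epsilon> p \<otimes> u"] by (simp add: m_assoc)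
        finally show "c p \<otimes> \<epsilon> p \<otimes> u \<otimes> b = \<epsilon> p \<otimes> u \<otimes> (c p \<otimes> b)" .
      qed (use cR \<epsilon>_closed u ab in auto)
      finally have "bimul R (v # us) u = (\<Oplus>p\<in>{..<N}. \<epsilon> p \<otimes> u \<otimes> (c p \<otimes> b)) \<oplus> (\<Oplus>p\<in>{..<N}. \<epsilon> p \<otimes> u \<otimes> \<kappa> p)"
        using \<kappa>(2)[OF u] by (simp add: v)
      also have "\<dots> = (\<Oplus>p\<in>{..<N}. \<epsilon> p \<otimes> u \<otimes> (c p \<otimes> b \<oplus> \<kappa> p))"
      proof -
        have "(\<Oplus>p\<in>{..<N}. \<epsilon> p \<otimes> u \<otimes> (c p \<otimes> b \<oplus> \<kappa> p)) =
            (\<Oplus>p\<in>{..<N}. \<epsilon> p \<otimes> u \<otimes> (c p \<otimes> b) \<oplus> \<epsilon> p \<otimes> u \<otimes> \<kappa> p)"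
          using cR \<epsilon>_closed u ab \<kappa>R by (intro finsum_cong' refl) (auto simp: r_distr)
        also have "\<dots> = (\<Oplus>p\<in>{..<N}. \<epsilon> p \<otimes> u \<otimes> (c p \<otimes> b)) \<oplus> (\<Oplus>p\<in>{..<N}. \<epsilon> p \<otimes> u \<otimes> \<kappa> p)"
          using cR \<epsilon>_closed u ab \<kappa>R by (intro finsum_addf) auto
        finally show ?thesis ..
      qed
      finally show ?thesis .
    qed
    moreover have "c p \<otimes> b \<oplus> \<kappa> p \<in> K" for p
      using K_center[OF c(1) ab(2)] \<kappa>(1) by (intro K_add)
    ultimately show ?case by (intro exI[of _ "\<lambda>p. c p \<otimes> b \<oplus> \<kappa> p"]) auto
  qed
  note coords = this
  from assms obtain us where us: "set us \<subseteq> carrier R \<times> K" "\<forall>w\<in>carrier R. T w = bimul R us w"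
    by (auto simp: biop_def)
  from coords[OF us(1)] us(2) show ?thesis by auto
qed

text \<open>Putting w = b e, multiplying by a from the left and summing over the terms of a dual
  operator from \<open>dual_bimul\<close> isolates e \<open>\<kappa> j\<close>, which equals
  \<open>\<kappa> j\<close>.\<close>

lemma coordinates_zero:
  assumes \<kappa>: "\<And>p. \<kappa> p \<in> K" and zero: "\<And>w. w \<in> W \<Longrightarrow> (\<Oplus>p\<in>{..<N}. \<epsilon> p \<otimes> w \<otimes> \<kappa> p) = \<zero>" and j: "j < N"
  shows "\<kappa> j = \<zero>"
proof -
  note \<kappa>R = K_memD(1)[OF \<kappa>]
  obtain us where us: "set us \<subseteq> carrier R \<times> carrier R"
    "\<And>i. i < N \<Longrightarrow> bimul R us (\<epsilon> i) = (if i = j then \<one> else \<zero>)"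
    using dual_bimul[OF j] by blast
  have eR: "e \<in> carrier R" by (rule e)
  have "set us \<subseteq> carrier R \<times> carrier R \<Longrightarrow> (\<Oplus>p\<in>{..<N}. bimul R us (\<epsilon> p) \<otimes> e \<otimes> \<kappa> p) = \<zero>" for us
  proof (induct us)
    case Nil
    show ?case using eR \<kappa>R by (intro add.finprod_one_eqI) simp
  next
    case (Cons v us)
    obtain a b where v: "v = (a, b)" by (cases v)
    then have ab: "a \<in> carrier R" "b \<in> carrier R" "set us \<subseteq> carrier R \<times> carrier R" using Cons.prems by auto
    have bR: "bimul R us (\<epsilon> p) \<in> carrier R" for p using ab \<epsilon>_closed by simp
    have "(\<Oplus>p\<in>{..<N}. bimul R (v # us) (\<epsilon> p) \<otimes> e \<otimes> \<kappa> p) =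
        (\<Oplus>p\<in>{..<N}. a \<otimes> (\<epsilon> p \<otimes> (b \<otimes> e) \<otimes> \<kappa> p) \<oplus> bimul R us (\<epsilon> p) \<otimes> e \<otimes> \<kappa> p)"
      using ab \<epsilon>_closed eR \<kappa>R bR by (intro finsum_cong' refl) (auto simp: v l_distr m_assoc)
    also have "\<dots> = (\<Oplus>p\<in>{..<N}. a \<otimes> (\<epsilon> p \<otimes> (b \<otimes> e) \<otimes> \<kappa> p)) \<oplus> (\<Oplus>p\<in>{..<N}. bimul R us (\<epsilon> p) \<otimes> e \<otimes> \<kappa> p)"
      using ab \<epsilon>_closed eR \<kappa>R bR by (intro finsum_addf) auto
    also have "(\<Oplus>p\<in>{..<N}. a \<otimes> (\<epsilon> p \<otimes> (b \<otimes> e) \<otimes> \<kappa> p)) = a \<otimes> (\<Oplus>p\<in>{..<N}. \<epsilon> p \<otimes> (b \<otimes> e) \<otimes> \<kappa> p)"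
      using ab \<epsilon>_closed eR \<kappa>R by (intro finsum_rdistr[symmetric]) auto
    also have "\<dots> = \<zero>" using zero[of "b \<otimes> e"] ab W_closed(2,6) by simp
    finally show ?case using Cons ab by simp
  qed
  from this[OF us(1)] have "\<zero> = (\<Oplus>p\<in>{..<N}. bimul R us (\<epsilon> p) \<otimes> e \<otimes> \<kappa> p)" by simp
  also have "\<dots> = (\<Oplus>p\<in>{..<N}. if j = p then e \<otimes> \<kappa> p else \<zero>)"
    using us(2) eR \<kappa>R by (intro finsum_cong' refl) auto
  also have "\<dots> = e \<otimes> \<kappa> j" using j eR \<kappa>R by (intro add.finprod_singleton) auto
  finally show ?thesis using K_memD(2)[OF \<kappa>] by simp
qed

text \<open>On l independent vectors the l * l matrix units are realised by operators, each
  described by N coordinates. If l * l exceeded N, the matrix units would be linearly dependent over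
  \<open>K\<close>.\<close>

lemma k_indep_bound:
  assumes w: "\<And>i. w i \<in> W" and indep: "k_indep l w"
  shows "l * l \<le> N"
proof (rule ccontr)
  assume less: "\<not> l * l \<le> N"
  have wR: "w i \<in> carrier R" for i using w W_closed by auto
  have T: "\<exists>T. biop R K T \<and> (\<forall>k<l. T (w k) = (if k = j then w i else \<zero>))" for i j
    using interpolation[OF w indep, of "\<lambda>k. if k = j then w i else \<zero>"] w W_closed(5) by presburger
  have "\<exists>\<kappa>. (\<forall>p. \<kappa> p \<in> K) \<and>
      (\<forall>k<l. (\<Oplus>p\<in>{..<N}. \<epsilon> p \<otimes> w k \<otimes> \<kappa> p) = (if k = j then w i else \<zero>))" for i j
  proof -
    from T obtain T where T: "biop R K T" "\<And>k. k < l \<Longrightarrow> T (w k) = (if k = j then w i else \<zero>)" by blast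
    from biop_coordinates[OF T(1)] obtain \<kappa> where
      \<kappa>: "\<forall>p. \<kappa> p \<in> K" "\<forall>u\<in>carrier R. T u = (\<Oplus>p\<in>{..<N}. \<epsilon> p \<otimes> u \<otimes> \<kappa> p)" by blast
    have "(\<Oplus>p\<in>{..<N}. \<epsilon> p \<otimes> w k \<otimes> \<kappa> p) = (if k = j then w i else \<zero>)" if "k < l" for k
      using bspec[OF \<kappa>(2) wR[of k]] T(2)[OF that] by (rule trans[OF sym])
    with \<kappa>(1) show ?thesis by blast
  qed
  then have "\<forall>i j. \<exists>\<kappa>. (\<forall>p. \<kappa> p \<in> K) \<and>
      (\<forall>k<l. (\<Oplus>p\<in>{..<N}. \<epsilon> p \<otimes> w k \<otimes> \<kappa> p) = (if k = j then w i else \<zero>))" by blast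
  from this[unfolded choice_iff] obtain \<kappa> where "\<forall>i j. (\<forall>p. \<kappa> i j p \<in> K) \<and>
      (\<forall>k<l. (\<Oplus>p\<in>{..<N}. \<epsilon> p \<otimes> w k \<otimes> \<kappa> i j p) = (if k = j then w i else \<zero>))" by blast
  then have \<kappa>: "\<And>i j p. \<kappa> i j p \<in> K"
     "\<And>i j k. k < l \<Longrightarrow> (\<Oplus>p\<in>{..<N}. \<epsilon> p \<otimes> w k \<otimes> \<kappa> i j p) = (if k = j then w i else \<zero>)" by blast+
  define J where "J = {..<l} \<times> {..<l}"
  have "\<exists>c. (\<forall>j. c j \<in> K) \<and> (\<exists>j\<in>J. c j \<noteq> \<zero>) \<and>
      (\<forall>p\<in>{..<N}. (\<Oplus>j\<in>J. (case j of (i, j) \<Rightarrow> \<kappa> i j p) \<otimes> c j) = \<zero>)"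
    using less e \<kappa> K_integral
    by (intro homogeneous_system[where u = e] K_subset K_e K_zero K_add K_uminus K_mult)
      (auto simp: J_def K_memD split: prod.splits)
  then obtain c where cK: "\<And>j. c j \<in> K" and c: "\<exists>j\<in>J. c j \<noteq> \<zero>"
     "\<And>p. p < N \<Longrightarrow> (\<Oplus>j\<in>J. \<kappa> (fst j) (snd j) p \<otimes> c j) = \<zero>" by (auto simp: split_def)
  note cR = K_memD(1)[OF cK] and \<kappa>R = K_memD(1)[OF \<kappa>(1)]
  have J: "finite J" by (simp add: J_def)
  \<comment> \<open>The relation between the operators is evaluated at \<open>w k\<close>: only the
    matrix units of column k contribute.\<close>
  have zero: "(\<Oplus>i\<in>{..<l}. w i \<otimes> c (i, k)) = \<zero>" if k: "k < l" for k
  proof -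
    have "(\<Oplus>i\<in>{..<l}. w i \<otimes> c (i, k)) = (\<Oplus>j\<in>(\<lambda>i. (i, k)) ` {..<l}. w (fst j) \<otimes> c j)"
      using wR cR by (subst finsum_reindex) (auto simp: inj_on_def)
    also have "\<dots> = (\<Oplus>j\<in>J. (if k = snd j then w (fst j) else \<zero>) \<otimes> c j)"
      using wR cR J k by (intro add.finprod_mono_neutral_cong_left) (auto simp: J_def)
    also have "\<dots> = (\<Oplus>j\<in>J. \<Oplus>p\<in>{..<N}. \<epsilon> p \<otimes> w k \<otimes> (\<kappa> (fst j) (snd j) p \<otimes> c j))"
    proof (intro finsum_cong' refl)
      fix j assume "j \<in> J"
      have "(if k = snd j then w (fst j) else \<zero>) \<otimes> c j
          = (\<Oplus>p\<in>{..<N}. \<epsilon> p \<otimes> w k \<otimes> \<kappa> (fst j) (snd j) p) \<otimes> c j"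
        using \<kappa>(2)[OF k, of "fst j" "snd j"] by simp
      also have "\<dots> = (\<Oplus>p\<in>{..<N}. \<epsilon> p \<otimes> w k \<otimes> \<kappa> (fst j) (snd j) p \<otimes> c j)"
        using \<epsilon>_closed wR \<kappa>R cR by (intro finsum_ldistr) auto
      also have "\<dots> = (\<Oplus>p\<in>{..<N}. \<epsilon> p \<otimes> w k \<otimes> (\<kappa> (fst j) (snd j) p \<otimes> c j))"
        using \<epsilon>_closed wR \<kappa>R cR by (intro finsum_cong' refl) (auto simp: m_assoc)
      finally show "(if k = snd j then w (fst j) else \<zero>) \<otimes> c j
          = (\<Oplus>p\<in>{..<N}. \<epsilon> p \<otimes> w k \<otimes> (\<kappa> (fst j) (snd j) p \<otimes> c j))" .
    qed (use \<epsilon>_closed wR \<kappa>R cR in auto)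
    also have "\<dots> = (\<Oplus>p\<in>{..<N}. \<Oplus>j\<in>J. \<epsilon> p \<otimes> w k \<otimes> (\<kappa> (fst j) (snd j) p \<otimes> c j))"
      using \<epsilon>_closed wR \<kappa>R cR J by (intro finsum_swap) auto
    also have "\<dots> = \<zero>"
    proof (rule add.finprod_one_eqI)
      fix p assume p: "p \<in> {..<N}"
      have "(\<Oplus>j\<in>J. \<epsilon> p \<otimes> w k \<otimes> (\<kappa> (fst j) (snd j) p \<otimes> c j)) =
         \<epsilon> p \<otimes> w k \<otimes> (\<Oplus>j\<in>J. \<kappa> (fst j) (snd j) p \<otimes> c j)"
        using \<epsilon>_closed wR \<kappa>R cR J by (intro finsum_rdistr[symmetric]) auto
      then show "(\<Oplus>j\<in>J. \<epsilon> p \<otimes> w k \<otimes> (\<kappa> (fst j) (snd j) p \<otimes> c j)) = \<zero>"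
        using c(2)[of p] p \<epsilon>_closed wR by simp
    qed
    finally show ?thesis .
  qed
  have "c (i, k) = \<zero>" if "i < l" "k < l" for i k
  proof -
    have "(\<forall>i. c (i, k) \<in> K) \<longrightarrow> (\<Oplus>i\<in>{..<l}. w i \<otimes> c (i, k)) = \<zero> \<longrightarrow> (\<forall>i<l. c (i, k) = \<zero>)"
      using indep unfolding k_indep_def by (rule spec)
    then show ?thesis using cK zero that by auto
  qed
  with c(1) show False by (auto simp: J_def)
qed

text \<open>An independent family of maximal size exists because l is at most l * l and so at most
  N. A further vector satisfies a relation whose leading coefficient can be divided out in
  \<open>K\<close>.\<close>

lemma ex_basis:
  "\<exists>l w. l * l \<le> N \<and> (\<forall>i. w i \<in> W) \<and> k_indep l w \<and>
     (\<forall>u\<in>W. \<exists>c. (\<forall>i. c i \<in> K) \<and> u = (\<Oplus>i\<in>{..<l}. w i \<otimes> c i))"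
proof -
  define A where "A = {l. \<exists>w. (\<forall>i. w i \<in> W) \<and> k_indep l w}"
  have "A \<subseteq> {..N}"
    using k_indep_bound by (auto simp: A_def) (metis le_square order_trans)
  then have fin: "finite A" by (rule finite_subset) auto
  have "0 \<in> A" using W_closed by (auto simp: A_def k_indep_def)
  then have "Max A \<in> A" using fin by (intro Max_in) auto
  define l where "l = Max A"
  obtain w where w: "\<And>i. w i \<in> W" "k_indep l w" using \<open>Max A \<in> A\<close> by (auto simp: A_def l_def)
  have wR: "w i \<in> carrier R" for i using w W_closed by auto
  have "\<exists>c. (\<forall>i. c i \<in> K) \<and> u = (\<Oplus>i\<in>{..<l}. w i \<otimes> c i)" if u: "u \<in> W" for u
  proof -
    have uR: "u \<in> carrier R" "u \<otimes> e = u" using u W_closed by auto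
    define w' where "w' i = (if i = l then u else w i)" for i
    have w'W: "w' i \<in> W" for i using w u by (simp add: w'_def)
    have "\<not> k_indep (Suc l) w'"
    proof
      assume "k_indep (Suc l) w'"
      then have "Suc l \<in> A" using w'W by (auto simp: A_def)
      then have "Suc l \<le> Max A" using fin by (intro Max_ge)
      then show False by (simp add: l_def)
    qed
    then obtain c i where cK: "\<And>i. c i \<in> K" and c: "(\<Oplus>i\<in>{..<Suc l}. w' i \<otimes> c i) = \<zero>" "i < Suc l" "c i \<noteq> \<zero>"
      by (auto simp: k_indep_def)
    note cR = K_memD(1)[OF cK]
    have sum: "u \<otimes> c l \<oplus> (\<Oplus>i\<in>{..<l}. w i \<otimes> c i) = \<zero>"
    proof -
      have "(\<Oplus>i\<in>{..<Suc l}. w' i \<otimes> c i) = w' l \<otimes> c l \<oplus> (\<Oplus>i\<in>{..<l}. w' i \<otimes> c i)"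
        unfolding lessThan_Suc using cR w'W W_closed by (intro finsum_insert) auto
      also have "(\<Oplus>i\<in>{..<l}. w' i \<otimes> c i) = (\<Oplus>i\<in>{..<l}. w i \<otimes> c i)"
        using cR wR by (intro finsum_cong' refl) (auto simp: w'_def)
      finally show ?thesis using c by (simp add: w'_def)
    qed
    have "c l \<noteq> \<zero>"
    proof
      assume cl: "c l = \<zero>"
      then have "(\<Oplus>i\<in>{..<l}. w i \<otimes> c i) = \<zero>" using sum uR wR cR by simp
      then have "\<forall>i<l. c i = \<zero>" using w(2) cK by (auto simp: k_indep_def)
      then show False using c cl by (auto simp: less_Suc_eq)
    qed
    then obtain d where d: "d \<in> K" "c l \<otimes> d = e" using K_inverse cK by blast
    have dR: "d \<in> carrier R" using d K_memD by auto
    have "u \<otimes> c l = \<ominus> (\<Oplus>i\<in>{..<l}. w i \<otimes> c i)"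
      using sum uR wR cR by (intro minus_equality[symmetric]) auto
    also have "\<dots> = (\<Oplus>i\<in>{..<l}. \<ominus> (w i \<otimes> c i))"
      using wR cR by (intro finsum_uminus[symmetric]) auto
    finally have "u \<otimes> c l \<otimes> d = (\<Oplus>i\<in>{..<l}. \<ominus> (w i \<otimes> c i) \<otimes> d)"
      using wR cR dR by (simp add: finsum_ldistr Pi_def)
    moreover have "u \<otimes> c l \<otimes> d = u" using uR cR dR d by (simp add: m_assoc)
    moreover have "(\<Oplus>i\<in>{..<l}. \<ominus> (w i \<otimes> c i) \<otimes> d) = (\<Oplus>i\<in>{..<l}. w i \<otimes> (\<ominus> c i \<otimes> d))"
      using wR cR dR by (intro finsum_cong' refl) (auto simp: l_minus r_minus m_assoc)
    ultimately have "u = (\<Oplus>i\<in>{..<l}. w i \<otimes> (\<ominus> c i \<otimes> d))" by simp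
    moreover have "\<ominus> c i \<otimes> d \<in> K" for i using cK d by (intro K_mult K_uminus)
    ultimately show ?thesis by (intro exI[of _ "\<lambda>i. \<ominus> c i \<otimes> d"]) auto
  qed
  moreover have "l * l \<le> N" using k_indep_bound w by blast
  ultimately show ?thesis using w by blast
qed

end

section \<open>Group algebras\<close>

definition mono :: "('a, 'm) ring_scheme \<Rightarrow> 'a \<Rightarrow> 'g \<Rightarrow> 'g \<Rightarrow> 'a" where
  "mono R a g = (\<lambda>x. if x = g then a else \<zero>\<^bsub>R\<^esub>)"

text \<open>Finitely supported functions with convolution. Inverses in the group turn the
  convolution into a single sum over the support of the left factor.\<close>

definition group_ring :: "('a, 'm) ring_scheme \<Rightarrow> ('g, 'n) monoid_scheme \<Rightarrow> ('g \<Rightarrow> 'a) ring" where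
  "group_ring R G =
    \<lparr>carrier = {\<phi>. (\<forall>g. \<phi> g \<in> carrier R) \<and> {g. \<phi> g \<noteq> \<zero>\<^bsub>R\<^esub>} \<subseteq> carrier G \<and> finite {g. \<phi> g \<noteq> \<zero>\<^bsub>R\<^esub>}},
     monoid.mult = (\<lambda>\<phi> \<psi> x. if x \<in> carrier G
       then \<Oplus>\<^bsub>R\<^esub>g\<in>{g. \<phi> g \<noteq> \<zero>\<^bsub>R\<^esub>}. \<phi> g \<otimes>\<^bsub>R\<^esub> \<psi> (inv\<^bsub>G\<^esub> g \<otimes>\<^bsub>G\<^esub> x) else \<zero>\<^bsub>R\<^esub>),
     one = mono R \<one>\<^bsub>R\<^esub> \<one>\<^bsub>G\<^esub>, zero = (\<lambda>x. \<zero>\<^bsub>R\<^esub>), add = (\<lambda>\<phi> \<psi> x. \<phi> x \<oplus>\<^bsub>R\<^esub> \<psi> x)\<rparr>"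

locale group_algebra = ring R + G: comm_group G
  for R (structure) and G :: "('g, 'n) monoid_scheme"
begin

abbreviation "B \<equiv> group_ring R G"

lemma B_simps:
  "\<zero>\<^bsub>B\<^esub> = (\<lambda>x. \<zero>)" "\<one>\<^bsub>B\<^esub> = mono R \<one> \<one>\<^bsub>G\<^esub>" "\<phi> \<oplus>\<^bsub>B\<^esub> \<psi> = (\<lambda>x. \<phi> x \<oplus> \<psi> x)"
  "\<phi> \<otimes>\<^bsub>B\<^esub> \<psi> = (\<lambda>x. if x \<in> carrier G
     then \<Oplus>g\<in>{g. \<phi> g \<noteq> \<zero>}. \<phi> g \<otimes> \<psi> (inv\<^bsub>G\<^esub> g \<otimes>\<^bsub>G\<^esub> x) else \<zero>)"
  by (simp_all add: group_ring_def)

lemma B_carrier: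
  "\<phi> \<in> carrier B \<longleftrightarrow> (\<forall>g. \<phi> g \<in> carrier R) \<and> {g. \<phi> g \<noteq> \<zero>} \<subseteq> carrier G \<and> finite {g. \<phi> g \<noteq> \<zero>}"
  by (simp add: group_ring_def)

lemma B_closed: "\<phi> \<in> carrier B \<Longrightarrow> \<phi> g \<in> carrier R"
  by (simp add: B_carrier)

lemma B_outside: "\<phi> \<in> carrier B \<Longrightarrow> g \<notin> carrier G \<Longrightarrow> \<phi> g = \<zero>"
  by (auto simp: B_carrier)

lemma mono_closed: "a \<in> carrier R \<Longrightarrow> g \<in> carrier G \<Longrightarrow> mono R a g \<in> carrier B"
  by (auto simp: B_carrier mono_def intro: finite_subset[of _ "{g}"])

lemma B_zero_closed: "\<zero>\<^bsub>B\<^esub> \<in> carrier B"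
  by (simp add: B_carrier B_simps)

lemma B_add_closed:
  assumes "\<phi> \<in> carrier B" "\<psi> \<in> carrier B" shows "\<phi> \<oplus>\<^bsub>B\<^esub> \<psi> \<in> carrier B"
proof -
  have "{g. \<phi> g \<oplus> \<psi> g \<noteq> \<zero>} \<subseteq> {g. \<phi> g \<noteq> \<zero>} \<union> {g. \<psi> g \<noteq> \<zero>}" by auto
  moreover have "finite ({g. \<phi> g \<noteq> \<zero>} \<union> {g. \<psi> g \<noteq> \<zero>})" "{g. \<phi> g \<noteq> \<zero>} \<union> {g. \<psi> g \<noteq> \<zero>} \<subseteq> carrier G"
    using assms by (auto simp: B_carrier)
  ultimately have "finite {g. \<phi> g \<oplus> \<psi> g \<noteq> \<zero>}" "{g. \<phi> g \<oplus> \<psi> g \<noteq> \<zero>} \<subseteq> carrier G"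
    using finite_subset by (blast, blast)
  then show ?thesis using assms by (simp add: B_carrier B_simps)
qed

text \<open>Adding one monomial at a time outside the current support keeps the coefficients of the
  parts visible in the sum; a condition on all coefficients thus passes to both parts.\<close>

lemma B_induct [consumes 1, case_names zero add]:
  assumes "\<phi> \<in> carrier B" "P \<zero>\<^bsub>B\<^esub>"
    "\<And>\<phi> a g. \<lbrakk>\<phi> \<in> carrier B; a \<in> carrier R; g \<in> carrier G; \<phi> g = \<zero>; P \<phi>\<rbrakk> \<Longrightarrow> P (mono R a g \<oplus>\<^bsub>B\<^esub> \<phi>)"
  shows "P \<phi>"
  using assms(1)
proof (induct "card {g. \<phi> g \<noteq> \<zero>}" arbitrary: \<phi> rule: less_induct)
  case less
  show ?case
  proof (cases "{g. \<phi> g \<noteq> \<zero>} = {}")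
    case True
    then have "\<phi> = \<zero>\<^bsub>B\<^esub>" by (auto simp: B_simps)
    then show ?thesis using assms(2) by simp
  next
    case False
    then obtain g where g: "\<phi> g \<noteq> \<zero>" by auto
    define \<psi> where "\<psi> = \<phi>(g := \<zero>)"
    have eq: "{x. \<psi> x \<noteq> \<zero>} = {x. \<phi> x \<noteq> \<zero>} - {g}" by (auto simp: \<psi>_def)
    have \<psi>: "\<psi> \<in> carrier B" using less.prems by (auto simp: B_carrier eq) (simp add: \<psi>_def)
    have "card {x. \<psi> x \<noteq> \<zero>} < card {x. \<phi> x \<noteq> \<zero>}"
      unfolding eq using less.prems g by (intro card_Diff1_less) (auto simp: B_carrier)
    from less.hyps[OF this \<psi>] have "P \<psi>" .
    moreover have "\<phi> = mono R (\<phi> g) g \<oplus>\<^bsub>B\<^esub> \<psi>"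
      using B_closed[OF less.prems] by (auto simp: B_simps mono_def \<psi>_def)
    moreover have "g \<in> carrier G" using g B_outside[OF less.prems] by auto
    ultimately show ?thesis using assms(3)[OF \<psi> B_closed[OF less.prems], of g g] by (simp add: \<psi>_def)
  qed
qed

lemma mult_superset:
  assumes "\<phi> \<in> carrier B" "\<psi> \<in> carrier B" "finite F" "{g. \<phi> g \<noteq> \<zero>} \<subseteq> F" "x \<in> carrier G"
  shows "(\<phi> \<otimes>\<^bsub>B\<^esub> \<psi>) x = (\<Oplus>g\<in>F. \<phi> g \<otimes> \<psi> (inv\<^bsub>G\<^esub> g \<otimes>\<^bsub>G\<^esub> x))"
  using assms by (simp add: B_simps, intro add.finprod_mono_neutral_cong_left) (auto simp: B_closed)

lemma mult_outside: "x \<notin> carrier G \<Longrightarrow> (\<phi> \<otimes>\<^bsub>B\<^esub> \<psi>) x = \<zero>"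
  by (simp add: B_simps)

lemma mono_mult:
  assumes "a \<in> carrier R" "g \<in> carrier G" "\<psi> \<in> carrier B" "x \<in> carrier G"
  shows "(mono R a g \<otimes>\<^bsub>B\<^esub> \<psi>) x = a \<otimes> \<psi> (inv\<^bsub>G\<^esub> g \<otimes>\<^bsub>G\<^esub> x)"
proof -
  have "(mono R a g \<otimes>\<^bsub>B\<^esub> \<psi>) x = (\<Oplus>h\<in>{g}. mono R a g h \<otimes> \<psi> (inv\<^bsub>G\<^esub> h \<otimes>\<^bsub>G\<^esub> x))"
    using assms by (intro mult_superset mono_closed) (auto simp: mono_def)
  then show ?thesis using assms by (simp add: mono_def B_closed)
qed

lemma mult_closed: "\<phi> \<in> carrier B \<Longrightarrow> \<psi> \<in> carrier B \<Longrightarrow> \<phi> \<otimes>\<^bsub>B\<^esub> \<psi> \<in> carrier B"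
proof -
  assume \<phi>: "\<phi> \<in> carrier B" and \<psi>: "\<psi> \<in> carrier B"
  let ?S = "(\<lambda>(g, h). g \<otimes>\<^bsub>G\<^esub> h) ` ({g. \<phi> g \<noteq> \<zero>} \<times> {h. \<psi> h \<noteq> \<zero>})"
  have "x \<in> ?S" if x: "(\<phi> \<otimes>\<^bsub>B\<^esub> \<psi>) x \<noteq> \<zero>" for x
  proof -
    have xG: "x \<in> carrier G" using x mult_outside by blast
    have "\<exists>g. \<phi> g \<noteq> \<zero> \<and> \<phi> g \<otimes> \<psi> (inv\<^bsub>G\<^esub> g \<otimes>\<^bsub>G\<^esub> x) \<noteq> \<zero>"
    proof (rule ccontr)
      assume "\<not> (\<exists>g. \<phi> g \<noteq> \<zero> \<and> \<phi> g \<otimes> \<psi> (inv\<^bsub>G\<^esub> g \<otimes>\<^bsub>G\<^esub> x) \<noteq> \<zero>)"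
      then have "(\<Oplus>g\<in>{g. \<phi> g \<noteq> \<zero>}. \<phi> g \<otimes> \<psi> (inv\<^bsub>G\<^esub> g \<otimes>\<^bsub>G\<^esub> x)) = \<zero>"
        by (intro add.finprod_one_eqI) auto
      then show False using x xG by (simp add: B_simps)
    qed
    then obtain g where g: "\<phi> g \<noteq> \<zero>" "\<phi> g \<otimes> \<psi> (inv\<^bsub>G\<^esub> g \<otimes>\<^bsub>G\<^esub> x) \<noteq> \<zero>" by blast
    have gG: "g \<in> carrier G" using g B_outside[OF \<phi>] by blast
    have "\<psi> (inv\<^bsub>G\<^esub> g \<otimes>\<^bsub>G\<^esub> x) \<noteq> \<zero>" using g B_closed[OF \<phi>] by auto
    moreover have "x = g \<otimes>\<^bsub>G\<^esub> (inv\<^bsub>G\<^esub> g \<otimes>\<^bsub>G\<^esub> x)" using gG xG by (simp flip: G.m_assoc)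
    ultimately show ?thesis using g by force
  qed
  then have sub: "{x. (\<phi> \<otimes>\<^bsub>B\<^esub> \<psi>) x \<noteq> \<zero>} \<subseteq> ?S" by blast
  have "finite ?S" using \<phi> \<psi> by (auto simp: B_carrier)
  then have "finite {x. (\<phi> \<otimes>\<^bsub>B\<^esub> \<psi>) x \<noteq> \<zero>}" using sub finite_subset by blast
  moreover have "{x. (\<phi> \<otimes>\<^bsub>B\<^esub> \<psi>) x \<noteq> \<zero>} \<subseteq> carrier G" using mult_outside by blast
  moreover have "(\<phi> \<otimes>\<^bsub>B\<^esub> \<psi>) x \<in> carrier R" for x
    using B_closed[OF \<phi>] B_closed[OF \<psi>] by (auto simp: B_simps intro!: finsum_closed)
  ultimately show ?thesis unfolding B_carrier by blast
qed

lemma B_l_distr: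
  assumes "\<phi> \<in> carrier B" "\<phi>' \<in> carrier B" "\<psi> \<in> carrier B"
  shows "(\<phi> \<oplus>\<^bsub>B\<^esub> \<phi>') \<otimes>\<^bsub>B\<^esub> \<psi> = \<phi> \<otimes>\<^bsub>B\<^esub> \<psi> \<oplus>\<^bsub>B\<^esub> \<phi>' \<otimes>\<^bsub>B\<^esub> \<psi>"
proof
  fix x
  let ?F = "{g. \<phi> g \<noteq> \<zero>} \<union> {g. \<phi>' g \<noteq> \<zero>}"
  have F: "finite ?F" using assms by (auto simp: B_carrier)
  show "((\<phi> \<oplus>\<^bsub>B\<^esub> \<phi>') \<otimes>\<^bsub>B\<^esub> \<psi>) x = (\<phi> \<otimes>\<^bsub>B\<^esub> \<psi> \<oplus>\<^bsub>B\<^esub> \<phi>' \<otimes>\<^bsub>B\<^esub> \<psi>) x"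
  proof (cases "x \<in> carrier G")
    case True
    have "((\<phi> \<oplus>\<^bsub>B\<^esub> \<phi>') \<otimes>\<^bsub>B\<^esub> \<psi>) x = (\<Oplus>g\<in>?F. (\<phi> \<oplus>\<^bsub>B\<^esub> \<phi>') g \<otimes> \<psi> (inv\<^bsub>G\<^esub> g \<otimes>\<^bsub>G\<^esub> x))"
      using assms True by (intro mult_superset F B_add_closed) (auto simp: B_simps(3))
    also have "\<dots> = (\<Oplus>g\<in>?F. \<phi> g \<otimes> \<psi> (inv\<^bsub>G\<^esub> g \<otimes>\<^bsub>G\<^esub> x) \<oplus> \<phi>' g \<otimes> \<psi> (inv\<^bsub>G\<^esub> g \<otimes>\<^bsub>G\<^esub> x))"
      using assms by (intro finsum_cong' refl) (auto simp: B_simps(3) B_closed l_distr)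
    also have "\<dots> = (\<phi> \<otimes>\<^bsub>B\<^esub> \<psi>) x \<oplus> (\<phi>' \<otimes>\<^bsub>B\<^esub> \<psi>) x"
      using assms True F
      by (subst finsum_addf) (auto simp: B_closed mult_superset[of _ _ ?F])
    finally show ?thesis by (simp add: B_simps(3))
  qed (simp add: B_simps)
qed

lemma B_r_distr:
  assumes "\<phi> \<in> carrier B" "\<psi> \<in> carrier B" "\<psi>' \<in> carrier B"
  shows "\<phi> \<otimes>\<^bsub>B\<^esub> (\<psi> \<oplus>\<^bsub>B\<^esub> \<psi>') = \<phi> \<otimes>\<^bsub>B\<^esub> \<psi> \<oplus>\<^bsub>B\<^esub> \<phi> \<otimes>\<^bsub>B\<^esub> \<psi>'"
  using assms by (auto simp: B_simps B_closed r_distr fun_eq_iff Pi_def intro!: finsum_addf)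

lemma mono_mult_mono:
  assumes "a \<in> carrier R" "b \<in> carrier R" "g \<in> carrier G" "h \<in> carrier G"
  shows "mono R a g \<otimes>\<^bsub>B\<^esub> mono R b h = mono R (a \<otimes> b) (g \<otimes>\<^bsub>G\<^esub> h)"
proof
  fix x
  show "(mono R a g \<otimes>\<^bsub>B\<^esub> mono R b h) x = mono R (a \<otimes> b) (g \<otimes>\<^bsub>G\<^esub> h) x"
  proof (cases "x \<in> carrier G")
    case True
    have "inv\<^bsub>G\<^esub> g \<otimes>\<^bsub>G\<^esub> x = h \<longleftrightarrow> x = g \<otimes>\<^bsub>G\<^esub> h"
    proof
      assume "inv\<^bsub>G\<^esub> g \<otimes>\<^bsub>G\<^esub> x = h"
      moreover have "g \<otimes>\<^bsub>G\<^esub> (inv\<^bsub>G\<^esub> g \<otimes>\<^bsub>G\<^esub> x) = x" using assms True by (simp flip: G.m_assoc)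
      ultimately show "x = g \<otimes>\<^bsub>G\<^esub> h" by simp
    qed (use assms in \<open>simp flip: G.m_assoc\<close>)
    then show ?thesis using assms True mono_mult[of a g "mono R b h" x]
      by (auto simp: mono_closed) (auto simp: mono_def)
  next
    case False
    then have "x \<noteq> g \<otimes>\<^bsub>G\<^esub> h" using assms by auto
    then show ?thesis using False by (simp add: mult_outside mono_def)
  qed
qed

lemma zero_mult: "\<psi> \<in> carrier B \<Longrightarrow> \<zero>\<^bsub>B\<^esub> \<otimes>\<^bsub>B\<^esub> \<psi> = \<zero>\<^bsub>B\<^esub>"
  by (auto simp: B_simps)

lemma mult_zero: "\<phi> \<in> carrier B \<Longrightarrow> \<phi> \<otimes>\<^bsub>B\<^esub> \<zero>\<^bsub>B\<^esub> = \<zero>\<^bsub>B\<^esub>"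
  by (auto simp: B_simps B_closed intro!: add.finprod_one_eqI)

lemma B_assoc:
  assumes \<phi>: "\<phi> \<in> carrier B" and \<psi>: "\<psi> \<in> carrier B" and \<chi>: "\<chi> \<in> carrier B"
  shows "\<phi> \<otimes>\<^bsub>B\<^esub> \<psi> \<otimes>\<^bsub>B\<^esub> \<chi> = \<phi> \<otimes>\<^bsub>B\<^esub> (\<psi> \<otimes>\<^bsub>B\<^esub> \<chi>)"
  using \<phi>
proof (induct rule: B_induct)
  case zero
  then show ?case using \<psi> \<chi> by (simp add: zero_mult mult_closed)
next
  case (add \<phi> a g)
  have "mono R a g \<otimes>\<^bsub>B\<^esub> \<psi> \<otimes>\<^bsub>B\<^esub> \<chi> = mono R a g \<otimes>\<^bsub>B\<^esub> (\<psi> \<otimes>\<^bsub>B\<^esub> \<chi>)"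
    using \<psi>
  proof (induct rule: B_induct)
    case zero
    then show ?case using \<chi> add by (simp add: zero_mult mult_zero mono_closed)
  next
    case (add \<psi> b h)
    note a = \<open>a \<in> carrier R\<close> \<open>g \<in> carrier G\<close>
    have "mono R a g \<otimes>\<^bsub>B\<^esub> mono R b h \<otimes>\<^bsub>B\<^esub> \<chi> = mono R a g \<otimes>\<^bsub>B\<^esub> (mono R b h \<otimes>\<^bsub>B\<^esub> \<chi>)"
    proof
      fix x
      show "(mono R a g \<otimes>\<^bsub>B\<^esub> mono R b h \<otimes>\<^bsub>B\<^esub> \<chi>) x = (mono R a g \<otimes>\<^bsub>B\<^esub> (mono R b h \<otimes>\<^bsub>B\<^esub> \<chi>)) x"
      proof (cases "x \<in> carrier G")
        case True
        have "inv\<^bsub>G\<^esub> (g \<otimes>\<^bsub>G\<^esub> h) \<otimes>\<^bsub>G\<^esub> x = inv\<^bsub>G\<^esub> h \<otimes>\<^bsub>G\<^esub> (inv\<^bsub>G\<^esub> g \<otimes>\<^bsub>G\<^esub> x)"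
          using a add True by (simp add: G.inv_mult_group G.m_assoc)
        then show ?thesis
          using a add True \<chi> by (simp add: mono_mult_mono mono_mult mono_closed mult_closed B_closed m_assoc)
      qed (simp add: mult_outside)
    qed
    then show ?case
      using a add \<chi> by (simp add: B_l_distr B_r_distr mono_closed mult_closed B_add_closed)
  qed
  then show ?case
    using add \<psi> \<chi> by (simp add: B_l_distr mono_closed mult_closed B_add_closed)
qed

lemma one_mult:
  assumes \<phi>: "\<phi> \<in> carrier B"
  shows "\<one>\<^bsub>B\<^esub> \<otimes>\<^bsub>B\<^esub> \<phi> = \<phi>" "\<phi> \<otimes>\<^bsub>B\<^esub> \<one>\<^bsub>B\<^esub> = \<phi>"
proof -
  have c: "\<one>\<^bsub>B\<^esub> \<in> carrier B" by (simp add: B_simps mono_closed)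
  show "\<phi> \<otimes>\<^bsub>B\<^esub> \<one>\<^bsub>B\<^esub> = \<phi>"
    using \<phi>
  proof (induct rule: B_induct)
    case (add \<phi> a g)
    have "mono R a g \<otimes>\<^bsub>B\<^esub> \<one>\<^bsub>B\<^esub> = mono R a g"
      unfolding B_simps(2) using add by (simp add: mono_mult_mono)
    then show ?case using add c by (simp add: B_l_distr mono_closed)
  qed (simp add: zero_mult c)
  show "\<one>\<^bsub>B\<^esub> \<otimes>\<^bsub>B\<^esub> \<phi> = \<phi>"
    using \<phi>
  proof (induct rule: B_induct)
    case (add \<phi> a g)
    have "\<one>\<^bsub>B\<^esub> \<otimes>\<^bsub>B\<^esub> mono R a g = mono R a g"
      unfolding B_simps(2) using add by (simp add: mono_mult_mono)
    then show ?case using add c by (simp add: B_r_distr mono_closed)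
  qed (simp add: mult_zero c)
qed

lemma ring_B: "ring B"
proof (rule ringI)
  show "abelian_group B"
  proof (rule abelian_groupI)
    fix \<phi> assume \<phi>: "\<phi> \<in> carrier B"
    have "{g. \<ominus> \<phi> g \<noteq> \<zero>} = {g. \<phi> g \<noteq> \<zero>}"
      using B_closed[OF \<phi>] by (metis (no_types, lifting) minus_minus minus_zero)
    then have "(\<lambda>g. \<ominus> \<phi> g) \<in> carrier B" using \<phi> by (simp add: B_carrier)
    moreover have "(\<lambda>g. \<ominus> \<phi> g) \<oplus>\<^bsub>B\<^esub> \<phi> = \<zero>\<^bsub>B\<^esub>" using B_closed[OF \<phi>] by (simp add: B_simps l_neg)
    ultimately show "\<exists>\<psi>\<in>carrier B. \<psi> \<oplus>\<^bsub>B\<^esub> \<phi> = \<zero>\<^bsub>B\<^esub>" by blast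
    show "\<zero>\<^bsub>B\<^esub> \<oplus>\<^bsub>B\<^esub> \<phi> = \<phi>" using B_closed[OF \<phi>] by (simp add: B_simps)
  next
    fix \<phi> \<psi> assume "\<phi> \<in> carrier B" "\<psi> \<in> carrier B"
    then show "\<phi> \<oplus>\<^bsub>B\<^esub> \<psi> \<in> carrier B" "\<phi> \<oplus>\<^bsub>B\<^esub> \<psi> = \<psi> \<oplus>\<^bsub>B\<^esub> \<phi>"
      by (auto simp: B_add_closed) (auto simp: B_simps B_closed a_comm)
  next
    fix \<phi> \<psi> \<chi> assume "\<phi> \<in> carrier B" "\<psi> \<in> carrier B" "\<chi> \<in> carrier B"
    then show "\<phi> \<oplus>\<^bsub>B\<^esub> \<psi> \<oplus>\<^bsub>B\<^esub> \<chi> = \<phi> \<oplus>\<^bsub>B\<^esub> (\<psi> \<oplus>\<^bsub>B\<^esub> \<chi>)"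
      by (auto simp: B_simps B_closed a_assoc)
  qed (rule B_zero_closed)
  show "monoid B"
    by (rule monoidI) (auto simp: mult_closed B_assoc one_mult, simp add: B_simps mono_closed)
qed (auto simp: B_l_distr B_r_distr)

lemma mono_add:
  assumes "a \<in> carrier R" "b \<in> carrier R"
  shows "mono R (a \<oplus> b) g = mono R a g \<oplus>\<^bsub>B\<^esub> mono R b g"
  using assms by (auto simp: B_simps mono_def)

end

section \<open>Identities of \<open>n \<times> n\<close> matrices near a maximal ideal\<close>

lemma ring_hom_ncpoly_eval:
  assumes R: "ring R" and S: "ring S" and h: "h \<in> Ring.ring_hom R S" and b: "\<And>k. b k \<in> carrier R"
  shows "h (ncpoly_eval R b f) = ncpoly_eval S (\<lambda>k. h (b k)) f"
proof -
  interpret R: ring R by fact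
  interpret S: ring S by fact
  have c: "foldr (\<lambda>i y. b i \<otimes>\<^bsub>R\<^esub> y) xs \<one>\<^bsub>R\<^esub> \<in> carrier R" for xs
    using b by (induct xs) auto
  have "h (foldr (\<lambda>i y. b i \<otimes>\<^bsub>R\<^esub> y) xs \<one>\<^bsub>R\<^esub>) = foldr (\<lambda>i y. h (b i) \<otimes>\<^bsub>S\<^esub> y) xs \<one>\<^bsub>S\<^esub>" for xs
    using h b c by (induct xs) (auto simp: Ring.ring_hom_mult Ring.ring_hom_one)
  then have "h (word_eval R b w) = word_eval S (\<lambda>k. h (b k)) w" for w by (simp add: word_eval_def)
  moreover have "h (pm_eval R (word_eval R b) f) = pm_eval S (\<lambda>w. h (word_eval R b w)) f"
    using h b by (intro additive_map_pm_eval R S) (auto simp: Ring.ring_hom_add Ring.ring_hom_closed)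
  ultimately show ?thesis by (simp add: ncpoly_eval_eq_pm_eval)
qed

definition (in split_simple_ring) K_group :: "'a monoid" where
  "K_group = \<lparr>carrier = K - {\<zero>}, monoid.mult = (\<otimes>), one = e\<rparr>"

lemma (in split_simple_ring) K_group: "comm_group K_group"
proof (rule comm_groupI)
  fix x y z assume x: "x \<in> carrier K_group" and y: "y \<in> carrier K_group" and z: "z \<in> carrier K_group"
  have K: "x \<in> K" "y \<in> K" "z \<in> K" "x \<noteq> \<zero>" "y \<noteq> \<zero>" using x y z by (auto simp: K_group_def)
  show "x \<otimes>\<^bsub>K_group\<^esub> y \<in> carrier K_group"
    using K K_mult K_integral[of x y] K_memD by (auto simp: K_group_def)
  show "x \<otimes>\<^bsub>K_group\<^esub> y \<otimes>\<^bsub>K_group\<^esub> z = x \<otimes>\<^bsub>K_group\<^esub> (y \<otimes>\<^bsub>K_group\<^esub> z)"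
    using K K_memD(1) by (simp add: K_group_def m_assoc)
  show "x \<otimes>\<^bsub>K_group\<^esub> y = y \<otimes>\<^bsub>K_group\<^esub> x" using K K_memD(4) by (simp add: K_group_def)
next
  show "\<one>\<^bsub>K_group\<^esub> \<in> carrier K_group" using e K_e by (simp add: K_group_def)
next
  fix x assume x: "x \<in> carrier K_group"
  then have K: "x \<in> K" "x \<noteq> \<zero>" by (auto simp: K_group_def)
  show "\<one>\<^bsub>K_group\<^esub> \<otimes>\<^bsub>K_group\<^esub> x = x" using K K_memD by (simp add: K_group_def)
  from K_inverse[OF K] obtain y where y: "y \<in> K" "x \<otimes> y = e" by auto
  then have "y \<noteq> \<zero>" using e K K_memD(1) by auto
  moreover have "y \<otimes> x = e" using y K K_memD(4) by simp
  ultimately show "\<exists>y\<in>carrier K_group. y \<otimes>\<^bsub>K_group\<^esub> x = \<one>\<^bsub>K_group\<^esub>" using y by (auto simp: K_group_def)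
qed

lemma (in ring) comb_memI:
  assumes "m \<in> N" "\<And>i. c i \<in> q" "N \<subseteq> carrier R" "q \<subseteq> carrier R" "\<And>i. g i \<in> carrier R"
  shows "m \<oplus> (\<Oplus>i\<in>{..<s}. c i \<otimes> g i) \<in> comb N q g s"
proof (induct s)
  case 0
  then show ?case using assms by auto
next
  case (Suc s)
  have "m \<oplus> (\<Oplus>i\<in>{..<Suc s}. c i \<otimes> g i) = (m \<oplus> (\<Oplus>i\<in>{..<s}. c i \<otimes> g i)) \<oplus> c s \<otimes> g s"
    using assms by (subst lessThan_Suc, subst finsum_insert) (auto simp: a_ac subset_iff intro!: finsum_closed)
  with Suc show ?case using assms(2) by auto
qed

text \<open>\<open>P0\<close> stands for the image of the base ring in the centre of
  \<open>A\<close>, h for reduction to the residue algebra and x for lifts of its basis. The last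
  assumption says that the kernel of h is generated by the g with scalars that themselves reduce to
  zero, as holds for M A.\<close>

locale local_split = ring A + Q: split_simple_ring Q N \<epsilon> e K
  for A :: "('a, 'm) ring_scheme" (structure) and Q :: "('q, 'k) ring_scheme" and N \<epsilon> e K +
  fixes h :: "'a \<Rightarrow> 'q" and P0 :: "'a set" and x :: "nat \<Rightarrow> 'a" and s :: nat and g :: "nat \<Rightarrow> 'a"
  assumes hom: "h \<in> Ring.ring_hom A Q"
    and P0: "P0 \<subseteq> carrier A" "\<zero> \<in> P0" "\<one> \<in> P0" "\<And>y z. y \<in> P0 \<Longrightarrow> z \<in> P0 \<Longrightarrow> y \<oplus> z \<in> P0"
      "\<And>y z. y \<in> P0 \<Longrightarrow> z \<in> P0 \<Longrightarrow> y \<otimes> z \<in> P0" "\<And>y. y \<in> P0 \<Longrightarrow> \<ominus> y \<in> P0"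
      "\<And>y z. y \<in> P0 \<Longrightarrow> z \<in> carrier A \<Longrightarrow> y \<otimes> z = z \<otimes> y"
    and center: "ring_center Q = h ` P0"
    and x: "\<And>p. x p \<in> carrier A" "\<And>p. h (x p) = \<epsilon> p"
    and g: "\<And>i. g i \<in> carrier A"
      "\<And>a. a \<in> carrier A \<Longrightarrow> \<exists>r. (\<forall>i. r i \<in> P0) \<and> a = (\<Oplus>i\<in>{..<s}. r i \<otimes> g i)"
    and ker: "\<And>a. a \<in> carrier A \<Longrightarrow> h a = \<zero>\<^bsub>Q\<^esub> \<Longrightarrow>
      \<exists>r. (\<forall>i. r i \<in> P0 \<and> h (r i) = \<zero>\<^bsub>Q\<^esub>) \<and> a = (\<Oplus>i\<in>{..<s}. r i \<otimes> g i)"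

sublocale local_split \<subseteq> group_algebra A Q.K_group
  by (intro group_algebra.intro ring_axioms Q.K_group)

sublocale group_algebra \<subseteq> BB: ring B
  by (rule ring_B)

section \<open>The action of the group algebra on the residue algebra\<close>

context local_split
begin

abbreviation G :: "'q monoid" where "G \<equiv> Q.K_group"

lemma G_simps: "carrier G = K - {\<zero>\<^bsub>Q\<^esub>}" "monoid.mult G = monoid.mult Q" "\<one>\<^bsub>G\<^esub> = e"
  by (simp_all add: Q.K_group_def)

lemma GK: "k \<in> carrier G \<Longrightarrow> k \<in> K" "k \<in> carrier G \<Longrightarrow> k \<in> carrier Q"
  using Q.K_subset by (auto simp: G_simps)

lemma h_closed: "a \<in> carrier A \<Longrightarrow> h a \<in> carrier Q"
  using Ring.ring_hom_closed[OF hom] .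

lemma h_zero: "h \<zero> = \<zero>\<^bsub>Q\<^esub>"
  using Ring.ring_hom_zero[OF hom ring_axioms Q.ring_axioms] .

lemma h_uminus: "a \<in> carrier A \<Longrightarrow> h (\<ominus> a) = \<ominus>\<^bsub>Q\<^esub> h a"
proof -
  assume a: "a \<in> carrier A"
  then have "h (\<ominus> a) \<oplus>\<^bsub>Q\<^esub> h a = \<zero>\<^bsub>Q\<^esub>"
    using Ring.ring_hom_add[OF hom, of "\<ominus> a" a] by (simp add: l_neg h_zero)
  then show ?thesis using a h_closed by (intro Q.minus_equality[symmetric]) auto
qed

lemma h_finsum:
  assumes "finite I" "\<And>i. i \<in> I \<Longrightarrow> f i \<in> carrier A"
  shows "h (\<Oplus>i\<in>I. f i) = (\<Oplus>\<^bsub>Q\<^esub>i\<in>I. h (f i))"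
  using assms by (induct I) (auto simp: h_zero Ring.ring_hom_add[OF hom] h_closed Pi_def finsum_closed)

lemma h_surj:
  assumes "y \<in> carrier Q" shows "\<exists>a\<in>carrier A. h a = y"
proof -
  from Q.\<epsilon>_span[OF assms] obtain c where c: "\<And>p. c p \<in> ring_center Q" "y = (\<Oplus>\<^bsub>Q\<^esub>p\<in>{..<N}. c p \<otimes>\<^bsub>Q\<^esub> \<epsilon> p)" by auto
  then have "\<forall>p. \<exists>r\<in>P0. h r = c p" unfolding center by (auto simp: image_iff) metis
  then obtain r where r: "\<And>p. r p \<in> P0" "\<And>p. h (r p) = c p" by metis
  have rA: "r p \<in> carrier A" for p using r P0 by auto
  have "h (\<Oplus>p\<in>{..<N}. r p \<otimes> x p) = y"
    using rA x(1) unfolding c(2) by (simp add: h_finsum Ring.ring_hom_mult[OF hom] r x(2))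
  then show ?thesis using rA x(1) by (intro bexI[of _ "\<Oplus>p\<in>{..<N}. r p \<otimes> x p"]) auto
qed

lemma P0_finsum: "(\<And>i. i \<in> I \<Longrightarrow> f i \<in> P0) \<Longrightarrow> (\<Oplus>i\<in>I. f i) \<in> P0"
  using P0(1) by (induct I rule: infinite_finite_induct) (auto simp: P0(2,4) Pi_def subset_iff)

text \<open>The group element k acts by right multiplication with k regarded as an element of
  \<open>K\<close>, and a coefficient a by left multiplication with its residue. On W this makes the
  group algebra act by \<open>K\<close>-linear maps.\<close>

definition \<pi> :: "('q \<Rightarrow> 'a) \<Rightarrow> 'q \<Rightarrow> 'q" where
  "\<pi> \<phi> w = (\<Oplus>\<^bsub>Q\<^esub>k\<in>{k. \<phi> k \<noteq> \<zero>}. h (\<phi> k) \<otimes>\<^bsub>Q\<^esub> w \<otimes>\<^bsub>Q\<^esub> k)"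

lemma \<pi>_superset:
  assumes "\<phi> \<in> carrier B" "w \<in> carrier Q" "finite F" "{k. \<phi> k \<noteq> \<zero>} \<subseteq> F" "F \<subseteq> carrier G"
  shows "\<pi> \<phi> w = (\<Oplus>\<^bsub>Q\<^esub>k\<in>F. h (\<phi> k) \<otimes>\<^bsub>Q\<^esub> w \<otimes>\<^bsub>Q\<^esub> k)"
  unfolding \<pi>_def
proof (rule Q.add.finprod_mono_neutral_cong_left)
  show "h (\<phi> k) \<otimes>\<^bsub>Q\<^esub> w \<otimes>\<^bsub>Q\<^esub> k = \<zero>\<^bsub>Q\<^esub>" if "k \<in> F - {k. \<phi> k \<noteq> \<zero>}" for k
    using that assms GK(2) by (auto simp: h_zero)
  show "(\<lambda>k. h (\<phi> k) \<otimes>\<^bsub>Q\<^esub> w \<otimes>\<^bsub>Q\<^esub> k) \<in> F \<rightarrow> carrier Q"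
    using assms GK(2) h_closed B_closed[OF assms(1)] by auto
qed (use assms in auto)

lemma \<pi>_add:
  assumes "\<phi> \<in> carrier B" "\<psi> \<in> carrier B" "w \<in> carrier Q"
  shows "\<pi> (\<phi> \<oplus>\<^bsub>B\<^esub> \<psi>) w = \<pi> \<phi> w \<oplus>\<^bsub>Q\<^esub> \<pi> \<psi> w"
proof -
  let ?F = "{k. \<phi> k \<noteq> \<zero>} \<union> {k. \<psi> k \<noteq> \<zero>}"
  have F: "finite ?F" "?F \<subseteq> carrier G" using assms by (auto simp: B_carrier)
  have cl: "h (\<phi> k) \<in> carrier Q" "h (\<psi> k) \<in> carrier Q" for k using assms by (auto simp: h_closed B_closed)
  have FQ: "k \<in> carrier Q" if "k \<in> ?F" for k using that F(2) GK(2) by blast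
  have "\<pi> (\<phi> \<oplus>\<^bsub>B\<^esub> \<psi>) w = (\<Oplus>\<^bsub>Q\<^esub>k\<in>?F. h ((\<phi> \<oplus>\<^bsub>B\<^esub> \<psi>) k) \<otimes>\<^bsub>Q\<^esub> w \<otimes>\<^bsub>Q\<^esub> k)"
    using assms by (intro \<pi>_superset F B_add_closed) (auto simp: B_simps(3))
  also have "\<dots> = (\<Oplus>\<^bsub>Q\<^esub>k\<in>?F. h (\<phi> k) \<otimes>\<^bsub>Q\<^esub> w \<otimes>\<^bsub>Q\<^esub> k \<oplus>\<^bsub>Q\<^esub> h (\<psi> k) \<otimes>\<^bsub>Q\<^esub> w \<otimes>\<^bsub>Q\<^esub> k)"
  proof (rule Q.finsum_cong'[OF refl])
    fix k assume "k \<in> ?F"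
    then show "h ((\<phi> \<oplus>\<^bsub>B\<^esub> \<psi>) k) \<otimes>\<^bsub>Q\<^esub> w \<otimes>\<^bsub>Q\<^esub> k =
        h (\<phi> k) \<otimes>\<^bsub>Q\<^esub> w \<otimes>\<^bsub>Q\<^esub> k \<oplus>\<^bsub>Q\<^esub> h (\<psi> k) \<otimes>\<^bsub>Q\<^esub> w \<otimes>\<^bsub>Q\<^esub> k"
      using assms cl FQ[of k] by (simp add: B_simps(3) Ring.ring_hom_add[OF hom] B_closed Q.l_distr)
  qed (use cl FQ assms in blast)
  also have "\<dots> = \<pi> \<phi> w \<oplus>\<^bsub>Q\<^esub> \<pi> \<psi> w"
  proof -
    have "\<pi> \<phi> w = (\<Oplus>\<^bsub>Q\<^esub>k\<in>?F. h (\<phi> k) \<otimes>\<^bsub>Q\<^esub> w \<otimes>\<^bsub>Q\<^esub> k)" "\<pi> \<psi> w = (\<Oplus>\<^bsub>Q\<^esub>k\<in>?F. h (\<psi> k) \<otimes>\<^bsub>Q\<^esub> w \<otimes>\<^bsub>Q\<^esub> k)"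
      using assms by (intro \<pi>_superset F; blast)+
    then show ?thesis using cl FQ assms(3) by (simp only:) (intro Q.finsum_addf; blast)
  qed
  finally show ?thesis .
qed

lemma \<pi>_mono:
  assumes "a \<in> carrier A" "k \<in> carrier G" "w \<in> carrier Q"
  shows "\<pi> (mono A a k) w = h a \<otimes>\<^bsub>Q\<^esub> w \<otimes>\<^bsub>Q\<^esub> k"
proof -
  have "\<pi> (mono A a k) w = (\<Oplus>\<^bsub>Q\<^esub>k'\<in>{k}. h (mono A a k k') \<otimes>\<^bsub>Q\<^esub> w \<otimes>\<^bsub>Q\<^esub> k')"
    using assms by (intro \<pi>_superset mono_closed) (auto simp: mono_def)
  then show ?thesis using assms GK h_closed by (simp add: mono_def)
qed

lemma \<pi>_zero: "\<pi> \<zero>\<^bsub>B\<^esub> w = \<zero>\<^bsub>Q\<^esub>"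
  by (simp add: \<pi>_def B_simps)

lemma biop_\<pi>:
  assumes "\<phi> \<in> carrier B" shows "biop Q K (\<pi> \<phi>)"
  using assms
proof (induct rule: B_induct)
  case zero
  show ?case by (rule Q.biop_cong[OF _ Q.biop_zero]) (simp add: \<pi>_zero)
next
  case (add \<phi> a k)
  have "biop Q K (\<lambda>w. h a \<otimes>\<^bsub>Q\<^esub> w \<otimes>\<^bsub>Q\<^esub> k \<oplus>\<^bsub>Q\<^esub> \<pi> \<phi> w)"
    using add GK by (intro Q.biop_add Q.biop_single Q.K_subset h_closed)
  then show ?case
    by (rule Q.biop_cong[rotated]) (simp add: \<pi>_add add mono_closed \<pi>_mono)
qed

lemma \<pi>_closed: "\<phi> \<in> carrier B \<Longrightarrow> w \<in> carrier Q \<Longrightarrow> \<pi> \<phi> w \<in> carrier Q"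
  using Q.biop_closed[OF biop_\<pi> Q.K_subset] .

lemma \<pi>_W:
  assumes "\<phi> \<in> carrier B" "w \<in> Q.W" shows "\<pi> \<phi> w \<in> Q.W"
proof -
  have "h (\<phi> k) \<otimes>\<^bsub>Q\<^esub> w \<otimes>\<^bsub>Q\<^esub> k \<in> Q.W" if "k \<in> {k. \<phi> k \<noteq> \<zero>}" for k
  proof -
    have "k \<in> carrier G" using that B_outside[OF assms(1)] by blast
    then show ?thesis using assms Q.W_closed GK h_closed B_closed by simp
  qed
  then show ?thesis unfolding \<pi>_def by (rule Q.W_finsum)
qed

lemma \<pi>_linear:
  assumes "\<phi> \<in> carrier B" "finite I" "\<And>i. i \<in> I \<Longrightarrow> y i \<in> carrier Q" "\<And>i. i \<in> I \<Longrightarrow> c i \<in> K"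
  shows "\<pi> \<phi> (\<Oplus>\<^bsub>Q\<^esub>i\<in>I. y i \<otimes>\<^bsub>Q\<^esub> c i) = (\<Oplus>\<^bsub>Q\<^esub>i\<in>I. \<pi> \<phi> (y i) \<otimes>\<^bsub>Q\<^esub> c i)"
  using assms Q.K_memD by (intro Q.biop_linear[OF biop_\<pi> Q.K_subset]) auto

lemma \<pi>_linear1:
  assumes "\<phi> \<in> carrier B" "y \<in> carrier Q" "c \<in> K"
  shows "\<pi> \<phi> (y \<otimes>\<^bsub>Q\<^esub> c) = \<pi> \<phi> y \<otimes>\<^bsub>Q\<^esub> c"
  using \<pi>_linear[of \<phi> "{()}" "\<lambda>_. y" "\<lambda>_. c"] assms Q.K_memD(1)[OF assms(3)] \<pi>_closed by simp

lemma \<pi>_zero_right: "\<phi> \<in> carrier B \<Longrightarrow> \<pi> \<phi> \<zero>\<^bsub>Q\<^esub> = \<zero>\<^bsub>Q\<^esub>"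
  using \<pi>_linear[of \<phi> "{}"] by simp

lemma \<pi>_add_right:
  assumes "\<phi> \<in> carrier B" "w \<in> carrier Q" "w' \<in> carrier Q"
  shows "\<pi> \<phi> (w \<oplus>\<^bsub>Q\<^esub> w') = \<pi> \<phi> w \<oplus>\<^bsub>Q\<^esub> \<pi> \<phi> w'"
  using assms(1)
proof (induct rule: B_induct)
  case zero
  then show ?case by (simp add: \<pi>_zero)
next
  case (add \<phi> a k)
  then show ?case using assms GK h_closed
    by (simp add: \<pi>_add mono_closed \<pi>_mono Q.r_distr Q.l_distr \<pi>_closed Q.a_ac)
qed

lemma \<pi>_mult:
  assumes \<phi>: "\<phi> \<in> carrier B" and \<psi>: "\<psi> \<in> carrier B" and w: "w \<in> carrier Q"
  shows "\<pi> (\<phi> \<otimes>\<^bsub>B\<^esub> \<psi>) w = \<pi> \<phi> (\<pi> \<psi> w)"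
  using \<phi>
proof (induct rule: B_induct)
  case zero
  then show ?case using \<psi> by (simp add: zero_mult \<pi>_zero)
next
  case (add \<phi> a k)
  have "\<pi> (mono A a k \<otimes>\<^bsub>B\<^esub> \<psi>) w = \<pi> (mono A a k) (\<pi> \<psi> w)"
    using \<psi>
  proof (induct rule: B_induct)
    case zero
    then show ?case using add w by (simp add: mult_zero mono_closed \<pi>_zero \<pi>_zero_right)
  next
    case (add \<psi> b k')
    note a = \<open>a \<in> carrier A\<close> \<open>k \<in> carrier G\<close>
    have kk: "k \<otimes>\<^bsub>G\<^esub> k' \<in> carrier G" using a add by simp
    have "\<pi> (mono A a k \<otimes>\<^bsub>B\<^esub> mono A b k') w = h a \<otimes>\<^bsub>Q\<^esub> (h b \<otimes>\<^bsub>Q\<^esub> w \<otimes>\<^bsub>Q\<^esub> k') \<otimes>\<^bsub>Q\<^esub> k"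
    proof -
      \<comment> \<open>Right multiplications compose in reverse order; commutativity of
        \<open>K\<close> repairs this and makes \<open>\<pi>\<close> multiplicative.\<close>
      have "k \<otimes>\<^bsub>Q\<^esub> k' = k' \<otimes>\<^bsub>Q\<^esub> k" using Q.K_memD(4)[OF GK(1)[OF a(2)] GK(1)[OF add(3)]] .
      then show ?thesis
        using a add w kk GK h_closed
        by (simp add: mono_mult_mono \<pi>_mono Ring.ring_hom_mult[OF hom] G_simps(2) Q.m_assoc)
    qed
    also have "\<dots> = \<pi> (mono A a k) (\<pi> (mono A b k') w)"
      using a add w GK h_closed by (simp add: \<pi>_mono)
    finally show ?case
      using a add w
      by (simp add: B_r_distr mono_closed \<pi>_add mult_closed \<pi>_add_right \<pi>_closed)
  qed
  then show ?case
    using add \<psi> w by (simp add: B_l_distr mono_closed \<pi>_add mult_closed \<pi>_closed)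
qed

text \<open>The unit of the group is e, so the unit of the group algebra acts as right
  multiplication by e, which is the identity exactly on W.\<close>

lemma \<pi>_one: "w \<in> Q.W \<Longrightarrow> \<pi> \<one>\<^bsub>B\<^esub> w = w"
proof -
  assume w: "w \<in> Q.W"
  have "e \<in> carrier G" using Q.e Q.K_e by (simp add: G_simps)
  then have "\<pi> (mono A \<one> e) w = h \<one> \<otimes>\<^bsub>Q\<^esub> w \<otimes>\<^bsub>Q\<^esub> e" using w Q.W_closed by (intro \<pi>_mono) auto
  then show ?thesis using w Q.W_closed Ring.ring_hom_one[OF hom] by (simp add: B_simps(2) G_simps(3))
qed

lemma \<pi>_surj:
  assumes "biop Q K T" shows "\<exists>\<phi>\<in>carrier B. \<forall>w\<in>carrier Q. \<pi> \<phi> w = T w"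
proof -
  have *: "set us \<subseteq> carrier Q \<times> K \<Longrightarrow> \<exists>\<phi>\<in>carrier B. \<forall>w\<in>carrier Q. \<pi> \<phi> w = bimul Q us w" for us
  proof (induct us)
    case Nil
    show ?case by (intro bexI[of _ "\<zero>\<^bsub>B\<^esub>"]) (auto simp: \<pi>_zero B_zero_closed)
  next
    case (Cons u us)
    obtain y k where u: "u = (y, k)" by (cases u)
    then have yk: "y \<in> carrier Q" "k \<in> K" "set us \<subseteq> carrier Q \<times> carrier Q"
      using Cons.prems Q.K_subset by auto
    from Cons obtain \<phi> where \<phi>: "\<phi> \<in> carrier B" "\<And>w. w \<in> carrier Q \<Longrightarrow> \<pi> \<phi> w = bimul Q us w" by auto
    show ?case
    \<comment> \<open>Zero is the one element of \<open>K\<close> missing from the group; a term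
      with right factor zero is dropped.\<close>
    proof (cases "k = \<zero>\<^bsub>Q\<^esub>")
      case True
      then show ?thesis using \<phi> yk by (intro bexI[of _ \<phi>]) (auto simp: u)
    next
      case False
      then have k: "k \<in> carrier G" using yk by (simp add: G_simps)
      from h_surj[OF yk(1)] obtain a where a: "a \<in> carrier A" "h a = y" by auto
      then show ?thesis using \<phi> k
        by (intro bexI[of _ "mono A a k \<oplus>\<^bsub>B\<^esub> \<phi>"]) (auto simp: u \<pi>_add mono_closed \<pi>_mono intro: B_add_closed)
    qed
  qed
  from assms obtain us where us: "set us \<subseteq> carrier Q \<times> K" "\<forall>w\<in>carrier Q. T w = bimul Q us w"
    by (auto simp: biop_def)
  from *[OF us(1)] us(2) show ?thesis by auto
qed

section \<open>Elements with scalar coefficients and their map onto \<open>K\<close>\<close>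

definition PB :: "('q \<Rightarrow> 'a) set" where "PB = {\<phi> \<in> carrier B. \<forall>k. \<phi> k \<in> P0}"

lemma PB_closed:
  "PB \<subseteq> carrier B" "\<one>\<^bsub>B\<^esub> \<in> PB" "\<zero>\<^bsub>B\<^esub> \<in> PB" "\<phi> \<in> PB \<Longrightarrow> \<psi> \<in> PB \<Longrightarrow> \<phi> \<oplus>\<^bsub>B\<^esub> \<psi> \<in> PB"
  "\<phi> \<in> PB \<Longrightarrow> \<psi> \<in> PB \<Longrightarrow> \<phi> \<otimes>\<^bsub>B\<^esub> \<psi> \<in> PB" "\<phi> \<in> PB \<Longrightarrow> \<ominus>\<^bsub>B\<^esub> \<phi> \<in> PB"
  "a \<in> P0 \<Longrightarrow> k \<in> carrier G \<Longrightarrow> mono A a k \<in> PB"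
proof -
  show m: "mono A a k \<in> PB" if "a \<in> P0" "k \<in> carrier G" for a k
    using that P0 mono_closed[of a k] by (auto simp: PB_def) (auto simp: mono_def)
  show "\<one>\<^bsub>B\<^esub> \<in> PB" using m[of \<one> "\<one>\<^bsub>G\<^esub>"] P0(3) by (simp add: B_simps(2))
  show mul: "\<phi> \<otimes>\<^bsub>B\<^esub> \<psi> \<in> PB" if "\<phi> \<in> PB" "\<psi> \<in> PB" for \<phi> \<psi>
    using that P0(2,5) mult_closed[of \<phi> \<psi>] by (auto simp: PB_def) (auto simp: B_simps intro!: P0_finsum)
  show "\<ominus>\<^bsub>B\<^esub> \<phi> \<in> PB" if "\<phi> \<in> PB"
  proof -
    have \<phi>: "\<phi> \<in> carrier B" using that by (simp add: PB_def)
    have "\<one>\<^bsub>G\<^esub> \<in> carrier G" by simp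
    then have m1: "mono A (\<ominus> \<one>) \<one>\<^bsub>G\<^esub> \<in> PB" using m P0(3,6) by blast
    have "mono A (\<ominus> \<one>) \<one>\<^bsub>G\<^esub> \<oplus>\<^bsub>B\<^esub> \<one>\<^bsub>B\<^esub> = \<zero>\<^bsub>B\<^esub>"
      by (auto simp: B_simps mono_def l_neg)
    moreover have "mono A (\<ominus> \<one>) \<one>\<^bsub>G\<^esub> \<in> carrier B" by (simp add: mono_closed)
    ultimately have "mono A (\<ominus> \<one>) \<one>\<^bsub>G\<^esub> = \<ominus>\<^bsub>B\<^esub> \<one>\<^bsub>B\<^esub>" by (intro BB.minus_equality[symmetric]) auto
    then have "\<ominus>\<^bsub>B\<^esub> \<phi> = mono A (\<ominus> \<one>) \<one>\<^bsub>G\<^esub> \<otimes>\<^bsub>B\<^esub> \<phi>" using \<phi> by (simp add: BB.l_minus)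
    then show ?thesis using mul[OF m1 that] by simp
  qed
qed (use P0 in \<open>auto simp: PB_def B_add_closed B_zero_closed\<close>, auto simp: B_simps)

lemma PB_central:
  assumes \<phi>: "\<phi> \<in> PB" and \<psi>: "\<psi> \<in> carrier B"
  shows "\<phi> \<otimes>\<^bsub>B\<^esub> \<psi> = \<psi> \<otimes>\<^bsub>B\<^esub> \<phi>"
proof -
  have "(\<forall>k. \<phi> k \<in> P0) \<longrightarrow> \<phi> \<otimes>\<^bsub>B\<^esub> \<psi> = \<psi> \<otimes>\<^bsub>B\<^esub> \<phi>" if "\<phi> \<in> carrier B" for \<phi>
    using that
  proof (induct rule: B_induct)
    case zero
    then show ?case using \<psi> by (simp add: zero_mult mult_zero)
  next
    case (add \<phi> a k)
    show ?case
    proof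
      assume P: "\<forall>k'. (mono A a k \<oplus>\<^bsub>B\<^esub> \<phi>) k' \<in> P0"
      have "a \<in> P0" using P[rule_format, of k] add by (simp add: B_simps mono_def)
      moreover have "\<phi> k' \<in> P0" for k'
        using P[rule_format, of k'] add P0(2) B_closed[OF add(1), of k']
        by (cases "k' = k") (auto simp: B_simps mono_def)
      ultimately have IH: "\<phi> \<otimes>\<^bsub>B\<^esub> \<psi> = \<psi> \<otimes>\<^bsub>B\<^esub> \<phi>" and aP: "a \<in> P0" using add by auto
      have "mono A a k \<otimes>\<^bsub>B\<^esub> \<psi> = \<psi> \<otimes>\<^bsub>B\<^esub> mono A a k"
        using \<psi>
      proof (induct rule: B_induct)
        case zero
        then show ?case using add by (simp add: zero_mult mult_zero mono_closed)
      next
        case (add \<psi> b k')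
        note a = \<open>a \<in> carrier A\<close> \<open>k \<in> carrier G\<close>
        have "mono A a k \<otimes>\<^bsub>B\<^esub> mono A b k' = mono A b k' \<otimes>\<^bsub>B\<^esub> mono A a k"
          using a add P0(7)[OF aP add(2)] G.m_comm[OF a(2) add(3)] by (simp add: mono_mult_mono)
        then show ?case using a add by (simp add: B_l_distr B_r_distr mono_closed)
      qed
      then show "(mono A a k \<oplus>\<^bsub>B\<^esub> \<phi>) \<otimes>\<^bsub>B\<^esub> \<psi> = \<psi> \<otimes>\<^bsub>B\<^esub> (mono A a k \<oplus>\<^bsub>B\<^esub> \<phi>)"
        using IH add \<psi> by (simp add: B_l_distr B_r_distr mono_closed)
    qed
  qed
  then show ?thesis using assms by (simp add: PB_def)
qed

text \<open>The scalar coefficients reduce to central elements and can be moved across w, so an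
  element of \<open>PB\<close> acts on W as a single right multiplication. Reading off its value at
  e is the map from \<open>PB\<close> to \<open>K\<close>.\<close>

lemma \<pi>_PB:
  assumes \<phi>: "\<phi> \<in> PB" and w: "w \<in> Q.W"
  shows "\<pi> \<phi> e \<in> K" "\<pi> \<phi> w = w \<otimes>\<^bsub>Q\<^esub> \<pi> \<phi> e"
proof -
  have \<phi>B: "\<phi> \<in> carrier B" using \<phi> PB_closed(1) by auto
  have wQ: "w \<in> carrier Q" using w Q.W_closed by auto
  let ?F = "{k. \<phi> k \<noteq> \<zero>}"
  have F: "finite ?F" "\<And>k. k \<in> ?F \<Longrightarrow> k \<in> carrier G" using \<phi>B by (auto simp: B_carrier)
  have c: "h (\<phi> k) \<in> ring_center Q" for k using \<phi> center by (auto simp: PB_def)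
  have hQ: "h (\<phi> k) \<in> carrier Q" for k using h_closed B_closed[OF \<phi>B] by blast
  have eq: "\<pi> \<phi> e = (\<Oplus>\<^bsub>Q\<^esub>k\<in>?F. h (\<phi> k) \<otimes>\<^bsub>Q\<^esub> k)"
    unfolding \<pi>_def
  proof (rule Q.finsum_cong'[OF refl])
    fix k assume "k \<in> ?F"
    then have k: "k \<in> K" using F GK by blast
    show "h (\<phi> k) \<otimes>\<^bsub>Q\<^esub> e \<otimes>\<^bsub>Q\<^esub> k = h (\<phi> k) \<otimes>\<^bsub>Q\<^esub> k"
      using hQ Q.e(1) Q.K_memD(1,2)[OF k] by (simp add: Q.m_assoc)
  qed (use hQ F GK(2) in blast)
  show "\<pi> \<phi> e \<in> K" unfolding eq using Q.K_center[OF c] F(2) GK(1) by (intro Q.K_finsum) blast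
  show "\<pi> \<phi> w = w \<otimes>\<^bsub>Q\<^esub> \<pi> \<phi> e"
  proof -
    have "w \<otimes>\<^bsub>Q\<^esub> \<pi> \<phi> e = (\<Oplus>\<^bsub>Q\<^esub>k\<in>?F. w \<otimes>\<^bsub>Q\<^esub> (h (\<phi> k) \<otimes>\<^bsub>Q\<^esub> k))"
      unfolding eq using wQ hQ F GK(2) by (intro Q.finsum_rdistr F) blast+
    also have "\<dots> = \<pi> \<phi> w"
      unfolding \<pi>_def
    proof (rule Q.finsum_cong'[OF refl])
      fix k assume "k \<in> ?F"
      then have k: "k \<in> carrier Q" using F GK by blast
      show "w \<otimes>\<^bsub>Q\<^esub> (h (\<phi> k) \<otimes>\<^bsub>Q\<^esub> k) = h (\<phi> k) \<otimes>\<^bsub>Q\<^esub> w \<otimes>\<^bsub>Q\<^esub> k"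
        using Q.center_comm[OF c wQ] hQ[of k] wQ k by (simp add: Q.m_assoc)
    qed (use wQ hQ F GK(2) in blast)
    finally show ?thesis ..
  qed
qed

text \<open>A nonzero element of \<open>K\<close> is the image of the group element with the same
  name; this is why the multiplicative group of \<open>K\<close> was chosen.\<close>

lemma \<kappa>_surj:
  assumes "z \<in> K" shows "\<exists>\<phi>\<in>PB. \<pi> \<phi> e = z"
proof (cases "z = \<zero>\<^bsub>Q\<^esub>")
  case True
  then show ?thesis using PB_closed(3) \<pi>_zero by (intro bexI[of _ "\<zero>\<^bsub>B\<^esub>"]) auto
next
  case False
  then have "z \<in> carrier G" using assms by (simp add: G_simps)
  then show ?thesis
    using P0(3) Q.e assms Q.K_memD[OF assms] Ring.ring_hom_one[OF hom]
    by (intro bexI[of _ "mono A \<one> z"] PB_closed(7)) (auto simp: \<pi>_mono)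
qed

end

lemma (in ring) finsum_split:
  assumes "\<And>i. f i \<in> carrier R"
  shows "(\<Oplus>i\<in>{..<s + t}. f i) = (\<Oplus>i\<in>{..<s}. f i) \<oplus> (\<Oplus>p\<in>{..<t}. f (s + p :: nat))"
proof (induct t)
  case (Suc t)
  have "(\<Oplus>i\<in>{..<s + Suc t}. f i) = f (s + t) \<oplus> (\<Oplus>i\<in>{..<s + t}. f i)"
    using assms by (simp add: lessThan_Suc)
  also have "\<dots> = (\<Oplus>i\<in>{..<s}. f i) \<oplus> (f (s + t) \<oplus> (\<Oplus>p\<in>{..<t}. f (s + p)))"
    using assms unfolding Suc by (simp add: a_ac)
  finally show ?case using assms by (simp add: lessThan_Suc)
qed (use assms in simp)

context group_algebra
begin

lemma B_finsum_apply:
  assumes "finite I" "\<And>i. i \<in> I \<Longrightarrow> f i \<in> carrier B"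
  shows "(\<Oplus>\<^bsub>B\<^esub>i\<in>I. f i) k = (\<Oplus>i\<in>I. f i k)"
  using assms
proof (induct I)
  case (insert a I)
  have "(\<Oplus>\<^bsub>B\<^esub>i\<in>insert a I. f i) = f a \<oplus>\<^bsub>B\<^esub> (\<Oplus>\<^bsub>B\<^esub>i\<in>I. f i)"
    using insert by (intro BB.finsum_insert) auto
  then show ?case using insert by (simp add: B_simps(3) B_closed Pi_def)
qed (simp add: B_simps)

lemma mono_one_mult:
  assumes "a \<in> carrier R" "\<psi> \<in> carrier B"
  shows "(mono R a \<one>\<^bsub>G\<^esub> \<otimes>\<^bsub>B\<^esub> \<psi>) k = a \<otimes> \<psi> k"
proof (cases "k \<in> carrier G")
  case True
  then show ?thesis using mono_mult[OF assms(1) _ assms(2) True, of "\<one>\<^bsub>G\<^esub>"] by simp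
next
  case False
  then show ?thesis using assms by (simp add: mult_outside B_outside)
qed

lemma const_hom: "(\<lambda>a. mono R a \<one>\<^bsub>G\<^esub>) \<in> Ring.ring_hom R B"
  by (rule ring_hom_memI) (auto simp: mono_closed mono_add mono_mult_mono B_simps(2))

end

section \<open>Generators over \<open>PB\<close> and the kernel of the action\<close>

context local_split
begin

text \<open>The generators g followed by the lifted basis x. The g alone generate, but with x added
  the coefficients of the g can be taken in the kernel, so that modulo the kernel only the basis is
  seen.\<close>

definition y :: "nat \<Rightarrow> 'a" where "y i = (if i < s then g i else x (i - s))"
definition \<gamma> :: "nat \<Rightarrow> 'q \<Rightarrow> 'a" where "\<gamma> i = mono A (y i) \<one>\<^bsub>G\<^esub>"
text \<open>The kernel of the map from \<open>PB\<close> to \<open>K\<close>, the ideal to which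
  Nakayama's lemma is applied.\<close>

definition q :: "('q \<Rightarrow> 'a) set" where "q = {\<phi> \<in> PB. \<pi> \<phi> e = \<zero>\<^bsub>Q\<^esub>}"

lemma y_closed: "y i \<in> carrier A"
  using g x by (simp add: y_def)

lemma \<gamma>_closed: "\<gamma> i \<in> carrier B"
  using y_closed by (simp add: \<gamma>_def mono_closed)

lemma PB_B: "\<phi> \<in> PB \<Longrightarrow> \<phi> \<in> carrier B"
  using PB_closed(1) by auto

lemma \<pi>_finsum:
  assumes "finite I" "\<And>i. i \<in> I \<Longrightarrow> f i \<in> carrier B" "w \<in> carrier Q"
  shows "\<pi> (\<Oplus>\<^bsub>B\<^esub>i\<in>I. f i) w = (\<Oplus>\<^bsub>Q\<^esub>i\<in>I. \<pi> (f i) w)"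
  using assms(1,2)
proof (induct I)
  case (insert a I)
  have "(\<Oplus>\<^bsub>B\<^esub>i\<in>insert a I. f i) = f a \<oplus>\<^bsub>B\<^esub> (\<Oplus>\<^bsub>B\<^esub>i\<in>I. f i)"
    using insert by (intro BB.finsum_insert) auto
  moreover have "(\<Oplus>\<^bsub>B\<^esub>i\<in>I. f i) \<in> carrier B" using insert by (intro BB.finsum_closed) auto
  ultimately show ?case using insert assms(3) by (simp add: \<pi>_add \<pi>_closed Pi_def)
qed (simp add: \<pi>_zero)

text \<open>Subtracting a lift of the coordinates of h(a) leaves an element of the kernel of h,
  which the g absorb with coefficients in the kernel. The last clause keeps supports finite when the
  lemma is applied to each coefficient of an element of the group algebra.\<close>

lemma coords:
  assumes a: "a \<in> carrier A"
  shows "\<exists>r. (\<forall>i. r i \<in> P0) \<and> (\<forall>i<s. h (r i) = \<zero>\<^bsub>Q\<^esub>) \<and> a = (\<Oplus>i\<in>{..<s + N}. r i \<otimes> y i) \<and>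
    (a = \<zero> \<longrightarrow> (\<forall>i. r i = \<zero>))"
proof (cases "a = \<zero>")
  case True
  then show ?thesis using y_closed P0(2) by (intro exI[of _ "\<lambda>_. \<zero>"]) (auto simp: h_zero)
next
  case False
  from Q.\<epsilon>_span[OF h_closed[OF a]] obtain c where c: "\<And>p. c p \<in> ring_center Q"
    "h a = (\<Oplus>\<^bsub>Q\<^esub>p\<in>{..<N}. c p \<otimes>\<^bsub>Q\<^esub> \<epsilon> p)" by auto
  then have "\<forall>p. \<exists>r\<in>P0. h r = c p" unfolding center by (auto simp: image_iff) metis
  then obtain r where r: "\<And>p. r p \<in> P0" "\<And>p. h (r p) = c p" by metis
  have rA: "r p \<in> carrier A" for p using r P0 by auto
  define a' where "a' = (\<Oplus>p\<in>{..<N}. r p \<otimes> x p)"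
  have a'A: "a' \<in> carrier A" using rA x by (simp add: a'_def)
  have "h a' = h a"
    using rA x(1) unfolding c(2) a'_def by (simp add: h_finsum Ring.ring_hom_mult[OF hom] r x(2))
  then have "h (a \<oplus> \<ominus> a') = \<zero>\<^bsub>Q\<^esub>"
    using a a'A h_closed by (simp add: Ring.ring_hom_add[OF hom] h_uminus Q.r_neg)
  then obtain t where t: "\<And>i. t i \<in> P0" "\<And>i. h (t i) = \<zero>\<^bsub>Q\<^esub>" "a \<oplus> \<ominus> a' = (\<Oplus>i\<in>{..<s}. t i \<otimes> g i)"
    using ker[of "a \<oplus> \<ominus> a'"] a a'A by auto
  have tA: "t i \<in> carrier A" for i using t P0 by auto
  define u where "u i = (if i < s then t i else r (i - s))" for i
  have uA: "u i \<in> carrier A" for i using tA rA by (simp add: u_def)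
  have "(\<Oplus>i\<in>{..<s + N}. u i \<otimes> y i) = (\<Oplus>i\<in>{..<s}. u i \<otimes> y i) \<oplus> (\<Oplus>p\<in>{..<N}. u (s + p) \<otimes> y (s + p))"
    using uA y_closed by (intro finsum_split) auto
  also have "(\<Oplus>i\<in>{..<s}. u i \<otimes> y i) = (\<Oplus>i\<in>{..<s}. t i \<otimes> g i)"
    using tA g by (intro finsum_cong') (auto simp: u_def y_def)
  also have "(\<Oplus>p\<in>{..<N}. u (s + p) \<otimes> y (s + p)) = a'"
    using rA x by (simp add: u_def y_def a'_def)
  also have "(\<Oplus>i\<in>{..<s}. t i \<otimes> g i) \<oplus> a' = a"
    using a a'A by (simp flip: t(3)) (simp add: a_assoc l_neg)
  finally show ?thesis using False t r by (intro exI[of _ u]) (auto simp: u_def)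
qed

lemma B_coords:
  assumes \<phi>: "\<phi> \<in> carrier B"
  shows "\<exists>c. (\<forall>i. c i \<in> PB) \<and> (\<forall>i<s. c i \<in> q) \<and> \<phi> = (\<Oplus>\<^bsub>B\<^esub>i\<in>{..<s + N}. c i \<otimes>\<^bsub>B\<^esub> \<gamma> i)"
proof -
  have "\<forall>k. \<exists>r. (\<forall>i. r i \<in> P0) \<and> (\<forall>i<s. h (r i) = \<zero>\<^bsub>Q\<^esub>) \<and> \<phi> k = (\<Oplus>i\<in>{..<s + N}. r i \<otimes> y i) \<and>
    (\<phi> k = \<zero> \<longrightarrow> (\<forall>i. r i = \<zero>))"
    using coords B_closed[OF \<phi>] by blast
  then obtain r where r: "\<And>k i. r k i \<in> P0" "\<And>k i. i < s \<Longrightarrow> h (r k i) = \<zero>\<^bsub>Q\<^esub>"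
    "\<And>k. \<phi> k = (\<Oplus>i\<in>{..<s + N}. r k i \<otimes> y i)" "\<And>k i. \<phi> k = \<zero> \<Longrightarrow> r k i = \<zero>" by metis
  have rA: "r k i \<in> carrier A" for k i using r(1) P0 by auto
  define c where "c i = (\<lambda>k. r k i)" for i
  have cPB: "c i \<in> PB" for i
  proof -
    have "{k. c i k \<noteq> \<zero>} \<subseteq> {k. \<phi> k \<noteq> \<zero>}" using r(4) by (auto simp: c_def)
    moreover have "finite {k. \<phi> k \<noteq> \<zero>}" "{k. \<phi> k \<noteq> \<zero>} \<subseteq> carrier G" using \<phi> by (auto simp: B_carrier)
    ultimately have "finite {k. c i k \<noteq> \<zero>}" "{k. c i k \<noteq> \<zero>} \<subseteq> carrier G" using finite_subset by (blast, blast)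
    then show ?thesis using r(1) rA by (auto simp: PB_def B_carrier c_def)
  qed
  have "c i \<in> q" if i: "i < s" for i
  proof -
    have "h (c i k) \<otimes>\<^bsub>Q\<^esub> e \<otimes>\<^bsub>Q\<^esub> k = \<zero>\<^bsub>Q\<^esub>" if "k \<in> {k. c i k \<noteq> \<zero>}" for k
    proof -
      have "k \<in> carrier Q" using that B_outside[OF PB_B[OF cPB]] GK by blast
      then show ?thesis using r(2)[OF i] Q.e by (simp add: c_def)
    qed
    then have "\<pi> (c i) e = \<zero>\<^bsub>Q\<^esub>" unfolding \<pi>_def by (rule Q.add.finprod_one_eqI)
    then show ?thesis using cPB by (simp add: q_def)
  qed
  moreover have "\<phi> = (\<Oplus>\<^bsub>B\<^esub>i\<in>{..<s + N}. c i \<otimes>\<^bsub>B\<^esub> \<gamma> i)"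
  proof
    fix k
    have "(c i \<otimes>\<^bsub>B\<^esub> \<gamma> i) k = r k i \<otimes> y i" for i
    proof -
      have "(c i \<otimes>\<^bsub>B\<^esub> \<gamma> i) k = (\<gamma> i \<otimes>\<^bsub>B\<^esub> c i) k" using PB_central[OF cPB \<gamma>_closed] by simp
      also have "\<dots> = y i \<otimes> r k i"
        unfolding \<gamma>_def using mono_one_mult[OF y_closed PB_B[OF cPB]] by (simp add: c_def)
      also have "\<dots> = r k i \<otimes> y i" using P0(7)[OF r(1) y_closed] by simp
      finally show ?thesis .
    qed
    then show "\<phi> k = (\<Oplus>\<^bsub>B\<^esub>i\<in>{..<s + N}. c i \<otimes>\<^bsub>B\<^esub> \<gamma> i) k"
      using PB_B[OF cPB] \<gamma>_closed by (subst B_finsum_apply) (auto simp: mult_closed r(3)[of k])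
  qed
  ultimately show ?thesis using cPB by blast
qed

lemma q_closed:
  "q \<subseteq> PB" "\<phi> \<in> q \<Longrightarrow> \<psi> \<in> q \<Longrightarrow> \<phi> \<oplus>\<^bsub>B\<^esub> \<psi> \<in> q" "\<phi> \<in> PB \<Longrightarrow> \<psi> \<in> q \<Longrightarrow> \<phi> \<otimes>\<^bsub>B\<^esub> \<psi> \<in> q"
  "\<phi> \<in> q \<Longrightarrow> \<ominus>\<^bsub>B\<^esub> \<phi> \<in> q" "\<zero>\<^bsub>B\<^esub> \<in> q"
proof -
  show m: "\<phi> \<otimes>\<^bsub>B\<^esub> \<psi> \<in> q" if "\<phi> \<in> PB" "\<psi> \<in> q" for \<phi> \<psi>
    using that Q.e PB_closed by (auto simp: q_def \<pi>_mult PB_B \<pi>_zero_right)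
  show "\<ominus>\<^bsub>B\<^esub> \<phi> \<in> q" if "\<phi> \<in> q"
  proof -
    have "\<ominus>\<^bsub>B\<^esub> \<phi> = \<ominus>\<^bsub>B\<^esub> \<one>\<^bsub>B\<^esub> \<otimes>\<^bsub>B\<^esub> \<phi>" using that PB_B by (simp add: BB.l_minus q_def)
    then show ?thesis using m[of "\<ominus>\<^bsub>B\<^esub> \<one>\<^bsub>B\<^esub>" \<phi>] that PB_closed(2,6) by simp
  qed
qed (use Q.e PB_closed in \<open>auto simp: q_def \<pi>_add PB_B \<pi>_zero\<close>)

text \<open>The coefficients of the g lie in q by \<open>B_coords\<close>. An element that acts as
  zero on W has zero coordinates at the basis, by \<open>coordinates_zero\<close>, and this puts the
  coefficients of the x into q too.\<close>

lemma ker_\<pi>: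
  assumes \<phi>: "\<phi> \<in> carrier B" and zero: "\<And>w. w \<in> Q.W \<Longrightarrow> \<pi> \<phi> w = \<zero>\<^bsub>Q\<^esub>"
  shows "\<exists>c. (\<forall>i. c i \<in> q) \<and> \<phi> = (\<Oplus>\<^bsub>B\<^esub>i\<in>{..<s + N}. c i \<otimes>\<^bsub>B\<^esub> \<gamma> i)"
proof -
  from B_coords[OF \<phi>] obtain c where c: "\<And>i. c i \<in> PB" "\<And>i. i < s \<Longrightarrow> c i \<in> q"
    "\<phi> = (\<Oplus>\<^bsub>B\<^esub>i\<in>{..<s + N}. c i \<otimes>\<^bsub>B\<^esub> \<gamma> i)" by auto
  have cB: "c i \<in> carrier B" for i using c PB_B by auto
  have K: "\<pi> (c i) e \<in> K" for i using \<pi>_PB(1)[OF c(1) Q.W_closed(6)] .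
  have "(\<Oplus>\<^bsub>Q\<^esub>p\<in>{..<N}. \<epsilon> p \<otimes>\<^bsub>Q\<^esub> w \<otimes>\<^bsub>Q\<^esub> \<pi> (c (s + p)) e) = \<zero>\<^bsub>Q\<^esub>" if w: "w \<in> Q.W" for w
  proof -
    have wQ: "w \<in> carrier Q" using w Q.W_closed by auto
    have t: "\<pi> (c i \<otimes>\<^bsub>B\<^esub> \<gamma> i) w = h (y i) \<otimes>\<^bsub>Q\<^esub> w \<otimes>\<^bsub>Q\<^esub> \<pi> (c i) e" for i
    proof -
      have e1: "\<one>\<^bsub>G\<^esub> = e" "e \<in> carrier G" using Q.e Q.K_e by (simp_all add: G_simps)
      have "\<pi> (c i \<otimes>\<^bsub>B\<^esub> \<gamma> i) w = \<pi> (\<gamma> i) (\<pi> (c i) w)"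
        using PB_central[OF c(1) \<gamma>_closed] cB \<gamma>_closed wQ by (simp add: \<pi>_mult)
      also have "\<dots> = h (y i) \<otimes>\<^bsub>Q\<^esub> (w \<otimes>\<^bsub>Q\<^esub> \<pi> (c i) e) \<otimes>\<^bsub>Q\<^esub> e"
        using y_closed cB wQ \<pi>_PB(2)[OF c(1) w, of i] \<pi>_closed[of "c i" w]
        unfolding \<gamma>_def by (subst \<pi>_mono) (auto simp: e1)
      also have "\<dots> = h (y i) \<otimes>\<^bsub>Q\<^esub> w \<otimes>\<^bsub>Q\<^esub> \<pi> (c i) e"
        using h_closed[OF y_closed] wQ Q.e(1) Q.K_memD(1,3)[OF K] by (simp add: Q.m_assoc)
      finally show ?thesis .
    qed
    have cl: "h (y i) \<otimes>\<^bsub>Q\<^esub> w \<otimes>\<^bsub>Q\<^esub> \<pi> (c i) e \<in> carrier Q" for i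
      using h_closed[OF y_closed] wQ Q.K_memD(1)[OF K] by simp
    have "\<zero>\<^bsub>Q\<^esub> = \<pi> \<phi> w" using zero[OF w] by simp
    also have "\<dots> = (\<Oplus>\<^bsub>Q\<^esub>i\<in>{..<s + N}. h (y i) \<otimes>\<^bsub>Q\<^esub> w \<otimes>\<^bsub>Q\<^esub> \<pi> (c i) e)"
      unfolding c(3) using cB \<gamma>_closed wQ by (subst \<pi>_finsum) (auto simp: t mult_closed)
    also have "\<dots> = (\<Oplus>\<^bsub>Q\<^esub>i\<in>{..<s}. h (y i) \<otimes>\<^bsub>Q\<^esub> w \<otimes>\<^bsub>Q\<^esub> \<pi> (c i) e) \<oplus>\<^bsub>Q\<^esub>
        (\<Oplus>\<^bsub>Q\<^esub>p\<in>{..<N}. h (y (s + p)) \<otimes>\<^bsub>Q\<^esub> w \<otimes>\<^bsub>Q\<^esub> \<pi> (c (s + p)) e)"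
      using cl by (rule Q.finsum_split)
    also have "(\<Oplus>\<^bsub>Q\<^esub>i\<in>{..<s}. h (y i) \<otimes>\<^bsub>Q\<^esub> w \<otimes>\<^bsub>Q\<^esub> \<pi> (c i) e) = \<zero>\<^bsub>Q\<^esub>"
      using c(2) h_closed[OF y_closed] wQ by (intro Q.add.finprod_one_eqI) (auto simp: q_def)
    also have "(\<Oplus>\<^bsub>Q\<^esub>p\<in>{..<N}. h (y (s + p)) \<otimes>\<^bsub>Q\<^esub> w \<otimes>\<^bsub>Q\<^esub> \<pi> (c (s + p)) e) =
        (\<Oplus>\<^bsub>Q\<^esub>p\<in>{..<N}. \<epsilon> p \<otimes>\<^bsub>Q\<^esub> w \<otimes>\<^bsub>Q\<^esub> \<pi> (c (s + p)) e)"
      by (simp add: y_def x(2))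
    finally show ?thesis using Q.\<epsilon>_closed wQ Q.K_memD(1)[OF K] by simp
  qed
  from Q.coordinates_zero[OF K this] have z: "\<pi> (c (s + p)) e = \<zero>\<^bsub>Q\<^esub>" if "p < N" for p
    using that by blast
  \<comment> \<open>Coefficients beyond the range of summation are reset to zero so that every one
    lies in q.\<close>
  define d where "d i = (if i < s + N then c i else \<zero>\<^bsub>B\<^esub>)" for i
  have "d i \<in> q" for i
    using c(1,2) z[of "i - s"] q_closed(5) by (cases "i < s") (auto simp: d_def q_def)
  moreover have "\<phi> = (\<Oplus>\<^bsub>B\<^esub>i\<in>{..<s + N}. d i \<otimes>\<^bsub>B\<^esub> \<gamma> i)"
    unfolding c(3) using cB \<gamma>_closed by (intro BB.finsum_cong') (auto simp: d_def mult_closed)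
  ultimately show ?thesis by blast
qed

text \<open>Modulo \<open>q\<close> the group algebra becomes the full ring of \<open>l \<times> l\<close> matrices over \<open>K\<close>. The lift \<open>a\<close>
  of a nilpotent Jordan block generates, over \<open>PB\<close>, a commutative subring over which the lifts
  \<open>V i\<close> of the first column of matrix units generate everything; Nakayama's lemma turns this into an
  honest generation statement after multiplication by \<open>\<Delta> \<equiv> 1\<close> modulo \<open>q\<close>.\<close>

theorem local_identity:
  assumes N: "N \<le> n\<^sup>2" and f: "Z_identity (int_matrix_ring n) m f" and b: "\<And>k. b k \<in> carrier A"
  shows "\<exists>r\<in>P0. h r \<noteq> \<zero>\<^bsub>Q\<^esub> \<and> ncpoly_eval A b f \<otimes> r = \<zero>"
proof -
  from Q.ex_basis obtain l w where l: "l * l \<le> N" and w: "\<And>i. w i \<in> Q.W" and indep: "Q.k_indep l w"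
    and span: "\<And>u. u \<in> Q.W \<Longrightarrow> \<exists>c. (\<forall>i. c i \<in> K) \<and> u = (\<Oplus>\<^bsub>Q\<^esub>i\<in>{..<l}. w i \<otimes>\<^bsub>Q\<^esub> c i)" by blast
  have ln: "l \<le> n" using l N by (metis order_trans power2_eq_square power2_nat_le_eq_le)
  have wQ: "w i \<in> carrier Q" for i using w Q.W_closed by auto
  have lift: "\<exists>\<phi>\<in>carrier B. \<forall>j<l. \<pi> \<phi> (w j) = z j" if "\<And>j. z j \<in> Q.W" for z
  proof -
    from Q.interpolation[OF w indep, of z] that obtain T where T: "biop Q K T" "\<forall>j<l. T (w j) = z j" by blast
    from \<pi>_surj[OF T(1)] obtain \<phi> where "\<phi> \<in> carrier B" "\<forall>w\<in>carrier Q. \<pi> \<phi> w = T w" by blast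
    with T(2) wQ show ?thesis by (intro bexI[of _ \<phi>]) auto
  qed
  \<comment> \<open>Lifts of the matrix units of the first column: \<open>w 0\<close> goes to
    \<open>w i\<close>, the other basis vectors to zero.\<close>
  have "\<exists>\<phi>\<in>carrier B. \<forall>j<l. \<pi> \<phi> (w j) = (if j = 0 then w i else \<zero>\<^bsub>Q\<^esub>)" for i
    using w Q.W_closed(5) by (intro lift) auto
  then obtain V0 where V0: "\<And>i. V0 i \<in> carrier B"
    "\<And>i j. j < l \<Longrightarrow> \<pi> (V0 i) (w j) = (if j = 0 then w i else \<zero>\<^bsub>Q\<^esub>)" by metis
  \<comment> \<open>The row is padded with zeros from length l to length n, so that identities of n
    x n matrices apply.\<close>
  define V where "V i = (if i < l then V0 i else \<zero>\<^bsub>B\<^esub>)" for i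
  have V: "V i \<in> carrier B" for i using V0 B_zero_closed by (simp add: V_def)
  \<comment> \<open>The nilpotent shift; its j-th power sends \<open>w j\<close> to
    \<open>w 0\<close>.\<close>
  have "\<exists>\<phi>\<in>carrier B. \<forall>j<l. \<pi> \<phi> (w j) = (if j = 0 then \<zero>\<^bsub>Q\<^esub> else w (j - 1))"
    using w Q.W_closed(5) by (intro lift) auto
  then obtain a where a: "a \<in> carrier B"
    "\<And>j. j < l \<Longrightarrow> \<pi> a (w j) = (if j = 0 then \<zero>\<^bsub>Q\<^esub> else w (j - 1))" by metis
  have aj: "a [^]\<^bsub>B\<^esub> j \<in> carrier B" for j :: nat using a by simp
  have \<pi>a: "\<pi> (a [^]\<^bsub>B\<^esub> j) (w k) = (if j \<le> k then w (k - j) else \<zero>\<^bsub>Q\<^esub>)" if "k < l" for j k :: nat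
    using that
  proof (induct j arbitrary: k)
    case 0
    then show ?case using \<pi>_one[OF w] by simp
  next
    case (Suc j)
    have "\<pi> (a [^]\<^bsub>B\<^esub> Suc j) (w k) = \<pi> (a [^]\<^bsub>B\<^esub> j) (\<pi> a (w k))"
      using a aj wQ by (simp add: \<pi>_mult)
    then show ?case
      using a(2)[OF Suc.prems] Suc.hyps[of "k - 1"] Suc.prems aj
      by (cases k) (auto simp: \<pi>_zero_right)
  qed
  define C where "C = {z \<in> carrier B. z \<otimes>\<^bsub>B\<^esub> a = a \<otimes>\<^bsub>B\<^esub> z}"
  \<comment> \<open>The double centraliser of a: it contains a and all of \<open>PB\<close>, and it
    is commutative because a lies in C and so S lies in C. It contains the polynomials in a over
    \<open>PB\<close> without a need to describe them.\<close>
  define S where "S = {z \<in> carrier B. \<forall>t\<in>C. z \<otimes>\<^bsub>B\<^esub> t = t \<otimes>\<^bsub>B\<^esub> z}"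
  have aC: "a \<in> C" using a by (simp add: C_def)
  have SB: "z \<in> carrier B" if "z \<in> S" for z using that by (simp add: S_def)
  have SC: "z \<in> C" if "z \<in> S" for z using that aC by (auto simp: S_def C_def)
  have SD: "z \<otimes>\<^bsub>B\<^esub> t = t \<otimes>\<^bsub>B\<^esub> z" if "z \<in> S" "t \<in> C" for z t
    using that unfolding S_def by blast
  have S_comm: "z \<otimes>\<^bsub>B\<^esub> t = t \<otimes>\<^bsub>B\<^esub> z" if "z \<in> S" "t \<in> S" for z t
    using SD[OF that(1) SC[OF that(2)]] .
  have CB: "z \<in> carrier B" if "z \<in> C" for z using that by (simp add: C_def)
  have S_PB: "z \<in> S" if "z \<in> PB" for z
    using that PB_B PB_central CB by (auto simp: S_def)
  have S_a: "a \<in> S" using a by (auto simp: S_def C_def)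
  have S_add: "z \<oplus>\<^bsub>B\<^esub> t \<in> S" if "z \<in> S" "t \<in> S" for z t
    using that CB B_add_closed unfolding S_def by (simp add: B_l_distr B_r_distr)
  have S_mult: "z \<otimes>\<^bsub>B\<^esub> t \<in> S" if z: "z \<in> S" and t: "t \<in> S" for z t
  proof -
    have "z \<otimes>\<^bsub>B\<^esub> t \<otimes>\<^bsub>B\<^esub> u = u \<otimes>\<^bsub>B\<^esub> (z \<otimes>\<^bsub>B\<^esub> t)" if u: "u \<in> C" for u
    proof -
      note cl = SB[OF z] SB[OF t] CB[OF u]
      have "z \<otimes>\<^bsub>B\<^esub> t \<otimes>\<^bsub>B\<^esub> u = z \<otimes>\<^bsub>B\<^esub> (u \<otimes>\<^bsub>B\<^esub> t)"
        using B_assoc[OF cl(1,2,3)] SD[OF t u] by simp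
      also have "\<dots> = u \<otimes>\<^bsub>B\<^esub> z \<otimes>\<^bsub>B\<^esub> t" using B_assoc[OF cl(1,3,2)] SD[OF z u] by simp
      also have "\<dots> = u \<otimes>\<^bsub>B\<^esub> (z \<otimes>\<^bsub>B\<^esub> t)" using B_assoc[OF cl(3,1,2)] .
      finally show ?thesis .
    qed
    then show ?thesis unfolding S_def using mult_closed[OF SB[OF z] SB[OF t]] by blast
  qed
  have S_pow: "a [^]\<^bsub>B\<^esub> j \<in> S" for j :: nat
    using S_a S_mult S_PB[OF PB_closed(2)] by (induct j) auto
  have S_finsum: "(\<Oplus>\<^bsub>B\<^esub>j\<in>J. z j) \<in> S" if "\<And>j. z j \<in> S" for z :: "nat \<Rightarrow> _" and J
    using that SB S_PB[OF PB_closed(3)] S_add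
    by (induct J rule: infinite_finite_induct) (auto simp: Pi_def)
  define M where "M = {\<Oplus>\<^bsub>B\<^esub>i\<in>{..<n}. V i \<otimes>\<^bsub>B\<^esub> z i | z. \<forall>i. z i \<in> S}"
  have MI: "(\<Oplus>\<^bsub>B\<^esub>i\<in>{..<n}. V i \<otimes>\<^bsub>B\<^esub> z i) \<in> M" if "\<And>i. z i \<in> S" for z
    using that by (auto simp: M_def)
  have MD: "\<exists>z. (\<forall>i. z i \<in> S) \<and> u = (\<Oplus>\<^bsub>B\<^esub>i\<in>{..<n}. V i \<otimes>\<^bsub>B\<^esub> z i)" if "u \<in> M" for u
    using that by (auto simp: M_def)
  have MB: "M \<subseteq> carrier B" using V SB mult_closed by (auto simp: M_def intro!: BB.finsum_closed)
  have M_add: "u \<oplus>\<^bsub>B\<^esub> v \<in> M" if u: "u \<in> M" and v: "v \<in> M" for u v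
  proof -
    from MD[OF u] obtain z where z: "\<And>i. z i \<in> S" "u = (\<Oplus>\<^bsub>B\<^esub>i\<in>{..<n}. V i \<otimes>\<^bsub>B\<^esub> z i)" by blast
    from MD[OF v] obtain t where t: "\<And>i. t i \<in> S" "v = (\<Oplus>\<^bsub>B\<^esub>i\<in>{..<n}. V i \<otimes>\<^bsub>B\<^esub> t i)" by blast
    have "u \<oplus>\<^bsub>B\<^esub> v = (\<Oplus>\<^bsub>B\<^esub>i\<in>{..<n}. V i \<otimes>\<^bsub>B\<^esub> z i \<oplus>\<^bsub>B\<^esub> V i \<otimes>\<^bsub>B\<^esub> t i)"
      unfolding z(2) t(2) using V SB[OF z(1)] SB[OF t(1)] mult_closed by (intro BB.finsum_addf[symmetric]) auto
    also have "\<dots> = (\<Oplus>\<^bsub>B\<^esub>i\<in>{..<n}. V i \<otimes>\<^bsub>B\<^esub> (z i \<oplus>\<^bsub>B\<^esub> t i))"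
      using V SB[OF z(1)] SB[OF t(1)] mult_closed B_add_closed
      by (intro BB.finsum_cong') (auto simp: B_r_distr)
    finally show ?thesis using MI[of "\<lambda>i. z i \<oplus>\<^bsub>B\<^esub> t i"] S_add z t by simp
  qed
  have M_mult: "p \<otimes>\<^bsub>B\<^esub> u \<in> M" if p: "p \<in> PB" and u: "u \<in> M" for p u
  proof -
    from MD[OF u] obtain z where z: "\<And>i. z i \<in> S" "u = (\<Oplus>\<^bsub>B\<^esub>i\<in>{..<n}. V i \<otimes>\<^bsub>B\<^esub> z i)" by blast
    have pB: "p \<in> carrier B" using p PB_B by simp
    have "p \<otimes>\<^bsub>B\<^esub> u = (\<Oplus>\<^bsub>B\<^esub>i\<in>{..<n}. p \<otimes>\<^bsub>B\<^esub> (V i \<otimes>\<^bsub>B\<^esub> z i))"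
      unfolding z(2) using V SB[OF z(1)] mult_closed pB by (intro BB.finsum_rdistr) auto
    also have "\<dots> = (\<Oplus>\<^bsub>B\<^esub>i\<in>{..<n}. V i \<otimes>\<^bsub>B\<^esub> (p \<otimes>\<^bsub>B\<^esub> z i))"
    proof (rule BB.finsum_cong'[OF refl])
      fix i
      have "p \<otimes>\<^bsub>B\<^esub> (V i \<otimes>\<^bsub>B\<^esub> z i) = p \<otimes>\<^bsub>B\<^esub> V i \<otimes>\<^bsub>B\<^esub> z i" using V SB[OF z(1)] pB by (simp add: B_assoc)
      also have "\<dots> = V i \<otimes>\<^bsub>B\<^esub> (p \<otimes>\<^bsub>B\<^esub> z i)"
        using PB_central[OF p V] V SB[OF z(1)] pB by (simp add: B_assoc)
      finally show "p \<otimes>\<^bsub>B\<^esub> (V i \<otimes>\<^bsub>B\<^esub> z i) = V i \<otimes>\<^bsub>B\<^esub> (p \<otimes>\<^bsub>B\<^esub> z i)" .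
    qed (use V SB[OF z(1)] pB mult_closed in auto)
    finally show ?thesis using MI[of "\<lambda>i. p \<otimes>\<^bsub>B\<^esub> z i"] S_mult S_PB[OF p] z by simp
  qed
  \<comment> \<open>The right S-span M of the row reaches every element of the group algebra up to
    one that acts as zero on W.\<close>
  have approx: "\<exists>u\<in>M. \<forall>w\<in>Q.W. \<pi> (\<phi> \<ominus>\<^bsub>B\<^esub> u) w = \<zero>\<^bsub>Q\<^esub>" if \<phi>: "\<phi> \<in> carrier B" for \<phi>
  proof -
    have "\<forall>j. \<exists>c. (\<forall>i. c i \<in> K) \<and> \<pi> \<phi> (w j) = (\<Oplus>\<^bsub>Q\<^esub>i\<in>{..<l}. w i \<otimes>\<^bsub>Q\<^esub> c i)"
      using span \<pi>_W[OF \<phi> w] by blast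
    then obtain c where c: "\<And>j i. c j i \<in> K" "\<And>j. \<pi> \<phi> (w j) = (\<Oplus>\<^bsub>Q\<^esub>i\<in>{..<l}. w i \<otimes>\<^bsub>Q\<^esub> c j i)" by metis
    have cQ: "c j i \<in> carrier Q" for j i using c Q.K_subset by auto
    define p where "p j i = (SOME \<phi>. \<phi> \<in> PB \<and> \<pi> \<phi> e = c j i)" for j i
    have "p j i \<in> PB \<and> \<pi> (p j i) e = c j i" for j i
    proof -
      have "\<exists>\<phi>. \<phi> \<in> PB \<and> \<pi> \<phi> e = c j i" using \<kappa>_surj[OF c(1), of j i] by blast
      from someI_ex[OF this] show ?thesis unfolding p_def .
    qed
    then have p: "\<And>j i. p j i \<in> PB" "\<And>j i. \<pi> (p j i) e = c j i" by auto
    have pB: "p j i \<in> carrier B" for j i using p PB_B by auto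
    have \<pi>p: "\<pi> (p j i) (w k) = w k \<otimes>\<^bsub>Q\<^esub> c j i" for i j k using \<pi>_PB(2)[OF p(1) w] p(2) by simp
    \<comment> \<open>The column of \<open>\<phi> (w j)\<close> is put behind the j-th power of a.
      At \<open>w k\<close>, powers above k give zero, powers below k give a basis vector other than
      \<open>w 0\<close>, which \<open>V i\<close> kills, and the k-th power gives
      \<open>w 0\<close>; so V i * z i sends \<open>w k\<close> to its i-th component.\<close>
    define z where "z i = (\<Oplus>\<^bsub>B\<^esub>j\<in>{..<l}. a [^]\<^bsub>B\<^esub> j \<otimes>\<^bsub>B\<^esub> p j i)" for i
    have zS: "z i \<in> S" for i unfolding z_def by (intro S_finsum S_mult S_pow S_PB p)
    define u where "u = (\<Oplus>\<^bsub>B\<^esub>i\<in>{..<n}. V i \<otimes>\<^bsub>B\<^esub> z i)"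
    have uM: "u \<in> M" unfolding u_def using zS by (rule MI)
    then have uB: "u \<in> carrier B" using MB by auto
    have zw: "\<pi> (V i \<otimes>\<^bsub>B\<^esub> z i) (w k) = (if i < l then w i \<otimes>\<^bsub>Q\<^esub> c k i else \<zero>\<^bsub>Q\<^esub>)" if k: "k < l" for i k
    proof (cases "i < l")
      case False
      then show ?thesis using SB[OF zS] by (simp add: V_def zero_mult \<pi>_zero)
    next
      case True
      have l0: "k - j < l" for j using k by auto
      define t where "t j = (if j \<le> k then w (k - j) else \<zero>\<^bsub>Q\<^esub>)" for j
      have tQ: "t j \<in> carrier Q" for j using wQ by (simp add: t_def)
      have "\<pi> (z i) (w k) = (\<Oplus>\<^bsub>Q\<^esub>j\<in>{..<l}. \<pi> (a [^]\<^bsub>B\<^esub> j \<otimes>\<^bsub>B\<^esub> p j i) (w k))"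
        unfolding z_def using aj pB wQ mult_closed by (intro \<pi>_finsum) auto
      also have "\<dots> = (\<Oplus>\<^bsub>Q\<^esub>j\<in>{..<l}. t j \<otimes>\<^bsub>Q\<^esub> c j i)"
      proof (rule Q.finsum_cong'[OF refl])
        fix j
        have "\<pi> (a [^]\<^bsub>B\<^esub> j \<otimes>\<^bsub>B\<^esub> p j i) (w k) = \<pi> (a [^]\<^bsub>B\<^esub> j) (w k \<otimes>\<^bsub>Q\<^esub> c j i)"
          using aj pB wQ by (simp add: \<pi>_mult \<pi>p)
        also have "\<dots> = t j \<otimes>\<^bsub>Q\<^esub> c j i" using aj wQ c(1) \<pi>a[OF k] by (simp add: \<pi>_linear1 t_def)
        finally show "\<pi> (a [^]\<^bsub>B\<^esub> j \<otimes>\<^bsub>B\<^esub> p j i) (w k) = t j \<otimes>\<^bsub>Q\<^esub> c j i" .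
      qed (use tQ cQ in auto)
      finally have "\<pi> (V i \<otimes>\<^bsub>B\<^esub> z i) (w k) = \<pi> (V i) (\<Oplus>\<^bsub>Q\<^esub>j\<in>{..<l}. t j \<otimes>\<^bsub>Q\<^esub> c j i)"
        using V SB[OF zS] wQ by (simp add: \<pi>_mult)
      also have "\<dots> = (\<Oplus>\<^bsub>Q\<^esub>j\<in>{..<l}. \<pi> (V i) (t j) \<otimes>\<^bsub>Q\<^esub> c j i)"
        using V tQ c(1) by (intro \<pi>_linear) auto
      also have "\<dots> = (\<Oplus>\<^bsub>Q\<^esub>j\<in>{..<l}. if k = j then w i \<otimes>\<^bsub>Q\<^esub> c j i else \<zero>\<^bsub>Q\<^esub>)"
      proof (rule Q.finsum_cong'[OF refl])
        fix j
        have "\<pi> (V i) (t j) = (if k = j then w i else \<zero>\<^bsub>Q\<^esub>)"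
          using V0 True V0(2)[OF l0[of j], of i] by (auto simp: t_def V_def \<pi>_zero_right)
        then show "\<pi> (V i) (t j) \<otimes>\<^bsub>Q\<^esub> c j i = (if k = j then w i \<otimes>\<^bsub>Q\<^esub> c j i else \<zero>\<^bsub>Q\<^esub>)" using cQ by simp
      qed (use wQ cQ in auto)
      also have "\<dots> = w i \<otimes>\<^bsub>Q\<^esub> c k i" using k wQ cQ by (intro Q.add.finprod_singleton) auto
      finally show ?thesis using True by simp
    qed
    have eq: "\<pi> u (w k) = \<pi> \<phi> (w k)" if k: "k < l" for k
    proof -
      have "\<pi> u (w k) = (\<Oplus>\<^bsub>Q\<^esub>i\<in>{..<n}. if i < l then w i \<otimes>\<^bsub>Q\<^esub> c k i else \<zero>\<^bsub>Q\<^esub>)"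
        unfolding u_def using V SB[OF zS] wQ mult_closed by (subst \<pi>_finsum) (auto simp: zw[OF k])
      also have "\<dots> = (\<Oplus>\<^bsub>Q\<^esub>i\<in>{..<l}. w i \<otimes>\<^bsub>Q\<^esub> c k i)"
        using ln wQ cQ by (intro Q.add.finprod_mono_neutral_cong_right) auto
      finally show ?thesis using c(2) by simp
    qed
    have diff: "\<phi> \<ominus>\<^bsub>B\<^esub> u \<in> carrier B" using \<phi> uB by simp
    have zero: "\<pi> (\<phi> \<ominus>\<^bsub>B\<^esub> u) (w k) = \<zero>\<^bsub>Q\<^esub>" if k: "k < l" for k
    proof -
      have "(\<phi> \<ominus>\<^bsub>B\<^esub> u) \<oplus>\<^bsub>B\<^esub> u = \<phi>" using \<phi> uB by (simp add: a_minus_def BB.a_assoc BB.l_neg)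
      then have "\<pi> (\<phi> \<ominus>\<^bsub>B\<^esub> u) (w k) \<oplus>\<^bsub>Q\<^esub> \<pi> \<phi> (w k) = \<pi> \<phi> (w k)"
        using \<pi>_add[OF diff uB wQ, of k] eq[OF k] by metis
      then have "\<pi> (\<phi> \<ominus>\<^bsub>B\<^esub> u) (w k) \<oplus>\<^bsub>Q\<^esub> \<pi> \<phi> (w k) = \<zero>\<^bsub>Q\<^esub> \<oplus>\<^bsub>Q\<^esub> \<pi> \<phi> (w k)"
        using Q.l_zero[OF \<pi>_closed[OF \<phi> wQ]] by (rule trans[OF _ sym])
      then show ?thesis
        using Q.add.r_cancel[OF _ \<pi>_closed[OF diff wQ] Q.zero_closed \<pi>_closed[OF \<phi> wQ]] by blast
    qed
    have "\<pi> (\<phi> \<ominus>\<^bsub>B\<^esub> u) v = \<zero>\<^bsub>Q\<^esub>" if v: "v \<in> Q.W" for v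
    proof -
      from span[OF v] obtain c where c: "\<And>i. c i \<in> K" "v = (\<Oplus>\<^bsub>Q\<^esub>i\<in>{..<l}. w i \<otimes>\<^bsub>Q\<^esub> c i)" by blast
      have "\<pi> (\<phi> \<ominus>\<^bsub>B\<^esub> u) v = (\<Oplus>\<^bsub>Q\<^esub>i\<in>{..<l}. \<pi> (\<phi> \<ominus>\<^bsub>B\<^esub> u) (w i) \<otimes>\<^bsub>Q\<^esub> c i)"
        unfolding c(2) using wQ c(1) by (intro \<pi>_linear diff) auto
      also have "\<dots> = \<zero>\<^bsub>Q\<^esub>"
        using zero Q.K_memD(1)[OF c(1)] by (intro Q.add.finprod_one_eqI) auto
      finally show ?thesis .
    qed
    then show ?thesis using uM by blast
  qed
  \<comment> \<open>By \<open>approx\<close> and \<open>ker_\<pi>\<close>, each generator lies in M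
    plus the q-span of the generators, which is the hypothesis of Nakayama's lemma with factor
    1.\<close>
  have "\<exists>\<delta>\<in>PB. \<delta> \<ominus>\<^bsub>B\<^esub> \<one>\<^bsub>B\<^esub> \<in> q \<and> (\<forall>i<s + N. \<delta> \<otimes>\<^bsub>B\<^esub> \<gamma> i \<in> M)"
  proof (rule BB.nakayama)
    fix i assume "i < s + N"
    from approx[OF \<gamma>_closed, of i] obtain u where u: "u \<in> M" "\<And>w. w \<in> Q.W \<Longrightarrow> \<pi> (\<gamma> i \<ominus>\<^bsub>B\<^esub> u) w = \<zero>\<^bsub>Q\<^esub>" by blast
    have uB: "u \<in> carrier B" using u MB by auto
    from ker_\<pi>[OF BB.minus_closed[OF \<gamma>_closed uB] u(2)] obtain c where
      c: "\<And>j. c j \<in> q" "\<gamma> i \<ominus>\<^bsub>B\<^esub> u = (\<Oplus>\<^bsub>B\<^esub>j\<in>{..<s + N}. c j \<otimes>\<^bsub>B\<^esub> \<gamma> j)" by blast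
    have "u \<oplus>\<^bsub>B\<^esub> (\<Oplus>\<^bsub>B\<^esub>j\<in>{..<s + N}. c j \<otimes>\<^bsub>B\<^esub> \<gamma> j) \<in> BB.comb M q \<gamma> (s + N)"
      using u c q_closed(1) PB_closed(1) MB \<gamma>_closed by (intro BB.comb_memI) auto
    also have "u \<oplus>\<^bsub>B\<^esub> (\<Oplus>\<^bsub>B\<^esub>j\<in>{..<s + N}. c j \<otimes>\<^bsub>B\<^esub> \<gamma> j) = \<gamma> i"
      unfolding c(2)[symmetric] using uB \<gamma>_closed[of i] by (simp add: a_minus_def BB.a_ac BB.r_neg)
        (simp add: BB.r_neg BB.r_neg1 BB.r_neg2)
    finally show "\<exists>\<delta>\<in>PB. \<delta> \<ominus>\<^bsub>B\<^esub> \<one>\<^bsub>B\<^esub> \<in> q \<and> \<delta> \<otimes>\<^bsub>B\<^esub> \<gamma> i \<in> BB.comb M q \<gamma> (s + N)"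
      using \<gamma>_closed[of i] PB_closed(2) q_closed(5)
      by (intro bexI[of _ "\<one>\<^bsub>B\<^esub>"]) (auto simp: one_mult a_minus_def BB.r_neg)
  qed (use PB_closed PB_central q_closed MB M_add M_mult \<gamma>_closed in auto)
  then obtain \<Delta> where \<Delta>: "\<Delta> \<in> PB" "\<Delta> \<ominus>\<^bsub>B\<^esub> \<one>\<^bsub>B\<^esub> \<in> q" "\<And>i. i < s + N \<Longrightarrow> \<Delta> \<otimes>\<^bsub>B\<^esub> \<gamma> i \<in> M" by blast
  have \<Delta>B: "\<Delta> \<in> carrier B" using \<Delta> PB_B by auto
  \<comment> \<open>The generators span the group algebra over \<open>PB\<close>, and
    \<open>\<Delta>\<close> is central, so it carries the whole algebra into M.\<close>
  have \<Delta>M: "\<phi> \<otimes>\<^bsub>B\<^esub> \<Delta> \<in> M" if \<phi>: "\<phi> \<in> carrier B" for \<phi>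
  proof -
    from B_coords[OF \<phi>] obtain c where c: "\<And>i. c i \<in> PB" "\<phi> = (\<Oplus>\<^bsub>B\<^esub>i\<in>{..<s + N}. c i \<otimes>\<^bsub>B\<^esub> \<gamma> i)" by auto
    have cB: "c i \<in> carrier B" for i using c PB_B by auto
    have M0: "\<zero>\<^bsub>B\<^esub> \<in> M"
      using M_mult[OF PB_closed(3) MI[of "\<lambda>_. \<one>\<^bsub>B\<^esub>"]] S_PB[OF PB_closed(2)] MB MI[of "\<lambda>_. \<one>\<^bsub>B\<^esub>"]
      by (simp add: subset_iff)
    have "\<phi> \<otimes>\<^bsub>B\<^esub> \<Delta> = (\<Oplus>\<^bsub>B\<^esub>i\<in>{..<s + N}. c i \<otimes>\<^bsub>B\<^esub> \<gamma> i \<otimes>\<^bsub>B\<^esub> \<Delta>)"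
      unfolding c(2) using cB \<gamma>_closed \<Delta>B mult_closed by (intro BB.finsum_ldistr) auto
    also have "\<dots> = (\<Oplus>\<^bsub>B\<^esub>i\<in>{..<s + N}. c i \<otimes>\<^bsub>B\<^esub> (\<Delta> \<otimes>\<^bsub>B\<^esub> \<gamma> i))"
      using cB \<gamma>_closed \<Delta>B mult_closed PB_central[OF \<Delta>(1) \<gamma>_closed]
      by (intro BB.finsum_cong') (auto simp: B_assoc)
    also have "\<dots> \<in> M"
    proof -
      have "t \<le> s + N \<Longrightarrow> (\<Oplus>\<^bsub>B\<^esub>i\<in>{..<t}. c i \<otimes>\<^bsub>B\<^esub> (\<Delta> \<otimes>\<^bsub>B\<^esub> \<gamma> i)) \<in> M" for t
      proof (induct t)
        case 0
        then show ?case using M0 by simp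
      next
        case (Suc t)
        have "(\<Oplus>\<^bsub>B\<^esub>i\<in>{..<Suc t}. c i \<otimes>\<^bsub>B\<^esub> (\<Delta> \<otimes>\<^bsub>B\<^esub> \<gamma> i)) =
            c t \<otimes>\<^bsub>B\<^esub> (\<Delta> \<otimes>\<^bsub>B\<^esub> \<gamma> t) \<oplus>\<^bsub>B\<^esub> (\<Oplus>\<^bsub>B\<^esub>i\<in>{..<t}. c i \<otimes>\<^bsub>B\<^esub> (\<Delta> \<otimes>\<^bsub>B\<^esub> \<gamma> i))"
          unfolding lessThan_Suc using cB \<gamma>_closed \<Delta>B mult_closed by (intro BB.finsum_insert) auto
        then show ?case using Suc M_add M_mult[OF c(1) \<Delta>(3)] by simp
      qed
      then show ?thesis by blast
    qed
    finally show ?thesis .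
  qed
  define \<beta> where "\<beta> k = mono A (b k) \<one>\<^bsub>G\<^esub>" for k
  have \<beta>: "\<beta> k \<in> carrier B" for k using b by (simp add: \<beta>_def mono_closed)
  define Z where "Z k i = (SOME z. (\<forall>j. z j \<in> S) \<and>
      \<beta> k \<otimes>\<^bsub>B\<^esub> V i \<otimes>\<^bsub>B\<^esub> \<Delta> = (\<Oplus>\<^bsub>B\<^esub>j\<in>{..<n}. V j \<otimes>\<^bsub>B\<^esub> z j))" for k i
  have "(\<forall>j. Z k i j \<in> S) \<and> \<beta> k \<otimes>\<^bsub>B\<^esub> V i \<otimes>\<^bsub>B\<^esub> \<Delta> = (\<Oplus>\<^bsub>B\<^esub>j\<in>{..<n}. V j \<otimes>\<^bsub>B\<^esub> Z k i j)" for k i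
    using someI_ex[OF MD[OF \<Delta>M[OF mult_closed[OF \<beta> V]], of k i]] unfolding Z_def .
  then have Z: "\<And>k i j. Z k i j \<in> S"
      "\<And>k i. \<beta> k \<otimes>\<^bsub>B\<^esub> V i \<otimes>\<^bsub>B\<^esub> \<Delta> = (\<Oplus>\<^bsub>B\<^esub>j\<in>{..<n}. V j \<otimes>\<^bsub>B\<^esub> Z k i j)" by blast+
  define Y where "Y = (\<lambda>(k, j, i). Z k i j)"
  have YS: "Y t \<in> S" for t using Z(1) by (simp add: Y_def split: prod.splits)
  have "\<exists>D::nat. \<forall>i<n. ncpoly_eval B \<beta> f \<otimes>\<^bsub>B\<^esub> V i \<otimes>\<^bsub>B\<^esub> \<Delta> [^]\<^bsub>B\<^esub> D = \<zero>\<^bsub>B\<^esub>"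
  proof (rule BB.identity_annihilates_row[OF f \<beta> V])
    show "Y t \<in> carrier B" for t using SB[OF YS] .
    show "Y t \<otimes>\<^bsub>B\<^esub> Y u = Y u \<otimes>\<^bsub>B\<^esub> Y t" for t u by (rule S_comm[OF YS YS])
    show "\<Delta> \<in> carrier B" by (rule \<Delta>B)
    show "\<Delta> \<otimes>\<^bsub>B\<^esub> t = t \<otimes>\<^bsub>B\<^esub> \<Delta>" if "t \<in> carrier B" for t using PB_central[OF \<Delta>(1) that] .
    show "\<beta> k \<otimes>\<^bsub>B\<^esub> V i \<otimes>\<^bsub>B\<^esub> \<Delta> = (\<Oplus>\<^bsub>B\<^esub>j\<in>{..<n}. V j \<otimes>\<^bsub>B\<^esub> Y (k, j, i))" for k i
      using Z(2) by (simp add: Y_def)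
  qed
  then obtain D :: nat where D: "\<And>i. i < n \<Longrightarrow> ncpoly_eval B \<beta> f \<otimes>\<^bsub>B\<^esub> V i \<otimes>\<^bsub>B\<^esub> \<Delta> [^]\<^bsub>B\<^esub> D = \<zero>\<^bsub>B\<^esub>" by blast
  define F where "F = ncpoly_eval A b f"
  have FA: "F \<in> carrier A" unfolding F_def using b by (rule ncpoly_eval_closed)
  have F: "ncpoly_eval B \<beta> f = mono A F \<one>\<^bsub>G\<^esub>"
    unfolding F_def \<beta>_def using ring_hom_ncpoly_eval[OF ring_axioms ring_B const_hom b] by simp
  have FB: "mono A F \<one>\<^bsub>G\<^esub> \<in> carrier B" using FA by (simp add: mono_closed)
  have \<Delta>j: "\<Delta> [^]\<^bsub>B\<^esub> j \<in> PB" for j :: nat using \<Delta>(1) PB_closed(2,5) by (induct j) auto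
  have "mono A F \<one>\<^bsub>G\<^esub> \<otimes>\<^bsub>B\<^esub> \<Delta> [^]\<^bsub>B\<^esub> Suc D = \<zero>\<^bsub>B\<^esub>"
  proof -
    \<comment> \<open>One more factor \<open>\<Delta>\<close> is a combination of the row with
      coefficients on the right, so annihilating the row up to the D-th power annihilates
      \<open>\<Delta>\<close> to the power D + 1.\<close>
    have "\<Delta> \<in> M" using \<Delta>M[OF BB.one_closed] \<Delta>B by (simp add: one_mult)
    from MD[OF this] obtain z where z: "\<And>i. z i \<in> S" "\<Delta> = (\<Oplus>\<^bsub>B\<^esub>i\<in>{..<n}. V i \<otimes>\<^bsub>B\<^esub> z i)" by blast
    let ?E = "\<Delta> [^]\<^bsub>B\<^esub> D"
    have E: "?E \<in> carrier B" using \<Delta>j PB_B by auto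
    have "mono A F \<one>\<^bsub>G\<^esub> \<otimes>\<^bsub>B\<^esub> \<Delta> [^]\<^bsub>B\<^esub> Suc D = mono A F \<one>\<^bsub>G\<^esub> \<otimes>\<^bsub>B\<^esub> ?E \<otimes>\<^bsub>B\<^esub> \<Delta>"
      using FB E \<Delta>B by (simp add: B_assoc)
    also have "\<dots> = mono A F \<one>\<^bsub>G\<^esub> \<otimes>\<^bsub>B\<^esub> ?E \<otimes>\<^bsub>B\<^esub> (\<Oplus>\<^bsub>B\<^esub>i\<in>{..<n}. V i \<otimes>\<^bsub>B\<^esub> z i)"
      using z(2) by simp
    also have "\<dots> = (\<Oplus>\<^bsub>B\<^esub>i\<in>{..<n}. mono A F \<one>\<^bsub>G\<^esub> \<otimes>\<^bsub>B\<^esub> ?E \<otimes>\<^bsub>B\<^esub> (V i \<otimes>\<^bsub>B\<^esub> z i))"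
      using FB E V SB[OF z(1)] mult_closed by (intro BB.finsum_rdistr) auto
    also have "\<dots> = \<zero>\<^bsub>B\<^esub>"
    proof (rule BB.add.finprod_one_eqI)
      fix i assume "i \<in> {..<n}"
      then have i: "mono A F \<one>\<^bsub>G\<^esub> \<otimes>\<^bsub>B\<^esub> V i \<otimes>\<^bsub>B\<^esub> ?E = \<zero>\<^bsub>B\<^esub>" using D F by simp
      have "mono A F \<one>\<^bsub>G\<^esub> \<otimes>\<^bsub>B\<^esub> ?E \<otimes>\<^bsub>B\<^esub> (V i \<otimes>\<^bsub>B\<^esub> z i) = mono A F \<one>\<^bsub>G\<^esub> \<otimes>\<^bsub>B\<^esub> (?E \<otimes>\<^bsub>B\<^esub> V i) \<otimes>\<^bsub>B\<^esub> z i"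
        using FB E V SB[OF z(1)] mult_closed by (simp add: B_assoc)
      also have "?E \<otimes>\<^bsub>B\<^esub> V i = V i \<otimes>\<^bsub>B\<^esub> ?E" by (rule PB_central[OF \<Delta>j V])
      also have "mono A F \<one>\<^bsub>G\<^esub> \<otimes>\<^bsub>B\<^esub> (V i \<otimes>\<^bsub>B\<^esub> ?E) = \<zero>\<^bsub>B\<^esub>"
        using i FB E V by (simp add: B_assoc)
      finally show "mono A F \<one>\<^bsub>G\<^esub> \<otimes>\<^bsub>B\<^esub> ?E \<otimes>\<^bsub>B\<^esub> (V i \<otimes>\<^bsub>B\<^esub> z i) = \<zero>\<^bsub>B\<^esub>"
        using SB[OF z(1)] by (simp add: zero_mult)
    qed
    finally show ?thesis .
  qed
  \<comment> \<open>Multiplication by a constant acts on each coefficient separately, so every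
    coefficient of the power of \<open>\<Delta>\<close> annihilates F.\<close>
  then have F0: "F \<otimes> (\<Delta> [^]\<^bsub>B\<^esub> Suc D) k = \<zero>" for k
    using mono_one_mult[OF FA PB_B[OF \<Delta>j], of "Suc D" k] by (simp add: B_simps(1))
  have eW: "e \<in> Q.W" "e \<in> carrier Q" using Q.W_closed(6) Q.e by auto
  \<comment> \<open>As \<open>\<Delta>\<close> is 1 modulo q, its powers act as the identity on e;
    hence their coefficients cannot all reduce to zero, and one that does not is the required
    scalar.\<close>
  have \<pi>\<Delta>: "\<pi> \<Delta> e = e"
  proof -
    have "\<Delta> = (\<Delta> \<ominus>\<^bsub>B\<^esub> \<one>\<^bsub>B\<^esub>) \<oplus>\<^bsub>B\<^esub> \<one>\<^bsub>B\<^esub>" using \<Delta>B by (simp add: a_minus_def BB.a_assoc BB.l_neg)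
    then have "\<pi> \<Delta> e = \<pi> (\<Delta> \<ominus>\<^bsub>B\<^esub> \<one>\<^bsub>B\<^esub>) e \<oplus>\<^bsub>Q\<^esub> \<pi> \<one>\<^bsub>B\<^esub> e"
      using \<pi>_add[of "\<Delta> \<ominus>\<^bsub>B\<^esub> \<one>\<^bsub>B\<^esub>" "\<one>\<^bsub>B\<^esub>" e] \<Delta>B eW by simp
    then show ?thesis using \<Delta>(2) eW \<pi>_one by (simp add: q_def)
  qed
  have "\<pi> (\<Delta> [^]\<^bsub>B\<^esub> j) e = e" for j :: nat
  proof (induct j)
    case 0
    then show ?case using eW \<pi>_one by simp
  next
    case (Suc j)
    then show ?case using \<Delta>B PB_B[OF \<Delta>j] eW \<pi>\<Delta> by (simp add: \<pi>_mult)
  qed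
  moreover have "\<pi> (\<Delta> [^]\<^bsub>B\<^esub> Suc D) e = \<zero>\<^bsub>Q\<^esub>" if "\<And>k. h ((\<Delta> [^]\<^bsub>B\<^esub> Suc D) k) = \<zero>\<^bsub>Q\<^esub>"
    unfolding \<pi>_def
  proof (rule Q.add.finprod_one_eqI)
    fix k assume "k \<in> {k. (\<Delta> [^]\<^bsub>B\<^esub> Suc D) k \<noteq> \<zero>}"
    then have "k \<in> carrier Q" using B_outside[OF PB_B[OF \<Delta>j]] GK by blast
    then show "h ((\<Delta> [^]\<^bsub>B\<^esub> Suc D) k) \<otimes>\<^bsub>Q\<^esub> e \<otimes>\<^bsub>Q\<^esub> k = \<zero>\<^bsub>Q\<^esub>" unfolding that using eW by simp
  qed
  ultimately obtain k where k: "h ((\<Delta> [^]\<^bsub>B\<^esub> Suc D) k) \<noteq> \<zero>\<^bsub>Q\<^esub>" using Q.e(3) by metis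
  have "(\<Delta> [^]\<^bsub>B\<^esub> Suc D) k \<in> P0" using \<Delta>j[of "Suc D"] by (simp add: PB_def)
  with k F0[of k] show ?thesis unfolding F_def by blast
qed

end

section \<open>Localization\<close>

lemma UN_constant_eq:
  assumes "A \<noteq> {}" "\<And>x. x \<in> A \<Longrightarrow> f x = c" shows "(\<Union>x\<in>A. f x) = c"
  using assms by auto

text \<open>Operations on classes are defined as unions over all representatives; independence of
  the representatives means that the united sets all coincide.\<close>

lemma UN2_constant_eq:
  assumes "A \<noteq> {}" "B \<noteq> {}" "\<And>a s b t. (a, s) \<in> A \<Longrightarrow> (b, t) \<in> B \<Longrightarrow> f a s b t = c"
  shows "(\<Union>(a, s)\<in>A. \<Union>(b, t)\<in>B. f a s b t) = c"
proof (rule UN_constant_eq[OF assms(1)])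
  fix z assume "z \<in> A"
  then obtain a s where z: "z = (a, s)" "(a, s) \<in> A" by (cases z) auto
  have "(\<Union>(b, t)\<in>B. f a s b t) = c"
  proof (rule UN_constant_eq[OF assms(2)])
    fix w assume "w \<in> B"
    then show "(case w of (b, t) \<Rightarrow> f a s b t) = c" using assms(3)[OF z(2)] by (cases w) auto
  qed
  then show "(case z of (a, s) \<Rightarrow> \<Union>(b, t)\<in>B. f a s b t) = c" using z by simp
qed

locale multiplicative_set = cring R for R (structure) +
  fixes S
  assumes S_subset: "S \<subseteq> carrier R" and S_one: "\<one> \<in> S" and S_mult: "\<And>s t. s \<in> S \<Longrightarrow> t \<in> S \<Longrightarrow> s \<otimes> t \<in> S"
begin

abbreviation frac :: "'a \<Rightarrow> 'a \<Rightarrow> ('a \<times> 'a) set" where "frac \<equiv> fraction R S"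
abbreviation T :: "('a \<times> 'a) set ring" where "T \<equiv> localization R S"

lemma S_carrier: "s \<in> S \<Longrightarrow> s \<in> carrier R"
  using S_subset by auto

lemma equiv_fraction_rel: "equiv (carrier R \<times> S) (fraction_rel R S)"
proof (rule equivI)
  show "fraction_rel R S \<subseteq> (carrier R \<times> S) \<times> carrier R \<times> S" by (auto simp: fraction_rel_def)
  show "refl_on (carrier R \<times> S) (fraction_rel R S)"
  proof (rule refl_onI)
    fix z assume "z \<in> carrier R \<times> S"
    then obtain a s where z: "z = (a, s)" "a \<in> carrier R" "s \<in> S" by auto
    then show "(z, z) \<in> fraction_rel R S"
      using S_one S_carrier by (auto simp: fraction_rel_def a_minus_def r_neg intro!: bexI[of _ \<one>])
  qed
  show "sym (fraction_rel R S)"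
  proof (rule symI)
    fix z w assume "(z, w) \<in> fraction_rel R S"
    then obtain a s b t u where z: "z = (a, s)" "w = (b, t)" "a \<in> carrier R" "s \<in> S" "b \<in> carrier R" "t \<in> S"
      "u \<in> S" "u \<otimes> (a \<otimes> t \<ominus> b \<otimes> s) = \<zero>" by (auto simp: fraction_rel_def)
    have R: "a \<in> carrier R" "s \<in> carrier R" "b \<in> carrier R" "t \<in> carrier R" "u \<in> carrier R"
      using z S_carrier by auto
    then have "u \<otimes> (b \<otimes> s \<ominus> a \<otimes> t) = \<ominus> (u \<otimes> (a \<otimes> t \<ominus> b \<otimes> s))" by algebra
    then have "u \<otimes> (b \<otimes> s \<ominus> a \<otimes> t) = \<zero>" using z(8) by simp
    then show "(w, z) \<in> fraction_rel R S" using z by (auto simp: fraction_rel_def)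
  qed
  show "trans (fraction_rel R S)"
  proof (rule transI)
    fix z w y assume "(z, w) \<in> fraction_rel R S" "(w, y) \<in> fraction_rel R S"
    then obtain a s b t u c r v where z: "z = (a, s)" "w = (b, t)" "y = (c, r)" "a \<in> carrier R" "s \<in> S"
      "b \<in> carrier R" "t \<in> S" "c \<in> carrier R" "r \<in> S" "u \<in> S" "v \<in> S"
      and eq: "u \<otimes> (a \<otimes> t \<ominus> b \<otimes> s) = \<zero>" "v \<otimes> (b \<otimes> r \<ominus> c \<otimes> t) = \<zero>" by (auto simp: fraction_rel_def)
    have R: "a \<in> carrier R" "s \<in> carrier R" "b \<in> carrier R" "t \<in> carrier R" "u \<in> carrier R"
      "c \<in> carrier R" "r \<in> carrier R" "v \<in> carrier R"
      using z S_carrier by auto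
    \<comment> \<open>The witness for transitivity contains the middle denominator t besides the two
      given witnesses.\<close>
    then have "(u \<otimes> v \<otimes> t) \<otimes> (a \<otimes> r \<ominus> c \<otimes> s) =
      (v \<otimes> r) \<otimes> (u \<otimes> (a \<otimes> t \<ominus> b \<otimes> s)) \<oplus> (u \<otimes> s) \<otimes> (v \<otimes> (b \<otimes> r \<ominus> c \<otimes> t))" by algebra
    then have "(u \<otimes> v \<otimes> t) \<otimes> (a \<otimes> r \<ominus> c \<otimes> s) = \<zero>" using eq R by simp
    moreover have "u \<otimes> v \<otimes> t \<in> S" using z S_mult by auto
    ultimately show "(z, y) \<in> fraction_rel R S" using z by (auto simp: fraction_rel_def)
  qed
qed

lemma frac_eq_iff:
  assumes "a \<in> carrier R" "s \<in> S" "b \<in> carrier R" "t \<in> S"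
  shows "frac a s = frac b t \<longleftrightarrow> (\<exists>u\<in>S. u \<otimes> (a \<otimes> t \<ominus> b \<otimes> s) = \<zero>)"
  unfolding fraction_def using assms
  by (subst eq_equiv_class_iff[OF equiv_fraction_rel]) (auto simp: fraction_rel_def)

lemma cross_eq:
  assumes "u \<in> carrier R" "x \<in> carrier R" "y \<in> carrier R"
  shows "u \<otimes> (x \<ominus> y) = \<zero> \<longleftrightarrow> u \<otimes> x = u \<otimes> y"
proof -
  have "u \<otimes> (x \<ominus> y) = u \<otimes> x \<ominus> u \<otimes> y" using assms by (simp add: a_minus_def r_distr r_minus)
  then show ?thesis using assms by simp
qed

lemma frac_eqI:
  assumes "a \<in> carrier R" "s \<in> S" "b \<in> carrier R" "t \<in> S" "a \<otimes> t = b \<otimes> s"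
  shows "frac a s = frac b t"
  using assms S_one S_carrier by (subst frac_eq_iff) (auto simp: a_minus_def r_neg intro!: bexI[of _ \<one>])

lemma frac_closed: "a \<in> carrier R \<Longrightarrow> s \<in> S \<Longrightarrow> frac a s \<in> carrier T"
  by (auto simp: localization_def fraction_def intro: quotientI)

lemma T_cases:
  assumes "C \<in> carrier T" obtains a s where "a \<in> carrier R" "s \<in> S" "C = frac a s"
  using assms by (auto simp: localization_def fraction_def elim!: quotientE)

lemma frac_memD:
  assumes "(b, t) \<in> frac a s"
  shows "b \<in> carrier R" "t \<in> S" "\<exists>u\<in>S. u \<otimes> (a \<otimes> t \<ominus> b \<otimes> s) = \<zero>"
  using assms by (auto simp: fraction_def fraction_rel_def)

lemma frac_self: "a \<in> carrier R \<Longrightarrow> s \<in> S \<Longrightarrow> (a, s) \<in> frac a s"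
  using equiv_fraction_rel unfolding fraction_def by (intro equiv_class_self) auto

lemma frac_mult:
  assumes "a \<in> carrier R" "s \<in> S" "b \<in> carrier R" "t \<in> S"
  shows "frac a s \<otimes>\<^bsub>T\<^esub> frac b t = frac (a \<otimes> b) (s \<otimes> t)"
proof -
  have "frac (a' \<otimes> b') (s' \<otimes> t') = frac (a \<otimes> b) (s \<otimes> t)"
    if 1: "(a', s') \<in> frac a s" and 2: "(b', t') \<in> frac b t" for a' s' b' t'
  proof -
    note d1 = frac_memD[OF 1] and d2 = frac_memD[OF 2]
    from d1(3) obtain u where u: "u \<in> S" "u \<otimes> (a \<otimes> s') = u \<otimes> (a' \<otimes> s)"
      using assms d1 S_carrier by (auto simp: cross_eq)
    from d2(3) obtain v where v: "v \<in> S" "v \<otimes> (b \<otimes> t') = v \<otimes> (b' \<otimes> t)"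
      using assms d2 S_carrier by (auto simp: cross_eq)
    have R: "a \<in> carrier R" "s \<in> carrier R" "b \<in> carrier R" "t \<in> carrier R" "u \<in> carrier R" "v \<in> carrier R"
      "a' \<in> carrier R" "s' \<in> carrier R" "b' \<in> carrier R" "t' \<in> carrier R"
      using assms d1 d2 u v S_carrier by auto
    have "(u \<otimes> v) \<otimes> ((a' \<otimes> b') \<otimes> (s \<otimes> t)) = (u \<otimes> (a' \<otimes> s)) \<otimes> (v \<otimes> (b' \<otimes> t))" using R by (simp add: m_ac)
    also have "\<dots> = (u \<otimes> (a \<otimes> s')) \<otimes> (v \<otimes> (b \<otimes> t'))" using u(2) v(2) by simp
    also have "\<dots> = (u \<otimes> v) \<otimes> ((a \<otimes> b) \<otimes> (s' \<otimes> t'))" using R by (simp add: m_ac)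
    finally have "(u \<otimes> v) \<otimes> ((a' \<otimes> b') \<otimes> (s \<otimes> t) \<ominus> (a \<otimes> b) \<otimes> (s' \<otimes> t')) = \<zero>"
      using R by (subst cross_eq) auto
    moreover have "a' \<otimes> b' \<in> carrier R" "s' \<otimes> t' \<in> S" "a \<otimes> b \<in> carrier R" "s \<otimes> t \<in> S" "u \<otimes> v \<in> S"
      using R assms d1 d2 u v S_mult by auto
    ultimately show ?thesis by (subst frac_eq_iff) blast+
  qed
  then have "(\<Union>(a', s')\<in>frac a s. \<Union>(b', t')\<in>frac b t. frac (a' \<otimes> b') (s' \<otimes> t')) = frac (a \<otimes> b) (s \<otimes> t)"
    using frac_self[OF assms(1,2)] frac_self[OF assms(3,4)] by (intro UN2_constant_eq) blast+
  then show ?thesis by (simp add: localization_def)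
qed

lemma frac_add:
  assumes "a \<in> carrier R" "s \<in> S" "b \<in> carrier R" "t \<in> S"
  shows "frac a s \<oplus>\<^bsub>T\<^esub> frac b t = frac (a \<otimes> t \<oplus> b \<otimes> s) (s \<otimes> t)"
proof -
  have "frac (a' \<otimes> t' \<oplus> b' \<otimes> s') (s' \<otimes> t') = frac (a \<otimes> t \<oplus> b \<otimes> s) (s \<otimes> t)"
    if 1: "(a', s') \<in> frac a s" and 2: "(b', t') \<in> frac b t" for a' s' b' t'
  proof -
    note d1 = frac_memD[OF 1] and d2 = frac_memD[OF 2]
    from d1(3) obtain u where u: "u \<in> S" "u \<otimes> (a \<otimes> s') = u \<otimes> (a' \<otimes> s)"
      using assms d1 S_carrier by (auto simp: cross_eq)
    from d2(3) obtain v where v: "v \<in> S" "v \<otimes> (b \<otimes> t') = v \<otimes> (b' \<otimes> t)"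
      using assms d2 S_carrier by (auto simp: cross_eq)
    have R: "a \<in> carrier R" "s \<in> carrier R" "b \<in> carrier R" "t \<in> carrier R" "u \<in> carrier R" "v \<in> carrier R"
      "a' \<in> carrier R" "s' \<in> carrier R" "b' \<in> carrier R" "t' \<in> carrier R"
      using assms d1 d2 u v S_carrier by auto
    have "(u \<otimes> v) \<otimes> ((a' \<otimes> t' \<oplus> b' \<otimes> s') \<otimes> (s \<otimes> t)) =
        (u \<otimes> (a' \<otimes> s)) \<otimes> (v \<otimes> (t \<otimes> t')) \<oplus> (v \<otimes> (b' \<otimes> t)) \<otimes> (u \<otimes> (s \<otimes> s'))"
      using R by (simp add: l_distr r_distr m_ac)
    also have "\<dots> = (u \<otimes> (a \<otimes> s')) \<otimes> (v \<otimes> (t \<otimes> t')) \<oplus> (v \<otimes> (b \<otimes> t')) \<otimes> (u \<otimes> (s \<otimes> s'))"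
      using u(2) v(2) by simp
    also have "\<dots> = (u \<otimes> v) \<otimes> ((a \<otimes> t \<oplus> b \<otimes> s) \<otimes> (s' \<otimes> t'))"
      using R by (simp add: l_distr r_distr m_ac)
    finally show ?thesis
      using assms d1 d2 u v S_mult R by (subst frac_eq_iff) (auto simp: cross_eq intro!: bexI[of _ "u \<otimes> v"])
  qed
  then have "(\<Union>(a', s')\<in>frac a s. \<Union>(b', t')\<in>frac b t. frac (a' \<otimes> t' \<oplus> b' \<otimes> s') (s' \<otimes> t')) =
      frac (a \<otimes> t \<oplus> b \<otimes> s) (s \<otimes> t)"
    using frac_self[OF assms(1,2)] frac_self[OF assms(3,4)] by (intro UN2_constant_eq) blast+
  then show ?thesis by (simp add: localization_def)
qed

lemma T_one: "\<one>\<^bsub>T\<^esub> = frac \<one> \<one>" and T_zero: "\<zero>\<^bsub>T\<^esub> = frac \<zero> \<one>"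
  by (simp_all add: localization_def)

lemma cring_T: "cring T"
proof (rule cringI)
  show "abelian_group T"
  proof (rule abelian_groupI)
    fix C assume "C \<in> carrier T"
    then obtain a s where C: "a \<in> carrier R" "s \<in> S" "C = frac a s" by (rule T_cases)
    have s: "s \<in> carrier R" using C S_carrier by auto
    show "\<zero>\<^bsub>T\<^esub> \<oplus>\<^bsub>T\<^esub> C = C" using C s S_one by (simp add: T_zero frac_add)
    have "frac (\<ominus> a) s \<oplus>\<^bsub>T\<^esub> C = \<zero>\<^bsub>T\<^esub>"
      using C s S_one S_mult by (simp add: T_zero frac_add l_minus l_neg, intro frac_eqI) auto
    then show "\<exists>D\<in>carrier T. D \<oplus>\<^bsub>T\<^esub> C = \<zero>\<^bsub>T\<^esub>" using C by (intro bexI[of _ "frac (\<ominus> a) s"] frac_closed) auto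
  next
    show "\<zero>\<^bsub>T\<^esub> \<in> carrier T" using S_one by (simp add: T_zero frac_closed)
  next
    fix C D assume CD: "C \<in> carrier T" "D \<in> carrier T"
    from CD(1) obtain a s where C: "a \<in> carrier R" "s \<in> S" "C = frac a s" by (rule T_cases)
    from CD(2) obtain b t where D: "b \<in> carrier R" "t \<in> S" "D = frac b t" by (rule T_cases)
    have st: "s \<in> carrier R" "t \<in> carrier R" using C D S_carrier by auto
    show "C \<oplus>\<^bsub>T\<^esub> D \<in> carrier T" using C D st S_mult by (simp add: frac_add frac_closed)
    show "C \<oplus>\<^bsub>T\<^esub> D = D \<oplus>\<^bsub>T\<^esub> C" using C D st by (simp add: frac_add m_comm a_comm)
    fix E assume "E \<in> carrier T"
    then obtain c r where E: "c \<in> carrier R" "r \<in> S" "E = frac c r" by (rule T_cases)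
    have r: "r \<in> carrier R" using E S_carrier by auto
    have "(a \<otimes> t \<oplus> b \<otimes> s) \<otimes> r \<oplus> c \<otimes> (s \<otimes> t) = a \<otimes> (t \<otimes> r) \<oplus> (b \<otimes> r \<oplus> c \<otimes> t) \<otimes> s"
      using C(1) D(1) E(1) st r by algebra
    then show "C \<oplus>\<^bsub>T\<^esub> D \<oplus>\<^bsub>T\<^esub> E = C \<oplus>\<^bsub>T\<^esub> (D \<oplus>\<^bsub>T\<^esub> E)"
      using C D E st r S_mult by (simp add: frac_add m_assoc)
  qed
  show "comm_monoid T"
  proof (rule comm_monoidI)
    show "\<one>\<^bsub>T\<^esub> \<in> carrier T" using S_one by (simp add: T_one frac_closed)
    fix C assume "C \<in> carrier T"
    then obtain a s where C: "a \<in> carrier R" "s \<in> S" "C = frac a s" by (rule T_cases)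
    have s: "s \<in> carrier R" using C S_carrier by auto
    show "\<one>\<^bsub>T\<^esub> \<otimes>\<^bsub>T\<^esub> C = C" using C s S_one by (simp add: T_one frac_mult)
    fix D assume "D \<in> carrier T"
    then obtain b t where D: "b \<in> carrier R" "t \<in> S" "D = frac b t" by (rule T_cases)
    have t: "t \<in> carrier R" using D S_carrier by auto
    show "C \<otimes>\<^bsub>T\<^esub> D \<in> carrier T" using C D s t S_mult by (simp add: frac_mult frac_closed)
    show "C \<otimes>\<^bsub>T\<^esub> D = D \<otimes>\<^bsub>T\<^esub> C" using C D s t by (simp add: frac_mult m_comm)
    fix E assume "E \<in> carrier T"
    then obtain c r where E: "c \<in> carrier R" "r \<in> S" "E = frac c r" by (rule T_cases)
    have r: "r \<in> carrier R" using E S_carrier by auto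
    show "C \<otimes>\<^bsub>T\<^esub> D \<otimes>\<^bsub>T\<^esub> E = C \<otimes>\<^bsub>T\<^esub> (D \<otimes>\<^bsub>T\<^esub> E)"
      using C D E s t r S_mult by (simp add: frac_mult m_assoc)
  qed
  fix C D E assume CDE: "C \<in> carrier T" "D \<in> carrier T" "E \<in> carrier T"
  from CDE(1) obtain a s where C: "a \<in> carrier R" "s \<in> S" "C = frac a s" by (rule T_cases)
  from CDE(2) obtain b t where D: "b \<in> carrier R" "t \<in> S" "D = frac b t" by (rule T_cases)
  from CDE(3) obtain c r where E: "c \<in> carrier R" "r \<in> S" "E = frac c r" by (rule T_cases)
  have R: "s \<in> carrier R" "t \<in> carrier R" "r \<in> carrier R" using C D E S_carrier by auto
  have "frac ((a \<otimes> t \<oplus> b \<otimes> s) \<otimes> c) (s \<otimes> t \<otimes> r) =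
      frac ((a \<otimes> c) \<otimes> (t \<otimes> r) \<oplus> (b \<otimes> c) \<otimes> (s \<otimes> r)) ((s \<otimes> r) \<otimes> (t \<otimes> r))"
  proof (rule frac_eqI)
    show "(a \<otimes> t \<oplus> b \<otimes> s) \<otimes> c \<otimes> ((s \<otimes> r) \<otimes> (t \<otimes> r)) =
       ((a \<otimes> c) \<otimes> (t \<otimes> r) \<oplus> (b \<otimes> c) \<otimes> (s \<otimes> r)) \<otimes> (s \<otimes> t \<otimes> r)"
      using C(1) D(1) E(1) R by algebra
  qed (use C D E R S_mult in auto)
  then show "(C \<oplus>\<^bsub>T\<^esub> D) \<otimes>\<^bsub>T\<^esub> E = C \<otimes>\<^bsub>T\<^esub> E \<oplus>\<^bsub>T\<^esub> D \<otimes>\<^bsub>T\<^esub> E"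
    using C D E R S_mult by (simp add: frac_mult frac_add)
qed

lemma frac_ring_hom: "(\<lambda>r. frac r \<one>) \<in> Ring.ring_hom R T"
  using S_one by (intro ring_hom_memI) (auto simp: frac_closed frac_mult frac_add T_one)

end

section \<open>Base change\<close>

locale scalar_extension = M: Module.module R M + T: cring T
  for R (structure) and M :: "('r, 'm, 'k) module_scheme" (structure) and T :: "('t, 'l) ring_scheme" +
  fixes \<phi> :: "'r \<Rightarrow> 't"
  assumes \<phi>: "\<phi> \<in> Ring.ring_hom R T"
begin

abbreviation F :: "('m \<times> 't \<Rightarrow>\<^sub>0 int) monoid" where
  "F \<equiv> free_Abelian_group (carrier M \<times> carrier T)"
abbreviation TK :: "('m \<times> 't \<Rightarrow>\<^sub>0 int) set" where
  "TK \<equiv> tensor_kernel R M (restrict_scalars \<phi> T)"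
abbreviation L :: "('t, ('m \<times> 't \<Rightarrow>\<^sub>0 int) set) module" where "L \<equiv> base_change R M \<phi> T"

definition cl :: "('m \<times> 't \<Rightarrow>\<^sub>0 int) \<Rightarrow> ('m \<times> 't \<Rightarrow>\<^sub>0 int) set" where "cl c = TK #>\<^bsub>F\<^esub> c"

definition tens :: "'m \<Rightarrow> 't \<Rightarrow> ('m \<times> 't \<Rightarrow>\<^sub>0 int) set" where "tens x y = cl (frag_of (x, y))"

definition E :: "'t \<Rightarrow> ('m \<times> 't \<Rightarrow>\<^sub>0 int) \<Rightarrow> ('m \<times> 't \<Rightarrow>\<^sub>0 int)" where
  "E t = frag_extend (\<lambda>(x, y). frag_of (x, t \<otimes>\<^bsub>T\<^esub> y))"

lemma restrict_simps:
  "carrier (restrict_scalars \<phi> T) = carrier T" "add (restrict_scalars \<phi> T) = add T"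
  "module.smult (restrict_scalars \<phi> T) = (\<lambda>r x. \<phi> r \<otimes>\<^bsub>T\<^esub> x)"
  by (simp_all add: restrict_scalars_def)

lemma \<phi>_closed: "r \<in> carrier R \<Longrightarrow> \<phi> r \<in> carrier T"
  using Ring.ring_hom_closed[OF \<phi>] .

lemma F_diff: "c \<in> carrier F \<Longrightarrow> d \<in> carrier F \<Longrightarrow> c - d \<in> carrier F"
  using keys_diff[of c d] by auto

lemma F_add: "c \<in> carrier F \<Longrightarrow> d \<in> carrier F \<Longrightarrow> c + d \<in> carrier F"
  using keys_add[of c d] by auto

lemma F_frag_of: "x \<in> carrier M \<Longrightarrow> y \<in> carrier T \<Longrightarrow> frag_of (x, y) \<in> carrier F"
  by simp

lemma relations_in_F: "tensor_relations R M (restrict_scalars \<phi> T) \<subseteq> carrier F"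
  unfolding tensor_relations_def restrict_simps
  by (auto simp del: carrier_free_Abelian_group_iff intro!: F_diff F_frag_of \<phi>_closed M.smult_closed)

lemma TK_eq: "TK = generate F (tensor_relations R M (restrict_scalars \<phi> T))"
  by (simp add: tensor_kernel_def restrict_simps)

lemma TK_subgroup: "subgroup TK F"
  unfolding TK_eq by (rule group.generate_is_subgroup) (simp_all only: group_free_Abelian_group relations_in_F)

lemma TK_closed:
  "TK \<subseteq> carrier F" "0 \<in> TK" "c \<in> TK \<Longrightarrow> d \<in> TK \<Longrightarrow> c + d \<in> TK" "c \<in> TK \<Longrightarrow> - c \<in> TK"
proof -
  show 1: "TK \<subseteq> carrier F" using TK_subgroup by (rule subgroup.subset)
  show "0 \<in> TK" using subgroup.one_closed[OF TK_subgroup] by simp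
  show "c + d \<in> TK" if "c \<in> TK" "d \<in> TK" using subgroup.m_closed[OF TK_subgroup that] by simp
  show "- c \<in> TK" if "c \<in> TK"
  proof -
    have "c \<in> carrier F" using that 1 by blast
    then have "inv\<^bsub>F\<^esub> c = - c" by simp
    then show ?thesis using subgroup.m_inv_closed[OF TK_subgroup that] by simp
  qed
qed

lemma TK_diff: "c \<in> TK \<Longrightarrow> d \<in> TK \<Longrightarrow> c - d \<in> TK"
  using TK_closed(3)[of c "- d"] TK_closed(4)[of d] by simp

lemma cl_alt: "cl c = {k + c | k. k \<in> TK}"
  by (auto simp: cl_def r_coset_def)

lemma cl_eq_iff: "cl c = cl d \<longleftrightarrow> c - d \<in> TK"
proof
  assume "cl c = cl d"
  moreover have "c \<in> cl c" using TK_closed(2) by (force simp: cl_alt)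
  ultimately show "c - d \<in> TK" by (auto simp: cl_alt)
next
  assume *: "c - d \<in> TK"
  have "k + c \<in> cl d" if "k \<in> TK" for k
  proof -
    have "k + c = (k + (c - d)) + d" by simp
    then show ?thesis using TK_closed(3)[OF that *] unfolding cl_alt by blast
  qed
  moreover have "k + d \<in> cl c" if "k \<in> TK" for k
  proof -
    have "k + d = (k - (c - d)) + c" by simp
    then show ?thesis using TK_diff[OF that *] unfolding cl_alt by blast
  qed
  ultimately show "cl c = cl d" by (auto simp: cl_alt[of c] cl_alt[of d])
qed

lemma normal_TK: "TK \<lhd> F"
  using comm_group.subgroup_imp_normal[OF abelian_free_Abelian_group TK_subgroup] .

lemma L_simps:
  "carrier L = carrier (F Mod TK)" "add L = monoid.mult (F Mod TK)" "zero L = TK"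
  "module.smult L = (\<lambda>t C. \<Union>c\<in>C. TK #>\<^bsub>F\<^esub> E t c)"
  by (simp_all add: base_change_def tensor_product_def Let_def restrict_simps E_def)

lemma L_carrier: "C \<in> carrier L \<longleftrightarrow> (\<exists>c\<in>carrier F. C = cl c)"
  by (auto simp: L_simps FactGroup_def RCOSETS_def cl_def simp del: carrier_free_Abelian_group_iff)

lemma cl_closed: "c \<in> carrier F \<Longrightarrow> cl c \<in> carrier L"
  using L_carrier by blast

lemma cl_add: "c \<in> carrier F \<Longrightarrow> d \<in> carrier F \<Longrightarrow> cl c \<oplus>\<^bsub>L\<^esub> cl d = cl (c + d)"
  using normal.rcos_sum[OF normal_TK, of c d] by (simp add: L_simps(2) cl_def)

lemma cl_zero: "\<zero>\<^bsub>L\<^esub> = cl 0"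
  by (auto simp: L_simps cl_alt)

lemma abelian_group_L: "abelian_group L"
proof -
  interpret D: comm_group "F Mod TK"
    using comm_group.abelian_FactGroup[OF abelian_free_Abelian_group TK_subgroup] .
  have z: "\<zero>\<^bsub>L\<^esub> = \<one>\<^bsub>F Mod TK\<^esub>" by (simp add: L_simps(3))
  show ?thesis
    by (rule abelian_groupI; unfold L_simps(1,2) z)
      (rule D.m_closed D.one_closed D.m_assoc D.m_comm D.l_one D.l_inv_ex; assumption?)+
qed

lemma E_diff: "E t (c - d) = E t c - E t d"
  by (simp add: E_def frag_extend_diff)

lemma E_frag_of: "E t (frag_of (x, y)) = frag_of (x, t \<otimes>\<^bsub>T\<^esub> y)"
  by (simp add: E_def)

lemma E_add: "E t (c + d) = E t c + E t d"
  by (simp add: E_def frag_extend_add)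

lemma E_0: "E t 0 = 0"
  by (simp add: E_def)

lemma F_induct [consumes 1, case_names zero frag diff]:
  assumes "c \<in> carrier F" "P 0" "\<And>x y. x \<in> carrier M \<Longrightarrow> y \<in> carrier T \<Longrightarrow> P (frag_of (x, y))"
    "\<And>a b. \<lbrakk>a \<in> carrier F; b \<in> carrier F; P a; P b\<rbrakk> \<Longrightarrow> P (a - b)"
  shows "P c"
proof -
  have "c \<in> carrier F \<and> P c"
  proof (rule frag_induction[of c "carrier M \<times> carrier T"])
    show "Poly_Mapping.keys c \<subseteq> carrier M \<times> carrier T" using assms(1) by simp
    show "0 \<in> carrier F \<and> P 0" using assms(2) by simp
    show "frag_of z \<in> carrier F \<and> P (frag_of z)" if "z \<in> carrier M \<times> carrier T" for z
      using that assms(3) by auto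
    show "a - b \<in> carrier F \<and> P (a - b)" if "a \<in> carrier F \<and> P a" "b \<in> carrier F \<and> P b" for a b
      using that assms(4) F_diff by blast
  qed
  then show ?thesis ..
qed

lemma E_closed:
  assumes "t \<in> carrier T" "c \<in> carrier F" shows "E t c \<in> carrier F"
  using assms(2)
proof (induct rule: F_induct)
  case (frag x y)
  then show ?case using assms by (simp add: E_frag_of)
next
  case (diff a b)
  then show ?case unfolding E_diff by (intro F_diff)
qed (simp add: E_0)

lemma rel_in_TK: "c \<in> tensor_relations R M (restrict_scalars \<phi> T) \<Longrightarrow> c \<in> TK"
  unfolding TK_eq by (rule generate.incl)

lemma tensor_rel1: "x \<in> carrier M \<Longrightarrow> x' \<in> carrier M \<Longrightarrow> y \<in> carrier T \<Longrightarrow>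
    frag_of (x \<oplus>\<^bsub>M\<^esub> x', y) - frag_of (x, y) - frag_of (x', y) \<in> TK"
  by (rule rel_in_TK) (unfold tensor_relations_def restrict_simps, blast)

lemma tensor_rel2: "x \<in> carrier M \<Longrightarrow> y \<in> carrier T \<Longrightarrow> y' \<in> carrier T \<Longrightarrow>
    frag_of (x, y \<oplus>\<^bsub>T\<^esub> y') - frag_of (x, y) - frag_of (x, y') \<in> TK"
  by (rule rel_in_TK) (unfold tensor_relations_def restrict_simps, blast)

lemma tensor_rel3: "r \<in> carrier R \<Longrightarrow> x \<in> carrier M \<Longrightarrow> y \<in> carrier T \<Longrightarrow>
    frag_of (r \<odot>\<^bsub>M\<^esub> x, y) - frag_of (x, \<phi> r \<otimes>\<^bsub>T\<^esub> y) \<in> TK"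
  by (rule rel_in_TK) (unfold tensor_relations_def restrict_simps, blast)

lemma TK_induct [consumes 1, case_names rel1 rel2 rel3 zero uminus add]:
  assumes "c \<in> TK"
    "\<And>x x' y. x \<in> carrier M \<Longrightarrow> x' \<in> carrier M \<Longrightarrow> y \<in> carrier T \<Longrightarrow>
       P (frag_of (x \<oplus>\<^bsub>M\<^esub> x', y) - frag_of (x, y) - frag_of (x', y))"
    "\<And>x y y'. x \<in> carrier M \<Longrightarrow> y \<in> carrier T \<Longrightarrow> y' \<in> carrier T \<Longrightarrow>
       P (frag_of (x, y \<oplus>\<^bsub>T\<^esub> y') - frag_of (x, y) - frag_of (x, y'))"
    "\<And>r x y. r \<in> carrier R \<Longrightarrow> x \<in> carrier M \<Longrightarrow> y \<in> carrier T \<Longrightarrow>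
       P (frag_of (r \<odot>\<^bsub>M\<^esub> x, y) - frag_of (x, \<phi> r \<otimes>\<^bsub>T\<^esub> y))"
    "P 0" "\<And>c. c \<in> TK \<Longrightarrow> P c \<Longrightarrow> P (- c)" "\<And>c d. c \<in> TK \<Longrightarrow> d \<in> TK \<Longrightarrow> P c \<Longrightarrow> P d \<Longrightarrow> P (c + d)"
  shows "P c"
proof -
  have rel: "P c" if "c \<in> tensor_relations R M (restrict_scalars \<phi> T)" for c
    using that unfolding tensor_relations_def restrict_simps by (auto intro: assms(2-4))
  from assms(1) show ?thesis
    unfolding TK_eq
  proof (induct rule: generate.induct)
    case one
    then show ?case using assms(5) by simp
  next
    case (incl c)
    then show ?case by (rule rel)
  next
    case (inv c)
    have "c \<in> carrier F" using inv relations_in_F by blast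
    then have "inv\<^bsub>F\<^esub> c = - c" by simp
    then show ?case using assms(6)[OF rel_in_TK[OF inv] rel[OF inv]] by simp
  next
    case (eng c d)
    then show ?case using assms(7)[of c d] by (simp add: TK_eq)
  qed
qed

text \<open>Scalars act on formal sums through the second factor. They respect the balancing
  relation because T is commutative, so the action passes to the quotient.\<close>

lemma E_TK:
  assumes t: "t \<in> carrier T" and c: "c \<in> TK" shows "E t c \<in> TK"
  using c
proof (induct rule: TK_induct)
  case (rel1 x x' y)
  then show ?case using t by (simp add: E_diff E_frag_of tensor_rel1)
next
  case (rel2 x y y')
  then show ?case using t tensor_rel2[of x "t \<otimes>\<^bsub>T\<^esub> y" "t \<otimes>\<^bsub>T\<^esub> y'"] t by (simp add: E_diff E_frag_of T.r_distr)
next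
  case (rel3 r x y)
  have "t \<otimes>\<^bsub>T\<^esub> (\<phi> r \<otimes>\<^bsub>T\<^esub> y) = \<phi> r \<otimes>\<^bsub>T\<^esub> (t \<otimes>\<^bsub>T\<^esub> y)"
    using rel3 t \<phi>_closed by (simp add: T.m_lcomm)
  then show ?case using tensor_rel3[of r x "t \<otimes>\<^bsub>T\<^esub> y"] rel3 t by (simp add: E_diff E_frag_of)
next
  case (uminus c)
  then show ?case using E_diff[of t 0 c] TK_closed(4) by (simp add: E_0)
qed (simp_all add: E_0 E_add TK_closed)

lemma cl_smult:
  assumes t: "t \<in> carrier T" and c: "c \<in> carrier F"
  shows "t \<odot>\<^bsub>L\<^esub> cl c = cl (E t c)"
proof -
  have "cl (E t d) = cl (E t c)" if "d \<in> cl c" for d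
  proof -
    from that obtain k where "d = k + c" "k \<in> TK" by (auto simp: cl_alt)
    then have "E t d - E t c = E t k" by (simp add: E_add)
    then show ?thesis using E_TK[OF t \<open>k \<in> TK\<close>] by (simp add: cl_eq_iff)
  qed
  moreover have "c \<in> cl c" using TK_closed(2) by (force simp: cl_alt)
  ultimately show ?thesis unfolding L_simps(4) cl_def[symmetric] by blast
qed

lemma module_L: "Module.module T L"
proof (rule moduleI)
  show "cring T" ..
  show "abelian_group L" by (rule abelian_group_L)
next
  fix t C assume t: "t \<in> carrier T" and "C \<in> carrier L"
  then obtain c where c: "c \<in> carrier F" "C = cl c" using L_carrier by blast
  show "t \<odot>\<^bsub>L\<^esub> C \<in> carrier L" using c t by (simp only: cl_smult cl_closed E_closed)
  fix u assume u: "u \<in> carrier T"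
  have "E (t \<oplus>\<^bsub>T\<^esub> u) c - (E t c + E u c) \<in> TK"
    using c(1)
  proof (induct rule: F_induct)
    case (frag x y)
    then show ?case using tensor_rel2[of x "t \<otimes>\<^bsub>T\<^esub> y" "u \<otimes>\<^bsub>T\<^esub> y"] t u
      by (simp add: E_frag_of T.l_distr diff_diff_eq)
  next
    case (diff a b)
    have "E (t \<oplus>\<^bsub>T\<^esub> u) (a - b) - (E t (a - b) + E u (a - b)) =
       (E (t \<oplus>\<^bsub>T\<^esub> u) a - (E t a + E u a)) - (E (t \<oplus>\<^bsub>T\<^esub> u) b - (E t b + E u b))"
      by (simp add: E_diff)
    then show ?case using TK_diff[OF diff(3,4)] by simp
  qed (simp add: E_0 TK_closed)
  then show "(t \<oplus>\<^bsub>T\<^esub> u) \<odot>\<^bsub>L\<^esub> C = t \<odot>\<^bsub>L\<^esub> C \<oplus>\<^bsub>L\<^esub> u \<odot>\<^bsub>L\<^esub> C"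
    unfolding c(2) using c(1) t u by (simp only: cl_smult cl_add E_closed T.a_closed cl_eq_iff)
  have "E (t \<otimes>\<^bsub>T\<^esub> u) c = E t (E u c)"
    using c(1)
  proof (induct rule: F_induct)
    case (frag x y)
    then show ?case using t u by (simp add: E_frag_of T.m_assoc)
  qed (simp_all add: E_0 E_diff)
  then show "t \<otimes>\<^bsub>T\<^esub> u \<odot>\<^bsub>L\<^esub> C = t \<odot>\<^bsub>L\<^esub> (u \<odot>\<^bsub>L\<^esub> C)"
    unfolding c(2) using c(1) t u by (simp only: cl_smult E_closed T.m_closed)
next
  fix t C D assume t: "t \<in> carrier T" and "C \<in> carrier L" "D \<in> carrier L"
  from \<open>C \<in> carrier L\<close> obtain c where "c \<in> carrier F" "C = cl c" using L_carrier by blast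
  moreover from \<open>D \<in> carrier L\<close> obtain d where "d \<in> carrier F" "D = cl d" using L_carrier by blast
  ultimately have c: "c \<in> carrier F" "C = cl c" "d \<in> carrier F" "D = cl d" by this+
  show "t \<odot>\<^bsub>L\<^esub> (C \<oplus>\<^bsub>L\<^esub> D) = t \<odot>\<^bsub>L\<^esub> C \<oplus>\<^bsub>L\<^esub> t \<odot>\<^bsub>L\<^esub> D"
    unfolding c(2,4) using c(1,3) t by (simp only: cl_smult cl_add E_closed F_add E_add)
next
  fix C assume "C \<in> carrier L"
  then obtain c where c: "c \<in> carrier F" "C = cl c" using L_carrier by blast
  have "E \<one>\<^bsub>T\<^esub> c = c"
    using c(1)
  proof (induct rule: F_induct)
    case (frag x y)
    then show ?case by (simp add: E_frag_of)
  qed (simp_all add: E_0 E_diff)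
  then show "\<one>\<^bsub>T\<^esub> \<odot>\<^bsub>L\<^esub> C = C" unfolding c(2) using c(1) by (simp only: cl_smult T.one_closed)
qed

sublocale L: Module.module T L
  by (rule module_L)

section \<open>Pure tensors and the universal property\<close>

lemma tens_closed: "x \<in> carrier M \<Longrightarrow> y \<in> carrier T \<Longrightarrow> tens x y \<in> carrier L"
  unfolding tens_def by (intro cl_closed F_frag_of)

lemma tens_add_left:
  assumes "x \<in> carrier M" "x' \<in> carrier M" "y \<in> carrier T"
  shows "tens (x \<oplus>\<^bsub>M\<^esub> x') y = tens x y \<oplus>\<^bsub>L\<^esub> tens x' y"
  unfolding tens_def using assms tensor_rel1[OF assms]
  by (simp only: cl_add F_frag_of cl_eq_iff diff_diff_eq)

lemma tens_smult_left:
  assumes "r \<in> carrier R" "x \<in> carrier M" "y \<in> carrier T"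
  shows "tens (r \<odot>\<^bsub>M\<^esub> x) y = tens x (\<phi> r \<otimes>\<^bsub>T\<^esub> y)"
  unfolding tens_def using tensor_rel3[OF assms] by (simp only: cl_eq_iff)

lemma smult_tens:
  assumes "t \<in> carrier T" "x \<in> carrier M" "y \<in> carrier T"
  shows "t \<odot>\<^bsub>L\<^esub> tens x y = tens x (t \<otimes>\<^bsub>T\<^esub> y)"
  unfolding tens_def using assms by (simp only: cl_smult F_frag_of E_frag_of)

lemma L_induct [consumes 1, case_names zero tens diff]:
  assumes "C \<in> carrier L" "P \<zero>\<^bsub>L\<^esub>" "\<And>x y. x \<in> carrier M \<Longrightarrow> y \<in> carrier T \<Longrightarrow> P (tens x y)"
    "\<And>C D. \<lbrakk>C \<in> carrier L; D \<in> carrier L; P C; P D\<rbrakk> \<Longrightarrow> P (C \<ominus>\<^bsub>L\<^esub> D)"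
  shows "P C"
proof -
  from assms(1) obtain c where c: "c \<in> carrier F" "C = cl c" using L_carrier by blast
  from c(1) have "P (cl c)"
  proof (induct rule: F_induct)
    case zero
    then show ?case using assms(2) by (simp add: cl_zero)
  next
    case (frag x y)
    then show ?case using assms(3) by (simp add: tens_def)
  next
    case (diff a b)
    have ab: "cl (a - b) \<in> carrier L" "cl a \<in> carrier L" "cl b \<in> carrier L"
      using diff F_diff by (blast intro: cl_closed)+
    have "cl (a - b) \<oplus>\<^bsub>L\<^esub> cl b = cl a"
      using diff(1,2) by (simp only: cl_add F_diff diff_add_cancel)
    then have "cl a \<ominus>\<^bsub>L\<^esub> cl b = cl (a - b)"
    proof -
      assume "cl (a - b) \<oplus>\<^bsub>L\<^esub> cl b = cl a"
      then have "cl a \<ominus>\<^bsub>L\<^esub> cl b = cl (a - b) \<oplus>\<^bsub>L\<^esub> cl b \<oplus>\<^bsub>L\<^esub> \<ominus>\<^bsub>L\<^esub> cl b" by (simp add: a_minus_def)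
      then show ?thesis using ab by (simp add: L.M.a_assoc L.M.r_neg)
    qed
    then show ?case using assms(4)[OF ab(2,3) diff(3,4)] by simp
  qed
  then show ?thesis using c by simp
qed

text \<open>The extension of f to the free abelian group kills the three families of relations, so
  its value at a class can be read from any representative. Compatibility with scalars of T is
  established separately for the map in question.\<close>

lemma L_universal:
  assumes "abelian_group H"
    and f: "\<And>x y. x \<in> carrier M \<Longrightarrow> y \<in> carrier T \<Longrightarrow> f x y \<in> carrier H"
      "\<And>x x' y. x \<in> carrier M \<Longrightarrow> x' \<in> carrier M \<Longrightarrow> y \<in> carrier T \<Longrightarrow> f (x \<oplus>\<^bsub>M\<^esub> x') y = f x y \<oplus>\<^bsub>H\<^esub> f x' y"
      "\<And>x y y'. x \<in> carrier M \<Longrightarrow> y \<in> carrier T \<Longrightarrow> y' \<in> carrier T \<Longrightarrow> f x (y \<oplus>\<^bsub>T\<^esub> y') = f x y \<oplus>\<^bsub>H\<^esub> f x y'"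
      "\<And>r x y. r \<in> carrier R \<Longrightarrow> x \<in> carrier M \<Longrightarrow> y \<in> carrier T \<Longrightarrow> f (r \<odot>\<^bsub>M\<^esub> x) y = f x (\<phi> r \<otimes>\<^bsub>T\<^esub> y)"
  shows "\<exists>\<Psi>. (\<forall>C\<in>carrier L. \<Psi> C \<in> carrier H) \<and> (\<forall>C\<in>carrier L. \<forall>D\<in>carrier L. \<Psi> (C \<oplus>\<^bsub>L\<^esub> D) = \<Psi> C \<oplus>\<^bsub>H\<^esub> \<Psi> D) \<and>
    (\<forall>x\<in>carrier M. \<forall>y\<in>carrier T. \<Psi> (tens x y) = f x y)"
proof -
  interpret H: abelian_group H by fact
  have "(\<lambda>(x, y). f x y) ` (carrier M \<times> carrier T) \<subseteq> carrier (add_monoid H)" using f(1) by auto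
  from comm_group.free_Abelian_group_universal[OF H.a_comm_group this] obtain k where
    k: "k \<in> hom F (add_monoid H)"
    "\<And>z. z \<in> carrier M \<times> carrier T \<Longrightarrow> k (frag_of z) = (\<lambda>(x, y). f x y) z" by blast
  interpret k: group_hom F "add_monoid H" k
    by (intro group_hom.intro group_hom_axioms.intro k H.a_group group_free_Abelian_group)
  have kc: "k c \<in> carrier H" if "c \<in> carrier F" for c using k.hom_closed[OF that] by simp
  have kadd: "k (c + d) = k c \<oplus>\<^bsub>H\<^esub> k d" if "c \<in> carrier F" "d \<in> carrier F" for c d
    using k.hom_mult[OF that] by simp
  have k0: "k 0 = \<zero>\<^bsub>H\<^esub>" using k.hom_one by simp
  have kdiff: "k (c - d) = k c \<ominus>\<^bsub>H\<^esub> k d" if "c \<in> carrier F" "d \<in> carrier F" for c d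
  proof -
    have "k (c - d) \<oplus>\<^bsub>H\<^esub> k d = k c" using kadd[OF F_diff[OF that] that(2)] by simp
    then show ?thesis
      using kc[OF F_diff[OF that]] kc[OF that(2)] by (simp add: a_minus_def H.a_assoc H.r_neg flip: \<open>k (c - d) \<oplus>\<^bsub>H\<^esub> k d = k c\<close>)
  qed
  have kf: "k (frag_of (x, y)) = f x y" if "x \<in> carrier M" "y \<in> carrier T" for x y using k(2) that by simp
  have kTK: "k c = \<zero>\<^bsub>H\<^esub>" if "c \<in> TK" for c
    using that
  proof (induct rule: TK_induct)
    case (rel1 x x' y)
    then have "frag_of (x \<oplus>\<^bsub>M\<^esub> x', y) \<in> carrier F" "frag_of (x, y) \<in> carrier F" "frag_of (x', y) \<in> carrier F" by auto
    then show ?case using rel1 f(1) f(2)[OF rel1] F_diff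
      by (simp only: kdiff kf M.a_closed) (simp add: a_minus_def H.a_ac H.r_neg1 H.r_neg2 H.r_neg)
  next
    case (rel2 x y y')
    then have "frag_of (x, y \<oplus>\<^bsub>T\<^esub> y') \<in> carrier F" "frag_of (x, y) \<in> carrier F" "frag_of (x, y') \<in> carrier F" by auto
    then show ?case using rel2 f(1) f(3)[OF rel2] F_diff
      by (simp only: kdiff kf T.a_closed) (simp add: a_minus_def H.a_ac H.r_neg1 H.r_neg2 H.r_neg)
  next
    case (rel3 r x y)
    then have "frag_of (r \<odot>\<^bsub>M\<^esub> x, y) \<in> carrier F" "frag_of (x, \<phi> r \<otimes>\<^bsub>T\<^esub> y) \<in> carrier F" using \<phi>_closed by auto
    then show ?case using rel3 f(1)[of x "\<phi> r \<otimes>\<^bsub>T\<^esub> y"] f(4)[OF rel3] \<phi>_closed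
      by (simp only: kdiff kf M.smult_closed T.m_closed) (simp add: a_minus_def H.r_neg)
  next
    case (uminus c)
    then show ?case using kdiff[of 0 c] TK_closed(1) k0 by (auto simp: a_minus_def H.r_neg)
  next
    case (add c d)
    then show ?case using kadd TK_closed(1) by (simp add: subset_iff)
  qed (rule k0)
  define \<Psi> where "\<Psi> C = k (SOME c. c \<in> carrier F \<and> C = cl c)" for C
  have \<Psi>: "\<Psi> (cl c) = k c" if "c \<in> carrier F" for c
  proof -
    define d where "d = (SOME d. d \<in> carrier F \<and> cl c = cl d)"
    have d: "d \<in> carrier F \<and> cl c = cl d"
      unfolding d_def by (rule someI[of _ c]) (use that in blast)
    then have "d - c \<in> TK" using cl_eq_iff[of d c] by simp
    then have "k (d - c) = \<zero>\<^bsub>H\<^esub>" by (rule kTK)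
    then have "k d = k c" using kadd[OF F_diff[of d c] that] d that kc[OF that] by simp
    then show ?thesis by (simp add: \<Psi>_def d_def)
  qed
  show ?thesis
  proof (intro exI[of _ \<Psi>] conjI ballI)
    fix C assume "C \<in> carrier L"
    then obtain c where c: "c \<in> carrier F" "C = cl c" using L_carrier by blast
    then show "\<Psi> C \<in> carrier H" using kc \<Psi> by simp
    fix D assume "D \<in> carrier L"
    then obtain d where d: "d \<in> carrier F" "D = cl d" using L_carrier by blast
    show "\<Psi> (C \<oplus>\<^bsub>L\<^esub> D) = \<Psi> C \<oplus>\<^bsub>H\<^esub> \<Psi> D"
      unfolding c(2) d(2) using c(1) d(1) by (simp only: cl_add \<Psi> F_add kadd)
  next
    fix x y assume "x \<in> carrier M" "y \<in> carrier T"
    then show "\<Psi> (tens x y) = f x y" unfolding tens_def by (simp only: \<Psi> F_frag_of kf)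
  qed
qed

end

section \<open>The residue algebra at a maximal ideal\<close>

locale azumaya_at = azumaya_algebra R A for R (structure) and A (structure) +
  fixes M :: "'a set"
  assumes M: "maximalideal M R"
begin

abbreviation J where "J \<equiv> ideal_smult M A"
abbreviation Q where "Q \<equiv> quotient_algebra A M"
definition h where "h a = J +>\<^bsub>A\<^esub> a"
definition \<iota> where "\<iota> r = r \<odot>\<^bsub>A\<^esub> \<one>\<^bsub>A\<^esub>"
definition \<zeta> where "\<zeta> r = h (\<iota> r)"

lemma M_ideal: "ideal M R"
  using M by (rule maximalideal.axioms)

lemma M_closed:
  "M \<subseteq> carrier R" "\<zero>\<^bsub>R\<^esub> \<in> M" "m \<in> M \<Longrightarrow> m' \<in> M \<Longrightarrow> m \<oplus>\<^bsub>R\<^esub> m' \<in> M" "m \<in> M \<Longrightarrow> \<ominus>\<^bsub>R\<^esub> m \<in> M"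
  "m \<in> M \<Longrightarrow> r \<in> carrier R \<Longrightarrow> r \<otimes>\<^bsub>R\<^esub> m \<in> M" "m \<in> M \<Longrightarrow> r \<in> carrier R \<Longrightarrow> m \<otimes>\<^bsub>R\<^esub> r \<in> M"
proof -
  interpret M: ideal M R by (rule M_ideal)
  show "M \<subseteq> carrier R" "\<zero>\<^bsub>R\<^esub> \<in> M" "m \<in> M \<Longrightarrow> m' \<in> M \<Longrightarrow> m \<oplus>\<^bsub>R\<^esub> m' \<in> M" "m \<in> M \<Longrightarrow> \<ominus>\<^bsub>R\<^esub> m \<in> M"
    "m \<in> M \<Longrightarrow> r \<in> carrier R \<Longrightarrow> r \<otimes>\<^bsub>R\<^esub> m \<in> M" "m \<in> M \<Longrightarrow> r \<in> carrier R \<Longrightarrow> m \<otimes>\<^bsub>R\<^esub> r \<in> M"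
    using M.Icarr M.I_l_closed M.I_r_closed by auto
qed

lemma \<iota>_closed: "r \<in> carrier R \<Longrightarrow> \<iota> r \<in> carrier A"
  by (simp add: \<iota>_def)

lemma smult_eq: "r \<in> carrier R \<Longrightarrow> a \<in> carrier A \<Longrightarrow> r \<odot>\<^bsub>A\<^esub> a = \<iota> r \<otimes>\<^bsub>A\<^esub> a"
  using smult_mult_left[of r "\<one>\<^bsub>A\<^esub>" a] by (simp add: \<iota>_def)

lemma \<iota>_central: "r \<in> carrier R \<Longrightarrow> a \<in> carrier A \<Longrightarrow> \<iota> r \<otimes>\<^bsub>A\<^esub> a = a \<otimes>\<^bsub>A\<^esub> \<iota> r"
  using smult_mult_right[of r a "\<one>\<^bsub>A\<^esub>"] smult_eq[of r a] by (simp add: \<iota>_def)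

lemma \<iota>_hom: "\<iota> \<in> Ring.ring_hom R A"
proof (rule ring_hom_memI)
  fix r s assume rs: "r \<in> carrier R" "s \<in> carrier R"
  show "\<iota> (r \<otimes>\<^bsub>R\<^esub> s) = \<iota> r \<otimes>\<^bsub>A\<^esub> \<iota> s"
    using rs smult_eq[of r "\<iota> s"] \<iota>_closed smult_assoc1[of r s "\<one>\<^bsub>A\<^esub>"] by (simp add: \<iota>_def)
  show "\<iota> (r \<oplus>\<^bsub>R\<^esub> s) = \<iota> r \<oplus>\<^bsub>A\<^esub> \<iota> s"
    using rs smult_l_distr[of r s "\<one>\<^bsub>A\<^esub>"] by (simp add: \<iota>_def)
qed (use smult_one[of "\<one>\<^bsub>A\<^esub>"] in \<open>auto simp: \<iota>_def\<close>)

lemma J_eq: "J = generate (add_monoid A) {r \<odot>\<^bsub>A\<^esub> x | r x. r \<in> M \<and> x \<in> carrier A}"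
  by (simp add: ideal_smult_def)

lemma J_subgroup: "subgroup J (add_monoid A)"
  unfolding J_eq using M_closed(1) by (intro M.add.generate_is_subgroup) auto

lemma J_closed:
  "J \<subseteq> carrier A" "\<zero>\<^bsub>A\<^esub> \<in> J" "x \<in> J \<Longrightarrow> y \<in> J \<Longrightarrow> x \<oplus>\<^bsub>A\<^esub> y \<in> J" "m \<in> M \<Longrightarrow> a \<in> carrier A \<Longrightarrow> m \<odot>\<^bsub>A\<^esub> a \<in> J"
proof -
  show "J \<subseteq> carrier A" using subgroup.subset[OF J_subgroup] by simp
  show "\<zero>\<^bsub>A\<^esub> \<in> J" using subgroup.one_closed[OF J_subgroup] by simp
  show "x \<in> J \<Longrightarrow> y \<in> J \<Longrightarrow> x \<oplus>\<^bsub>A\<^esub> y \<in> J" using subgroup.m_closed[OF J_subgroup, of x y] by simp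
  show "m \<odot>\<^bsub>A\<^esub> a \<in> J" if "m \<in> M" "a \<in> carrier A"
    unfolding J_eq using that by (intro generate.incl) blast
qed

text \<open>Inverses of generators are again generators, since -(m a) = (-m) a; the case of inverses
  therefore disappears.\<close>

lemma J_induct [consumes 1, case_names zero smult add]:
  assumes "x \<in> J" "P \<zero>\<^bsub>A\<^esub>" "\<And>m a. m \<in> M \<Longrightarrow> a \<in> carrier A \<Longrightarrow> P (m \<odot>\<^bsub>A\<^esub> a)"
    "\<And>x y. \<lbrakk>x \<in> J; y \<in> J; P x; P y\<rbrakk> \<Longrightarrow> P (x \<oplus>\<^bsub>A\<^esub> y)"
  shows "P x"
  using assms(1) unfolding J_eq
proof (induct rule: generate.induct)
  case one
  then show ?case using assms(2) by simp
next
  case (incl x)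
  then show ?case using assms(3) by auto
next
  case (inv x)
  then obtain m a where x: "x = m \<odot>\<^bsub>A\<^esub> a" "m \<in> M" "a \<in> carrier A" by auto
  have mR: "m \<in> carrier R" using x M_closed(1) by auto
  have "inv\<^bsub>add_monoid A\<^esub> x = \<ominus>\<^bsub>A\<^esub> x" by (simp add: a_inv_def)
  also have "\<dots> = (\<ominus>\<^bsub>R\<^esub> m) \<odot>\<^bsub>A\<^esub> a" using x mR smult_l_minus[of m a] by simp
  finally show ?case using assms(3)[of "\<ominus>\<^bsub>R\<^esub> m" a] x M_closed(4) by simp
next
  case (eng x y)
  then show ?case using assms(4) by (simp add: J_eq)
qed

lemma J_ideal: "ideal J A"
proof (rule idealI)
  show "subgroup J (add_monoid A)" by (rule J_subgroup)
  fix x a assume x: "x \<in> J" and a: "a \<in> carrier A"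
  show "a \<otimes>\<^bsub>A\<^esub> x \<in> J"
    using x
  proof (induct rule: J_induct)
    case zero
    then show ?case using a J_closed(2) by simp
  next
    case (smult m b)
    then show ?case using a M_closed(1) J_closed(4)[of m "a \<otimes>\<^bsub>A\<^esub> b"] smult_mult_right[of m a b] by auto
  next
    case (add x y)
    then show ?case using a J_closed by (simp add: A.r_distr subset_iff)
  qed
  show "x \<otimes>\<^bsub>A\<^esub> a \<in> J"
    using x
  proof (induct rule: J_induct)
    case zero
    then show ?case using a J_closed(2) by simp
  next
    case (smult m b)
    then show ?case using a M_closed(1) J_closed(4)[of m "b \<otimes>\<^bsub>A\<^esub> a"] smult_mult_left[of m b a] by auto
  next
    case (add x y)
    then show ?case using a J_closed by (simp add: A.l_distr subset_iff)
  qed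
qed (rule A.ring_axioms)

lemma Q_simps:
  "carrier Q = carrier (A Quot J)" "monoid.mult Q = monoid.mult (A Quot J)" "one Q = one (A Quot J)"
  "zero Q = zero (A Quot J)" "add Q = add (A Quot J)"
  "module.smult Q = (\<lambda>C D. \<Union>r \<in> C. \<Union>x \<in> D. J +>\<^bsub>A\<^esub> (r \<odot>\<^bsub>A\<^esub> x))"
  by (simp_all add: quotient_algebra_def Let_def)

lemma csa: "central_simple_algebra (R Quot M) Q"
  using residually_central_simple[OF M] .

lemma ring_Q: "ring Q"
  using csa by (simp add: central_simple_algebra_def simple_ring_def)

lemma h_hom: "h \<in> Ring.ring_hom A Q"
proof -
  have "h = (+>\<^bsub>A\<^esub>) J" by (simp add: h_def fun_eq_iff)
  then show ?thesis
    using ideal.rcos_ring_hom[OF J_ideal] by (simp add: Ring.ring_hom_def Q_simps)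
qed

lemma h_zero_iff: "a \<in> carrier A \<Longrightarrow> h a = \<zero>\<^bsub>Q\<^esub> \<longleftrightarrow> a \<in> J"
proof -
  assume a: "a \<in> carrier A"
  interpret J: ideal J A by (rule J_ideal)
  have "\<zero>\<^bsub>Q\<^esub> = J" by (simp add: Q_simps FactRing_def)
  then show ?thesis
    using a J.a_rcos_const[of a] J.rcos_const_imp_mem[of a] by (auto simp: h_def)
qed

lemma Q_carrier: "carrier Q = h ` carrier A"
  by (auto simp: Q_simps FactRing_def A_RCOSETS_def' h_def)

lemma h_eqI: "a \<in> carrier A \<Longrightarrow> b \<in> carrier A \<Longrightarrow> a \<ominus>\<^bsub>A\<^esub> b \<in> J \<Longrightarrow> h a = h b"
proof -
  assume ab: "a \<in> carrier A" "b \<in> carrier A" "a \<ominus>\<^bsub>A\<^esub> b \<in> J"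
  interpret Q: ring Q by (rule ring_Q)
  have d: "a \<ominus>\<^bsub>A\<^esub> b \<in> carrier A" using ab by simp
  have "a = (a \<ominus>\<^bsub>A\<^esub> b) \<oplus>\<^bsub>A\<^esub> b" using ab by (simp add: a_minus_def M.a_assoc M.l_neg)
  then have "h a = h (a \<ominus>\<^bsub>A\<^esub> b) \<oplus>\<^bsub>Q\<^esub> h b" using Ring.ring_hom_add[OF h_hom d ab(2)] by simp
  then show ?thesis using h_zero_iff[OF d] ab Ring.ring_hom_closed[OF h_hom ab(2)] by simp
qed

lemma \<zeta>_hom: "\<zeta> \<in> Ring.ring_hom R Q"
proof -
  have "\<zeta> = h \<circ> \<iota>" by (simp add: fun_eq_iff \<zeta>_def)
  then show ?thesis using ring_hom_trans[OF \<iota>_hom h_hom] by simp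
qed

text \<open>The centre of a central simple algebra consists of its scalars. The scalar action is a
  union over representatives of two cosets, and all of them give the class of r times 1, so the
  centre is the image of R.\<close>

lemma center_Q: "ring_center Q = \<zeta> ` carrier R"
proof -
  interpret A: ring A by (rule A.ring_axioms)
  interpret J: ideal J A by (rule J_ideal)
  have Rq: "carrier (R Quot M) = (\<lambda>r. M +>\<^bsub>R\<^esub> r) ` carrier R"
    by (auto simp: FactRing_def A_RCOSETS_def')
  have "(M +>\<^bsub>R\<^esub> r) \<odot>\<^bsub>Q\<^esub> \<one>\<^bsub>Q\<^esub> = \<zeta> r" if r: "r \<in> carrier R" for r
  proof -
    have one: "\<one>\<^bsub>Q\<^esub> = J +>\<^bsub>A\<^esub> \<one>\<^bsub>A\<^esub>" by (simp add: Q_simps FactRing_def)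
    have "J +>\<^bsub>A\<^esub> (r' \<odot>\<^bsub>A\<^esub> x) = \<zeta> r" if "r' \<in> M +>\<^bsub>R\<^esub> r" "x \<in> J +>\<^bsub>A\<^esub> \<one>\<^bsub>A\<^esub>" for r' x
    proof -
      from that obtain m where m: "m \<in> M" "r' = m \<oplus>\<^bsub>R\<^esub> r" by (auto simp: a_r_coset_def')
      from that obtain j where j: "j \<in> J" "x = j \<oplus>\<^bsub>A\<^esub> \<one>\<^bsub>A\<^esub>" by (auto simp: a_r_coset_def')
      have R: "m \<in> carrier R" "r' \<in> carrier R" "j \<in> carrier A" "x \<in> carrier A"
        using m j r M_closed(1) J_closed(1) by auto
      have "r' \<odot>\<^bsub>A\<^esub> x = r' \<odot>\<^bsub>A\<^esub> j \<oplus>\<^bsub>A\<^esub> (m \<odot>\<^bsub>A\<^esub> \<one>\<^bsub>A\<^esub> \<oplus>\<^bsub>A\<^esub> \<iota> r)"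
        using R r by (simp add: j(2) smult_r_distr \<iota>_def) (simp add: m(2) smult_l_distr)
      then have "r' \<odot>\<^bsub>A\<^esub> x \<ominus>\<^bsub>A\<^esub> \<iota> r = r' \<odot>\<^bsub>A\<^esub> j \<oplus>\<^bsub>A\<^esub> m \<odot>\<^bsub>A\<^esub> \<one>\<^bsub>A\<^esub>"
        using R r \<iota>_closed[OF r] by (simp add: a_minus_def M.a_assoc M.r_neg)
      moreover have "r' \<odot>\<^bsub>A\<^esub> j \<in> J"
        using smult_eq[OF R(2,3)] J.I_l_closed[OF j(1) \<iota>_closed[OF R(2)]] by simp
      ultimately have "r' \<odot>\<^bsub>A\<^esub> x \<ominus>\<^bsub>A\<^esub> \<iota> r \<in> J" using J_closed(3,4)[of _ _] m(1) by auto
      then show ?thesis using h_eqI[of "r' \<odot>\<^bsub>A\<^esub> x" "\<iota> r"] R r \<iota>_closed by (simp add: \<zeta>_def h_def)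
    qed
    moreover have "r \<in> M +>\<^bsub>R\<^esub> r" using r M_closed(2) by (force simp: a_r_coset_def')
    moreover have "\<one>\<^bsub>A\<^esub> \<in> J +>\<^bsub>A\<^esub> \<one>\<^bsub>A\<^esub>" using J_closed(2) by (force simp: a_r_coset_def')
    ultimately show ?thesis unfolding Q_simps(6) one by blast
  qed
  then show ?thesis using csa Rq by (auto simp: central_simple_algebra_def image_iff)
qed

lemma residue_inverse:
  assumes s: "s \<in> carrier R - M"
  shows "\<exists>t\<in>carrier R. \<zeta> s \<otimes>\<^bsub>Q\<^esub> \<zeta> t = \<one>\<^bsub>Q\<^esub>"
proof -
  interpret M: maximalideal M R by (rule M)
  interpret K: field "R Quot M" by (rule M.quotient_is_field) (rule R.is_cring)
  interpret Q: ring Q by (rule ring_Q)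
  have sR: "s \<in> carrier R" using s by simp
  have z: "\<zero>\<^bsub>R Quot M\<^esub> = M" by (simp add: FactRing_def)
  have c: "M +>\<^bsub>R\<^esub> s \<in> carrier (R Quot M)" using sR by (auto simp: FactRing_def A_RCOSETS_def')
  have "M +>\<^bsub>R\<^esub> s \<noteq> M" using s M.rcos_const_imp_mem by auto
  then have "M +>\<^bsub>R\<^esub> s \<in> Units (R Quot M)" using c z K.field_Units by auto
  then obtain y where y: "y \<in> carrier (R Quot M)" "(M +>\<^bsub>R\<^esub> s) \<otimes>\<^bsub>R Quot M\<^esub> y = \<one>\<^bsub>R Quot M\<^esub>"
    by (auto simp: Units_def)
  then obtain t where t: "t \<in> carrier R" "y = M +>\<^bsub>R\<^esub> t" by (auto simp: FactRing_def A_RCOSETS_def')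
  have "M +>\<^bsub>R\<^esub> (s \<otimes>\<^bsub>R\<^esub> t) = M +>\<^bsub>R\<^esub> \<one>\<^bsub>R\<^esub>"
    using y t sR by (simp add: FactRing_def M.rcoset_mult_add)
  moreover have "s \<otimes>\<^bsub>R\<^esub> t \<in> M +>\<^bsub>R\<^esub> (s \<otimes>\<^bsub>R\<^esub> t)" using M_closed(2) sR t by (force simp: a_r_coset_def')
  ultimately obtain m where m: "m \<in> M" "s \<otimes>\<^bsub>R\<^esub> t = m \<oplus>\<^bsub>R\<^esub> \<one>\<^bsub>R\<^esub>" by (auto simp: a_r_coset_def')
  have mR: "m \<in> carrier R" using m M_closed(1) by auto
  have "\<zeta> s \<otimes>\<^bsub>Q\<^esub> \<zeta> t = \<zeta> m \<oplus>\<^bsub>Q\<^esub> \<zeta> \<one>\<^bsub>R\<^esub>"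
    using Ring.ring_hom_mult[OF \<zeta>_hom sR t(1)] Ring.ring_hom_add[OF \<zeta>_hom mR R.one_closed] m(2) by simp
  also have "\<zeta> m = \<zero>\<^bsub>Q\<^esub>"
    using h_zero_iff[OF \<iota>_closed[OF mR]] J_closed(4)[OF m(1) A.one_closed] by (simp add: \<zeta>_def \<iota>_def)
  also have "\<zeta> \<one>\<^bsub>R\<^esub> = \<one>\<^bsub>Q\<^esub>" by (rule Ring.ring_hom_one[OF \<zeta>_hom])
  finally show ?thesis using t by auto
qed

lemma one_not_zero_Q: "\<one>\<^bsub>Q\<^esub> \<noteq> \<zero>\<^bsub>Q\<^esub>"
proof
  interpret Q: ring Q by (rule ring_Q)
  assume "\<one>\<^bsub>Q\<^esub> = \<zero>\<^bsub>Q\<^esub>"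
  then have "carrier Q = {\<zero>\<^bsub>Q\<^esub>}" by (rule Q.one_zeroD)
  then show False using csa by (simp add: central_simple_algebra_def simple_ring_def nonzero_ring_def)
qed

text \<open>A scalar outside M becomes invertible in the residue algebra, which is not the zero
  ring.\<close>

lemma \<zeta>_zero_iff:
  assumes r: "r \<in> carrier R" shows "\<zeta> r = \<zero>\<^bsub>Q\<^esub> \<longleftrightarrow> r \<in> M"
proof
  interpret Q: ring Q by (rule ring_Q)
  show "\<zeta> r = \<zero>\<^bsub>Q\<^esub>" if "r \<in> M"
    using h_zero_iff[OF \<iota>_closed[OF r]] J_closed(4)[OF that A.one_closed] by (simp add: \<zeta>_def \<iota>_def)
  show "r \<in> M" if z: "\<zeta> r = \<zero>\<^bsub>Q\<^esub>"
  proof (rule ccontr)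
    assume "r \<notin> M"
    then obtain t where "t \<in> carrier R" "\<zeta> r \<otimes>\<^bsub>Q\<^esub> \<zeta> t = \<one>\<^bsub>Q\<^esub>" using residue_inverse r by blast
    then show False using z one_not_zero_Q Ring.ring_hom_closed[OF \<zeta>_hom] by simp
  qed
qed

lemma ex_generators:
  "\<exists>s (g :: nat \<Rightarrow> 'c). (\<forall>i. g i \<in> carrier A) \<and>
     (\<forall>a\<in>carrier A. \<exists>r. (\<forall>i. r i \<in> carrier R) \<and> a = (\<Oplus>\<^bsub>A\<^esub>i\<in>{..<s}. \<iota> (r i) \<otimes>\<^bsub>A\<^esub> g i))"
proof -
  from finitely_generated obtain B where B: "finite B" "B \<subseteq> carrier A" "module.span R A B = carrier A"
    by (auto simp: finitely_generated_def)
  from ex_bij_betw_nat_finite[OF B(1)] obtain b where b: "bij_betw b {0..<card B} B" by blast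
  define g where "g i = (if i < card B then b i else \<zero>\<^bsub>A\<^esub>)" for i
  have bB: "b i \<in> B" if "i < card B" for i using b that by (auto simp: bij_betw_def)
  have gA: "g i \<in> carrier A" for i using bB B(2) by (auto simp: g_def)
  have "\<exists>r. (\<forall>i. r i \<in> carrier R) \<and> a = (\<Oplus>\<^bsub>A\<^esub>i\<in>{..<card B}. \<iota> (r i) \<otimes>\<^bsub>A\<^esub> g i)" if a: "a \<in> carrier A" for a
  proof -
    have "a \<in> module.span R A B" using a B(3) by simp
    then obtain c where c: "c \<in> B \<rightarrow> carrier R" "module.lincomb A c B = a"
      using finite_in_span[OF B(1,2)] by blast
    define r where "r i = (if i < card B then c (b i) else \<zero>\<^bsub>R\<^esub>)" for i
    have rR: "r i \<in> carrier R" for i using c(1) bB by (auto simp: r_def)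
    have "a = (\<Oplus>\<^bsub>A\<^esub>v\<in>b ` {..<card B}. c v \<odot>\<^bsub>A\<^esub> v)"
      using c(2) b by (simp add: lincomb_def bij_betw_def lessThan_atLeast0)
    also have "\<dots> = (\<Oplus>\<^bsub>A\<^esub>i\<in>{..<card B}. c (b i) \<odot>\<^bsub>A\<^esub> b i)"
      using b bB B(2) c(1) by (intro M.finsum_reindex) (auto simp: bij_betw_def lessThan_atLeast0 subset_iff Pi_iff)
    also have "\<dots> = (\<Oplus>\<^bsub>A\<^esub>i\<in>{..<card B}. \<iota> (r i) \<otimes>\<^bsub>A\<^esub> g i)"
    proof (rule M.finsum_cong'[OF refl])
      fix i assume "i \<in> {..<card B}"
      then show "c (b i) \<odot>\<^bsub>A\<^esub> b i = \<iota> (r i) \<otimes>\<^bsub>A\<^esub> g i"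
        using smult_eq[OF rR gA, of i i] by (simp add: r_def g_def)
    qed (use rR gA \<iota>_closed in auto)
    finally show ?thesis using rR by blast
  qed
  then show ?thesis using gA by blast
qed

text \<open>Expanding a in m a by the generators gives coefficients m r, which lie in M. This is the
  form in which \<open>local_split\<close> asks for the kernel.\<close>

lemma J_generators:
  assumes g: "\<And>i. g i \<in> carrier A"
    and gen: "\<And>a. a \<in> carrier A \<Longrightarrow> \<exists>r. (\<forall>i. r i \<in> carrier R) \<and> a = (\<Oplus>\<^bsub>A\<^esub>i\<in>{..<s::nat}. \<iota> (r i) \<otimes>\<^bsub>A\<^esub> g i)"
    and x: "x \<in> J"
  shows "\<exists>r. (\<forall>i. r i \<in> M) \<and> x = (\<Oplus>\<^bsub>A\<^esub>i\<in>{..<s}. \<iota> (r i) \<otimes>\<^bsub>A\<^esub> g i)"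
  using x
proof (induct rule: J_induct)
  case zero
  have "\<iota> \<zero>\<^bsub>R\<^esub> = \<zero>\<^bsub>A\<^esub>" by (simp add: \<iota>_def)
  then show ?case using g M_closed(2) by (intro exI[of _ "\<lambda>_. \<zero>\<^bsub>R\<^esub>"]) (simp add: M.finsum_zero)
next
  case (smult m a)
  from gen[OF smult(2)] obtain r where r: "\<And>i. r i \<in> carrier R" "a = (\<Oplus>\<^bsub>A\<^esub>i\<in>{..<s}. \<iota> (r i) \<otimes>\<^bsub>A\<^esub> g i)" by blast
  have mR: "m \<in> carrier R" using smult M_closed(1) by auto
  have "m \<odot>\<^bsub>A\<^esub> a = (\<Oplus>\<^bsub>A\<^esub>i\<in>{..<s}. \<iota> m \<otimes>\<^bsub>A\<^esub> (\<iota> (r i) \<otimes>\<^bsub>A\<^esub> g i))"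
    unfolding smult_eq[OF mR smult(2)] unfolding r(2) using r(1) g \<iota>_closed mR by (intro A.finsum_rdistr) auto
  also have "\<dots> = (\<Oplus>\<^bsub>A\<^esub>i\<in>{..<s}. \<iota> (m \<otimes>\<^bsub>R\<^esub> r i) \<otimes>\<^bsub>A\<^esub> g i)"
    using r(1) g \<iota>_closed mR
    by (intro M.finsum_cong' refl) (auto simp: Ring.ring_hom_mult[OF \<iota>_hom] A.m_assoc)
  finally show ?case using r(1) M_closed(6)[OF smult(1)] by (intro exI[of _ "\<lambda>i. m \<otimes>\<^bsub>R\<^esub> r i"]) auto
next
  case (add x y)
  then obtain r t where r: "\<And>i. r i \<in> M" "x = (\<Oplus>\<^bsub>A\<^esub>i\<in>{..<s}. \<iota> (r i) \<otimes>\<^bsub>A\<^esub> g i)"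
    and t: "\<And>i. t i \<in> M" "y = (\<Oplus>\<^bsub>A\<^esub>i\<in>{..<s}. \<iota> (t i) \<otimes>\<^bsub>A\<^esub> g i)" by blast
  have R: "r i \<in> carrier R" "t i \<in> carrier R" for i using r t M_closed(1) by auto
  have "x \<oplus>\<^bsub>A\<^esub> y = (\<Oplus>\<^bsub>A\<^esub>i\<in>{..<s}. \<iota> (r i) \<otimes>\<^bsub>A\<^esub> g i \<oplus>\<^bsub>A\<^esub> \<iota> (t i) \<otimes>\<^bsub>A\<^esub> g i)"
    unfolding r(2) t(2) using R g \<iota>_closed by (intro M.finsum_addf[symmetric]) auto
  also have "\<dots> = (\<Oplus>\<^bsub>A\<^esub>i\<in>{..<s}. \<iota> (r i \<oplus>\<^bsub>R\<^esub> t i) \<otimes>\<^bsub>A\<^esub> g i)"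
    using R g \<iota>_closed by (intro M.finsum_cong' refl) (auto simp: Ring.ring_hom_add[OF \<iota>_hom] A.l_distr)
  finally show ?case using r t M_closed(3) by (intro exI[of _ "\<lambda>i. r i \<oplus>\<^bsub>R\<^esub> t i"]) auto
qed

subsection \<open>Bases of the localization are bases of the residue algebra\<close>

text \<open>Reduction maps the localized module L onto Q, compatibly with the residue map of the
  local ring, so the images of a basis span. For independence, a relation is lifted to an element of
  the kernel of reduction; such an element also has coordinates that reduce to zero, and by
  uniqueness of coordinates these are the lifted coefficients.\<close>

lemma residue_basis:
  assumes "free_of_rank (local_ring_at R M) (local_module_at R A M) N"
  shows "\<exists>x. (\<forall>p. x p \<in> carrier A) \<and> simple_ring_of_rank Q N (\<lambda>p. h (x p))"
proof -
  interpret Q: ring Q by (rule ring_Q)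
  interpret M: primeideal M R by (rule R.maximalideal_prime[OF M])
  define S where "S = carrier R - M"
  interpret MS: multiplicative_set R S
  proof unfold_locales
    show "\<one>\<^bsub>R\<^esub> \<in> S" using M.I_notcarr M.one_imp_carrier by (auto simp: S_def)
    show "s \<otimes>\<^bsub>R\<^esub> t \<in> S" if "s \<in> S" "t \<in> S" for s t using that M.I_prime by (auto simp: S_def)
  qed (auto simp: S_def)
  define \<phi> where "\<phi> r = MS.frac r \<one>\<^bsub>R\<^esub>" for r
  have \<phi>_hom: "\<phi> \<in> Ring.ring_hom R MS.T" using MS.frac_ring_hom by (simp add: \<phi>_def[abs_def])
  interpret T: cring MS.T by (rule MS.cring_T)
  interpret SE: scalar_extension R A MS.T \<phi>
    by unfold_locales (rule \<phi>_hom)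
  have L_eq: "local_module_at R A M = SE.L" by (simp add: local_module_at_def S_def \<phi>_def[abs_def])
  note Rh = Ring.ring_hom_mult[OF \<zeta>_hom] Ring.ring_hom_add[OF \<zeta>_hom]
  have \<zeta>Q: "\<zeta> r \<in> carrier Q" if "r \<in> carrier R" for r using Ring.ring_hom_closed[OF \<zeta>_hom that] .
  have hQ: "h a \<in> carrier Q" if "a \<in> carrier A" for a using Ring.ring_hom_closed[OF h_hom that] .
  have \<zeta>_comm: "\<zeta> r \<otimes>\<^bsub>Q\<^esub> w = w \<otimes>\<^bsub>Q\<^esub> \<zeta> r" if "r \<in> carrier R" "w \<in> carrier Q" for r w
  proof -
    have "\<zeta> r \<in> ring_center Q" using center_Q that by auto
    then show ?thesis using that(2) by (simp add: ring_center_def)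
  qed
  have cancel: "z = z'" if "z \<in> carrier Q" "z' \<in> carrier Q" "s \<in> S" "z \<otimes>\<^bsub>Q\<^esub> \<zeta> s = z' \<otimes>\<^bsub>Q\<^esub> \<zeta> s" for z z' s
  proof -
    have "s \<in> carrier R - M" using that(3) by (simp add: S_def)
    from residue_inverse[OF this] obtain t where t: "t \<in> carrier R" "\<zeta> s \<otimes>\<^bsub>Q\<^esub> \<zeta> t = \<one>\<^bsub>Q\<^esub>" by blast
    have s: "\<zeta> s \<in> carrier Q" using \<zeta>Q MS.S_carrier that(3) by auto
    have "z = z \<otimes>\<^bsub>Q\<^esub> \<zeta> s \<otimes>\<^bsub>Q\<^esub> \<zeta> t" using that(1) t s \<zeta>Q[OF t(1)] by (simp add: Q.m_assoc)
    also have "\<dots> = z'" unfolding that(4) using that(1,2) t s \<zeta>Q[OF t(1)] by (simp add: Q.m_assoc)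
    finally show ?thesis .
  qed
  \<comment> \<open>The residue map of the local ring, with values in the centre of Q: r/s goes to
    the z with z * \<open>\<zeta> s\<close> = \<open>\<zeta> r\<close>, which is unique because
    \<open>\<zeta> s\<close> is invertible.\<close>
  define \<eta> where "\<eta> C = (SOME z. z \<in> carrier Q \<and>
      (\<exists>r\<in>carrier R. \<exists>s\<in>S. C = MS.frac r s \<and> z \<otimes>\<^bsub>Q\<^esub> \<zeta> s = \<zeta> r))" for C
  have \<eta>I: "\<eta> (MS.frac r s) = z" if z: "z \<in> carrier Q" "z \<otimes>\<^bsub>Q\<^esub> \<zeta> s = \<zeta> r" and rs: "r \<in> carrier R" "s \<in> S" for r s z
    unfolding \<eta>_def
  proof (rule some_equality)
    fix z' assume "z' \<in> carrier Q \<and> (\<exists>r'\<in>carrier R. \<exists>s'\<in>S. MS.frac r s = MS.frac r' s' \<and> z' \<otimes>\<^bsub>Q\<^esub> \<zeta> s' = \<zeta> r')"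
    then obtain r' s' where z': "z' \<in> carrier Q" "r' \<in> carrier R" "s' \<in> S" "MS.frac r s = MS.frac r' s'"
      "z' \<otimes>\<^bsub>Q\<^esub> \<zeta> s' = \<zeta> r'" by blast
    then obtain u where u: "u \<in> S" "u \<otimes>\<^bsub>R\<^esub> (r \<otimes>\<^bsub>R\<^esub> s' \<ominus>\<^bsub>R\<^esub> r' \<otimes>\<^bsub>R\<^esub> s) = \<zero>\<^bsub>R\<^esub>"
      using rs by (auto simp: MS.frac_eq_iff)
    have R: "s \<in> carrier R" "s' \<in> carrier R" "u \<in> carrier R" using rs z' u MS.S_carrier by auto
    have eq: "u \<otimes>\<^bsub>R\<^esub> (r \<otimes>\<^bsub>R\<^esub> s') = u \<otimes>\<^bsub>R\<^esub> (r' \<otimes>\<^bsub>R\<^esub> s)"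
      using u(2) R rs z'(2) MS.cross_eq[of u "r \<otimes>\<^bsub>R\<^esub> s'" "r' \<otimes>\<^bsub>R\<^esub> s"] by simp
    have "z' \<otimes>\<^bsub>Q\<^esub> \<zeta> (u \<otimes>\<^bsub>R\<^esub> (s \<otimes>\<^bsub>R\<^esub> s')) = \<zeta> (u \<otimes>\<^bsub>R\<^esub> (r' \<otimes>\<^bsub>R\<^esub> s))"
    proof -
      have "u \<otimes>\<^bsub>R\<^esub> (s \<otimes>\<^bsub>R\<^esub> s') = s' \<otimes>\<^bsub>R\<^esub> (u \<otimes>\<^bsub>R\<^esub> s)" "r' \<otimes>\<^bsub>R\<^esub> (u \<otimes>\<^bsub>R\<^esub> s) = u \<otimes>\<^bsub>R\<^esub> (r' \<otimes>\<^bsub>R\<^esub> s)"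
        using R z'(2) by (simp_all add: R.m_ac)
      moreover have "z' \<otimes>\<^bsub>Q\<^esub> \<zeta> (s' \<otimes>\<^bsub>R\<^esub> (u \<otimes>\<^bsub>R\<^esub> s)) = \<zeta> (r' \<otimes>\<^bsub>R\<^esub> (u \<otimes>\<^bsub>R\<^esub> s))"
        using R z' \<zeta>Q by (simp add: Rh flip: z'(5)) (simp add: Q.m_assoc)
      ultimately show ?thesis by simp
    qed
    also have "\<dots> = \<zeta> (u \<otimes>\<^bsub>R\<^esub> (r \<otimes>\<^bsub>R\<^esub> s'))" using eq by simp
    also have "\<dots> = z \<otimes>\<^bsub>Q\<^esub> \<zeta> (u \<otimes>\<^bsub>R\<^esub> (s \<otimes>\<^bsub>R\<^esub> s'))"
    proof -
      have "u \<otimes>\<^bsub>R\<^esub> (s \<otimes>\<^bsub>R\<^esub> s') = s \<otimes>\<^bsub>R\<^esub> (u \<otimes>\<^bsub>R\<^esub> s')" "r \<otimes>\<^bsub>R\<^esub> (u \<otimes>\<^bsub>R\<^esub> s') = u \<otimes>\<^bsub>R\<^esub> (r \<otimes>\<^bsub>R\<^esub> s')"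
        using R rs by (simp_all add: R.m_ac)
      moreover have "z \<otimes>\<^bsub>Q\<^esub> \<zeta> (s \<otimes>\<^bsub>R\<^esub> (u \<otimes>\<^bsub>R\<^esub> s')) = \<zeta> (r \<otimes>\<^bsub>R\<^esub> (u \<otimes>\<^bsub>R\<^esub> s'))"
        using R z rs \<zeta>Q by (simp add: Rh flip: z(2)) (simp add: Q.m_assoc)
      ultimately show ?thesis by simp
    qed
    finally show "z' = z" by (rule cancel[OF z'(1) z(1), rotated]) (use u rs z'(3) MS.S_mult in simp)
  qed (use that in blast)
  have \<eta>_frac: "\<eta> (MS.frac r s) \<in> \<zeta> ` carrier R" "\<eta> (MS.frac r s) \<otimes>\<^bsub>Q\<^esub> \<zeta> s = \<zeta> r"
    if rs: "r \<in> carrier R" "s \<in> S" for r s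
  proof -
    obtain t where t: "t \<in> carrier R" "\<zeta> s \<otimes>\<^bsub>Q\<^esub> \<zeta> t = \<one>\<^bsub>Q\<^esub>" using residue_inverse rs(2) by (auto simp: S_def)
    have s: "s \<in> carrier R" using rs MS.S_carrier by auto
    have "\<zeta> (r \<otimes>\<^bsub>R\<^esub> t) \<otimes>\<^bsub>Q\<^esub> \<zeta> s = \<zeta> r \<otimes>\<^bsub>Q\<^esub> (\<zeta> s \<otimes>\<^bsub>Q\<^esub> \<zeta> t)"
      using rs t s \<zeta>Q \<zeta>_comm[OF t(1) \<zeta>Q[OF s]] by (simp add: Rh Q.m_assoc)
    then have e: "\<zeta> (r \<otimes>\<^bsub>R\<^esub> t) \<otimes>\<^bsub>Q\<^esub> \<zeta> s = \<zeta> r" using t(2) \<zeta>Q rs by simp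
    then have "\<eta> (MS.frac r s) = \<zeta> (r \<otimes>\<^bsub>R\<^esub> t)" using rs t \<zeta>Q by (intro \<eta>I) auto
    then show "\<eta> (MS.frac r s) \<in> \<zeta> ` carrier R" "\<eta> (MS.frac r s) \<otimes>\<^bsub>Q\<^esub> \<zeta> s = \<zeta> r" using e rs t by auto
  qed
  have \<eta>c: "\<eta> C \<in> \<zeta> ` carrier R" if "C \<in> carrier MS.T" for C
    using that \<eta>_frac(1) by (auto elim!: MS.T_cases)
  have \<eta>Q: "\<eta> C \<in> carrier Q" if "C \<in> carrier MS.T" for C using \<eta>c[OF that] \<zeta>Q by auto
  have \<eta>_comm: "\<eta> C \<otimes>\<^bsub>Q\<^esub> w = w \<otimes>\<^bsub>Q\<^esub> \<eta> C" if "C \<in> carrier MS.T" "w \<in> carrier Q" for C w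
    using \<eta>c[OF that(1)] \<zeta>_comm that(2) by auto
  have \<eta>_add: "\<eta> (C \<oplus>\<^bsub>MS.T\<^esub> D) = \<eta> C \<oplus>\<^bsub>Q\<^esub> \<eta> D" and \<eta>_mult: "\<eta> (C \<otimes>\<^bsub>MS.T\<^esub> D) = \<eta> C \<otimes>\<^bsub>Q\<^esub> \<eta> D"
    if CD: "C \<in> carrier MS.T" "D \<in> carrier MS.T" for C D
  proof -
    from CD(1) obtain r s where C: "r \<in> carrier R" "s \<in> S" "C = MS.frac r s" by (rule MS.T_cases)
    from CD(2) obtain r' s' where D: "r' \<in> carrier R" "s' \<in> S" "D = MS.frac r' s'" by (rule MS.T_cases)
    have s: "s \<in> carrier R" "s' \<in> carrier R" using C D MS.S_carrier by auto
    have eC: "\<eta> C \<otimes>\<^bsub>Q\<^esub> \<zeta> s = \<zeta> r" "\<eta> D \<otimes>\<^bsub>Q\<^esub> \<zeta> s' = \<zeta> r'" using C D \<eta>_frac by auto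
    note cl = \<eta>Q[OF CD(1)] \<eta>Q[OF CD(2)] \<zeta>Q[OF s(1)] \<zeta>Q[OF s(2)] \<zeta>Q[OF C(1)] \<zeta>Q[OF D(1)]
    have 1: "\<eta> C \<otimes>\<^bsub>Q\<^esub> (\<zeta> s \<otimes>\<^bsub>Q\<^esub> \<zeta> s') = \<zeta> r \<otimes>\<^bsub>Q\<^esub> \<zeta> s'" using cl eC(1) by (simp flip: Q.m_assoc)
    have 2: "\<eta> D \<otimes>\<^bsub>Q\<^esub> (\<zeta> s \<otimes>\<^bsub>Q\<^esub> \<zeta> s') = \<zeta> r' \<otimes>\<^bsub>Q\<^esub> \<zeta> s"
      unfolding \<zeta>_comm[OF s(1) cl(4)] using cl eC(2) by (simp flip: Q.m_assoc)
    show "\<eta> (C \<oplus>\<^bsub>MS.T\<^esub> D) = \<eta> C \<oplus>\<^bsub>Q\<^esub> \<eta> D"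
      unfolding C(3) D(3) MS.frac_add[OF C(1,2) D(1,2)]
    proof (rule \<eta>I, unfold C(3)[symmetric] D(3)[symmetric])
      show "(\<eta> C \<oplus>\<^bsub>Q\<^esub> \<eta> D) \<otimes>\<^bsub>Q\<^esub> \<zeta> (s \<otimes>\<^bsub>R\<^esub> s') = \<zeta> (r \<otimes>\<^bsub>R\<^esub> s' \<oplus>\<^bsub>R\<^esub> r' \<otimes>\<^bsub>R\<^esub> s)"
        using cl s C(1) D(1) by (simp add: Rh Q.l_distr 1 2)
    qed (use cl C D s MS.S_mult in auto)
    show "\<eta> (C \<otimes>\<^bsub>MS.T\<^esub> D) = \<eta> C \<otimes>\<^bsub>Q\<^esub> \<eta> D"
      unfolding C(3) D(3) MS.frac_mult[OF C(1,2) D(1,2)]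
    proof (rule \<eta>I, unfold C(3)[symmetric] D(3)[symmetric])
      have "(\<eta> C \<otimes>\<^bsub>Q\<^esub> \<eta> D) \<otimes>\<^bsub>Q\<^esub> (\<zeta> s \<otimes>\<^bsub>Q\<^esub> \<zeta> s') = \<eta> C \<otimes>\<^bsub>Q\<^esub> (\<zeta> r' \<otimes>\<^bsub>Q\<^esub> \<zeta> s)"
        using cl 2 by (simp add: Q.m_assoc)
      also have "\<dots> = \<zeta> r \<otimes>\<^bsub>Q\<^esub> \<zeta> r'"
        unfolding \<zeta>_comm[OF D(1) cl(3)] using cl eC(1) by (simp flip: Q.m_assoc)
      finally show "(\<eta> C \<otimes>\<^bsub>Q\<^esub> \<eta> D) \<otimes>\<^bsub>Q\<^esub> \<zeta> (s \<otimes>\<^bsub>R\<^esub> s') = \<zeta> (r \<otimes>\<^bsub>R\<^esub> r')"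
        using s C(1) D(1) by (simp add: Rh)
    qed (use cl C D s MS.S_mult in auto)
  qed
  have \<eta>\<phi>: "\<eta> (\<phi> r) = \<zeta> r" if "r \<in> carrier R" for r
    unfolding \<phi>_def using that \<zeta>Q MS.S_one Ring.ring_hom_one[OF \<zeta>_hom] by (intro \<eta>I) auto
  have \<phi>T: "\<phi> r \<in> carrier MS.T" if "r \<in> carrier R" for r using Ring.ring_hom_closed[OF \<phi>_hom that] .
  \<comment> \<open>The reduction of L: x tensor y goes to the residue of y times the class of
    x.\<close>
  have "\<exists>\<Psi>. (\<forall>C\<in>carrier SE.L. \<Psi> C \<in> carrier Q) \<and>
    (\<forall>C\<in>carrier SE.L. \<forall>D\<in>carrier SE.L. \<Psi> (C \<oplus>\<^bsub>SE.L\<^esub> D) = \<Psi> C \<oplus>\<^bsub>Q\<^esub> \<Psi> D) \<and>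
    (\<forall>x\<in>carrier A. \<forall>y\<in>carrier MS.T. \<Psi> (SE.tens x y) = \<eta> y \<otimes>\<^bsub>Q\<^esub> h x)"
  proof (rule SE.L_universal)
    show "abelian_group Q" by (rule Q.is_abelian_group)
    show "\<eta> (y \<oplus>\<^bsub>MS.T\<^esub> y') \<otimes>\<^bsub>Q\<^esub> h x = \<eta> y \<otimes>\<^bsub>Q\<^esub> h x \<oplus>\<^bsub>Q\<^esub> \<eta> y' \<otimes>\<^bsub>Q\<^esub> h x"
      if "x \<in> carrier A" "y \<in> carrier MS.T" "y' \<in> carrier MS.T" for x y y'
      using that \<eta>Q hQ by (simp add: \<eta>_add Q.l_distr)
    show "\<eta> y \<otimes>\<^bsub>Q\<^esub> h (r \<odot>\<^bsub>A\<^esub> x) = \<eta> (\<phi> r \<otimes>\<^bsub>MS.T\<^esub> y) \<otimes>\<^bsub>Q\<^esub> h x"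
      if "r \<in> carrier R" "x \<in> carrier A" "y \<in> carrier MS.T" for r x y
    proof -
      have "h (r \<odot>\<^bsub>A\<^esub> x) = \<zeta> r \<otimes>\<^bsub>Q\<^esub> h x"
        using that smult_eq \<iota>_closed by (simp add: Ring.ring_hom_mult[OF h_hom] \<zeta>_def)
      moreover have "\<eta> (\<phi> r \<otimes>\<^bsub>MS.T\<^esub> y) = \<eta> y \<otimes>\<^bsub>Q\<^esub> \<zeta> r"
        using that \<phi>T \<eta>Q \<zeta>Q by (simp add: \<eta>_mult \<eta>\<phi> \<zeta>_comm)
      ultimately show ?thesis using that \<eta>Q \<zeta>Q hQ by (simp add: Q.m_assoc)
    qed
  qed (use \<eta>Q hQ in \<open>auto simp: Ring.ring_hom_add[OF h_hom] Q.r_distr\<close>)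
  then obtain \<Psi> where \<Psi>Q: "\<And>C. C \<in> carrier SE.L \<Longrightarrow> \<Psi> C \<in> carrier Q"
    and \<Psi>_add: "\<And>C D. C \<in> carrier SE.L \<Longrightarrow> D \<in> carrier SE.L \<Longrightarrow> \<Psi> (C \<oplus>\<^bsub>SE.L\<^esub> D) = \<Psi> C \<oplus>\<^bsub>Q\<^esub> \<Psi> D"
    and \<Psi>_tens: "\<And>x y. x \<in> carrier A \<Longrightarrow> y \<in> carrier MS.T \<Longrightarrow> \<Psi> (SE.tens x y) = \<eta> y \<otimes>\<^bsub>Q\<^esub> h x" by blast
  have frac1: "MS.frac \<one>\<^bsub>R\<^esub> s \<in> carrier MS.T" if "s \<in> S" for s using that by (simp add: MS.frac_closed)
  have \<phi>_frac: "\<phi> r \<otimes>\<^bsub>MS.T\<^esub> MS.frac \<one>\<^bsub>R\<^esub> s = MS.frac r s" if "r \<in> carrier R" "s \<in> S" for r s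
    using that MS.S_one MS.S_carrier by (simp add: \<phi>_def MS.frac_mult)
  have tens_zero: "SE.tens \<zero>\<^bsub>A\<^esub> y = \<zero>\<^bsub>SE.L\<^esub>" if y: "y \<in> carrier MS.T" for y
  proof -
    have z: "SE.tens \<zero>\<^bsub>A\<^esub> y \<in> carrier SE.L" using y by (intro SE.tens_closed) auto
    have "SE.tens \<zero>\<^bsub>A\<^esub> y \<oplus>\<^bsub>SE.L\<^esub> SE.tens \<zero>\<^bsub>A\<^esub> y = SE.tens \<zero>\<^bsub>A\<^esub> y"
      using SE.tens_add_left[of "\<zero>\<^bsub>A\<^esub>" "\<zero>\<^bsub>A\<^esub>" y] y by simp
    then show ?thesis using z by (metis SE.L.M.add.r_cancel_one)
  qed
  \<comment> \<open>Common denominators: every element of the localized module is a single tensor of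
    some x with 1/s.\<close>
  have rep: "\<exists>x\<in>carrier A. \<exists>s\<in>S. C = SE.tens x (MS.frac \<one>\<^bsub>R\<^esub> s)" if "C \<in> carrier SE.L" for C
    using that
  proof (induct rule: SE.L_induct)
    case zero
    then show ?case using tens_zero frac1 MS.S_one by (intro bexI[of _ "\<zero>\<^bsub>A\<^esub>"] bexI[of _ "\<one>\<^bsub>R\<^esub>"]) auto
  next
    case (tens x y)
    from tens(2) obtain r s where y: "r \<in> carrier R" "s \<in> S" "y = MS.frac r s" by (rule MS.T_cases)
    then show ?case
      using tens SE.tens_smult_left[OF y(1) tens(1) frac1[OF y(2)]] \<phi>_frac
      by (intro bexI[of _ "r \<odot>\<^bsub>A\<^esub> x"] bexI[of _ s]) auto
  next
    case (diff C D)
    then obtain x s y t where C: "x \<in> carrier A" "s \<in> S" "C = SE.tens x (MS.frac \<one>\<^bsub>R\<^esub> s)"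
      and D: "y \<in> carrier A" "t \<in> S" "D = SE.tens y (MS.frac \<one>\<^bsub>R\<^esub> t)" by blast
    have st: "s \<in> carrier R" "t \<in> carrier R" "s \<otimes>\<^bsub>R\<^esub> t \<in> S" using C D MS.S_carrier MS.S_mult by auto
    let ?u = "MS.frac \<one>\<^bsub>R\<^esub> (s \<otimes>\<^bsub>R\<^esub> t)"
    have u: "?u \<in> carrier MS.T" using st frac1 by simp
    have "MS.frac t (s \<otimes>\<^bsub>R\<^esub> t) = MS.frac \<one>\<^bsub>R\<^esub> s" "MS.frac s (s \<otimes>\<^bsub>R\<^esub> t) = MS.frac \<one>\<^bsub>R\<^esub> t"
    proof -
      have "t \<otimes>\<^bsub>R\<^esub> s = \<one>\<^bsub>R\<^esub> \<otimes>\<^bsub>R\<^esub> (s \<otimes>\<^bsub>R\<^esub> t)" using st R.m_comm[of s t] by simp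
      then show "MS.frac t (s \<otimes>\<^bsub>R\<^esub> t) = MS.frac \<one>\<^bsub>R\<^esub> s"
        by (rule MS.frac_eqI[OF st(2,3) R.one_closed C(2)])
      have "s \<otimes>\<^bsub>R\<^esub> t = \<one>\<^bsub>R\<^esub> \<otimes>\<^bsub>R\<^esub> (s \<otimes>\<^bsub>R\<^esub> t)" using st by simp
      then show "MS.frac s (s \<otimes>\<^bsub>R\<^esub> t) = MS.frac \<one>\<^bsub>R\<^esub> t"
        by (rule MS.frac_eqI[OF st(1,3) R.one_closed D(2)])
    qed
    then have "C = SE.tens (t \<odot>\<^bsub>A\<^esub> x) ?u" "D = SE.tens (s \<odot>\<^bsub>A\<^esub> y) ?u"
      using C D st u by (simp_all add: SE.tens_smult_left \<phi>_frac)
    then obtain x' y' where x': "x' \<in> carrier A" "C = SE.tens x' ?u" and y': "y' \<in> carrier A" "D = SE.tens y' ?u"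
      using C D st by blast
    have "SE.tens (x' \<ominus>\<^bsub>A\<^esub> y') ?u \<oplus>\<^bsub>SE.L\<^esub> D = C"
      using SE.tens_add_left[of "x' \<ominus>\<^bsub>A\<^esub> y'" y' ?u] x' y' u
      by (simp add: a_minus_def M.a_assoc M.l_neg)
    moreover have "SE.tens (x' \<ominus>\<^bsub>A\<^esub> y') ?u \<in> carrier SE.L" using x' y' u by (intro SE.tens_closed) auto
    ultimately have "C \<ominus>\<^bsub>SE.L\<^esub> D = SE.tens (x' \<ominus>\<^bsub>A\<^esub> y') ?u"
      using diff(2) by (auto simp: a_minus_def SE.L.M.a_assoc SE.L.M.r_neg)
    then show ?case using x' y' st by (intro bexI[of _ "x' \<ominus>\<^bsub>A\<^esub> y'"] bexI[of _ "s \<otimes>\<^bsub>R\<^esub> t"]) auto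
  qed
  have \<Psi>_smult: "\<Psi> (t \<odot>\<^bsub>SE.L\<^esub> C) = \<eta> t \<otimes>\<^bsub>Q\<^esub> \<Psi> C" if t: "t \<in> carrier MS.T" and C: "C \<in> carrier SE.L" for t C
  proof -
    from rep[OF C] obtain x s where x: "x \<in> carrier A" "s \<in> S" "C = SE.tens x (MS.frac \<one>\<^bsub>R\<^esub> s)" by blast
    then show ?thesis
      using t frac1[OF x(2)] \<eta>Q hQ by (simp add: SE.smult_tens \<Psi>_tens \<eta>_mult Q.m_assoc)
  qed
  from assms obtain B where B: "finite B" "card B = N" "B \<subseteq> carrier SE.L" "\<not> module.lin_dep MS.T SE.L B"
    "module.span MS.T SE.L B = carrier SE.L"
    unfolding free_of_rank_def L_eq S_def[symmetric] by blast
  from ex_bij_betw_nat_finite[OF B(1)] obtain b where b: "bij_betw b {..<N} B"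
    using B(2) by (auto simp: lessThan_atLeast0)
  define \<beta> where "\<beta> p = (if p < N then b p else \<zero>\<^bsub>SE.L\<^esub>)" for p
  have bB: "b p \<in> B" if "p < N" for p using b that by (auto simp: bij_betw_def)
  have \<beta>L: "\<beta> p \<in> carrier SE.L" for p using bB B(3) by (auto simp: \<beta>_def)
  have sum_b: "SE.L.lincomb c B = (\<Oplus>\<^bsub>SE.L\<^esub>p\<in>{..<N}. c (b p) \<odot>\<^bsub>SE.L\<^esub> \<beta> p)" if c: "c \<in> B \<rightarrow> carrier MS.T" for c
  proof -
    have "SE.L.lincomb c B = (\<Oplus>\<^bsub>SE.L\<^esub>v\<in>b ` {..<N}. c v \<odot>\<^bsub>SE.L\<^esub> v)"
      using b by (simp add: SE.L.lincomb_def bij_betw_def)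
    also have "\<dots> = (\<Oplus>\<^bsub>SE.L\<^esub>p\<in>{..<N}. c (b p) \<odot>\<^bsub>SE.L\<^esub> b p)"
      using b bB B(3) c by (intro SE.L.M.finsum_reindex) (auto simp: bij_betw_def subset_iff Pi_iff)
    also have "\<dots> = (\<Oplus>\<^bsub>SE.L\<^esub>p\<in>{..<N}. c (b p) \<odot>\<^bsub>SE.L\<^esub> \<beta> p)"
    proof (rule SE.L.M.finsum_cong'[OF refl])
      show "(\<lambda>p. c (b p) \<odot>\<^bsub>SE.L\<^esub> \<beta> p) \<in> {..<N} \<rightarrow> carrier SE.L" using c bB \<beta>L by auto
    qed (simp add: \<beta>_def)
    finally show ?thesis .
  qed
  have span: "\<exists>t. (\<forall>p. t p \<in> carrier MS.T) \<and> C = (\<Oplus>\<^bsub>SE.L\<^esub>p\<in>{..<N}. t p \<odot>\<^bsub>SE.L\<^esub> \<beta> p)" if C: "C \<in> carrier SE.L" for C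
  proof -
    have "C \<in> module.span MS.T SE.L B" using C B(5) by simp
    then obtain c where c: "c \<in> B \<rightarrow> carrier MS.T" "SE.L.lincomb c B = C"
      using SE.L.finite_in_span[OF B(1,3)] by blast
    define t where "t p = (if p < N then c (b p) else \<zero>\<^bsub>MS.T\<^esub>)" for p
    have tT: "t p \<in> carrier MS.T" for p using c(1) bB by (auto simp: t_def)
    have "C = (\<Oplus>\<^bsub>SE.L\<^esub>p\<in>{..<N}. t p \<odot>\<^bsub>SE.L\<^esub> \<beta> p)"
      unfolding c(2)[symmetric] sum_b[OF c(1)]
    proof (rule SE.L.M.finsum_cong'[OF refl])
      show "(\<lambda>p. t p \<odot>\<^bsub>SE.L\<^esub> \<beta> p) \<in> {..<N} \<rightarrow> carrier SE.L" using tT \<beta>L by auto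
    qed (simp add: t_def)
    then show ?thesis using tT by blast
  qed
  have indep: "t p = \<zero>\<^bsub>MS.T\<^esub>" if t: "\<And>p. t p \<in> carrier MS.T" "(\<Oplus>\<^bsub>SE.L\<^esub>p\<in>{..<N}. t p \<odot>\<^bsub>SE.L\<^esub> \<beta> p) = \<zero>\<^bsub>SE.L\<^esub>"
    and p: "p < N" for t p
  proof (rule ccontr)
    assume nz: "t p \<noteq> \<zero>\<^bsub>MS.T\<^esub>"
    define c where "c v = t (inv_into {..<N} b v)" for v
    have cb: "c (b p) = t p" if "p < N" for p using b that by (simp add: c_def bij_betw_def inv_into_f_f)
    have c: "c \<in> B \<rightarrow> carrier MS.T" using t(1) by (simp add: c_def)
    have "SE.L.lincomb c B = (\<Oplus>\<^bsub>SE.L\<^esub>p\<in>{..<N}. t p \<odot>\<^bsub>SE.L\<^esub> \<beta> p)"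
      unfolding sum_b[OF c]
    proof (rule SE.L.M.finsum_cong'[OF refl])
      show "(\<lambda>p. t p \<odot>\<^bsub>SE.L\<^esub> \<beta> p) \<in> {..<N} \<rightarrow> carrier SE.L" using t \<beta>L by auto
    qed (simp add: cb)
    then have "SE.L.lincomb c B = \<zero>\<^bsub>SE.L\<^esub>" using t(2) by simp
    then have "SE.L.lin_dep B"
      using SE.L.lin_dep_crit[OF B(1) order_refl c bB[OF p]] nz cb[OF p] by simp
    then show False using B(4) by simp
  qed
  have \<Psi>_sum: "\<Psi> (\<Oplus>\<^bsub>SE.L\<^esub>p\<in>{..<k}. t p \<odot>\<^bsub>SE.L\<^esub> \<beta> p) = (\<Oplus>\<^bsub>Q\<^esub>p\<in>{..<k}. \<eta> (t p) \<otimes>\<^bsub>Q\<^esub> \<Psi> (\<beta> p))"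
    if t: "\<And>p. t p \<in> carrier MS.T" for t and k :: nat
  proof (induct k)
    case 0
    have "\<Psi> (SE.tens \<zero>\<^bsub>A\<^esub> \<one>\<^bsub>MS.T\<^esub>) = \<zero>\<^bsub>Q\<^esub>"
      using \<Psi>_tens[of "\<zero>\<^bsub>A\<^esub>" "\<one>\<^bsub>MS.T\<^esub>"] \<eta>Q h_zero_iff[of "\<zero>\<^bsub>A\<^esub>"] J_closed(2) by simp
    then show ?case using tens_zero[of "\<one>\<^bsub>MS.T\<^esub>"] by simp
  next
    case (Suc k)
    have cl: "t p \<odot>\<^bsub>SE.L\<^esub> \<beta> p \<in> carrier SE.L" for p using t \<beta>L by simp
    have "(\<Oplus>\<^bsub>SE.L\<^esub>p\<in>{..<Suc k}. t p \<odot>\<^bsub>SE.L\<^esub> \<beta> p) =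
        t k \<odot>\<^bsub>SE.L\<^esub> \<beta> k \<oplus>\<^bsub>SE.L\<^esub> (\<Oplus>\<^bsub>SE.L\<^esub>p\<in>{..<k}. t p \<odot>\<^bsub>SE.L\<^esub> \<beta> p)"
      unfolding lessThan_Suc using cl by (intro SE.L.M.finsum_insert) auto
    moreover have "(\<Oplus>\<^bsub>SE.L\<^esub>p\<in>{..<k}. t p \<odot>\<^bsub>SE.L\<^esub> \<beta> p) \<in> carrier SE.L" using cl by (intro SE.L.M.finsum_closed) auto
    moreover have "(\<Oplus>\<^bsub>Q\<^esub>p\<in>{..<Suc k}. \<eta> (t p) \<otimes>\<^bsub>Q\<^esub> \<Psi> (\<beta> p)) =
        \<eta> (t k) \<otimes>\<^bsub>Q\<^esub> \<Psi> (\<beta> k) \<oplus>\<^bsub>Q\<^esub> (\<Oplus>\<^bsub>Q\<^esub>p\<in>{..<k}. \<eta> (t p) \<otimes>\<^bsub>Q\<^esub> \<Psi> (\<beta> p))"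
      unfolding lessThan_Suc using t \<eta>Q \<Psi>Q \<beta>L by (intro Q.finsum_insert) auto
    ultimately show ?case using Suc cl t \<beta>L by (simp add: \<Psi>_add \<Psi>_smult)
  qed
  \<comment> \<open>The tensor of m a with y is m y times the tensor of a with 1, so elements coming
    from J have coordinates with residue zero.\<close>
  have J_tens: "\<exists>\<mu>. (\<forall>p. \<mu> p \<in> carrier MS.T \<and> \<eta> (\<mu> p) = \<zero>\<^bsub>Q\<^esub>) \<and>
      SE.tens x y = (\<Oplus>\<^bsub>SE.L\<^esub>p\<in>{..<N}. \<mu> p \<odot>\<^bsub>SE.L\<^esub> \<beta> p)" if x: "x \<in> J" and y: "y \<in> carrier MS.T" for x y
    using x
  proof (induct rule: J_induct)
    case zero
    have "\<eta> \<zero>\<^bsub>MS.T\<^esub> = \<zero>\<^bsub>Q\<^esub>"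
      using \<eta>\<phi>[OF R.zero_closed] \<zeta>_zero_iff[OF R.zero_closed] M_closed(2) by (simp add: \<phi>_def MS.T_zero)
    moreover have "(\<Oplus>\<^bsub>SE.L\<^esub>p\<in>{..<N}. \<zero>\<^bsub>MS.T\<^esub> \<odot>\<^bsub>SE.L\<^esub> \<beta> p) = \<zero>\<^bsub>SE.L\<^esub>"
      using \<beta>L by (intro SE.L.M.add.finprod_one_eqI) simp
    ultimately show ?case using tens_zero[OF y] by (intro exI[of _ "\<lambda>_. \<zero>\<^bsub>MS.T\<^esub>"]) simp
  next
    case (smult m a)
    have mR: "m \<in> carrier R" using smult M_closed(1) by auto
    define u where "u = \<phi> m \<otimes>\<^bsub>MS.T\<^esub> y"
    have uT: "u \<in> carrier MS.T" using \<phi>T mR y by (simp add: u_def)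
    have \<eta>u: "\<eta> u = \<zero>\<^bsub>Q\<^esub>" using \<phi>T mR y \<eta>Q \<zeta>_zero_iff[OF mR] smult(1) by (simp add: u_def \<eta>_mult \<eta>\<phi>)
    have a1: "SE.tens a \<one>\<^bsub>MS.T\<^esub> \<in> carrier SE.L" using smult by (intro SE.tens_closed) auto
    from span[OF this] obtain t where t: "\<And>p. t p \<in> carrier MS.T"
      "SE.tens a \<one>\<^bsub>MS.T\<^esub> = (\<Oplus>\<^bsub>SE.L\<^esub>p\<in>{..<N}. t p \<odot>\<^bsub>SE.L\<^esub> \<beta> p)" by blast
    have "SE.tens (m \<odot>\<^bsub>A\<^esub> a) y = u \<odot>\<^bsub>SE.L\<^esub> SE.tens a \<one>\<^bsub>MS.T\<^esub>"
      using smult mR y uT by (simp add: SE.tens_smult_left SE.smult_tens u_def)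
    also have "\<dots> = (\<Oplus>\<^bsub>SE.L\<^esub>p\<in>{..<N}. u \<odot>\<^bsub>SE.L\<^esub> (t p \<odot>\<^bsub>SE.L\<^esub> \<beta> p))"
      unfolding t(2) using uT t(1) \<beta>L by (intro SE.L.finsum_smult) auto
    also have "\<dots> = (\<Oplus>\<^bsub>SE.L\<^esub>p\<in>{..<N}. (u \<otimes>\<^bsub>MS.T\<^esub> t p) \<odot>\<^bsub>SE.L\<^esub> \<beta> p)"
      using uT t(1) \<beta>L by (intro SE.L.M.finsum_cong' refl) (auto simp: SE.L.smult_assoc1)
    finally show ?case
      using uT t(1) \<eta>u \<eta>Q by (intro exI[of _ "\<lambda>p. u \<otimes>\<^bsub>MS.T\<^esub> t p"]) (simp add: \<eta>_mult)
  next
    case (add x x')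
    from add(3) obtain \<mu> where \<mu>: "\<And>p. \<mu> p \<in> carrier MS.T" "\<And>p. \<eta> (\<mu> p) = \<zero>\<^bsub>Q\<^esub>"
        "SE.tens x y = (\<Oplus>\<^bsub>SE.L\<^esub>p\<in>{..<N}. \<mu> p \<odot>\<^bsub>SE.L\<^esub> \<beta> p)" by blast
    from add(4) obtain \<nu> where \<nu>: "\<And>p. \<nu> p \<in> carrier MS.T" "\<And>p. \<eta> (\<nu> p) = \<zero>\<^bsub>Q\<^esub>"
        "SE.tens x' y = (\<Oplus>\<^bsub>SE.L\<^esub>p\<in>{..<N}. \<nu> p \<odot>\<^bsub>SE.L\<^esub> \<beta> p)" by blast
    have xA: "x \<in> carrier A" "x' \<in> carrier A" using add J_closed(1) by auto
    have "SE.tens (x \<oplus>\<^bsub>A\<^esub> x') y = (\<Oplus>\<^bsub>SE.L\<^esub>p\<in>{..<N}. \<mu> p \<odot>\<^bsub>SE.L\<^esub> \<beta> p \<oplus>\<^bsub>SE.L\<^esub> \<nu> p \<odot>\<^bsub>SE.L\<^esub> \<beta> p)"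
      unfolding SE.tens_add_left[OF xA y] \<mu>(3) \<nu>(3) using \<mu>(1) \<nu>(1) \<beta>L
      by (intro SE.L.M.finsum_addf[symmetric]) auto
    also have "\<dots> = (\<Oplus>\<^bsub>SE.L\<^esub>p\<in>{..<N}. (\<mu> p \<oplus>\<^bsub>MS.T\<^esub> \<nu> p) \<odot>\<^bsub>SE.L\<^esub> \<beta> p)"
      using \<mu>(1) \<nu>(1) \<beta>L by (intro SE.L.M.finsum_cong' refl) (auto simp: SE.L.smult_l_distr)
    finally show ?case
      using \<mu> \<nu> by (intro exI[of _ "\<lambda>p. \<mu> p \<oplus>\<^bsub>MS.T\<^esub> \<nu> p"]) (simp add: \<eta>_add)
  qed
  have "\<exists>a. a \<in> carrier A \<and> h a = \<Psi> (\<beta> p)" for p using \<Psi>Q[OF \<beta>L, of p] Q_carrier by auto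
  then obtain x where x: "\<And>p. x p \<in> carrier A" "\<And>p. h (x p) = \<Psi> (\<beta> p)" by metis
  have "simple_ring_of_rank Q N (\<lambda>p. h (x p))"
  proof (intro simple_ring_of_rank.intro simple_ring_of_rank_axioms.intro)
    show "ring Q" by (rule ring_Q)
    show "\<one>\<^bsub>Q\<^esub> \<noteq> \<zero>\<^bsub>Q\<^esub>" by (rule one_not_zero_Q)
    show "I = {\<zero>\<^bsub>Q\<^esub>} \<or> I = carrier Q" if "ideal I Q" for I
      using csa that by (simp add: central_simple_algebra_def simple_ring_def)
    show "h (x p) \<in> carrier Q" for p by (rule hQ[OF x(1)])
    show "\<exists>c. (\<forall>p. c p \<in> ring_center Q) \<and> w = (\<Oplus>\<^bsub>Q\<^esub>p\<in>{..<N}. c p \<otimes>\<^bsub>Q\<^esub> h (x p))" if w: "w \<in> carrier Q" for w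
    proof -
      from w obtain a where a: "a \<in> carrier A" "w = h a" using Q_carrier by auto
      have a1: "SE.tens a \<one>\<^bsub>MS.T\<^esub> \<in> carrier SE.L" using a by (intro SE.tens_closed) auto
      from span[OF this] obtain t where t: "\<And>p. t p \<in> carrier MS.T"
        "SE.tens a \<one>\<^bsub>MS.T\<^esub> = (\<Oplus>\<^bsub>SE.L\<^esub>p\<in>{..<N}. t p \<odot>\<^bsub>SE.L\<^esub> \<beta> p)" by blast
      have "\<eta> \<one>\<^bsub>MS.T\<^esub> = \<one>\<^bsub>Q\<^esub>"
        using \<eta>\<phi>[OF R.one_closed] Ring.ring_hom_one[OF \<zeta>_hom] by (simp add: \<phi>_def MS.T_one)
      then have "w = \<Psi> (SE.tens a \<one>\<^bsub>MS.T\<^esub>)" using a hQ by (simp add: \<Psi>_tens)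
      also have "\<dots> = (\<Oplus>\<^bsub>Q\<^esub>p\<in>{..<N}. \<eta> (t p) \<otimes>\<^bsub>Q\<^esub> h (x p))" unfolding t(2) \<Psi>_sum[OF t(1)] x(2) ..
      finally show ?thesis using \<eta>c[OF t(1)] center_Q by (intro exI[of _ "\<lambda>p. \<eta> (t p)"]) auto
    qed
    show "c p = \<zero>\<^bsub>Q\<^esub>" if c: "\<And>p. c p \<in> ring_center Q" "(\<Oplus>\<^bsub>Q\<^esub>p\<in>{..<N}. c p \<otimes>\<^bsub>Q\<^esub> h (x p)) = \<zero>\<^bsub>Q\<^esub>" and p: "p < N" for c p
    proof -
      have "\<exists>r. r \<in> carrier R \<and> \<zeta> r = c p" for p using c(1)[of p] center_Q by auto
      then obtain r where r: "\<And>p. r p \<in> carrier R" "\<And>p. \<zeta> (r p) = c p" by metis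
      have \<phi>r: "\<phi> (r p) \<in> carrier MS.T" for p using \<phi>T r by simp
      \<comment> \<open>The relation is lifted by choosing preimages in R of its coefficients; C
        then reduces to zero, and its numerator lies in J.\<close>
      define C where "C = (\<Oplus>\<^bsub>SE.L\<^esub>p\<in>{..<N}. \<phi> (r p) \<odot>\<^bsub>SE.L\<^esub> \<beta> p)"
      have CL: "C \<in> carrier SE.L" unfolding C_def using \<phi>r \<beta>L by (intro SE.L.M.finsum_closed) auto
      have "\<Psi> C = \<zero>\<^bsub>Q\<^esub>" unfolding C_def \<Psi>_sum[OF \<phi>r] using c(2) r \<eta>\<phi> x(2) by simp
      from rep[OF CL] obtain a s where a: "a \<in> carrier A" "s \<in> S" "C = SE.tens a (MS.frac \<one>\<^bsub>R\<^esub> s)" by blast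
      have sR: "s \<in> carrier R" using a MS.S_carrier by auto
      have "\<eta> (MS.frac \<one>\<^bsub>R\<^esub> s) \<otimes>\<^bsub>Q\<^esub> h a = \<zero>\<^bsub>Q\<^esub>" using \<open>\<Psi> C = \<zero>\<^bsub>Q\<^esub>\<close> a frac1 by (simp add: \<Psi>_tens)
      then have "\<zeta> s \<otimes>\<^bsub>Q\<^esub> (\<eta> (MS.frac \<one>\<^bsub>R\<^esub> s) \<otimes>\<^bsub>Q\<^esub> h a) = \<zero>\<^bsub>Q\<^esub>" using \<zeta>Q[OF sR] by simp
      moreover have "\<zeta> s \<otimes>\<^bsub>Q\<^esub> \<eta> (MS.frac \<one>\<^bsub>R\<^esub> s) = \<one>\<^bsub>Q\<^esub>"
        using \<eta>_frac(2)[OF R.one_closed a(2)] \<zeta>_comm[OF sR \<eta>Q[OF frac1[OF a(2)]]] Ring.ring_hom_one[OF \<zeta>_hom] by simp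
      ultimately have "h a = \<zero>\<^bsub>Q\<^esub>"
        using \<zeta>Q[OF sR] \<eta>Q[OF frac1[OF a(2)]] hQ[OF a(1)] by (simp flip: Q.m_assoc)
      then have "a \<in> J" using h_zero_iff a(1) by simp
      from J_tens[OF this frac1[OF a(2)]] a(3) obtain \<mu> where \<mu>: "\<And>p. \<mu> p \<in> carrier MS.T" "\<And>p. \<eta> (\<mu> p) = \<zero>\<^bsub>Q\<^esub>"
        "C = (\<Oplus>\<^bsub>SE.L\<^esub>p\<in>{..<N}. \<mu> p \<odot>\<^bsub>SE.L\<^esub> \<beta> p)" by auto
      define \<nu> where "\<nu> p = \<ominus>\<^bsub>MS.T\<^esub> \<mu> p" for p
      have \<nu>T: "\<nu> p \<in> carrier MS.T" for p using \<mu>(1) by (simp add: \<nu>_def)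
      have "(\<Oplus>\<^bsub>SE.L\<^esub>p\<in>{..<N}. (\<phi> (r p) \<oplus>\<^bsub>MS.T\<^esub> \<nu> p) \<odot>\<^bsub>SE.L\<^esub> \<beta> p) =
          (\<Oplus>\<^bsub>SE.L\<^esub>p\<in>{..<N}. \<phi> (r p) \<odot>\<^bsub>SE.L\<^esub> \<beta> p \<oplus>\<^bsub>SE.L\<^esub> \<nu> p \<odot>\<^bsub>SE.L\<^esub> \<beta> p)"
        using \<phi>r \<nu>T \<beta>L by (intro SE.L.M.finsum_cong' refl) (auto simp: SE.L.smult_l_distr)
      also have "\<dots> = C \<oplus>\<^bsub>SE.L\<^esub> (\<Oplus>\<^bsub>SE.L\<^esub>p\<in>{..<N}. \<nu> p \<odot>\<^bsub>SE.L\<^esub> \<beta> p)"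
        unfolding C_def using \<phi>r \<nu>T \<beta>L by (intro SE.L.M.finsum_addf) auto
      also have "\<dots> = (\<Oplus>\<^bsub>SE.L\<^esub>p\<in>{..<N}. \<mu> p \<odot>\<^bsub>SE.L\<^esub> \<beta> p \<oplus>\<^bsub>SE.L\<^esub> \<nu> p \<odot>\<^bsub>SE.L\<^esub> \<beta> p)"
        unfolding \<mu>(3) using \<mu>(1) \<nu>T \<beta>L by (intro SE.L.M.finsum_addf[symmetric]) auto
      also have "\<dots> = \<zero>\<^bsub>SE.L\<^esub>"
      proof (rule SE.L.M.add.finprod_one_eqI)
        fix p
        have "\<mu> p \<odot>\<^bsub>SE.L\<^esub> \<beta> p \<oplus>\<^bsub>SE.L\<^esub> \<nu> p \<odot>\<^bsub>SE.L\<^esub> \<beta> p = (\<mu> p \<oplus>\<^bsub>MS.T\<^esub> \<nu> p) \<odot>\<^bsub>SE.L\<^esub> \<beta> p"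
          using \<mu>(1) \<nu>T \<beta>L by (simp add: SE.L.smult_l_distr)
        then show "\<mu> p \<odot>\<^bsub>SE.L\<^esub> \<beta> p \<oplus>\<^bsub>SE.L\<^esub> \<nu> p \<odot>\<^bsub>SE.L\<^esub> \<beta> p = \<zero>\<^bsub>SE.L\<^esub>"
          using \<mu>(1) \<beta>L by (simp add: \<nu>_def T.r_neg)
      qed
      finally have "\<phi> (r p) \<oplus>\<^bsub>MS.T\<^esub> \<nu> p = \<zero>\<^bsub>MS.T\<^esub>"
        using indep[of "\<lambda>p. \<phi> (r p) \<oplus>\<^bsub>MS.T\<^esub> \<nu> p" p] \<phi>r \<nu>T p by simp
      then have "\<phi> (r p) = \<mu> p"
        using \<phi>r[of p] \<mu>(1)[of p] unfolding \<nu>_def by (metis T.minus_equality T.minus_minus \<nu>T \<nu>_def)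
      then have "\<zeta> (r p) = \<zero>\<^bsub>Q\<^esub>" using \<eta>\<phi>[OF r(1), of p] \<mu>(2) by simp
      then show ?thesis using r by simp
    qed
  qed
  then show ?thesis using x by blast
qed

end

section \<open>A polynomial that separates matrix rings of different size\<close>

text \<open>Triples encode three families of variables: tag 0 for the elements to be eliminated,
  tags 1 and 2 for left and right factors. The successor keeps clear of the letter 0, since
  variables are numbered from 1.\<close>

definition letter :: "nat \<times> nat \<times> nat \<Rightarrow> ncpoly" where
  "letter p = ncvar (Suc (to_nat p))"

definition sandwich :: "nat \<Rightarrow> nat \<Rightarrow> ncpoly \<Rightarrow> ncpoly" where
  "sandwich j l z = foldr (\<lambda>i s. letter (1, j, i) * z * letter (2, j, i) + s) [0..<l] 0"

text \<open>Each step replaces \<open>p # ps\<close> by the values on \<open>ps\<close> of the additive map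
  \<open>r \<mapsto> T p * r - T r * p\<close>, where \<open>T z = \<Sum>\<^sub>i U\<^sub>j\<^sub>i * z * V\<^sub>j\<^sub>i\<close>. This map kills \<open>p\<close>, so linear
  relations survive.\<close>

function eliminant :: "(nat \<Rightarrow> nat) \<Rightarrow> nat \<Rightarrow> ncpoly list \<Rightarrow> ncpoly" where
  "eliminant l j [] = 0"
| "eliminant l j [p] = p"
| "eliminant l j (p # q # ps) =
     eliminant l (Suc j) (map (\<lambda>r. sandwich j (l j) p * r - sandwich j (l j) r * p) (q # ps))"
  by pat_completeness auto
termination by (relation "measure (\<lambda>(l, j, ps). length ps)") auto

definition letters_positive :: "ncpoly \<Rightarrow> bool" where
  "letters_positive f \<longleftrightarrow> (\<forall>w\<in>Poly_Mapping.keys f. 0 \<notin> set (letters w))"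

lemma letters_positive_simps:
  "letters_positive 0" "letters_positive (letter p)"
  "letters_positive f \<Longrightarrow> letters_positive g \<Longrightarrow> letters_positive (f + g)"
  "letters_positive f \<Longrightarrow> letters_positive g \<Longrightarrow> letters_positive (f - g)"
  "letters_positive f \<Longrightarrow> letters_positive g \<Longrightarrow> letters_positive (f * g)"
proof -
  show "letters_positive 0" by (simp add: letters_positive_def)
  show "letters_positive (letter p)" by (auto simp: letters_positive_def letter_def ncvar_def)
  assume fg: "letters_positive f" "letters_positive g"
  show "letters_positive (f + g)"
    using fg subsetD[OF keys_add[of f g]] by (fastforce simp: letters_positive_def)
  show "letters_positive (f - g)"
    using fg subsetD[OF keys_diff[of f g]] by (fastforce simp: letters_positive_def)
  show "letters_positive (f * g)"
    unfolding letters_positive_def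
  proof
    fix w assume "w \<in> Poly_Mapping.keys (f * g)"
    then obtain u v where "w = u + v" "u \<in> Poly_Mapping.keys f" "v \<in> Poly_Mapping.keys g"
      using subsetD[OF keys_mult[of f g]] by blast
    then show "0 \<notin> set (letters w)" using fg by (auto simp: letters_positive_def plus_word_def)
  qed
qed

lemma letters_positive_sandwich:
  assumes "letters_positive z" shows "letters_positive (sandwich j l z)"
proof -
  have "letters_positive (foldr (\<lambda>i s. letter (1, j, i) * z * letter (2, j, i) + s) is 0)" for "is"
    using assms by (induct "is") (auto intro!: letters_positive_simps)
  then show ?thesis by (simp only: sandwich_def)
qed

lemma letters_positive_eliminant:
  "\<forall>p\<in>set ps. letters_positive p \<Longrightarrow> letters_positive (eliminant l j ps)"
proof (induct l j ps rule: eliminant.induct)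
  case (3 l j p q ps)
  show ?case
    unfolding eliminant.simps(3)
    by (rule 3(1)) (use 3(2) in \<open>auto intro!: letters_positive_simps(4,5) letters_positive_sandwich\<close>)
qed (auto simp: letters_positive_simps)

section \<open>Integer dependence and the two properties of the eliminant\<close>

context ring
begin

abbreviation int_relation :: "int list \<Rightarrow> 'a list \<Rightarrow> 'a" where
  "int_relation cs vs \<equiv> foldr (\<lambda>(c, v) s. [c] \<cdot>\<^bsub>R\<^esub> v \<oplus> s) (zip cs vs) \<zero>"

definition int_dependent :: "'a list \<Rightarrow> bool" where
  "int_dependent vs \<longleftrightarrow>
     (\<exists>cs. length cs = length vs \<and> (\<exists>c\<in>set cs. c \<noteq> 0) \<and> int_relation cs vs = \<zero>)"

lemma relation_closed: "set vs \<subseteq> carrier R \<Longrightarrow> int_relation cs vs \<in> carrier R"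
proof (induct vs arbitrary: cs)
  case (Cons v vs)
  then show ?case by (cases cs) auto
qed simp

lemma additive_add_pow:
  assumes "\<And>x. x \<in> carrier R \<Longrightarrow> h x \<in> carrier R"
    "\<And>x y. \<lbrakk>x \<in> carrier R; y \<in> carrier R\<rbrakk> \<Longrightarrow> h (x \<oplus> y) = h x \<oplus> h y" "x \<in> carrier R"
  shows "h ([(c::int)] \<cdot>\<^bsub>R\<^esub> x) = [c] \<cdot>\<^bsub>R\<^esub> h x"
proof -
  have "group_hom (add_monoid R) (add_monoid R) h"
    using assms(1,2) by (intro group_hom.intro group_hom_axioms.intro homI) (auto simp: add.group_axioms)
  from group_hom.hom_int_pow[OF this, of x c] show ?thesis
    using assms(3) by (simp add: add_pow_def)
qed

lemma relation_additive:
  assumes h: "\<And>x. x \<in> carrier R \<Longrightarrow> h x \<in> carrier R"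
    "\<And>x y. \<lbrakk>x \<in> carrier R; y \<in> carrier R\<rbrakk> \<Longrightarrow> h (x \<oplus> y) = h x \<oplus> h y"
    and "set vs \<subseteq> carrier R"
  shows "int_relation cs (map h vs) = h (int_relation cs vs)"
proof -
  have "h \<zero> \<oplus> h \<zero> = h \<zero>" using h(2)[of \<zero> \<zero>] by simp
  then have z: "h \<zero> = \<zero>" using h(1)[of \<zero>] by (simp add: add.r_cancel_one)
  show ?thesis
    using assms(3)
  proof (induct vs arbitrary: cs)
    case (Cons v vs)
    then show ?case
      using h additive_add_pow[of h v] relation_closed[of vs] by (cases cs) (auto simp: z)
  qed (simp add: z)
qed

text \<open>As h kills v, a relation loses its first term and remains a relation between the images.
  It becomes trivial only if it involved v alone; then v is zero by torsion-freeness, h vanishes,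
  and any relation holds.\<close>

lemma dependent_image:
  assumes h: "\<And>x. x \<in> carrier R \<Longrightarrow> h x \<in> carrier R"
    "\<And>x y. \<lbrakk>x \<in> carrier R; y \<in> carrier R\<rbrakk> \<Longrightarrow> h (x \<oplus> y) = h x \<oplus> h y"
    and vs: "set (v # vs) \<subseteq> carrier R" "vs \<noteq> []" "int_dependent (v # vs)" "h v = \<zero>"
    and torsion_free: "\<And>c x. \<lbrakk>x \<in> carrier R; [(c::int)] \<cdot>\<^bsub>R\<^esub> x = \<zero>; c \<noteq> 0\<rbrakk> \<Longrightarrow> x = \<zero>"
    and trivial: "v = \<zero> \<Longrightarrow> (\<forall>x\<in>carrier R. h x = \<zero>)"
  shows "int_dependent (map h vs)"
proof -
  from vs(3) obtain ds where ds: "length ds = length (v # vs)" "\<exists>c\<in>set ds. c \<noteq> 0" "int_relation ds (v # vs) = \<zero>"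
    by (auto simp only: int_dependent_def)
  then obtain c cs where "ds = c # cs" by (cases ds) auto
  with ds have cs: "length cs = length vs" "c \<noteq> 0 \<or> (\<exists>c\<in>set cs. c \<noteq> 0)"
      "int_relation (c # cs) (v # vs) = \<zero>"
    by auto
  show ?thesis
  proof (cases "\<exists>c\<in>set cs. c \<noteq> 0")
    case True
    have "int_relation cs (map h vs) = int_relation (c # cs) (map h (v # vs))"
      using vs h by (simp add: relation_additive relation_closed)
    also have "\<dots> = h (int_relation (c # cs) (v # vs))" by (rule relation_additive[OF h vs(1)])
    also have "\<dots> = \<zero>" unfolding cs(3) using h(2)[of \<zero> \<zero>] h(1)[of \<zero>] by (simp add: add.r_cancel_one)
    finally show ?thesis using True cs(1) unfolding int_dependent_def by (intro exI[of _ cs]) simp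
  next
    case False
    have "\<forall>c\<in>set cs. c = 0 \<Longrightarrow> set vs \<subseteq> carrier R \<Longrightarrow> int_relation cs vs = \<zero>" for cs vs
    proof (induct vs arbitrary: cs)
      case (Cons v vs)
      then show ?case by (cases cs) (auto simp: add_pow_int_0)
    qed simp
    from this[of cs vs] have "[c] \<cdot>\<^bsub>R\<^esub> v = \<zero>" using False cs(3) vs(1) by simp
    then have "v = \<zero>" using torsion_free[of v c] False cs(2) vs(1) by auto
    then have h0: "h x = \<zero>" if "x \<in> carrier R" for x using trivial that by simp
    have "int_relation (replicate (length vs) 1) (map h vs) = h (int_relation (replicate (length vs) 1) vs)"
      by (rule relation_additive[OF h]) (use vs(1) in auto)
    also have "\<dots> = \<zero>" using vs(1) by (intro h0 relation_closed) auto
    \<comment> \<open>All images are zero here, so the relation with all coefficients 1 serves; it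
      is nontrivial because the list is nonempty.\<close>
    finally show ?thesis using vs(2) unfolding int_dependent_def
      by (intro exI[of _ "replicate (length vs) 1"]) auto
  qed
qed

lemma ncpoly_eval_simps:
  assumes b: "\<And>k. b k \<in> carrier R"
  shows "ncpoly_eval R b 0 = \<zero>" "ncpoly_eval R b (f + g) = ncpoly_eval R b f \<oplus> ncpoly_eval R b g"
    "ncpoly_eval R b (f - g) = ncpoly_eval R b f \<ominus> ncpoly_eval R b g"
    "ncpoly_eval R b (f * g) = ncpoly_eval R b f \<otimes> ncpoly_eval R b g"
    "ncpoly_eval R b (letter p) = b (Suc (to_nat p))"
proof -
  show "ncpoly_eval R b (f * g) = ncpoly_eval R b f \<otimes> ncpoly_eval R b g" by (rule ncpoly_eval_mult[OF b])
  show "ncpoly_eval R b (letter p) = b (Suc (to_nat p))" unfolding letter_def by (rule ncpoly_eval_ncvar[OF b])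
qed (use b in \<open>simp_all add: ncpoly_eval_eq_pm_eval pm_eval_add pm_eval_diff\<close>)

lemma ncpoly_eval_sandwich:
  assumes b: "\<And>k. b k \<in> carrier R"
  shows "ncpoly_eval R b (sandwich j l z) =
    bimul R (map (\<lambda>i. (b (Suc (to_nat (1::nat, j, i))), b (Suc (to_nat (2::nat, j, i))))) [0..<l]) (ncpoly_eval R b z)"
proof -
  have "ncpoly_eval R b (foldr (\<lambda>i s. letter (1, j, i) * z * letter (2, j, i) + s) is 0) =
    bimul R (map (\<lambda>i. (b (Suc (to_nat (1::nat, j, i))), b (Suc (to_nat (2::nat, j, i))))) is) (ncpoly_eval R b z)" for "is"
    by (induct "is") (auto simp: ncpoly_eval_simps[OF b])
  then show ?thesis unfolding sandwich_def .
qed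

lemma bimul_add:
  assumes "set us \<subseteq> carrier R \<times> carrier R" "w \<in> carrier R" "w' \<in> carrier R"
  shows "bimul R us (w \<oplus> w') = bimul R us w \<oplus> bimul R us w'"
  using assms(1)
proof (induct us)
  case (Cons u us)
  then show ?case using assms(2,3) by (cases u) (simp add: l_distr r_distr a_ac)
qed simp

text \<open>Every elimination step is an additive map that kills the first element, so dependence
  survives down to one element; a dependent single element is zero without torsion.\<close>

lemma eliminant_vanishes:
  assumes b: "\<And>k. b k \<in> carrier R"
    and torsion_free: "\<And>c x. \<lbrakk>x \<in> carrier R; [(c::int)] \<cdot>\<^bsub>R\<^esub> x = \<zero>; c \<noteq> 0\<rbrakk> \<Longrightarrow> x = \<zero>"
    and "int_dependent (map (ncpoly_eval R b) ps)"
  shows "ncpoly_eval R b (eliminant l j ps) = \<zero>"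
  using assms(3)
proof (induct l j ps rule: eliminant.induct)
  case (1 l j)
  then show ?case by (simp add: ncpoly_eval_simps[OF b])
next
  case (2 l j p)
  then obtain c where "c \<noteq> 0" "[(c::int)] \<cdot>\<^bsub>R\<^esub> ncpoly_eval R b p \<oplus> \<zero> = \<zero>"
    by (auto simp: int_dependent_def length_Suc_conv)
  then show ?case using torsion_free[of "ncpoly_eval R b p" c] ncpoly_eval_closed[OF b] by simp
next
  case (3 l j p q ps)
  let ?ev = "ncpoly_eval R b"
  define us where "us = map (\<lambda>i. (b (Suc (to_nat (1::nat, j, i))), b (Suc (to_nat (2::nat, j, i))))) [0..<l j]"
  define h where "h x = bimul R us (?ev p) \<otimes> x \<ominus> bimul R us x \<otimes> ?ev p" for x
  have us: "set us \<subseteq> carrier R \<times> carrier R" using b by (auto simp: us_def)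
  have ev: "?ev f \<in> carrier R" for f by (rule ncpoly_eval_closed[OF b])
  have sandwich: "?ev (sandwich j (l j) z) = bimul R us (?ev z)" for z
    unfolding us_def by (rule ncpoly_eval_sandwich[OF b])
  have "int_dependent (map h (map ?ev (q # ps)))"
  proof (rule dependent_image[where v = "?ev p"])
    show "h x \<in> carrier R" if "x \<in> carrier R" for x using us ev that by (simp add: h_def)
    show "h (x \<oplus> y) = h x \<oplus> h y" if xy: "x \<in> carrier R" "y \<in> carrier R" for x y
    proof -
      have u: "bimul R us x \<in> carrier R" "bimul R us y \<in> carrier R" "bimul R us (?ev p) \<in> carrier R"
        using us xy ev by auto
      show ?thesis
        using xy u ev[of p] unfolding h_def bimul_add[OF us xy]
        by (simp add: l_distr r_distr a_minus_def minus_add a_ac)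
    qed
    show "set (?ev p # map ?ev (q # ps)) \<subseteq> carrier R" using ev by auto
    have u: "bimul R us (?ev p) \<in> carrier R" using us ev by simp
    then show "h (?ev p) = \<zero>" using ev[of p] by (simp add: h_def a_minus_def r_neg)
    show "\<forall>x\<in>carrier R. h x = \<zero>" if "?ev p = \<zero>"
    proof -
      have "bimul R us \<zero> = \<zero>"
        using bimul_add[OF us zero_closed zero_closed] us by (simp add: add.r_cancel_one)
      then show ?thesis using us by (simp add: h_def that a_minus_def)
    qed
  qed (use 3(2) torsion_free in auto)
  moreover have "map h (map ?ev (q # ps)) =
      map ?ev (map (\<lambda>r. sandwich j (l j) p * r - sandwich j (l j) r * p) (q # ps))"
    by (simp add: h_def ncpoly_eval_simps[OF b] sandwich)
  ultimately show ?case unfolding eliminant.simps(3) by (intro 3(1)) (simp only:)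
qed

text \<open>If the j-th sandwich is the coordinate function dual to \<open>\<epsilon> j\<close>, the
  step sends \<open>\<epsilon> i\<close> to 1 * \<open>\<epsilon> i\<close> - 0 *
  \<open>\<epsilon> j\<close>. The later basis elements pass through unchanged and the last one
  remains.\<close>

lemma eliminant_value:
  assumes b: "\<And>k. b k \<in> carrier R"
    and \<epsilon>: "\<And>p. \<epsilon> p \<in> carrier R"
    and us: "\<And>j i. j < N \<Longrightarrow> i < N \<Longrightarrow>
      bimul R (map (\<lambda>i. (b (Suc (to_nat (1::nat, j, i))), b (Suc (to_nat (2::nat, j, i))))) [0..<l j]) (\<epsilon> i) =
      (if i = j then \<one> else \<zero>)"
    and "map (ncpoly_eval R b) ps = map \<epsilon> [j..<N]" "j < N"
  shows "ncpoly_eval R b (eliminant l j ps) = \<epsilon> (N - 1)"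
  using us assms(4,5)
proof (induct l j ps rule: eliminant.induct)
  case (1 l j)
  then show ?case by simp
next
  case (2 l j p)
  then have "N = Suc j" "ncpoly_eval R b p = \<epsilon> j" by (auto simp: upt_conv_Cons)
  then show ?case by simp
next
  case (3 l j p q ps)
  let ?ev = "ncpoly_eval R b"
  define us where "us = map (\<lambda>i. (b (Suc (to_nat (1::nat, j, i))), b (Suc (to_nat (2::nat, j, i))))) [0..<l j]"
  have p: "?ev p = \<epsilon> j" and ps: "map ?ev (q # ps) = map \<epsilon> [Suc j..<N]"
    using 3(3,4) by (simp_all add: upt_conv_Cons)
  have "map \<epsilon> [Suc j..<N] \<noteq> []" unfolding ps[symmetric] by simp
  then have jN: "Suc j < N" by simp
  have sandwich: "?ev (sandwich j (l j) z) = bimul R us (?ev z)" for z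
    unfolding us_def by (rule ncpoly_eval_sandwich[OF b])
  have us: "bimul R us (\<epsilon> i) = (if i = j then \<one> else \<zero>)" if "i < N" for i
    unfolding us_def using 3(2) jN that by simp
  have "?ev (sandwich j (l j) p * r - sandwich j (l j) r * p) = ?ev r" if r: "r \<in> set (q # ps)" for r
  proof -
    have "?ev r \<in> set (map \<epsilon> [Suc j..<N])" unfolding ps[symmetric] set_map using r by (rule imageI)
    then obtain i where "Suc j \<le> i" "i < N" "?ev r = \<epsilon> i" by auto
    then show ?thesis
      using us[of i] us[of j] jN p \<epsilon>
      by (simp add: ncpoly_eval_simps[OF b] sandwich a_minus_def)
  qed
  then have "map ?ev (map (\<lambda>r. sandwich j (l j) p * r - sandwich j (l j) r * p) (q # ps)) = map \<epsilon> [Suc j..<N]"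
    unfolding ps[symmetric] map_map by (intro map_cong) auto
  then show ?case using 3(1)[OF 3(2) _ jN] by simp
qed

end

subsection \<open>Integer matrices\<close>

lemma int_matrix_add_pow:
  assumes "x \<in> carrier_mat n n"
  shows "[(c::int)] \<cdot>\<^bsub>int_matrix_ring n\<^esub> x = c \<cdot>\<^sub>m x"
proof -
  interpret M: ring "int_matrix_ring n" by (rule ring_mat)
  have x: "x \<in> carrier (int_matrix_ring n)" using assms by (simp add: ring_mat_def)
  show ?thesis
  proof (induct c rule: int_induct[where k = 0])
    case base
    show ?case unfolding M.add_pow_int_0 using assms by (auto simp: ring_mat_def intro!: eq_matI)
  next
    case (step1 i)
    have "[(i + 1)] \<cdot>\<^bsub>int_matrix_ring n\<^esub> x = [i] \<cdot>\<^bsub>int_matrix_ring n\<^esub> x + x"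
      using M.add.int_pow_mult[OF x, of i 1] M.add.int_pow_1[OF x] by (simp add: ring_mat_def)
    then show ?case using step1 assms by (auto simp: distrib_right)
  next
    case (step2 i)
    have "[(i - 1 + 1)] \<cdot>\<^bsub>int_matrix_ring n\<^esub> x = [(i - 1)] \<cdot>\<^bsub>int_matrix_ring n\<^esub> x + x"
      using M.add.int_pow_mult[OF x, of "i - 1" 1] M.add.int_pow_1[OF x] by (simp add: ring_mat_def)
    moreover have "[(i - 1)] \<cdot>\<^bsub>int_matrix_ring n\<^esub> x \<in> carrier_mat n n"
      using M.add.int_pow_closed[OF x, of "i - 1"] by (simp add: ring_mat_def)
    ultimately show ?case using step2 assms by (auto simp: left_diff_distrib mat_eq_iff)
  qed
qed

text \<open>One equation over the integers for each of the d * d entries, and N unknowns.\<close>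

lemma int_matrices_dependent:
  assumes v: "\<And>k. v k \<in> carrier (int_matrix_ring d)" and N: "d * d < N"
  shows "ring.int_dependent (int_matrix_ring d) (map v [0..<N])"
proof -
  interpret M: ring "int_matrix_ring d" by (rule ring_mat)
  have vc: "v k \<in> carrier_mat d d" for k using v[of k] by (simp add: ring_mat_def)
  have "\<exists>c. (\<forall>j. c j \<in> UNIV) \<and> (\<exists>j\<in>{..<N}. c j \<noteq> 0) \<and>
      (\<forall>i\<in>{..<d} \<times> {..<d}. (\<Sum>j<N. v j $$ i * c j) = 0)"
    using int.homogeneous_system[of UNIV 1 "{..<d} \<times> {..<d}" "{..<N}" "\<lambda>i j. v j $$ i"] N by simp
  then obtain c j where c: "j < N" "c j \<noteq> 0" "\<And>i k. i < d \<Longrightarrow> k < d \<Longrightarrow> (\<Sum>j<N. v j $$ (i, k) * c j) = 0"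
    by auto
  have rel: "M.int_relation (map c ks) (map v ks) \<in> carrier_mat d d \<and>
      (\<forall>i<d. \<forall>k<d. M.int_relation (map c ks) (map v ks) $$ (i, k) = (\<Sum>j\<leftarrow>ks. v j $$ (i, k) * c j))" for ks
  proof (induct ks)
    case Nil
    then show ?case by (simp add: ring_mat_def)
  next
    case (Cons j ks)
    define r where "r = M.int_relation (map c ks) (map v ks)"
    have "M.int_relation (map c (j # ks)) (map v (j # ks)) = c j \<cdot>\<^sub>m v j + r"
      using vc[of j] by (simp add: r_def int_matrix_add_pow ring_mat_simps)
    moreover have "r \<in> carrier_mat d d \<and> (\<forall>i<d. \<forall>k<d. r $$ (i, k) = (\<Sum>j\<leftarrow>ks. v j $$ (i, k) * c j))"
      using Cons unfolding r_def .
    ultimately show ?case using vc[of j] by auto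
  qed
  have "M.int_relation (map c [0..<N]) (map v [0..<N]) = \<zero>\<^bsub>int_matrix_ring d\<^esub>"
    using rel[of "[0..<N]"] c(3)
    by (intro eq_matI) (auto simp: ring_mat_def interv_sum_list_conv_sum_set_nat lessThan_atLeast0)
  then show ?thesis
    using c(1,2) unfolding M.int_dependent_def by (intro exI[of _ "map c [0..<N]"]) auto
qed

lemma int_matrix_torsion_free:
  assumes "x \<in> carrier (int_matrix_ring d)" "[(c::int)] \<cdot>\<^bsub>int_matrix_ring d\<^esub> x = \<zero>\<^bsub>int_matrix_ring d\<^esub>" "c \<noteq> 0"
  shows "x = \<zero>\<^bsub>int_matrix_ring d\<^esub>"
proof -
  have x: "x \<in> carrier_mat d d" using assms(1) by (simp add: ring_mat_def)
  show ?thesis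
    using assms(2) unfolding int_matrix_add_pow[OF x] using assms(3) x by (auto simp: ring_mat_def mat_eq_iff)
qed

text \<open>The N letters with tag 0 take dependent values under every substitution. The numbers l
  of sandwich terms stay arbitrary because they are dictated later by the simple ring on which the
  polynomial must not vanish.\<close>

theorem eliminant_int_matrix_identity:
  assumes "d * d < N"
  defines "F l \<equiv> eliminant l 0 (map (\<lambda>k. letter (0, k, 0)) [0..<N])"
  shows "\<exists>m. Z_identity (int_matrix_ring d) m (F l)"
proof -
  interpret M: ring "int_matrix_ring d" by (rule ring_mat)
  have "letters_positive (F l)"
    unfolding F_def by (intro letters_positive_eliminant) (auto simp: letters_positive_simps)
  then obtain m where m: "F l \<in> free_assoc_ring m"
    using ex_free_assoc_ring[of "F l"] by (auto simp: letters_positive_def)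
  have "ncpoly_eval (int_matrix_ring d) b (F l) = \<zero>\<^bsub>int_matrix_ring d\<^esub>"
    if b: "\<And>k. b k \<in> carrier (int_matrix_ring d)" for b
  proof -
    have "map (ncpoly_eval (int_matrix_ring d) b) (map (\<lambda>k. letter (0, k, 0)) [0..<N]) =
        map (\<lambda>k. b (Suc (to_nat (0::nat, k, 0::nat)))) [0..<N]"
      by (simp add: M.ncpoly_eval_simps(5)[OF b])
    then show ?thesis
      unfolding F_def using int_matrices_dependent[of "\<lambda>k. b (Suc (to_nat (0::nat, k, 0::nat)))", OF b assms(1)]
      by (intro M.eliminant_vanishes[OF b int_matrix_torsion_free]) (simp_all only:)
  qed
  then show ?thesis using m M.satisfies_identity_iff_total[OF m] by (auto simp: Z_identity_def)
qed

section \<open>Reduction to maximal ideals\<close>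

lemma (in ring) ex_maximalideal:
  assumes "ideal I R" "\<one> \<notin> I"
  shows "\<exists>M. maximalideal M R \<and> I \<subseteq> M"
proof -
  define F where "F = {J. ideal J R \<and> \<one> \<notin> J \<and> I \<subseteq> J}"
  have "\<exists>M\<in>F. \<forall>J\<in>F. M \<subseteq> J \<longrightarrow> J = M"
  proof (rule subset_Zorn_nonempty)
    show "F \<noteq> {}" using assms by (auto simp: F_def)
    fix C assume C: "C \<noteq> {}" "subset.chain F C"
    then have "subset.chain {J. ideal J R} C" by (auto simp: F_def pred_on.chain_def)
    then have "ideal (\<Union>C) R" using chain_Union_is_ideal[of C] C(1) by simp
    then show "\<Union>C \<in> F" using C by (auto simp: F_def pred_on.chain_def)
  qed
  then obtain M where M: "ideal M R" "\<one> \<notin> M" "I \<subseteq> M"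
    and max: "\<And>J. \<lbrakk>ideal J R; \<one> \<notin> J; I \<subseteq> J; M \<subseteq> J\<rbrakk> \<Longrightarrow> J = M"
    by (auto simp: F_def)
  have "maximalideal M R"
  proof (rule maximalidealI[OF M(1)])
    show "carrier R \<noteq> M" using M(2) by auto
    fix J assume J: "ideal J R" "M \<subseteq> J" "J \<subseteq> carrier R"
    show "J = M \<or> J = carrier R"
      using max[OF J(1) _ _ J(2)] ideal.one_imp_carrier[OF J(1)] M(3) J(2) by auto
  qed
  then show ?thesis using M(3) by blast
qed

section \<open>Both assertions at one maximal ideal\<close>

context azumaya_at
begin

lemma \<iota>_image_closed:
  "\<iota> ` carrier R \<subseteq> carrier A" "\<zero>\<^bsub>A\<^esub> \<in> \<iota> ` carrier R" "\<one>\<^bsub>A\<^esub> \<in> \<iota> ` carrier R"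
  "y \<in> \<iota> ` carrier R \<Longrightarrow> z \<in> \<iota> ` carrier R \<Longrightarrow> y \<oplus>\<^bsub>A\<^esub> z \<in> \<iota> ` carrier R"
  "y \<in> \<iota> ` carrier R \<Longrightarrow> z \<in> \<iota> ` carrier R \<Longrightarrow> y \<otimes>\<^bsub>A\<^esub> z \<in> \<iota> ` carrier R"
  "y \<in> \<iota> ` carrier R \<Longrightarrow> \<ominus>\<^bsub>A\<^esub> y \<in> \<iota> ` carrier R"
  "y \<in> \<iota> ` carrier R \<Longrightarrow> z \<in> carrier A \<Longrightarrow> y \<otimes>\<^bsub>A\<^esub> z = z \<otimes>\<^bsub>A\<^esub> y"
proof -
  interpret h: ring_hom_ring R A \<iota>
    by (rule ring_hom_ringI2[OF R.ring_axioms A.ring_axioms \<iota>_hom])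
  show "\<iota> ` carrier R \<subseteq> carrier A" using \<iota>_closed by auto
  show "\<zero>\<^bsub>A\<^esub> \<in> \<iota> ` carrier R" by (rule image_eqI[of _ _ "\<zero>\<^bsub>R\<^esub>"]) simp_all
  show "\<one>\<^bsub>A\<^esub> \<in> \<iota> ` carrier R" by (rule image_eqI[of _ _ "\<one>\<^bsub>R\<^esub>"]) simp_all
  show "y \<otimes>\<^bsub>A\<^esub> z = z \<otimes>\<^bsub>A\<^esub> y" if "y \<in> \<iota> ` carrier R" "z \<in> carrier A"
    using that \<iota>_central by auto
  assume y: "y \<in> \<iota> ` carrier R"
  then obtain r where r: "r \<in> carrier R" "y = \<iota> r" by blast
  show "\<ominus>\<^bsub>A\<^esub> y \<in> \<iota> ` carrier R" by (rule image_eqI[of _ _ "\<ominus>\<^bsub>R\<^esub> r"]) (simp_all add: r)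
  assume z: "z \<in> \<iota> ` carrier R"
  then obtain t where t: "t \<in> carrier R" "z = \<iota> t" by blast
  show "y \<oplus>\<^bsub>A\<^esub> z \<in> \<iota> ` carrier R" by (rule image_eqI[of _ _ "r \<oplus>\<^bsub>R\<^esub> t"]) (simp_all add: r t)
  show "y \<otimes>\<^bsub>A\<^esub> z \<in> \<iota> ` carrier R" by (rule image_eqI[of _ _ "r \<otimes>\<^bsub>R\<^esub> t"]) (simp_all add: r t)
qed

lemma local_vanishing:
  assumes free: "free_of_rank (local_ring_at R M) (local_module_at R A M) (n\<^sup>2)"
    and f: "Z_identity (int_matrix_ring n) m f" and b: "\<And>k. b k \<in> carrier A"
  shows "\<exists>r\<in>carrier R - M. r \<odot>\<^bsub>A\<^esub> ncpoly_eval A b f = \<zero>\<^bsub>A\<^esub>"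
proof -
  from residue_basis[OF free] obtain x where x: "\<And>p. x p \<in> carrier A"
    and srk: "simple_ring_of_rank Q (n\<^sup>2) (\<lambda>p. h (x p))" by blast
  from simple_ring_of_rank.ex_split[OF srk] obtain e K
    where split: "split_simple_ring Q (n\<^sup>2) (\<lambda>p. h (x p)) e K" by blast
  from ex_generators obtain s :: nat and g where g: "\<And>i::nat. g i \<in> carrier A"
    and gen: "\<And>a. a \<in> carrier A \<Longrightarrow>
      \<exists>r. (\<forall>i. r i \<in> carrier R) \<and> a = (\<Oplus>\<^bsub>A\<^esub>i\<in>{..<s}. \<iota> (r i) \<otimes>\<^bsub>A\<^esub> g i)" by blast
  interpret local_split A Q "n\<^sup>2" "\<lambda>p. h (x p)" e K h "\<iota> ` carrier R" x s g
  proof (intro local_split.intro local_split_axioms.intro)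
    show "ring_center Q = h ` \<iota> ` carrier R" using center_Q by (auto simp: \<zeta>_def)
    show "\<exists>r. (\<forall>i. r i \<in> \<iota> ` carrier R) \<and> a = (\<Oplus>\<^bsub>A\<^esub>i\<in>{..<s}. r i \<otimes>\<^bsub>A\<^esub> g i)" if "a \<in> carrier A" for a
    proof -
      from gen[OF that] obtain r where "\<And>i. r i \<in> carrier R" "a = (\<Oplus>\<^bsub>A\<^esub>i\<in>{..<s}. \<iota> (r i) \<otimes>\<^bsub>A\<^esub> g i)" by blast
      then show ?thesis by (intro exI[of _ "\<lambda>i. \<iota> (r i)"]) auto
    qed
    show "\<exists>r. (\<forall>i. r i \<in> \<iota> ` carrier R \<and> h (r i) = \<zero>\<^bsub>Q\<^esub>) \<and> a = (\<Oplus>\<^bsub>A\<^esub>i\<in>{..<s}. r i \<otimes>\<^bsub>A\<^esub> g i)"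
      if "a \<in> carrier A" "h a = \<zero>\<^bsub>Q\<^esub>" for a
    proof -
      have "a \<in> J" using h_zero_iff that by blast
      from J_generators[OF g gen this] obtain r where r: "\<And>i. r i \<in> M"
        "a = (\<Oplus>\<^bsub>A\<^esub>i\<in>{..<s}. \<iota> (r i) \<otimes>\<^bsub>A\<^esub> g i)" by blast
      have rR: "r i \<in> carrier R" for i using r(1) M_closed(1) by blast
      have "h (\<iota> (r i)) = \<zero>\<^bsub>Q\<^esub>" for i using \<zeta>_zero_iff[OF rR] r(1) by (simp add: \<zeta>_def)
      with rR r(2) show ?thesis by (intro exI[of _ "\<lambda>i. \<iota> (r i)"]) simp
    qed
  qed (assumption | rule A.ring_axioms split h_hom \<iota>_image_closed x g refl)+
  from local_identity[where b = b, OF order_refl f b] obtain y where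
    y: "y \<in> \<iota> ` carrier R" "h y \<noteq> \<zero>\<^bsub>Q\<^esub>" "ncpoly_eval A b f \<otimes>\<^bsub>A\<^esub> y = \<zero>\<^bsub>A\<^esub>"
    by (elim bexE conjE)
  then obtain r where "r \<in> carrier R" "y = \<iota> r" by (elim imageE)
  with y have r: "r \<in> carrier R" "h (\<iota> r) \<noteq> \<zero>\<^bsub>Q\<^esub>" "ncpoly_eval A b f \<otimes>\<^bsub>A\<^esub> \<iota> r = \<zero>\<^bsub>A\<^esub>" by simp_all
  have c: "ncpoly_eval A b f \<in> carrier A" by (rule A.ncpoly_eval_closed[OF b])
  have "r \<odot>\<^bsub>A\<^esub> ncpoly_eval A b f = \<zero>\<^bsub>A\<^esub>"
    using r(3) unfolding smult_eq[OF r(1) c] \<iota>_central[OF r(1) c] .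
  moreover have "r \<notin> M" using \<zeta>_zero_iff[OF r(1)] r(2) by (simp add: \<zeta>_def)
  ultimately show ?thesis using r(1) by blast
qed

text \<open>Otherwise the image of I in the simple ring Q is everything, so A = I + M A. Nakayama's
  lemma gives a scalar d congruent to 1 modulo M that carries the generators, hence also 1, into I;
  by hypothesis d then lies in M, which forces 1 = 0 in Q.\<close>

lemma ideal_subset_J:
  assumes I: "ideal I A" and M_I: "\<And>r. r \<in> carrier R \<Longrightarrow> \<iota> r \<in> I \<Longrightarrow> r \<in> M"
  shows "I \<subseteq> J"
proof (rule ccontr)
  interpret I: ideal I A by (rule I)
  interpret Q: ring Q by (rule ring_Q)
  interpret h: ring_hom_ring A Q h
    by (rule ring_hom_ringI2[OF A.ring_axioms ring_Q h_hom])
  interpret h': ring_hom_ring R A \<iota>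
    by (rule ring_hom_ringI2[OF R.ring_axioms A.ring_axioms \<iota>_hom])
  have MR: "m \<in> carrier R" if "m \<in> M" for m using that M_closed(1) by blast
  assume "\<not> I \<subseteq> J"
  then obtain y where y: "y \<in> I" "y \<notin> J" by blast
  have "ideal (h ` I) Q"
  proof (rule idealI[OF ring_Q])
    show "subgroup (h ` I) (add_monoid Q)"
      using h.a_group_hom I.a_subgroup by (metis additive_subgroup.a_subgroup group_hom.subgroup_img_is_subgroup I.additive_subgroup_axioms)
    fix w z assume w: "w \<in> h ` I" and z: "z \<in> carrier Q"
    from w obtain u where u: "u \<in> I" "w = h u" by blast
    from z obtain v where v: "v \<in> carrier A" "z = h v" using Q_carrier by auto
    have uA: "u \<in> carrier A" using u(1) I.Icarr by blast
    show "z \<otimes>\<^bsub>Q\<^esub> w \<in> h ` I"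
      using u v uA I.I_l_closed[OF u(1) v(1)] by (intro image_eqI[of _ _ "v \<otimes>\<^bsub>A\<^esub> u"]) simp_all
    show "w \<otimes>\<^bsub>Q\<^esub> z \<in> h ` I"
      using u v uA I.I_r_closed[OF u(1) v(1)] by (intro image_eqI[of _ _ "u \<otimes>\<^bsub>A\<^esub> v"]) simp_all
  qed
  moreover have "h ` I \<noteq> {\<zero>\<^bsub>Q\<^esub>}" using y h_zero_iff[of y] I.Icarr by auto
  ultimately have hI: "h ` I = carrier Q"
    using csa by (auto simp: central_simple_algebra_def simple_ring_def)
  from ex_generators obtain s :: nat and g where g: "\<And>i::nat. g i \<in> carrier A"
    and gen: "\<And>a. a \<in> carrier A \<Longrightarrow>
      \<exists>r. (\<forall>i. r i \<in> carrier R) \<and> a = (\<Oplus>\<^bsub>A\<^esub>i\<in>{..<s}. \<iota> (r i) \<otimes>\<^bsub>A\<^esub> g i)" by blast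
  have "\<exists>\<delta>\<in>\<iota> ` carrier R. \<delta> \<ominus>\<^bsub>A\<^esub> \<one>\<^bsub>A\<^esub> \<in> \<iota> ` M \<and> (\<forall>i<s. \<delta> \<otimes>\<^bsub>A\<^esub> g i \<in> I)"
  proof (rule A.nakayama[where g = g])
    show "\<iota> ` M \<subseteq> \<iota> ` carrier R" using M_closed(1) by auto
    show "x \<oplus>\<^bsub>A\<^esub> y \<in> \<iota> ` M" if xy: "x \<in> \<iota> ` M" "y \<in> \<iota> ` M" for x y
    proof -
      from xy obtain m m' where "m \<in> M" "x = \<iota> m" "m' \<in> M" "y = \<iota> m'" by blast
      then show ?thesis using MR M_closed(3) by (intro image_eqI[of _ _ "m \<oplus>\<^bsub>R\<^esub> m'"]) auto
    qed
    show "x \<otimes>\<^bsub>A\<^esub> y \<in> \<iota> ` M" if xy: "x \<in> \<iota> ` carrier R" "y \<in> \<iota> ` M" for x y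
    proof -
      from xy obtain m m' where "m \<in> carrier R" "x = \<iota> m" "m' \<in> M" "y = \<iota> m'" by blast
      then show ?thesis using MR M_closed(5) by (intro image_eqI[of _ _ "m \<otimes>\<^bsub>R\<^esub> m'"]) auto
    qed
    show "\<ominus>\<^bsub>A\<^esub> x \<in> \<iota> ` M" if x: "x \<in> \<iota> ` M" for x
    proof -
      from x obtain m where "m \<in> M" "x = \<iota> m" by blast
      then show ?thesis using MR M_closed(4) by (intro image_eqI[of _ _ "\<ominus>\<^bsub>R\<^esub> m"]) auto
    qed
    show "\<zero>\<^bsub>A\<^esub> \<in> \<iota> ` M" using M_closed(2) by (intro image_eqI[of _ _ "\<zero>\<^bsub>R\<^esub>"]) auto
    show "\<exists>\<delta>\<in>\<iota> ` carrier R. \<delta> \<ominus>\<^bsub>A\<^esub> \<one>\<^bsub>A\<^esub> \<in> \<iota> ` M \<and> \<delta> \<otimes>\<^bsub>A\<^esub> g i \<in> A.comb I (\<iota> ` M) g s" for i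
    proof
      have "h (g i) \<in> h ` I" unfolding hI using g by simp
      then obtain w where w: "w \<in> I" "h (g i) = h w" by blast
      have wA: "w \<in> carrier A" using w(1) I.Icarr by blast
      have "h (g i \<ominus>\<^bsub>A\<^esub> w) = \<zero>\<^bsub>Q\<^esub>"
        using g wA w(2) by (simp add: a_minus_def Q.r_neg)
      then have "g i \<ominus>\<^bsub>A\<^esub> w \<in> J" using h_zero_iff g wA by simp
      from J_generators[OF g gen this] obtain r where r: "\<And>i. r i \<in> M"
        "g i \<ominus>\<^bsub>A\<^esub> w = (\<Oplus>\<^bsub>A\<^esub>i\<in>{..<s}. \<iota> (r i) \<otimes>\<^bsub>A\<^esub> g i)" by blast
      have "g i = w \<oplus>\<^bsub>A\<^esub> (g i \<ominus>\<^bsub>A\<^esub> w)"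
        using g[of i] wA M.a_lcomm[of w "g i" "\<ominus>\<^bsub>A\<^esub> w"] by (simp add: a_minus_def M.r_neg)
      with g[of i] have "\<one>\<^bsub>A\<^esub> \<otimes>\<^bsub>A\<^esub> g i = w \<oplus>\<^bsub>A\<^esub> (g i \<ominus>\<^bsub>A\<^esub> w)" by simp
      also have "g i \<ominus>\<^bsub>A\<^esub> w = (\<Oplus>\<^bsub>A\<^esub>i\<in>{..<s}. \<iota> (r i) \<otimes>\<^bsub>A\<^esub> g i)" by (rule r(2))
      also have "w \<oplus>\<^bsub>A\<^esub> (\<Oplus>\<^bsub>A\<^esub>i\<in>{..<s}. \<iota> (r i) \<otimes>\<^bsub>A\<^esub> g i) \<in> A.comb I (\<iota> ` M) g s"
        using r(1) g \<iota>_closed M_closed(1) I.Icarr by (intro A.comb_memI w(1)) auto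
      finally have "\<one>\<^bsub>A\<^esub> \<otimes>\<^bsub>A\<^esub> g i \<in> A.comb I (\<iota> ` M) g s" .
      moreover have "\<one>\<^bsub>A\<^esub> \<ominus>\<^bsub>A\<^esub> \<one>\<^bsub>A\<^esub> \<in> \<iota> ` M"
        using M_closed(2) by (intro image_eqI[of _ _ "\<zero>\<^bsub>R\<^esub>"]) (auto simp: a_minus_def M.r_neg)
      ultimately show "\<one>\<^bsub>A\<^esub> \<ominus>\<^bsub>A\<^esub> \<one>\<^bsub>A\<^esub> \<in> \<iota> ` M \<and> \<one>\<^bsub>A\<^esub> \<otimes>\<^bsub>A\<^esub> g i \<in> A.comb I (\<iota> ` M) g s" by blast
    qed (rule \<iota>_image_closed(3))
    show "x \<otimes>\<^bsub>A\<^esub> y \<in> I" if "x \<in> \<iota> ` carrier R" "y \<in> I" for x y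
      using that \<iota>_closed I.I_l_closed by auto
    show "I \<subseteq> carrier A" using I.Icarr by blast
  qed (assumption | rule \<iota>_image_closed g I.a_closed)+
  then obtain d m where d: "d \<in> carrier R" "m \<in> M" "\<iota> d \<ominus>\<^bsub>A\<^esub> \<one>\<^bsub>A\<^esub> = \<iota> m" "\<And>i. i < s \<Longrightarrow> \<iota> d \<otimes>\<^bsub>A\<^esub> g i \<in> I"
    by auto
  have mR: "m \<in> carrier R" using d(2) M_closed(1) by blast
  from gen[OF A.one_closed] obtain r where r: "\<And>i. r i \<in> carrier R"
    "\<one>\<^bsub>A\<^esub> = (\<Oplus>\<^bsub>A\<^esub>i\<in>{..<s}. \<iota> (r i) \<otimes>\<^bsub>A\<^esub> g i)" by blast
  have fin: "(\<Oplus>\<^bsub>A\<^esub>i\<in>{..<k::nat}. v i) \<in> I" if "\<And>i. i < k \<Longrightarrow> v i \<in> I" for v k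
    using that
  proof (induct k)
    case (Suc k)
    have "(\<Oplus>\<^bsub>A\<^esub>i\<in>{..<Suc k}. v i) = v k \<oplus>\<^bsub>A\<^esub> (\<Oplus>\<^bsub>A\<^esub>i\<in>{..<k}. v i)"
      unfolding lessThan_Suc using Suc(2) I.Icarr by (intro M.finsum_insert) auto
    then show ?case using Suc by simp
  qed simp
  have "\<iota> d = \<iota> d \<otimes>\<^bsub>A\<^esub> (\<Oplus>\<^bsub>A\<^esub>i\<in>{..<s}. \<iota> (r i) \<otimes>\<^bsub>A\<^esub> g i)"
    unfolding r(2)[symmetric] using \<iota>_closed d(1) by simp
  also have "\<dots> = (\<Oplus>\<^bsub>A\<^esub>i\<in>{..<s}. \<iota> d \<otimes>\<^bsub>A\<^esub> (\<iota> (r i) \<otimes>\<^bsub>A\<^esub> g i))"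
    using r(1) g \<iota>_closed d(1) by (intro A.finsum_rdistr) auto
  also have "\<dots> = (\<Oplus>\<^bsub>A\<^esub>i\<in>{..<s}. \<iota> (r i) \<otimes>\<^bsub>A\<^esub> (\<iota> d \<otimes>\<^bsub>A\<^esub> g i))"
  proof (rule M.finsum_cong'[OF refl])
    fix i
    have cl: "\<iota> d \<in> carrier A" "\<iota> (r i) \<in> carrier A" "g i \<in> carrier A" using \<iota>_closed d(1) r(1) g by auto
    show "\<iota> d \<otimes>\<^bsub>A\<^esub> (\<iota> (r i) \<otimes>\<^bsub>A\<^esub> g i) = \<iota> (r i) \<otimes>\<^bsub>A\<^esub> (\<iota> d \<otimes>\<^bsub>A\<^esub> g i)"
      using A.m_assoc[OF cl] A.m_assoc[OF cl(2,1,3)] \<iota>_central[OF d(1) cl(2)] by simp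
  qed (use \<iota>_closed d(1) r(1) g in auto)
  also have "\<dots> \<in> I" by (rule fin, rule I.I_l_closed) (use d(4) \<iota>_closed r(1) in auto)
  finally have "d \<in> M" using M_I[OF d(1)] by blast
  \<comment> \<open>The congruence is known only inside A, where m is some element of M with the
    same image as d - 1; d - m lies in M and yet acts as 1.\<close>
  have "\<iota> (d \<ominus>\<^bsub>R\<^esub> m) = \<one>\<^bsub>A\<^esub>"
  proof -
    have "\<iota> d = (\<iota> d \<ominus>\<^bsub>A\<^esub> \<one>\<^bsub>A\<^esub>) \<oplus>\<^bsub>A\<^esub> \<one>\<^bsub>A\<^esub>"
      using \<iota>_closed[OF d(1)] by (simp add: a_minus_def M.a_assoc M.l_neg)
    then have "\<iota> d = \<iota> m \<oplus>\<^bsub>A\<^esub> \<one>\<^bsub>A\<^esub>" unfolding d(3) .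
    then have "\<iota> (d \<ominus>\<^bsub>R\<^esub> m) = \<iota> m \<oplus>\<^bsub>A\<^esub> \<one>\<^bsub>A\<^esub> \<ominus>\<^bsub>A\<^esub> \<iota> m" using d(1) mR by (simp add: a_minus_def)
    then show ?thesis using \<iota>_closed[OF mR] by (simp add: a_minus_def M.a_ac M.r_neg)
  qed
  moreover have "d \<ominus>\<^bsub>R\<^esub> m \<in> M" using M_closed(3)[OF \<open>d \<in> M\<close> M_closed(4)[OF d(2)]] by (simp add: a_minus_def)
  ultimately have "h \<one>\<^bsub>A\<^esub> = \<zero>\<^bsub>Q\<^esub>"
    using \<zeta>_zero_iff[of "d \<ominus>\<^bsub>R\<^esub> m"] d(1) mR by (simp add: \<zeta>_def)
  then show False using one_not_zero_Q Ring.ring_hom_one[OF h_hom] by simp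
qed

end

text \<open>The first letters take the basis as values, the others the left and right factors of the
  dual coordinate functions. The value is then the last basis element, which is nonzero because its
  dual function sends it to 1.\<close>

lemma (in simple_ring_of_rank) eliminant_nonzero:
  assumes "0 < N"
  shows "\<exists>l b. (\<forall>k. b k \<in> carrier R) \<and>
    ncpoly_eval R b (eliminant l 0 (map (\<lambda>k. letter (0, k, 0)) [0..<N])) \<noteq> \<zero>"
proof -
  define us where "us j = (SOME us. set us \<subseteq> carrier R \<times> carrier R \<and>
      (\<forall>i<N. bimul R us (\<epsilon> i) = (if i = j then \<one> else \<zero>)))" for j
  have us: "set (us j) \<subseteq> carrier R \<times> carrier R"
    "i < N \<Longrightarrow> bimul R (us j) (\<epsilon> i) = (if i = j then \<one> else \<zero>)" if "j < N" for i j
    using someI_ex[OF dual_bimul[OF that]] by (simp_all add: us_def)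
  \<comment> \<open>Decoding of the triples; \<open>l j\<close> is going to be the length of the
    list \<open>us j\<close>, and zero fills the positions beyond it.\<close>
  define letter_value where "letter_value = (\<lambda>(t::nat, j, i). if t = 0 then \<epsilon> j
      else if \<not> (j < N \<and> i < length (us j)) then \<zero> else if t = 1 then fst (us j ! i) else snd (us j ! i))"
  define b where "b k = (case k of 0 \<Rightarrow> \<zero> | Suc k \<Rightarrow> letter_value (from_nat k))" for k
  have lv: "letter_value p \<in> carrier R" for p
    using us(1) \<epsilon>_closed nth_mem by (cases p) (fastforce simp: letter_value_def)
  then have bR: "b k \<in> carrier R" for k by (simp add: b_def split: nat.split)
  define ps where "ps = map (\<lambda>k. letter (0, k, 0)) [0..<N]"
  have "ncpoly_eval R b (eliminant (\<lambda>j. length (us j)) 0 ps) = \<epsilon> (N - 1)"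
  proof (rule eliminant_value[OF bR \<epsilon>_closed])
    show "bimul R (map (\<lambda>i. (b (Suc (to_nat (1::nat, j, i))), b (Suc (to_nat (2::nat, j, i))))) [0..<length (us j)]) (\<epsilon> i) =
        (if i = j then \<one> else \<zero>)" if "j < N" "i < N" for j i
    proof -
      have "map (\<lambda>i. (b (Suc (to_nat (1::nat, j, i))), b (Suc (to_nat (2::nat, j, i))))) [0..<length (us j)] = us j"
        using that(1) by (intro nth_equalityI) (auto simp: b_def letter_value_def)
      then show ?thesis using us(2)[OF that] by simp
    qed
    show "map (ncpoly_eval R b) ps = map \<epsilon> [0..<N]"
      by (simp add: ps_def ncpoly_eval_simps[OF bR] b_def letter_value_def)
  qed (rule assms)
  moreover have "\<epsilon> (N - 1) \<noteq> \<zero>"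
  proof -
    obtain us where u: "set us \<subseteq> carrier R \<times> carrier R" "bimul R us (\<epsilon> (N - 1)) = \<one>"
      using dual_bimul[of "N - 1"] assms by auto
    have "bimul R us \<zero> = \<zero>"
      using bimul_add[OF u(1) zero_closed zero_closed] u(1) by (simp add: add.r_cancel_one)
    then show ?thesis using u(2) one_not_zero by auto
  qed
  ultimately show ?thesis using bR unfolding ps_def by metis
qed

text \<open>It is used twice: with I = 0 it is the annihilator of a value of f, and with c = 1 it is
  the contraction of I to the base ring.\<close>

lemma (in assoc_algebra) colon_ideal:
  assumes I: "ideal I A" and c: "c \<in> carrier A"
  shows "ideal {r \<in> carrier R. r \<odot>\<^bsub>A\<^esub> c \<in> I} R"
proof -
  interpret I: ideal I A by (rule I)
  have smult: "a \<odot>\<^bsub>A\<^esub> y \<in> I" if a: "a \<in> carrier R" and y: "y \<in> I" for a y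
    using smult_mult_left[OF a A.one_closed I.Icarr[OF y]] I.I_l_closed[OF y, of "a \<odot>\<^bsub>A\<^esub> \<one>\<^bsub>A\<^esub>"] a I.Icarr[OF y]
    by simp
  show ?thesis
  proof (rule idealI[OF R.ring_axioms])
    show "subgroup {r \<in> carrier R. r \<odot>\<^bsub>A\<^esub> c \<in> I} (add_monoid R)"
    proof (rule R.add.subgroupI)
      show "\<ominus>\<^bsub>R\<^esub> r \<in> {r \<in> carrier R. r \<odot>\<^bsub>A\<^esub> c \<in> I}" if "r \<in> {r \<in> carrier R. r \<odot>\<^bsub>A\<^esub> c \<in> I}" for r
        using that c smult_l_minus[of r c] by simp
      have "\<zero>\<^bsub>R\<^esub> \<in> {r \<in> carrier R. r \<odot>\<^bsub>A\<^esub> c \<in> I}" using c by simp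
      then show "{r \<in> carrier R. r \<odot>\<^bsub>A\<^esub> c \<in> I} \<noteq> {}" by blast
    qed (use c in \<open>auto simp: smult_l_distr\<close>)
    fix r a assume r: "r \<in> {r \<in> carrier R. r \<odot>\<^bsub>A\<^esub> c \<in> I}" and a: "a \<in> carrier R"
    then show "a \<otimes>\<^bsub>R\<^esub> r \<in> {r \<in> carrier R. r \<odot>\<^bsub>A\<^esub> c \<in> I}"
      using smult[OF a] smult_assoc1[OF a _ c, of r] by simp
    then show "r \<otimes>\<^bsub>R\<^esub> a \<in> {r \<in> carrier R. r \<odot>\<^bsub>A\<^esub> c \<in> I}"
      using R.m_comm[of r a] r a by simp
  qed
qed

lemma azumaya_satisfies_identity:
  assumes "azumaya_algebra R A" and rank: "constant_rank R A (n\<^sup>2)"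
    and f: "Z_identity (int_matrix_ring n) m f"
  shows "satisfies_identity A m f"
proof -
  interpret azumaya_algebra R A by (rule assms(1))
  have "ncpoly_eval A b f = \<zero>\<^bsub>A\<^esub>" if b: "\<And>k. b k \<in> carrier A" for b
  proof (rule ccontr)
    assume nz: "ncpoly_eval A b f \<noteq> \<zero>\<^bsub>A\<^esub>"
    have c: "ncpoly_eval A b f \<in> carrier A" by (rule A.ncpoly_eval_closed[OF b])
    \<comment> \<open>The annihilator of the nonzero value is proper, hence inside some maximal
      ideal M, whereas \<open>local_vanishing\<close> finds an element of it outside M.\<close>
    define I where "I = {r \<in> carrier R. r \<odot>\<^bsub>A\<^esub> ncpoly_eval A b f \<in> {\<zero>\<^bsub>A\<^esub>}}"
    have "ideal I R" unfolding I_def by (rule colon_ideal[OF A.zeroideal c])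
    moreover have "\<one>\<^bsub>R\<^esub> \<notin> I" using nz c by (simp add: I_def)
    ultimately obtain M where max: "maximalideal M R" "I \<subseteq> M" using R.ex_maximalideal by blast
    have at: "azumaya_at R A M" by (intro azumaya_at.intro azumaya_at_axioms.intro assms(1) max(1))
    have "free_of_rank (local_ring_at R M) (local_module_at R A M) (n\<^sup>2)"
      using rank R.maximalideal_prime[OF max(1)] by (simp add: constant_rank_def)
    from azumaya_at.local_vanishing[where b = b, OF at this f b] show False using max(2) by (auto simp: I_def)
  qed
  moreover have "f \<in> free_assoc_ring m" using f by (simp add: Z_identity_def)
  ultimately show ?thesis by (simp add: A.satisfies_identity_iff_total)
qed

lemma (in azumaya_at) quotient_not_identity:
  assumes free: "free_of_rank (local_ring_at R M) (local_module_at R A M) (n\<^sup>2)" and "n \<ge> 1"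
    and I: "ideal I A" and M_I: "\<And>r. r \<in> carrier R \<Longrightarrow> \<iota> r \<in> I \<Longrightarrow> r \<in> M"
  shows "\<not> satisfies_all_Z_identities_of (A Quot I) (int_matrix_ring (n - 1))"
proof
  assume sat: "satisfies_all_Z_identities_of (A Quot I) (int_matrix_ring (n - 1))"
  interpret I: ideal I A by (rule I)
  interpret AI: ring "A Quot I" by (rule I.quotient_is_ring)
  have IJ: "I \<subseteq> J" by (rule ideal_subset_J[OF I M_I])
  from residue_basis[OF free] obtain x where
    "simple_ring_of_rank Q (n\<^sup>2) (\<lambda>p. h (x p))" by blast
  from simple_ring_of_rank.eliminant_nonzero[OF this] \<open>n \<ge> 1\<close> obtain l b where
    b: "\<And>k. b k \<in> carrier Q" and nz:
    "ncpoly_eval Q b (eliminant l 0 (map (\<lambda>k. letter (0, k, 0)) [0..<n\<^sup>2])) \<noteq> \<zero>\<^bsub>Q\<^esub>" by auto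
  define F where "F = eliminant l 0 (map (\<lambda>k. letter (0, k, 0)) [0..<n\<^sup>2])"
  have "(n - 1) * (n - 1) < n\<^sup>2"
    using \<open>n \<ge> 1\<close> by (simp add: power2_eq_square mult_strict_mono)
  from eliminant_int_matrix_identity[OF this, of l] obtain m where
    m: "Z_identity (int_matrix_ring (n - 1)) m F" by (auto simp: F_def)
  \<comment> \<open>The substitution is lifted from Q to A, so that one value in A can be compared
    both in Q, where it is nonzero, and in A / I, where the identity makes it zero. The inclusion of
    I in J makes these incompatible.\<close>
  define b' where "b' k = (SOME a. a \<in> carrier A \<and> h a = b k)" for k
  have b': "b' k \<in> carrier A" "h (b' k) = b k" for k
  proof -
    have "\<exists>a. a \<in> carrier A \<and> h a = b k" using b[of k] Q_carrier by auto
    from someI_ex[OF this] show "b' k \<in> carrier A" "h (b' k) = b k" by (simp_all add: b'_def)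
  qed
  have "h (ncpoly_eval A b' F) = ncpoly_eval Q (\<lambda>k. h (b' k)) F"
    using b'(1) by (intro ring_hom_ncpoly_eval[OF A.ring_axioms ring_Q h_hom]) auto
  moreover have "(\<lambda>k. h (b' k)) = b" using b'(2) by (simp add: fun_eq_iff)
  ultimately have "h (ncpoly_eval A b' F) \<noteq> \<zero>\<^bsub>Q\<^esub>" using nz by (simp add: F_def)
  moreover have c: "ncpoly_eval A b' F \<in> carrier A" by (rule A.ncpoly_eval_closed[OF b'(1)])
  ultimately have nI: "ncpoly_eval A b' F \<notin> I" using h_zero_iff[OF c] IJ by blast
  have "I +>\<^bsub>A\<^esub> ncpoly_eval A b' F = ncpoly_eval (A Quot I) (\<lambda>k. I +>\<^bsub>A\<^esub> b' k) F"
    using b'(1) by (intro ring_hom_ncpoly_eval[OF A.ring_axioms AI.ring_axioms I.rcos_ring_hom]) auto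
  also have "\<dots> = \<zero>\<^bsub>A Quot I\<^esub>"
  proof -
    have "satisfies_identity (A Quot I) m F" "F \<in> free_assoc_ring m"
      using sat m by (auto simp: satisfies_all_Z_identities_of_def Z_identity_def)
    moreover have "I +>\<^bsub>A\<^esub> b' k \<in> carrier (A Quot I)" for k
      using b'(1) by (auto simp: FactRing_def A_RCOSETS_def')
    ultimately show ?thesis by (simp add: AI.satisfies_identity_iff_total)
  qed
  finally have "I +>\<^bsub>A\<^esub> ncpoly_eval A b' F = I" by (simp add: FactRing_def)
  then show False using I.rcos_const_imp_mem[OF c] nI by simp
qed

lemma azumaya_quotient_not_identity:
  assumes "azumaya_algebra R A" and rank: "constant_rank R A (n\<^sup>2)" and "n \<ge> 1"
    and I: "ideal I A" and nonzero: "nonzero_ring (A Quot I)"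
  shows "\<not> satisfies_all_Z_identities_of (A Quot I) (int_matrix_ring (n - 1))"
proof -
  interpret azumaya_algebra R A by (rule assms(1))
  interpret I: ideal I A by (rule I)
  interpret AI: ring "A Quot I" by (rule I.quotient_is_ring)
  have "\<one>\<^bsub>A\<^esub> \<notin> I"
  proof
    assume "\<one>\<^bsub>A\<^esub> \<in> I"
    then have "I = carrier A" by (rule I.one_imp_carrier)
    then have "\<one>\<^bsub>A Quot I\<^esub> = \<zero>\<^bsub>A Quot I\<^esub>"
      using I.a_rcos_const[of "\<one>\<^bsub>A\<^esub>"] by (simp add: FactRing_def)
    then show False using nonzero AI.one_zeroD by (simp add: nonzero_ring_def)
  qed
  then have "\<one>\<^bsub>R\<^esub> \<notin> {r \<in> carrier R. r \<odot>\<^bsub>A\<^esub> \<one>\<^bsub>A\<^esub> \<in> I}" by simp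
  \<comment> \<open>M is chosen above the contraction of I to R, so that scalars acting inside I lie
    in M, as \<open>ideal_subset_J\<close> demands.\<close>
  then obtain M where max: "maximalideal M R" "{r \<in> carrier R. r \<odot>\<^bsub>A\<^esub> \<one>\<^bsub>A\<^esub> \<in> I} \<subseteq> M"
    using R.ex_maximalideal[OF colon_ideal[OF I A.one_closed]] by blast
  have at: "azumaya_at R A M" by (intro azumaya_at.intro azumaya_at_axioms.intro assms(1) max(1))
  have free: "free_of_rank (local_ring_at R M) (local_module_at R A M) (n\<^sup>2)"
    using rank R.maximalideal_prime[OF max(1)] by (simp add: constant_rank_def)
  have "r \<in> M" if "r \<in> carrier R" "azumaya_at.\<iota> A r \<in> I" for r
    using that max(2) unfolding azumaya_at.\<iota>_def[OF at] by blast
  then show ?thesis by (rule azumaya_at.quotient_not_identity[OF at free assms(3) I])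
qed

theorem theorem2p6:
  fixes R :: "('r, 'p) ring_scheme" and A :: "('r, 'a, 'q) module_scheme" and n :: nat
  assumes "n \<ge> 1"
    and "azumaya_algebra R A"
    and "constant_rank R A (n ^ 2)"
  shows "satisfies_all_Z_identities_of A (int_matrix_ring n) \<and>
         (\<forall>I. ideal I A \<and> nonzero_ring (A Quot I) \<longrightarrow>
              \<not> satisfies_all_Z_identities_of (A Quot I) (int_matrix_ring (n - 1)))"
  using assms azumaya_satisfies_identity[of R A n] azumaya_quotient_not_identity[of R A n]
  unfolding satisfies_all_Z_identities_of_def[of A] by blast

end
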